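(* Let $n\ge 1$ and let $\varepsilon\in[1/\sqrt n,\,1]$. There is a randomized one-pass streaming algorithm which, given a stream $S\in\Sigma^n$, reports for every index $m$ of $S$ the midpoint $m$ together with an estimate $\tilde\ell(m)$ such that, with high probability (probability at least $1-1/n$), $$\ell(m)-\varepsilon\sqrt n<\tilde\ell(m)\le \ell(m)$$ holds for every reported midpoint $m$. The algorithm makes one pass over $S$, uses $O(n/\varepsilon)$ total time and $O(\sqrt n/\varepsilon)$ space.
   Context: Streaming model: the input is a string $S=S[1]S[2]\cdots S[n]$ over an alphabet $\Sigma\subset\mathbb N$, read once from left to right ($S[i]$ is read in iteration $i$); the working memory is limited while the output space is unlimited. Space is measured in the word model, i.e. as the number of registers of $O(\log n)$ bits. $S[i,j]$ denotes $S[i]S[i+1]\cdots S[j]$. Palindromes are considered in their even form: $S$ contains a palindrome of length $\ell$ with midpoint $m$ if $S[m-i+1]=S[m+i]$ for all $i\in\{1,\dots,\ell\}$ (with all indices in $\{1,\dots,n\}$). For an index $m$, $\ell(m)$ denotes the maximal such $\ell$ (so $P[m]$, the maximal palindrome centered at $m$, has length $\ell(m)$); $\ell(z)=0$ for $z\notin\{1,\dots,n\}$. *)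

theory Defs
  imports "HOL-Probability.Probability" "HOL-Library.Log_Nat"
begin

section \<open>Even palindromes\<close>

text \<open>Strings are lists; their positions are counted from 1.\<close>

definition letter :: "'a list \<Rightarrow> nat \<Rightarrow> 'a" where
  "letter S i = S ! (i - 1)"

text \<open>The guards \<open>i \<le> m\<close> and \<open>m + i \<le> length S\<close> say that both \<open>m - i + 1\<close> and \<open>m + i\<close> lie in
  \<open>{1..length S}\<close>; in particular the subtraction on \<open>nat\<close> is exact.\<close>

definition contains_palindrome :: "'a list \<Rightarrow> nat \<Rightarrow> nat \<Rightarrow> bool" where
  "contains_palindrome S m l \<longleftrightarrow>
     (\<forall>i\<in>{1..l}. i \<le> m \<and> m + i \<le> length S \<and> letter S (m - i + 1) = letter S (m + i))"

text \<open>Length \<open>0\<close> is always admissible and the admissible lengths are at most \<open>m\<close>, so the greatest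
  one exists. For \<open>m = 0\<close> and for \<open>m \<ge> length S\<close> it is \<open>0\<close>.\<close>

definition pal_length :: "'a list \<Rightarrow> nat \<Rightarrow> nat" where
  "pal_length S m = (GREATEST l. contains_palindrome S m l)"


section \<open>A randomized word RAM with a one-way input stream\<close>

text \<open>
  An algorithm is a finite program, independent of the input. Operands are addresses of registers.
  A register holds a word of \<open>w\<close> bits: every value is reduced modulo \<open>2 ^ w\<close> when it is written.
  Each instruction costs one time unit. \<open>Sub\<close> is truncated at \<open>0\<close>, and division by zero follows the
  conventions for \<open>nat\<close>. \<open>Read\<close> consumes the next letter of the stream, so that a letter is seen
  again only if the program has stored it; at the end of the stream it yields \<open>0\<close>. \<open>Report\<close> appends
  to a write-only output, which does not count as space. \<open>Rand d s\<close> draws a fresh uniform number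
  below the contents of register \<open>s\<close>.
\<close>

datatype binop = Add | Sub | Mult | Div | Mod

datatype instr =
    LoadImm nat nat
  | Arith binop nat nat nat
  | Load nat nat
  | Store nat nat
  | Jump nat
  | JumpZero nat nat
  | Read nat
  | Rand nat nat
  | Report nat nat

text \<open>The field \<open>used\<close> is the number of registers allocated so far: one more than the largest address
  that has been accessed for reading or writing.\<close>

record config =
  pc :: nat
  mem :: "nat \<Rightarrow> nat"
  stream :: "nat list"
  out :: "(nat \<times> nat) list"
  used :: nat

fun eval_binop :: "binop \<Rightarrow> nat \<Rightarrow> nat \<Rightarrow> nat" where
  "eval_binop Add x y = x + y"
| "eval_binop Sub x y = x - y"
| "eval_binop Mult x y = x * y"
| "eval_binop Div x y = x div y"
| "eval_binop Mod x y = x mod y"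

fun accessed :: "instr \<Rightarrow> (nat \<Rightarrow> nat) \<Rightarrow> nat set" where
  "accessed (LoadImm d x) M = {d}"
| "accessed (Arith f d s t) M = {d, s, t}"
| "accessed (Load d s) M = {d, s, M s}"
| "accessed (Store d s) M = {d, s, M d}"
| "accessed (Jump l) M = {}"
| "accessed (JumpZero s l) M = {s}"
| "accessed (Read d) M = {d}"
| "accessed (Rand d s) M = {d, s}"
| "accessed (Report s t) M = {s, t}"

definition allocate :: "nat set \<Rightarrow> config \<Rightarrow> config" where
  "allocate A c = c\<lparr>used := Max (insert (used c) (Suc ` A))\<rparr>"

definition goto :: "nat \<Rightarrow> config \<Rightarrow> config" where
  "goto l c = c\<lparr>pc := l\<rparr>"

definition write_reg :: "nat \<Rightarrow> nat \<Rightarrow> nat \<Rightarrow> config \<Rightarrow> config" where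
  "write_reg w d x c = c\<lparr>mem := (mem c)(d := x mod 2 ^ w), pc := pc c + 1\<rparr>"

fun exec :: "nat \<Rightarrow> instr \<Rightarrow> config \<Rightarrow> config pmf" where
  "exec w (LoadImm d x) c = return_pmf (write_reg w d x c)"
| "exec w (Arith f d s t) c = return_pmf (write_reg w d (eval_binop f (mem c s) (mem c t)) c)"
| "exec w (Load d s) c = return_pmf (write_reg w d (mem c (mem c s)) c)"
| "exec w (Store d s) c = return_pmf (write_reg w (mem c d) (mem c s) c)"
| "exec w (Jump l) c = return_pmf (goto l c)"
| "exec w (JumpZero s l) c = return_pmf (goto (if mem c s = 0 then l else pc c + 1) c)"
| "exec w (Read d) c =
     return_pmf (case stream c of
         [] \<Rightarrow> write_reg w d 0 c
       | x # xs \<Rightarrow> write_reg w d x (c\<lparr>stream := xs\<rparr>))"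
| "exec w (Rand d s) c =
     map_pmf (\<lambda>x. write_reg w d x c) (if mem c s = 0 then return_pmf 0 else pmf_of_set {..<mem c s})"
| "exec w (Report s t) c =
     return_pmf (goto (pc c + 1) (c\<lparr>out := out c @ [(mem c s, mem c t)]\<rparr>))"

definition halted :: "instr list \<Rightarrow> config \<Rightarrow> bool" where
  "halted P c \<longleftrightarrow> length P \<le> pc c"

definition step :: "nat \<Rightarrow> instr list \<Rightarrow> config \<Rightarrow> config pmf" where
  "step w P c =
     (if halted P c then return_pmf c
      else exec w (P ! pc c) (allocate (accessed (P ! pc c) (mem c)) c))"

text \<open>The distribution of the configuration after \<open>t\<close> time units. A halted configuration does not
  change any more.\<close>

primrec run :: "nat \<Rightarrow> instr list \<Rightarrow> nat \<Rightarrow> config \<Rightarrow> config pmf" where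
  "run w P 0 c = return_pmf c"
| "run w P (Suc t) c = bind_pmf (run w P t c) (step w P)"

text \<open>The parameters \<open>n = length S\<close> and \<open>\<epsilon>\<close> are given in the first two registers. As a register cannot
  hold a real number, \<open>\<epsilon>\<close> is given as \<open>\<lfloor>\<epsilon> n\<rfloor>\<close>, its truncation to a multiple of \<open>1 / n\<close>.\<close>

definition start :: "nat \<Rightarrow> real \<Rightarrow> nat list \<Rightarrow> config" where
  "start w \<epsilon> S =
     \<lparr>pc = 0,
      mem = (\<lambda>_. 0)(0 := length S mod 2 ^ w, 1 := nat \<lfloor>\<epsilon> * real (length S)\<rfloor> mod 2 ^ w),
      stream = S, out = [], used = 2\<rparr>"

text \<open>Words of \<open>O(log n)\<close> bits: \<open>floorlog 2 n\<close> is the length of the binary representation of \<open>n\<close>,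
  and hence positive for every \<open>n \<ge> 1\<close>.\<close>

definition word_bits :: "nat \<Rightarrow> nat \<Rightarrow> nat" where
  "word_bits k n = k * floorlog 2 n"

end

theory Submission
  imports Defs "HOL-Probability.Product_PMF" "HOL-Library.Discrete_Functions"
begin

text \<open>Put \<open>W \<approx> \<surd>n\<close> and \<open>g \<approx> \<epsilon> \<surd>n\<close>. Karp-Rabin fingerprints of the prefixes of the text and of its reversal
  decide whether a factor is a palindrome. They are kept for the last \<open>3 W\<close> positions and for all
  multiples of \<open>g\<close>. A centre with a palindrome shorter than \<open>W\<close> is settled inside the sliding window
  by trying the multiples of \<open>g\<close>. Centres of longer palindromes that lie within \<open>W / 2\<close> of each
  other form an arithmetic progression inside a periodic stretch of the text, so \<open>O(\<surd>n)\<close> records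
  describe all of them. The palindrome of a centre in a stretch ends at the nearer end of the
  stretch, except for the middle of the stretch. Isolated and middle centres are compared with the
  fingerprints at the multiples of \<open>g\<close>, whenever a position mirrored to such a multiple is read,
  which costs an error below \<open>g\<close>.

  The modulus of the fingerprints is a product of 28 random primes below \<open>R = O(n \<surd>n)\<close>, each found
  by trial division of \<open>O(log\<^sup>2 n)\<close> random numbers in time \<open>O(\<surd>R log\<^sup>2 n) = O(n)\<close>. For a fixed
  factor one prime fails with probability at most \<open>1 / root 4 n\<close>, so the union bound over the \<open>O(n\<^sup>2)\<close>
  factors leaves a failure probability below \<open>1 / n\<close>.\<close>

section \<open>Runs on a tape of random numbers\<close>

text \<open>Halting, space and the set of midpoints are demanded of every outcome; only the accuracy
  may fail. So the tracker is analysed twice: \<open>shape\<close> holds for an arbitrary oracle,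
  \<open>good\<close> only for a truthful one. For the same reason the program goes on drawing after
  it has found a prime: all runs then consume tapes of one length, and the result is a function of a
  list of independent draws. The base of the fingerprints is fixed and exceeds every letter code, so
  that as integers the fingerprints of a factor and of its reversal agree exactly for palindromes;
  only the modulus is random. A single prime large enough for the union bound would cost trial
  division more than linear time. With R of order n^(3/2) one trial division costs n^(3/4), and
  still so few primes below R divide a nonzero difference of O(n log n) bits that
  polylogarithmically many draws are unlikely to meet one. The rounds continue W positions beyond
  the end, into padding that no palindrome centred in the string can enter: centre m is decided in
  round m + W, and whatever is still growing gets stopped.\<close>

inductive tape_step :: "nat \<Rightarrow> nat \<Rightarrow> instr list \<Rightarrow> config \<times> nat list \<Rightarrow> config \<times> nat list \<Rightarrow> bool"
  for w R P where
  det: "\<not> halted P c \<Longrightarrow> (\<And>d s. P ! pc c \<noteq> Rand d s) \<Longrightarrow>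
    exec w (P ! pc c) (allocate (accessed (P ! pc c) (mem c)) c) = return_pmf c' \<Longrightarrow>
    tape_step w R P (c, \<omega>) (c', \<omega>)"
| rnd: "\<not> halted P c \<Longrightarrow> P ! pc c = Rand d s \<Longrightarrow> mem c s = R \<Longrightarrow> x < R \<Longrightarrow>
    tape_step w R P (c, x # \<omega>) (write_reg w d x (allocate {d, s} c), \<omega>)"

inductive tape_steps :: "nat \<Rightarrow> nat \<Rightarrow> instr list \<Rightarrow> nat \<Rightarrow> config \<times> nat list \<Rightarrow> config \<times> nat list \<Rightarrow> bool"
  for w R P where
  refl: "tape_steps w R P 0 x x"
| step: "tape_step w R P x y \<Longrightarrow> tape_steps w R P k y z \<Longrightarrow> tape_steps w R P (Suc k) x z"

lemma tape_steps_trans: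
  "tape_steps w R P k x y \<Longrightarrow> tape_steps w R P l y z \<Longrightarrow> tape_steps w R P (k + l) x z"
  by (induction rule: tape_steps.induct) (auto intro: tape_steps.step)

lemma tape_steps_one: "tape_step w R P x y \<Longrightarrow> tape_steps w R P 1 x y"
  using tape_steps.step[OF _ tape_steps.refl] by simp

lemma tape_steps_snoc:
  "tape_steps w R P k x y \<Longrightarrow> tape_step w R P y z \<Longrightarrow> tape_steps w R P (Suc k) x z"
  using tape_steps_trans[OF _ tape_steps_one] by fastforce

text \<open>\<open>run\<close> appends steps at the end, whereas the induction on the remaining time
  has to peel off the first step.\<close>

lemma run_Suc_front: "run w P (Suc t) c = bind_pmf (step w P c) (run w P t)"
proof (induction t arbitrary: c)
  case 0
  show ?case using bind_return_pmf'[of "step w P c"] by (simp add: bind_return_pmf run.simps(1)[abs_def])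
next
  case (Suc t)
  have "run w P (Suc (Suc t)) c = bind_pmf (bind_pmf (step w P c) (run w P t)) (step w P)"
    using Suc by simp
  then show ?case by (simp add: bind_assoc_pmf)
qed

lemma run_halted: "halted P c \<Longrightarrow> run w P t c = return_pmf c"
  by (induction t) (simp_all add: bind_return_pmf step_def)

lemma tape_steps_halted:
  "tape_steps w R P k (c, \<omega>) y \<Longrightarrow> halted P c \<Longrightarrow> k = 0 \<and> y = (c, \<omega>)"
  by (erule tape_steps.cases) (auto elim: tape_step.cases)

text \<open>If every tape of a fixed length leads to a halting run that consumes it entirely, then running
  the program amounts to drawing the tape in advance.\<close>

lemma run_eq_map_tape:
  assumes "0 < R"
    and "\<And>\<omega>. length \<omega> = N \<Longrightarrow> set \<omega> \<subseteq> {..<R} \<Longrightarrow>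
      \<exists>k\<le>t. \<exists>c'. tape_steps w R P k (c, \<omega>) (c', []) \<and> halted P c' \<and> Q \<omega> c'"
  shows "\<exists>f. run w P t c = map_pmf f (replicate_pmf N (pmf_of_set {..<R})) \<and>
    (\<forall>\<omega>. length \<omega> = N \<longrightarrow> set \<omega> \<subseteq> {..<R} \<longrightarrow> halted P (f \<omega>) \<and> Q \<omega> (f \<omega>))"
  using assms(2)
proof (induction t arbitrary: c N Q)
  case 0
  have *: "length \<omega> = N \<Longrightarrow> set \<omega> \<subseteq> {..<R} \<Longrightarrow> \<omega> = [] \<and> halted P c \<and> Q \<omega> c" for \<omega>
    using 0[of \<omega>] by (auto elim: tape_steps.cases)
  \<comment> \<open>The tape of zeros is admissible since \<open>0 < R\<close>. Here and in the step
    case it is the sample from which facts that do not depend on the tape are read off, such as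
    \<open>N = 0\<close> once the program has halted.\<close>
  have "set (replicate N (0::nat)) \<subseteq> {..<R}" using \<open>0 < R\<close> by (simp add: set_replicate_conv_if)
  from *[OF _ this] have "N = 0" by simp
  with * show ?case by (intro exI[of _ "\<lambda>_. c"]) simp
next
  case (Suc t)
  have len: "length (replicate N (0::nat)) = N" "set (replicate N 0) \<subseteq> {..<R}"
    using \<open>0 < R\<close> by (auto simp: set_replicate_conv_if)
  show ?case
  proof (cases "halted P c")
    case True
    have *: "length \<omega> = N \<Longrightarrow> set \<omega> \<subseteq> {..<R} \<Longrightarrow> \<omega> = [] \<and> Q \<omega> c" for \<omega>
      using Suc.prems[of \<omega>] tape_steps_halted[OF _ True] by blast
    from *[of "replicate N 0"] len have "N = 0" by (cases N) auto
    with * True show ?thesis by (intro exI[of _ "\<lambda>_. c"]) (simp add: run_halted del: run.simps)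
  next
    case False
    have first: "\<exists>k\<le>t. \<exists>c' c1 \<omega>1. tape_step w R P (c, \<omega>) (c1, \<omega>1) \<and>
        tape_steps w R P k (c1, \<omega>1) (c', []) \<and> halted P c' \<and> Q \<omega> c'"
      if "length \<omega> = N" "set \<omega> \<subseteq> {..<R}" for \<omega>
    proof -
      from Suc.prems[OF that] obtain k c' where k: "k \<le> Suc t"
        "tape_steps w R P k (c, \<omega>) (c', [])" "halted P c'" "Q \<omega> c'" by blast
      from k(2) show ?thesis
      proof cases
        case refl
        with False k(3) show ?thesis by simp
      next
        case (step y k')
        with k show ?thesis by (cases y) (metis Suc_le_mono)
      qed
    qed
    show ?thesis
    proof (cases "\<exists>d s. P ! pc c = Rand d s")
      case True
      then obtain d s where ins: "P ! pc c = Rand d s" by blast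
      have st: "\<exists>x. \<omega> = x # \<omega>1 \<and> mem c s = R \<and> x < R \<and>
          c1 = write_reg w d x (allocate {d, s} c)"
        if "tape_step w R P (c, \<omega>) (c1, \<omega>1)" for \<omega> c1 \<omega>1
        using that ins by cases auto
      obtain c1 \<omega>1 where "tape_step w R P (c, replicate N 0) (c1, \<omega>1)" using first[OF len] by blast
      with st obtain x where "replicate N 0 = x # \<omega>1" "mem c s = R" by blast
      then obtain N' where N: "N = Suc N'" and R: "mem c s = R" by (cases N) auto
      let ?c = "\<lambda>x. write_reg w d x (allocate {d, s} c)"
      have "\<exists>f. run w P t (?c x) = map_pmf f (replicate_pmf N' (pmf_of_set {..<R})) \<and>
          (\<forall>\<omega>. length \<omega> = N' \<longrightarrow> set \<omega> \<subseteq> {..<R} \<longrightarrow> halted P (f \<omega>) \<and> Q (x # \<omega>) (f \<omega>))"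
        if "x < R" for x
      proof (rule Suc.IH)
        fix \<omega> assume "length \<omega> = N'" "set \<omega> \<subseteq> {..<R}"
        with that N first[of "x # \<omega>"] st[of "x # \<omega>"]
        show "\<exists>k\<le>t. \<exists>c'. tape_steps w R P k (?c x, \<omega>) (c', []) \<and> halted P c' \<and> Q (x # \<omega>) c'"
          by fastforce
      qed
      then obtain f where f: "run w P t (?c x) = map_pmf (f x) (replicate_pmf N' (pmf_of_set {..<R}))"
        "length \<omega> = N' \<Longrightarrow> set \<omega> \<subseteq> {..<R} \<Longrightarrow> halted P (f x \<omega>) \<and> Q (x # \<omega>) (f x \<omega>)"
        if "x < R" for x \<omega>
        by metis
      have "run w P (Suc t) c = bind_pmf (pmf_of_set {..<R}) (\<lambda>x. run w P t (?c x))"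
        using False ins R \<open>0 < R\<close>
        by (simp add: run_Suc_front step_def map_pmf_def bind_assoc_pmf bind_return_pmf allocate_def
            del: run.simps)
      also have "\<dots> = bind_pmf (pmf_of_set {..<R})
          (\<lambda>x. map_pmf (f x) (replicate_pmf N' (pmf_of_set {..<R})))"
        using \<open>0 < R\<close> by (intro bind_pmf_cong refl f) (auto simp: lessThan_empty_iff)
      also have "\<dots> = map_pmf (\<lambda>\<omega>. f (hd \<omega>) (tl \<omega>)) (replicate_pmf N (pmf_of_set {..<R}))"
        by (simp add: N map_pmf_def bind_assoc_pmf bind_return_pmf)
      finally show ?thesis
        using f(2) N by (intro exI[of _ "\<lambda>\<omega>. f (hd \<omega>) (tl \<omega>)"]) (auto simp: length_Suc_conv)
    next
      case nr: False
      let ?D = "exec w (P ! pc c) (allocate (accessed (P ! pc c) (mem c)) c)"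
      have st: "\<omega>1 = \<omega> \<and> ?D = return_pmf c1"
        if "tape_step w R P (c, \<omega>) (c1, \<omega>1)" for \<omega> c1 \<omega>1
        using that nr by cases auto
      from first[OF len] st obtain c1 where c1: "?D = return_pmf c1" by blast
      have "\<exists>f. run w P t c1 = map_pmf f (replicate_pmf N (pmf_of_set {..<R})) \<and>
          (\<forall>\<omega>. length \<omega> = N \<longrightarrow> set \<omega> \<subseteq> {..<R} \<longrightarrow> halted P (f \<omega>) \<and> Q \<omega> (f \<omega>))"
        using first st c1 by (intro Suc.IH) (metis return_pmf_inj)
      moreover have "run w P (Suc t) c = run w P t c1"
        using False c1 by (simp add: run_Suc_front step_def bind_return_pmf del: run.simps)
      ultimately show ?thesis by simp
    qed
  qed
qed

section \<open>A structured language compiled to the word RAM\<close>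

datatype expr = Num nat | Var nat | Op binop expr expr | Arr nat expr

record state =
  vars :: "nat \<Rightarrow> nat"
  arr :: "nat \<Rightarrow> nat \<Rightarrow> nat"
  inp :: "nat list"
  outp :: "(nat \<times> nat) list"
  tape :: "nat list"

fun val :: "expr \<Rightarrow> state \<Rightarrow> nat" where
  "val (Num k) s = k"
| "val (Var x) s = vars s x"
| "val (Op f a b) s = eval_binop f (val a s) (val b s)"
| "val (Arr f a) s = arr s f (val a s)"

text \<open>Variable \<open>x\<close> lives in register \<open>x < 50\<close>, registers \<open>50..99\<close> hold intermediate results, and
  entry \<open>j\<close> of array \<open>f < 16\<close> lives in register \<open>100 + f + 16 * j\<close>. Expressions are safe if no
  intermediate result exceeds the word size \<open>w\<close> and no array index exceeds \<open>X\<close>. Results of the other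
  operations cannot overflow, since they are at most their first operand.\<close>

fun safe :: "nat \<Rightarrow> nat \<Rightarrow> expr \<Rightarrow> state \<Rightarrow> bool" where
  "safe w X (Num k) s \<longleftrightarrow> k < 2 ^ w"
| "safe w X (Var x) s \<longleftrightarrow> True"
| "safe w X (Op f a b) s \<longleftrightarrow> safe w X a s \<and> safe w X b s \<and>
     (f = Add \<or> f = Mult \<longrightarrow> eval_binop f (val a s) (val b s) < 2 ^ w)"
| "safe w X (Arr f a) s \<longleftrightarrow> safe w X a s \<and> val a s \<le> X"

text \<open>The registers from \<open>d\<close> on serve as an evaluation stack, with the result in
  \<open>d\<close>. The bound \<open>99\<close> leaves room for the scratch register
  \<open>Suc d\<close>.\<close>

fun wf_expr :: "nat \<Rightarrow> expr \<Rightarrow> bool" where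
  "wf_expr d (Num k) \<longleftrightarrow> d < 100"
| "wf_expr d (Var x) \<longleftrightarrow> d < 100 \<and> x < 50"
| "wf_expr d (Op f a b) \<longleftrightarrow> d < 99 \<and> wf_expr d a \<and> wf_expr (Suc d) b"
| "wf_expr d (Arr f a) \<longleftrightarrow> d < 99 \<and> f < 16 \<and> wf_expr d a"

text \<open>Interleaving 16 arrays with stride 16 lets each of them grow with the input, although
  the program is fixed before \<open>n\<close> is known.\<close>

definition addr_code :: "nat \<Rightarrow> nat \<Rightarrow> instr list" where
  "addr_code f d =
    [LoadImm (Suc d) 16, Arith Mult d d (Suc d), LoadImm (Suc d) (100 + f), Arith Add d d (Suc d)]"

text \<open>No instruction copies a register, so a variable is added to zero.\<close>

fun code_expr :: "nat \<Rightarrow> expr \<Rightarrow> instr list" where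
  "code_expr d (Num k) = [LoadImm d k]"
| "code_expr d (Var x) = [LoadImm d 0, Arith Add d d x]"
| "code_expr d (Op f a b) = code_expr d a @ code_expr (Suc d) b @ [Arith f d d (Suc d)]"
| "code_expr d (Arr f a) = code_expr d a @ addr_code f d @ [Load d d]"

fun expr_time :: "expr \<Rightarrow> nat" where
  "expr_time (Num k) = 1"
| "expr_time (Var x) = 2"
| "expr_time (Op f a b) = expr_time a + expr_time b + 1"
| "expr_time (Arr f a) = expr_time a + 5"

lemma length_code_expr [simp]: "length (code_expr d e) = expr_time e"
  by (induction d e rule: code_expr.induct) (auto simp: addr_code_def)

datatype com =
    Skip
  | Assign nat expr
  | AAssign nat expr expr
  | GetLetter nat
  | Draw nat nat
  | Output expr expr
  | Seq com com  (infixr ";;" 60)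
  | Cond expr com com
  | While expr com

fun com_size :: "com \<Rightarrow> nat" where
  "com_size Skip = 0"
| "com_size (Assign x e) = expr_time e + 2"
| "com_size (AAssign f a e) = expr_time a + expr_time e + 5"
| "com_size (GetLetter x) = 1"
| "com_size (Draw x y) = 1"
| "com_size (Output a b) = expr_time a + expr_time b + 1"
| "com_size (c1 ;; c2) = com_size c1 + com_size c2"
| "com_size (Cond e c1 c2) = expr_time e + com_size c1 + com_size c2 + 2"
| "com_size (While e c) = expr_time e + com_size c + 2"

text \<open>Jump targets are absolute, so the code depends on the address \<open>p\<close> of its
  first instruction.\<close>

fun code_com :: "nat \<Rightarrow> com \<Rightarrow> instr list" where
  "code_com p Skip = []"
| "code_com p (Assign x e) = code_expr 50 e @ [LoadImm x 0, Arith Add x x 50]"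
| "code_com p (AAssign f a e) = code_expr 50 a @ addr_code f 50 @ code_expr 51 e @ [Store 50 51]"
| "code_com p (GetLetter x) = [Read x]"
| "code_com p (Draw x y) = [Rand x y]"
| "code_com p (Output a b) = code_expr 50 a @ code_expr 51 b @ [Report 50 51]"
| "code_com p (c1 ;; c2) = code_com p c1 @ code_com (p + com_size c1) c2"
| "code_com p (Cond e c1 c2) =
    (let p1 = p + expr_time e + 1; p2 = p1 + com_size c1 + 1; p3 = p2 + com_size c2
     in code_expr 50 e @ [JumpZero 50 p2] @ code_com p1 c1 @ [Jump p3] @ code_com p2 c2)"
| "code_com p (While e c) =
    (let p1 = p + expr_time e + 1; p2 = p1 + com_size c + 1
     in code_expr 50 e @ [JumpZero 50 p2] @ code_com p1 c @ [Jump p])"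

lemma length_code_com [simp]: "length (code_com p c) = com_size c"
  by (induction p c rule: code_com.induct) (auto simp: addr_code_def Let_def)

fun wf_com :: "com \<Rightarrow> bool" where
  "wf_com Skip \<longleftrightarrow> True"
| "wf_com (Assign x e) \<longleftrightarrow> x < 50 \<and> wf_expr 50 e"
| "wf_com (AAssign f a e) \<longleftrightarrow> f < 16 \<and> wf_expr 50 a \<and> wf_expr 51 e"
| "wf_com (GetLetter x) \<longleftrightarrow> x < 50"
| "wf_com (Draw x y) \<longleftrightarrow> x < 50 \<and> y < 50"
| "wf_com (Output a b) \<longleftrightarrow> wf_expr 50 a \<and> wf_expr 51 b"
| "wf_com (c1 ;; c2) \<longleftrightarrow> wf_com c1 \<and> wf_com c2"
| "wf_com (Cond e c1 c2) \<longleftrightarrow> wf_expr 50 e \<and> wf_com c1 \<and> wf_com c2"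
| "wf_com (While e c) \<longleftrightarrow> wf_expr 50 e \<and> wf_com c"

abbreviation set_var :: "state \<Rightarrow> nat \<Rightarrow> nat \<Rightarrow> state" where
  "set_var s x v \<equiv> s\<lparr>vars := (vars s)(x := v)\<rparr>"

text \<open>The number between the two states is the exact running time. No rule covers an overflow,
  an array index beyond \<open>X\<close>, an exhausted input or tape, or a draw from a range other
  than \<open>R\<close>; so a derivation also certifies that none of these occurs.\<close>

inductive big :: "nat \<Rightarrow> nat \<Rightarrow> nat \<Rightarrow> com \<Rightarrow> state \<Rightarrow> nat \<Rightarrow> state \<Rightarrow> bool"
  for w X R where
  Skip: "big w X R Skip s 0 s"
| Assign: "safe w X e s \<Longrightarrow> big w X R (Assign x e) s (expr_time e + 2) (set_var s x (val e s))"
| AAssign: "safe w X a s \<Longrightarrow> safe w X e s \<Longrightarrow> val a s \<le> X \<Longrightarrow>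
    big w X R (AAssign f a e) s (expr_time a + expr_time e + 5)
      (s\<lparr>arr := (arr s)(f := (arr s f)(val a s := val e s))\<rparr>)"
| GetLetter: "inp s = y # ys \<Longrightarrow> y < 2 ^ w \<Longrightarrow>
    big w X R (GetLetter x) s 1 (set_var (s\<lparr>inp := ys\<rparr>) x y)"
| Draw: "tape s = v # vs \<Longrightarrow> vars s y = R \<Longrightarrow> v < R \<Longrightarrow>
    big w X R (Draw x y) s 1 (set_var (s\<lparr>tape := vs\<rparr>) x v)"
| Output: "safe w X a s \<Longrightarrow> safe w X b s \<Longrightarrow>
    big w X R (Output a b) s (expr_time a + expr_time b + 1) (s\<lparr>outp := outp s @ [(val a s, val b s)]\<rparr>)"
| Seq: "big w X R c1 s t1 s1 \<Longrightarrow> big w X R c2 s1 t2 s2 \<Longrightarrow> big w X R (c1 ;; c2) s (t1 + t2) s2"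
| CondT: "safe w X e s \<Longrightarrow> val e s \<noteq> 0 \<Longrightarrow> big w X R c1 s t s' \<Longrightarrow>
    big w X R (Cond e c1 c2) s (expr_time e + 1 + t + 1) s'"
| CondF: "safe w X e s \<Longrightarrow> val e s = 0 \<Longrightarrow> big w X R c2 s t s' \<Longrightarrow>
    big w X R (Cond e c1 c2) s (expr_time e + 1 + t) s'"
| WhileT: "safe w X e s \<Longrightarrow> val e s \<noteq> 0 \<Longrightarrow> big w X R c s t s1 \<Longrightarrow> big w X R (While e c) s1 t' s' \<Longrightarrow>
    big w X R (While e c) s (expr_time e + 1 + t + 1 + t') s'"
| WhileF: "safe w X e s \<Longrightarrow> val e s = 0 \<Longrightarrow> big w X R (While e c) s (expr_time e + 1) s"

text \<open>Registers 50 to 99 are constrained by the word size only. The number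
  \<open>116 + 16 * X\<close> is one more than the largest array address
  \<open>100 + 15 + 16 * X\<close>.\<close>

definition represents :: "nat \<Rightarrow> nat \<Rightarrow> state \<Rightarrow> config \<Rightarrow> bool" where
  "represents w X s c \<longleftrightarrow>
     (\<forall>x<50. mem c x = vars s x) \<and> (\<forall>f<16. \<forall>j\<le>X. mem c (100 + f + 16 * j) = arr s f j) \<and>
     stream c = inp s \<and> out c = outp s \<and> used c \<le> 116 + 16 * X \<and> (\<forall>x. mem c x < 2 ^ w)"

section \<open>Simulation of the structured language by compiled code\<close>

definition code_at :: "instr list \<Rightarrow> nat \<Rightarrow> instr list \<Rightarrow> bool" where
  "code_at P p cs \<longleftrightarrow> (\<exists>us vs. P = us @ cs @ vs \<and> length us = p)"

lemma code_at_append [simp]: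
  "code_at P p (cs @ cs') \<longleftrightarrow> code_at P p cs \<and> code_at P (p + length cs) cs'"
proof
  assume "code_at P p cs \<and> code_at P (p + length cs) cs'"
  then obtain us vs us' vs' where *: "P = us @ cs @ vs" "length us = p"
    "P = us' @ cs' @ vs'" "length us' = p + length cs" unfolding code_at_def by blast
  then have "(us @ cs) @ vs = us' @ cs' @ vs'" "length (us @ cs) = length us'" by auto
  then have "us' = us @ cs" by (subst (asm) append_eq_append_conv) auto
  with * show "code_at P p (cs @ cs')" unfolding code_at_def by (intro exI[of _ us] exI[of _ vs']) auto
next
  assume "code_at P p (cs @ cs')"
  then obtain us vs where "P = us @ cs @ cs' @ vs" "length us = p" unfolding code_at_def by auto
  then show "code_at P p cs \<and> code_at P (p + length cs) cs'"
    unfolding code_at_def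
    by (intro conjI exI[of _ us] exI[of _ "cs' @ vs"] exI[of _ "us @ cs"] exI[of _ vs]) auto
qed

lemma code_at_Cons [simp]:
  "NO_MATCH [] cs \<Longrightarrow> code_at P p (i # cs) \<longleftrightarrow> code_at P p [i] \<and> code_at P (Suc p) cs"
  using code_at_append[of P p "[i]" cs] by simp

lemma code_at_single: "code_at P p [i] \<Longrightarrow> p < length P \<and> P ! p = i"
  by (auto simp: code_at_def nth_append)

lemma max_used: "finite A \<Longrightarrow> A \<subseteq> {..<b} \<Longrightarrow> u \<le> b \<Longrightarrow> Max (insert u (Suc ` A)) \<le> (b::nat)"
  by (subst Max_le_iff) auto

lemma tape_step_det:
  assumes "code_at P (pc c) [i]" "\<And>d s. i \<noteq> Rand d s"
    "exec w i (allocate (accessed i (mem c)) c) = return_pmf c'"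
  shows "tape_step w R P (c, \<omega>) (c', \<omega>)"
  using assms code_at_single[OF assms(1)] by (intro tape_step.det) (auto simp: halted_def)

lemma finite_accessed [simp]: "finite (accessed i M)"
  by (cases i) auto

lemma steps_write_temp:
  assumes "code_at P (pc c) [i]" "\<And>d s. i \<noteq> Rand d s"
    "exec w i (allocate (accessed i (mem c)) c) = return_pmf (write_reg w d v (allocate (accessed i (mem c)) c))"
    "represents w X s c" "50 \<le> d" "d < 100" "accessed i (mem c) \<subseteq> {..<116 + 16 * X}" "v < 2 ^ w"
  shows "\<exists>c'. tape_steps w R P 1 (c, \<omega>) (c', \<omega>) \<and> pc c' = Suc (pc c) \<and> mem c' = (mem c)(d := v) \<and>
    represents w X s c'"
proof (intro exI conjI)
  have "used c \<le> 116 + 16 * X" using assms(4) by (simp add: represents_def)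
  from max_used[OF finite_accessed assms(7) this]
  show "represents w X s (write_reg w d v (allocate (accessed i (mem c)) c))"
    using assms(4-6,8) by (simp add: represents_def write_reg_def allocate_def)
  show "tape_steps w R P 1 (c, \<omega>) (write_reg w d v (allocate (accessed i (mem c)) c), \<omega>)"
    by (intro tape_steps_one tape_step_det[OF assms(1,2)] assms(3)) 
qed (use assms(8) in \<open>simp_all add: write_reg_def allocate_def\<close>)

lemma steps_LoadImm:
  assumes "code_at P (pc c) [LoadImm d k]" "represents w X s c" "50 \<le> d" "d < 100" "k < 2 ^ w"
  shows "\<exists>c'. tape_steps w R P 1 (c, \<omega>) (c', \<omega>) \<and> pc c' = Suc (pc c) \<and> mem c' = (mem c)(d := k) \<and>
    represents w X s c'"
  by (rule steps_write_temp[OF assms(1) _ _ assms(2-4)]) (use assms in auto)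

lemma steps_Arith:
  assumes "code_at P (pc c) [Arith f d x y]" "represents w X s c" "50 \<le> d" "d < 100"
    "x < 100" "y < 100" "eval_binop f (mem c x) (mem c y) < 2 ^ w"
  shows "\<exists>c'. tape_steps w R P 1 (c, \<omega>) (c', \<omega>) \<and> pc c' = Suc (pc c) \<and>
    mem c' = (mem c)(d := eval_binop f (mem c x) (mem c y)) \<and> represents w X s c'"
  by (rule steps_write_temp[OF assms(1) _ _ assms(2-4)]) (use assms in \<open>auto simp: allocate_def\<close>)

lemma steps_Load:
  assumes "code_at P (pc c) [Load d x]" "represents w X s c" "50 \<le> d" "d < 100"
    "x < 100" "mem c x < 116 + 16 * X"
  shows "\<exists>c'. tape_steps w R P 1 (c, \<omega>) (c', \<omega>) \<and> pc c' = Suc (pc c) \<and>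
    mem c' = (mem c)(d := mem c (mem c x)) \<and> represents w X s c'"
  by (rule steps_write_temp[OF assms(1) _ _ assms(2-4)])
    (use assms in \<open>auto simp: allocate_def represents_def\<close>)

lemma represents_lt: "represents w X s c \<Longrightarrow> mem c x < 2 ^ w"
  by (simp add: represents_def)

lemma eval_binop_less:
  "x < b \<Longrightarrow> (f = Add \<or> f = Mult \<longrightarrow> eval_binop f x y < b) \<Longrightarrow> eval_binop f x y < b"
  by (cases f) (auto intro: le_less_trans[OF diff_le_self] le_less_trans[OF div_le_dividend]
      le_less_trans[OF mod_less_eq_dividend])

lemma val_less:
  assumes "represents w X s c" "safe w X e s" "wf_expr d e"
  shows "val e s < 2 ^ w"
  using assms(2,3)
proof (induction e arbitrary: d)
  case (Var x)
  then show ?case using assms(1) by (metis represents_def safe.simps(2) val.simps(2) wf_expr.simps(2))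
next
  case (Op f a b)
  then show ?case using eval_binop_less by auto
next
  case (Arr f a)
  then have "arr s f (val a s) = mem c (100 + f + 16 * val a s)"
    using assms(1) by (simp add: represents_def)
  then show ?case using assms(1) by (simp add: represents_def)
qed auto

lemma addr_code_correct:
  assumes rep: "represents w X s c" and room: "116 + 16 * X \<le> 2 ^ w"
    and at: "code_at P (pc c) (addr_code f d)" and d: "50 \<le> d" "d < 99" "f < 16" and j: "mem c d \<le> X"
  shows "\<exists>c'. tape_steps w R P 4 (c, \<omega>) (c', \<omega>) \<and> pc c' = pc c + 4 \<and> represents w X s c' \<and>
    mem c' d = 100 + f + 16 * mem c d \<and> (\<forall>x<d. mem c' x = mem c x)"
proof -
  have at': "code_at P (pc c) [LoadImm (Suc d) 16]" "code_at P (Suc (pc c)) [Arith Mult d d (Suc d)]"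
    "code_at P (Suc (Suc (pc c))) [LoadImm (Suc d) (100 + f)]"
    "code_at P (Suc (Suc (Suc (pc c)))) [Arith Add d d (Suc d)]"
    using at by (simp_all add: addr_code_def)
  obtain c1 where c1: "tape_steps w R P 1 (c, \<omega>) (c1, \<omega>)" "pc c1 = Suc (pc c)"
    "mem c1 = (mem c)(Suc d := 16)" "represents w X s c1"
    using steps_LoadImm[OF at'(1) rep] d room by fastforce
  have "eval_binop Mult (mem c1 d) (mem c1 (Suc d)) < 2 ^ w" using c1(3) j room by simp
  then obtain c2 where c2: "tape_steps w R P 1 (c1, \<omega>) (c2, \<omega>)" "pc c2 = Suc (Suc (pc c))"
    "mem c2 = (mem c1)(d := mem c d * 16)" "represents w X s c2"
    using steps_Arith[OF _ c1(4), of P Mult d d "Suc d"] at'(2) c1(2,3) d by fastforce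
  obtain c3 where c3: "tape_steps w R P 1 (c2, \<omega>) (c3, \<omega>)" "pc c3 = Suc (Suc (Suc (pc c)))"
    "mem c3 = (mem c2)(Suc d := 100 + f)" "represents w X s c3"
    using steps_LoadImm[OF _ c2(4), of P "Suc d" "100 + f" R \<omega>] at'(3) c2(2) d room by auto
  have "eval_binop Add (mem c3 d) (mem c3 (Suc d)) < 2 ^ w" using c3(3) c2(3) j room d by simp
  then obtain c4 where c4: "tape_steps w R P 1 (c3, \<omega>) (c4, \<omega>)" "pc c4 = Suc (Suc (Suc (Suc (pc c))))"
    "mem c4 = (mem c3)(d := mem c d * 16 + (100 + f))" "represents w X s c4"
    using steps_Arith[OF _ c3(4), of P Add d d "Suc d" R \<omega>] at'(4) c3(2,3) c2(3) d by auto
  have "tape_steps w R P (1 + (1 + (1 + 1))) (c, \<omega>) (c4, \<omega>)"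
    using c1(1) c2(1) c3(1) c4(1) by (blast intro: tape_steps_trans)
  then show ?thesis
    using c4 c3(3) c2(3) c1(3) by (intro exI[of _ c4]) (auto simp: numeral_eq_Suc)
qed

lemma code_expr_correct:
  assumes room: "116 + 16 * X \<le> 2 ^ w"
  shows "represents w X s c \<Longrightarrow> code_at P (pc c) (code_expr d e) \<Longrightarrow> 50 \<le> d \<Longrightarrow> wf_expr d e \<Longrightarrow>
    safe w X e s \<Longrightarrow>
    \<exists>c'. tape_steps w R P (expr_time e) (c, \<omega>) (c', \<omega>) \<and> pc c' = pc c + expr_time e \<and>
      represents w X s c' \<and> mem c' d = val e s \<and> (\<forall>x<d. mem c' x = mem c x)"
proof (induction d e arbitrary: c rule: code_expr.induct)
  case (1 d k)
  then show ?case using steps_LoadImm[of P c d k w X s] by fastforce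
next
  case (2 d x)
  obtain c1 where c1: "tape_steps w R P 1 (c, \<omega>) (c1, \<omega>)" "pc c1 = Suc (pc c)"
    "mem c1 = (mem c)(d := 0)" "represents w X s c1"
    using steps_LoadImm[of P c d 0 w X s] 2 by fastforce
  have "mem c1 x = vars s x" "mem c1 d = 0" using c1(3,4) 2 by (auto simp: represents_def)
  then obtain c2 where c2: "tape_steps w R P 1 (c1, \<omega>) (c2, \<omega>)" "pc c2 = Suc (Suc (pc c))"
    "mem c2 = (mem c1)(d := vars s x)" "represents w X s c2"
    using steps_Arith[OF _ c1(4), of P Add d d x R \<omega>] 2 c1(2) represents_lt[OF c1(4), of x] by auto
  have "tape_steps w R P (1 + 1) (c, \<omega>) (c2, \<omega>)"
    using c1(1) c2(1) by (blast intro: tape_steps_trans)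
  then show ?case
    using c2 c1(3) by (intro exI[of _ c2]) (auto simp: numeral_eq_Suc)
next
  case (3 d f a b)
  obtain c1 where c1: "tape_steps w R P (expr_time a) (c, \<omega>) (c1, \<omega>)" "pc c1 = pc c + expr_time a"
    "represents w X s c1" "mem c1 d = val a s" "\<forall>x<d. mem c1 x = mem c x"
    using 3(1)[OF 3(3)] 3(4-) by auto
  obtain c2 where c2: "tape_steps w R P (expr_time b) (c1, \<omega>) (c2, \<omega>)" "pc c2 = pc c1 + expr_time b"
    "represents w X s c2" "mem c2 (Suc d) = val b s" "\<forall>x<Suc d. mem c2 x = mem c1 x"
    using 3(2)[OF c1(3)] 3(4-) c1(2) by auto
  have "eval_binop f (val a s) (val b s) < 2 ^ w"
    using val_less[OF c1(3) 3(7,6)] by simp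
  then obtain c3 where c3: "tape_steps w R P 1 (c2, \<omega>) (c3, \<omega>)" "pc c3 = Suc (pc c2)"
    "mem c3 = (mem c2)(d := eval_binop f (val a s) (val b s))" "represents w X s c3"
    using steps_Arith[OF _ c2(3), of P f d d "Suc d" R \<omega>] 3(4-) c1 c2 by auto
  have "tape_steps w R P (expr_time a + (expr_time b + 1)) (c, \<omega>) (c3, \<omega>)"
    using c1(1) c2(1) c3(1) by (blast intro: tape_steps_trans)
  then show ?case
    using c3 c2 c1 by (intro exI[of _ c3]) (auto simp: add.assoc)
next
  case (4 d f a)
  obtain c1 where c1: "tape_steps w R P (expr_time a) (c, \<omega>) (c1, \<omega>)" "pc c1 = pc c + expr_time a"
    "represents w X s c1" "mem c1 d = val a s" "\<forall>x<d. mem c1 x = mem c x"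
    using 4(1)[OF 4(2)] 4(3-) by auto
  obtain c2 where c2: "tape_steps w R P 4 (c1, \<omega>) (c2, \<omega>)" "pc c2 = pc c1 + 4"
    "represents w X s c2" "mem c2 d = 100 + f + 16 * val a s" "\<forall>x<d. mem c2 x = mem c1 x"
    using addr_code_correct[OF c1(3) room, of P f d R \<omega>] 4(3-) c1(2,4) by (auto simp: numeral_eq_Suc)
  have len: "length (addr_code f d) = 4" by (simp add: addr_code_def)
  obtain c3 where c3: "tape_steps w R P 1 (c2, \<omega>) (c3, \<omega>)" "pc c3 = Suc (pc c2)"
    "mem c3 = (mem c2)(d := mem c2 (mem c2 d))" "represents w X s c3"
    using steps_Load[OF _ c2(3), of P d d R \<omega>] 4(3-) c1 c2 len by (auto simp: add.assoc)
  have "tape_steps w R P (expr_time a + (4 + 1)) (c, \<omega>) (c3, \<omega>)"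
    using c1(1) c2(1) c3(1) by (blast intro: tape_steps_trans)
  moreover have "mem c2 (mem c2 d) = arr s f (val a s)"
    using c2(3,4) 4(3-) by (simp add: represents_def)
  ultimately show ?case
    using c3 c2 c1 by (intro exI[of _ c3]) (auto simp: add.assoc)
qed

text \<open>The residue modulo 16 identifies the array, so a store leaves all other cells
  alone.\<close>

lemma cell_eq_iff:
  fixes f f' j j' :: nat
  assumes "f < 16" "f' < 16"
  shows "f + 16 * j = f' + 16 * j' \<longleftrightarrow> f = f' \<and> j = j'"
proof
  assume *: "f + 16 * j = f' + 16 * j'"
  have "(f + 16 * j) mod 16 = f" "(f' + 16 * j') mod 16 = f'" using assms by auto
  with * have "f = f'" by metis
  with * show "f = f' \<and> j = j'" by simp
qed simp

text \<open>Induction on the evaluation instead of the command: after an iteration the same loop is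
  evaluated once more, from the configuration that has jumped back to its start.\<close>

lemma code_com_correct:
  assumes room: "116 + 16 * X \<le> 2 ^ w"
  shows "big w X R cm s t s' \<Longrightarrow> represents w X s c \<Longrightarrow> code_at P (pc c) (code_com (pc c) cm) \<Longrightarrow>
    wf_com cm \<Longrightarrow>
    \<exists>c'. tape_steps w R P t (c, tape s) (c', tape s') \<and> pc c' = pc c + com_size cm \<and> represents w X s' c'"
proof (induction arbitrary: c rule: big.induct)
  case (Skip s)
  then show ?case using tape_steps.refl by fastforce
next
  case (Assign e s x)
  obtain c1 where c1: "tape_steps w R P (expr_time e) (c, tape s) (c1, tape s)"
    "pc c1 = pc c + expr_time e" "represents w X s c1" "mem c1 50 = val e s"
    using code_expr_correct[OF room Assign(2), of P 50 e R "tape s"] Assign by auto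
  have at: "code_at P (pc c1) [LoadImm x 0]" "code_at P (Suc (pc c1)) [Arith Add x x 50]" "x < 50"
    using Assign(3,4) c1(2) by auto
  let ?c2 = "write_reg w x 0 (allocate {x} c1)"
  have s2: "tape_step w R P (c1, tape s) (?c2, tape s)"
    by (rule tape_step_det[OF at(1)]) auto
  let ?c3 = "write_reg w x (val e s) (allocate {x, x, 50} ?c2)"
  have lt: "val e s < 2 ^ w" using c1(4) represents_lt[OF c1(3), of 50] by simp
  have m: "mem ?c2 50 = val e s" "mem ?c2 x = 0" "pc ?c2 = Suc (pc c1)"
    using c1(4) at(3) by (auto simp: write_reg_def allocate_def)
  have s3: "tape_step w R P (?c2, tape s) (?c3, tape s)"
    by (rule tape_step_det[of _ _ "Arith Add x x 50"]) (use at(2) m in \<open>auto simp: allocate_def\<close>)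
  have "used ?c3 \<le> 116 + 16 * X"
    using c1(3) at(3) by (simp add: represents_def write_reg_def allocate_def)
  then have "represents w X (set_var s x (val e s)) ?c3"
    using c1(3) at(3) lt by (simp add: represents_def write_reg_def allocate_def)
  moreover have "tape_steps w R P (expr_time e + 2) (c, tape s) (?c3, tape s)"
    using tape_steps_snoc[OF tape_steps_snoc[OF c1(1) s2] s3] by simp
  moreover have "pc ?c3 = pc c + com_size (Assign x e)" using c1(2) by (simp add: write_reg_def allocate_def)
  ultimately show ?case by (intro exI[of _ ?c3]) simp
next
  case (AAssign a s e f)
  obtain c1 where c1: "tape_steps w R P (expr_time a) (c, tape s) (c1, tape s)"
    "pc c1 = pc c + expr_time a" "represents w X s c1" "mem c1 50 = val a s"
    using code_expr_correct[OF room AAssign(4), of P 50 a R "tape s"] AAssign by auto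
  have len: "length (addr_code f 50) = 4" by (simp add: addr_code_def)
  obtain c2 where c2: "tape_steps w R P 4 (c1, tape s) (c2, tape s)" "pc c2 = pc c1 + 4"
    "represents w X s c2" "mem c2 50 = 100 + f + 16 * val a s"
    using addr_code_correct[OF c1(3) room, of P f 50 R "tape s"] AAssign c1(2,4) by auto
  obtain c3 where c3: "tape_steps w R P (expr_time e) (c2, tape s) (c3, tape s)"
    "pc c3 = pc c2 + expr_time e" "represents w X s c3" "mem c3 51 = val e s" "mem c3 50 = mem c2 50"
    using code_expr_correct[OF room c2(3), of P 51 e R "tape s"] AAssign c1 c2 len by (auto simp: add.assoc)
  have at: "code_at P (pc c3) [Store 50 51]"
    using AAssign c1 c2 c3 len by (auto simp: add.assoc)
  let ?A = "{50, 51, mem c3 50}"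
  let ?c4 = "write_reg w (mem c3 50) (mem c3 51) (allocate ?A c3)"
  have s4: "tape_step w R P (c3, tape s) (?c4, tape s)"
    by (rule tape_step_det[OF at]) (auto simp: allocate_def)
  have lt: "val e s < 2 ^ w" using c3(4) represents_lt[OF c3(3), of 51] by simp
  let ?j = "val a s"
  have adr: "mem c3 50 = 100 + f + 16 * ?j" and jX: "?j \<le> X" "f < 16"
    using c3(5) c2(4) AAssign by auto
  have used4: "used ?c4 \<le> 116 + 16 * X"
    using c3(3) adr jX by (simp add: represents_def write_reg_def allocate_def)
  have "100 + f' + 16 * j' = mem c3 50 \<longleftrightarrow> f' = f \<and> j' = ?j" if "f' < 16" for f' j'
    using that jX adr cell_eq_iff[of f' f j' ?j] by simp
  moreover have m4: "mem ?c4 = (mem c3)(mem c3 50 := val e s)"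
    using lt c3(4) by (simp add: write_reg_def allocate_def)
  ultimately have "mem ?c4 (100 + f' + 16 * j') = ((arr s)(f := (arr s f)(?j := val e s))) f' j'"
    if "f' < 16" "j' \<le> X" for f' j'
    using that c3(3) by (simp add: represents_def)
  moreover have "mem ?c4 x = vars s x" if "x < 50" for x
    using that m4 adr c3(3) by (simp add: represents_def)
  moreover have "mem ?c4 x < 2 ^ w" for x
    using m4 lt represents_lt[OF c3(3)] by simp
  ultimately have "represents w X (s\<lparr>arr := (arr s)(f := (arr s f)(?j := val e s))\<rparr>) ?c4"
    using c3(3) used4 by (simp add: represents_def) (simp add: write_reg_def allocate_def)
  moreover have "tape_steps w R P (expr_time a + (4 + (expr_time e + 1))) (c, tape s) (?c4, tape s)"
    using c1(1) c2(1) c3(1) tape_steps_one[OF s4] by (blast intro: tape_steps_trans)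
  moreover have "pc ?c4 = pc c + com_size (AAssign f a e)"
    using c1(2) c2(2) c3(2) by (simp add: write_reg_def allocate_def)
  ultimately show ?case by (intro exI[of _ ?c4]) (simp add: ac_simps)
next
  case (GetLetter s y ys x)
  let ?c = "write_reg w x y ((allocate {x} c)\<lparr>stream := ys\<rparr>)"
  have st: "stream c = y # ys" using GetLetter by (simp add: represents_def)
  have "tape_step w R P (c, tape s) (?c, tape s)"
    by (rule tape_step_det[of _ _ "Read x"]) (use GetLetter st in \<open>auto simp: allocate_def\<close>)
  moreover have "represents w X (set_var (s\<lparr>inp := ys\<rparr>) x y) ?c"
    using GetLetter by (auto simp: represents_def write_reg_def allocate_def)
  ultimately show ?case
    using tape_steps_one by (intro exI[of _ ?c]) (auto simp: write_reg_def allocate_def)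
next
  case (Draw s v vs y x)
  let ?c = "write_reg w x v (allocate {x, y} c)"
  have lt: "v < 2 ^ w" "mem c y = R" using Draw represents_lt[of w X s c y]
    by (auto simp: represents_def)
  have at: "code_at P (pc c) [Rand x y]" using Draw by auto
  have "tape_step w R P (c, v # vs) (?c, vs)"
    using code_at_single[OF at] lt Draw by (intro tape_step.rnd) (auto simp: halted_def)
  moreover have "represents w X (set_var (s\<lparr>tape := vs\<rparr>) x v) ?c"
    using Draw lt by (auto simp: represents_def write_reg_def allocate_def)
  ultimately show ?case
    using tape_steps_one Draw by (intro exI[of _ ?c]) (auto simp: write_reg_def allocate_def)
next
  case (Output a s b)
  obtain c1 where c1: "tape_steps w R P (expr_time a) (c, tape s) (c1, tape s)"
    "pc c1 = pc c + expr_time a" "represents w X s c1" "mem c1 50 = val a s"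
    using code_expr_correct[OF room Output(3), of P 50 a R "tape s"] Output by auto
  obtain c2 where c2: "tape_steps w R P (expr_time b) (c1, tape s) (c2, tape s)"
    "pc c2 = pc c1 + expr_time b" "represents w X s c2" "mem c2 51 = val b s" "mem c2 50 = mem c1 50"
    using code_expr_correct[OF room c1(3), of P 51 b R "tape s"] Output c1 by auto
  have at: "code_at P (pc c2) [Report 50 51]"
    using Output c1 c2 by (auto simp: add.assoc)
  let ?c3 = "goto (pc c2 + 1) (allocate {50, 51} c2\<lparr>out := out c2 @ [(mem c2 50, mem c2 51)]\<rparr>)"
  have s3: "tape_step w R P (c2, tape s) (?c3, tape s)"
    by (rule tape_step_det[OF at]) (auto simp: allocate_def goto_def)
  have "represents w X (s\<lparr>outp := outp s @ [(val a s, val b s)]\<rparr>) ?c3"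
    using c2 c1 by (auto simp: represents_def goto_def allocate_def)
  moreover have "tape_steps w R P (expr_time a + (expr_time b + 1)) (c, tape s) (?c3, tape s)"
    using c1(1) c2(1) tape_steps_one[OF s3] by (blast intro: tape_steps_trans)
  ultimately show ?case using c1(2) c2(2)
    by (intro exI[of _ ?c3]) (auto simp: add.assoc goto_def)
next
  case (Seq c1 s t1 s1 c2 t2 s2)
  obtain d1 where d1: "tape_steps w R P t1 (c, tape s) (d1, tape s1)" "pc d1 = pc c + com_size c1"
    "represents w X s1 d1"
    using Seq(3)[OF Seq(5)] Seq(6,7) by auto
  obtain d2 where d2: "tape_steps w R P t2 (d1, tape s1) (d2, tape s2)" "pc d2 = pc d1 + com_size c2"
    "represents w X s2 d2"
    using Seq(4)[OF d1(3)] Seq(6,7) d1(2) by auto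
  show ?case using tape_steps_trans[OF d1(1) d2(1)] d1 d2 by (intro exI[of _ d2]) auto
next
  case (CondT e s b1 t s' b2)
  obtain c1 where c1: "tape_steps w R P (expr_time e) (c, tape s) (c1, tape s)"
    "pc c1 = pc c + expr_time e" "represents w X s c1" "mem c1 50 = val e s"
    using code_expr_correct[OF room CondT(5), of P 50 e R "tape s"] CondT by (auto simp: Let_def)
  let ?p1 = "pc c + expr_time e + 1" let ?p2 = "?p1 + com_size b1 + 1" let ?p3 = "?p2 + com_size b2"
  have at: "code_at P (pc c1) [JumpZero 50 ?p2]" "code_at P ?p1 (code_com ?p1 b1)"
    "code_at P (?p1 + com_size b1) [Jump ?p3]"
    using CondT(6) c1(2) by (auto simp: Let_def add.assoc)
  let ?c2 = "goto (pc c1 + 1) (allocate {50} c1)"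
  have s2: "tape_step w R P (c1, tape s) (?c2, tape s)"
    by (rule tape_step_det[OF at(1)]) (use CondT c1 in \<open>auto simp: allocate_def goto_def\<close>)
  have r2: "represents w X s ?c2" "pc ?c2 = ?p1"
    using c1 by (auto simp: represents_def goto_def allocate_def)
  obtain c3 where c3: "tape_steps w R P t (?c2, tape s) (c3, tape s')" "pc c3 = pc ?c2 + com_size b1"
    "represents w X s' c3"
    using CondT(4)[OF r2(1)] at(2) r2(2) CondT(7) by auto
  let ?c4 = "goto ?p3 (allocate {} c3)"
  have s4: "tape_step w R P (c3, tape s') (?c4, tape s')"
    by (rule tape_step_det[of _ _ "Jump ?p3"]) (use at(3) c3(2) r2(2) in \<open>auto simp: allocate_def goto_def\<close>)
  have "tape_steps w R P (expr_time e + (1 + (t + 1))) (c, tape s) (?c4, tape s')"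
    using c1(1) tape_steps_one[OF s2] c3(1) tape_steps_one[OF s4] by (blast intro: tape_steps_trans)
  moreover have "represents w X s' ?c4" using c3(3) by (simp add: represents_def goto_def allocate_def)
  ultimately show ?case by (intro exI[of _ ?c4]) (simp add: goto_def add.assoc)
next
  case (CondF e s b2 t s' b1)
  obtain c1 where c1: "tape_steps w R P (expr_time e) (c, tape s) (c1, tape s)"
    "pc c1 = pc c + expr_time e" "represents w X s c1" "mem c1 50 = val e s"
    using code_expr_correct[OF room CondF(5), of P 50 e R "tape s"] CondF by (auto simp: Let_def)
  let ?p1 = "pc c + expr_time e + 1" let ?p2 = "?p1 + com_size b1 + 1"
  have at: "code_at P (pc c1) [JumpZero 50 ?p2]" "code_at P ?p2 (code_com ?p2 b2)"
    using CondF(6) c1(2) by (auto simp: Let_def add.assoc)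
  let ?c2 = "goto ?p2 (allocate {50} c1)"
  have s2: "tape_step w R P (c1, tape s) (?c2, tape s)"
    by (rule tape_step_det[OF at(1)]) (use CondF c1 in \<open>auto simp: allocate_def goto_def\<close>)
  have r2: "represents w X s ?c2" "pc ?c2 = ?p2"
    using c1 by (auto simp: represents_def goto_def allocate_def)
  obtain c3 where c3: "tape_steps w R P t (?c2, tape s) (c3, tape s')" "pc c3 = pc ?c2 + com_size b2"
    "represents w X s' c3"
    using CondF(4)[OF r2(1)] at(2) r2(2) CondF(7) by auto
  have "tape_steps w R P (expr_time e + (1 + t)) (c, tape s) (c3, tape s')"
    using c1(1) tape_steps_one[OF s2] c3(1) by (blast intro: tape_steps_trans)
  then show ?case using c3 r2(2) by (intro exI[of _ c3]) (simp add: add.assoc)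
next
  case (WhileT e s b t s1 t' s')
  obtain c1 where c1: "tape_steps w R P (expr_time e) (c, tape s) (c1, tape s)"
    "pc c1 = pc c + expr_time e" "represents w X s c1" "mem c1 50 = val e s"
    using code_expr_correct[OF room WhileT(7), of P 50 e R "tape s"] WhileT by (auto simp: Let_def)
  let ?p1 = "pc c + expr_time e + 1" let ?p2 = "?p1 + com_size b + 1"
  have at: "code_at P (pc c1) [JumpZero 50 ?p2]" "code_at P ?p1 (code_com ?p1 b)"
    "code_at P (?p1 + com_size b) [Jump (pc c)]"
    using WhileT(8) c1(2) by (auto simp: Let_def add.assoc)
  let ?c2 = "goto (pc c1 + 1) (allocate {50} c1)"
  have s2: "tape_step w R P (c1, tape s) (?c2, tape s)"
    by (rule tape_step_det[OF at(1)]) (use WhileT c1 in \<open>auto simp: allocate_def goto_def\<close>)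
  have r2: "represents w X s ?c2" "pc ?c2 = ?p1"
    using c1 by (auto simp: represents_def goto_def allocate_def)
  obtain c3 where c3: "tape_steps w R P t (?c2, tape s) (c3, tape s1)" "pc c3 = pc ?c2 + com_size b"
    "represents w X s1 c3"
    using WhileT(5)[OF r2(1)] at(2) r2(2) WhileT(9) by auto
  let ?c4 = "goto (pc c) (allocate {} c3)"
  have s4: "tape_step w R P (c3, tape s1) (?c4, tape s1)"
    by (rule tape_step_det[of _ _ "Jump (pc c)"]) (use at(3) c3(2) r2(2) in \<open>auto simp: allocate_def goto_def\<close>)
  have r4: "represents w X s1 ?c4" "pc ?c4 = pc c"
    using c3(3) by (simp_all add: represents_def goto_def allocate_def)
  obtain c5 where c5: "tape_steps w R P t' (?c4, tape s1) (c5, tape s')"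
    "pc c5 = pc ?c4 + com_size (While e b)" "represents w X s' c5"
    using WhileT(6)[OF r4(1)] WhileT(8,9) r4(2) by auto
  have "tape_steps w R P (expr_time e + (1 + (t + (1 + t')))) (c, tape s) (c5, tape s')"
    using c1(1) tape_steps_one[OF s2] c3(1) tape_steps_one[OF s4] c5(1)
    by (blast intro: tape_steps_trans)
  then show ?case using c5 r4 by (intro exI[of _ c5]) (simp add: add.assoc)
next
  case (WhileF e s b)
  obtain c1 where c1: "tape_steps w R P (expr_time e) (c, tape s) (c1, tape s)"
    "pc c1 = pc c + expr_time e" "represents w X s c1" "mem c1 50 = val e s"
    using code_expr_correct[OF room WhileF(3), of P 50 e R "tape s"] WhileF by (auto simp: Let_def)
  let ?p2 = "pc c + expr_time e + 1 + com_size b + 1"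
  have at: "code_at P (pc c1) [JumpZero 50 ?p2]"
    using WhileF(4) c1(2) by (auto simp: Let_def add.assoc)
  let ?c2 = "goto ?p2 (allocate {50} c1)"
  have s2: "tape_step w R P (c1, tape s) (?c2, tape s)"
    by (rule tape_step_det[OF at(1)]) (use WhileF c1 in \<open>auto simp: allocate_def goto_def\<close>)
  have "represents w X s ?c2" "pc ?c2 = ?p2"
    using c1 by (auto simp: represents_def goto_def allocate_def)
  then show ?case using tape_steps_snoc[OF c1(1) s2] by (intro exI[of _ ?c2]) simp
qed

section \<open>Total correctness with running times\<close>

definition terminates :: "nat \<Rightarrow> nat \<Rightarrow> nat \<Rightarrow> com \<Rightarrow> state \<Rightarrow> nat \<Rightarrow> (state \<Rightarrow> bool) \<Rightarrow> bool" where
  "terminates w X R c s T Q \<longleftrightarrow> (\<exists>t\<le>T. \<exists>s'. big w X R c s t s' \<and> Q s')"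

lemma terminates_mono:
  "terminates w X R c s T Q \<Longrightarrow> T \<le> T' \<Longrightarrow> (\<And>s'. Q s' \<Longrightarrow> Q' s') \<Longrightarrow> terminates w X R c s T' Q'"
  unfolding terminates_def by (meson order_trans)

lemma terminates_Seq:
  assumes "terminates w X R c1 s T1 Q1" "\<And>s1. Q1 s1 \<Longrightarrow> terminates w X R c2 s1 T2 Q"
  shows "terminates w X R (c1 ;; c2) s (T1 + T2) Q"
proof -
  from assms obtain t1 s1 t2 s2 where "t1 \<le> T1" "big w X R c1 s t1 s1"
    "t2 \<le> T2" "big w X R c2 s1 t2 s2" "Q s2" unfolding terminates_def by meson
  then show ?thesis unfolding terminates_def
    by (intro exI[of _ "t1 + t2"] exI[of _ s2]) (auto intro: big.Seq)
qed

text \<open>\<open>k\<close> bounds the remaining iterations; the loop may stop sooner. The cost of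
  an iteration depends on \<open>k\<close> because only the rounds at multiples of \<open>g\<close>
  pay for a scan of all records, and a uniform bound per round would be too weak.\<close>

lemma terminates_While:
  fixes k :: nat and T :: "nat \<Rightarrow> nat"
  assumes "I k s" "\<And>k s. I k s \<Longrightarrow> safe w X e s"
    and "\<And>k s. I k s \<Longrightarrow> val e s \<noteq> 0 \<Longrightarrow> k > 0 \<and> terminates w X R c s (T k) (I (k - 1))"
  shows "terminates w X R (While e c) s ((\<Sum>j=1..k. T j + (expr_time e + 2)) + expr_time e + 1)
    (\<lambda>s'. (\<exists>k'. I k' s') \<and> val e s' = 0)"
  using assms(1)
proof (induction k arbitrary: s)
  case 0
  then have "val e s = 0" using assms(3) by blast
  with 0 have "big w X R (While e c) s (expr_time e + 1) s" using assms(2) by (intro big.WhileF)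
  with 0 \<open>val e s = 0\<close> show ?case unfolding terminates_def
    by (intro exI[of _ "expr_time e + 1"] exI[of _ s]) auto
next
  case (Suc k)
  show ?case
  proof (cases "val e s = 0")
    case True
    then have "big w X R (While e c) s (expr_time e + 1) s"
      using assms(2)[OF Suc.prems] by (intro big.WhileF)
    then show ?thesis using Suc.prems True unfolding terminates_def
      by (intro exI[of _ "expr_time e + 1"] exI[of _ s]) auto
  next
    case False
    then obtain t s1 where s1: "t \<le> T (Suc k)" "big w X R c s t s1" "I k s1"
      using assms(3)[OF Suc.prems] by (auto simp: terminates_def)
    from Suc.IH[OF s1(3)] obtain t' s' where s': "big w X R (While e c) s1 t' s'"
      "t' \<le> (\<Sum>j=1..k. T j + (expr_time e + 2)) + expr_time e + 1"
      "(\<exists>k'. I k' s') \<and> val e s' = 0" by (auto simp: terminates_def)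
    show ?thesis unfolding terminates_def
      using big.WhileT[OF assms(2)[OF Suc.prems] False s1(2) s'(1)] s' s1(1)
      by (intro exI[of _ "expr_time e + 1 + t + 1 + t'"]) auto
  qed
qed

text \<open>The weakest precondition of a loop-free program. Its size bounds its running time.\<close>

fun loop_free :: "com \<Rightarrow> bool" where
  "loop_free (c1 ;; c2) \<longleftrightarrow> loop_free c1 \<and> loop_free c2"
| "loop_free (Cond e c1 c2) \<longleftrightarrow> loop_free c1 \<and> loop_free c2"
| "loop_free (While e c) \<longleftrightarrow> False"
| "loop_free _ \<longleftrightarrow> True"

fun wp :: "nat \<Rightarrow> nat \<Rightarrow> nat \<Rightarrow> com \<Rightarrow> (state \<Rightarrow> bool) \<Rightarrow> state \<Rightarrow> bool" where
  "wp w X R Skip Q s \<longleftrightarrow> Q s"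
| "wp w X R (Assign x e) Q s \<longleftrightarrow> safe w X e s \<and> Q (set_var s x (val e s))"
| "wp w X R (AAssign f a e) Q s \<longleftrightarrow> safe w X a s \<and> safe w X e s \<and> val a s \<le> X \<and>
     Q (s\<lparr>arr := (arr s)(f := (arr s f)(val a s := val e s))\<rparr>)"
| "wp w X R (GetLetter x) Q s \<longleftrightarrow>
     (\<exists>y ys. inp s = y # ys \<and> y < 2 ^ w \<and> Q (set_var (s\<lparr>inp := ys\<rparr>) x y))"
| "wp w X R (Draw x y) Q s \<longleftrightarrow>
     (\<exists>v vs. tape s = v # vs \<and> vars s y = R \<and> v < R \<and> Q (set_var (s\<lparr>tape := vs\<rparr>) x v))"
| "wp w X R (Output a b) Q s \<longleftrightarrow> safe w X a s \<and> safe w X b s \<and>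
     Q (s\<lparr>outp := outp s @ [(val a s, val b s)]\<rparr>)"
| "wp w X R (c1 ;; c2) Q s \<longleftrightarrow> wp w X R c1 (wp w X R c2 Q) s"
| "wp w X R (Cond e c1 c2) Q s \<longleftrightarrow> safe w X e s \<and>
     (if val e s \<noteq> 0 then wp w X R c1 Q s else wp w X R c2 Q s)"
| "wp w X R (While e c) Q s \<longleftrightarrow> False"

lemma wp_imp_big:
  "wp w X R c Q s \<Longrightarrow> \<exists>t\<le>com_size c. \<exists>s'. big w X R c s t s' \<and> Q s'"
proof (induction c arbitrary: Q s)
  case (Seq c1 c2)
  then obtain t1 s1 where s1: "t1 \<le> com_size c1" "big w X R c1 s t1 s1" "wp w X R c2 Q s1"
    by fastforce
  with Seq.IH(2)[OF s1(3)] obtain t2 s2 where "t2 \<le> com_size c2" "big w X R c2 s1 t2 s2" "Q s2" by blast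
  with s1 show ?case by (intro exI[of _ "t1 + t2"]) (auto intro: big.Seq)
next
  case (Cond e c1 c2)
  show ?case
  proof (cases "val e s = 0")
    case True
    with Cond(3) have "wp w X R c2 Q s" by simp
    from Cond.IH(2)[OF this] obtain t s' where "t \<le> com_size c2" "big w X R c2 s t s'" "Q s'" by blast
    with True Cond(3) show ?thesis
      by (intro exI[of _ "expr_time e + 1 + t"] exI[of _ s'] conjI big.CondF) auto
  next
    case False
    with Cond(3) have "wp w X R c1 Q s" by simp
    from Cond.IH(1)[OF this] obtain t s' where "t \<le> com_size c1" "big w X R c1 s t s'" "Q s'" by blast
    with False Cond(3) show ?thesis
      by (intro exI[of _ "expr_time e + 1 + t + 1"] exI[of _ s'] conjI big.CondT) auto
  qed
next
  case Skip
  then show ?case using big.Skip by fastforce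
next
  case (Assign x e)
  then show ?case using big.Assign[of w X e s R x] by fastforce
next
  case (AAssign f a e)
  then show ?case using big.AAssign[of w X a s e R f] by fastforce
next
  case (GetLetter x)
  then show ?case using big.GetLetter by fastforce
next
  case (Draw x y)
  then show ?case using big.Draw by fastforce
next
  case (Output a b)
  then show ?case using big.Output[of w X a s b R] by fastforce
qed auto

lemma terminates_wp: "wp w X R c Q s \<Longrightarrow> terminates w X R c s (com_size c) Q"
  using wp_imp_big by (simp add: terminates_def)

section \<open>A lower bound for the number of primes\<close>

text \<open>The reciprocals of \<open>k * (m choose k)\<close> form Leibniz's harmonic triangle:
  column 1 consists of the numbers \<open>1 / m\<close>, and the entry of column
  \<open>Suc j\<close> in row \<open>m\<close> is the difference of the entries of column
  \<open>j\<close> in rows \<open>m - 1\<close> and \<open>m\<close>. So multiplication by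
  \<open>Lcm {1..m}\<close> makes all of them integers.\<close>

lemma binomial_dvd_Lcm_aux:
  "1 \<le> k \<Longrightarrow> k \<le> m \<Longrightarrow> real (Lcm {1..m}) / real (k * (m choose k)) \<in> \<int>"
proof (induction k arbitrary: m rule: nat_induct_at_least)
  case base
  then have "m dvd Lcm {1..m}" by (intro dvd_Lcm) auto
  then show ?case using base by (auto simp: dvd_def)
next
  case (Suc j)
  then obtain p where m: "m = Suc p" and jp: "j \<le> p" by (cases m) auto
  define x y where "x = real (p choose j)" and "y = real (Suc p choose j)"
  have pos: "x > 0" "y > 0" using jp by (auto simp: x_def y_def)
  have "(Suc p - j) * (Suc p choose j) = Suc p * (p choose j)"
    using binomial_absorb_comp[of "Suc p" j] by simp
  then have "real (Suc p - j) * y = real (Suc p) * x" unfolding x_def y_def by (metis of_nat_mult)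
  then have xy: "(real (Suc p) - real j) * y = real (Suc p) * x"
    using jp by (subst (asm) of_nat_diff) auto
  have Sj: "real (Suc j * (m choose Suc j)) = real (Suc p) * x"
    unfolding m x_def by (metis Suc_times_binomial of_nat_mult)
  have "real (Suc p) * (y - x) = real j * y" using xy by (simp add: algebra_simps)
  then have "1 / (real (Suc p) * x) = 1 / (real j * x) - 1 / (real j * y)"
    using pos Suc.hyps by (simp add: divide_simps) (simp add: algebra_simps)
  then have *: "real (Lcm {1..m}) / real (Suc j * (m choose Suc j)) =
      real (Lcm {1..m}) / real (j * (p choose j)) - real (Lcm {1..m}) / real (j * (m choose j))"
    unfolding Sj
    by (metis (no_types) divide_inverse inverse_eq_divide m of_nat_mult right_diff_distrib x_def y_def)
  have "Lcm {1..p} dvd Lcm {1..m}" by (intro Lcm_subset) (auto simp: m)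
  then obtain c where c: "Lcm {1..m} = Lcm {1..p} * c" by (auto simp: dvd_def)
  have "real (Lcm {1..p}) / real (j * (p choose j)) * real c \<in> \<int>"
    using Suc.IH[OF jp] by (intro Ints_mult) auto
  moreover have "real (Lcm {1..m}) / real (j * (p choose j)) =
      real (Lcm {1..p}) / real (j * (p choose j)) * real c" unfolding c by simp
  ultimately have "real (Lcm {1..m}) / real (j * (p choose j)) \<in> \<int>" by (simp only:)
  moreover have "real (Lcm {1..m}) / real (j * (m choose j)) \<in> \<int>"
    using jp m by (intro Suc.IH) auto
  ultimately show ?case unfolding * by (rule Ints_diff)
qed

lemma binomial_le_Lcm:
  assumes "1 \<le> k" "k \<le> m"
  shows "k * (m choose k) \<le> Lcm {1..m}"
proof -
  obtain z where z: "real (Lcm {1..m}) / real (k * (m choose k)) = of_int z"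
    using binomial_dvd_Lcm_aux[OF assms] by (auto elim: Ints_cases)
  have "Lcm {1..m} \<noteq> 0" by (subst Lcm_0_iff) auto
  then have "real (Lcm {1..m}) / real (k * (m choose k)) > 0"
    using assms \<open>Lcm {1..m} \<noteq> 0\<close> by (intro divide_pos_pos) (auto intro: Nat.gr0I)
  with z have "z \<ge> 1" by simp
  then have "1 \<le> real (Lcm {1..m}) / real (k * (m choose k))" unfolding z by simp
  moreover have "0 < real (k * (m choose k))" using assms by simp
  ultimately have "real (k * (m choose k)) \<le> real (Lcm {1..m})" by (simp only: le_divide_eq_1_pos)
  then show ?thesis by (simp only: of_nat_le_iff)
qed

lemma prime_power_dvd_Lcm:
  fixes p :: nat
  assumes "prime p" "finite A" "p ^ e dvd Lcm A" "0 \<notin> A" "e > 0"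
  shows "\<exists>a\<in>A. p ^ e dvd a"
  using assms(2-4)
proof (induction A)
  case empty
  then show ?case using assms(1,5) by (simp add: nat_power_eq_Suc_0_iff)
next
  case (insert a A)
  have "Lcm A \<noteq> 0" using insert by (subst Lcm_0_iff) auto
  then have "multiplicity p (lcm a (Lcm A)) = max (multiplicity p a) (multiplicity p (Lcm A))"
    using insert assms(1) by (intro multiplicity_lcm) auto
  moreover have "e \<le> multiplicity p (lcm a (Lcm A))"
    using insert.prems assms(1) \<open>Lcm A \<noteq> 0\<close> by (intro multiplicity_geI) auto
  ultimately consider "e \<le> multiplicity p a" | "e \<le> multiplicity p (Lcm A)" by linarith
  then show ?case
  proof cases
    case 1
    then show ?thesis using multiplicity_dvd' by blast
  next
    case 2
    then have "p ^ e dvd Lcm A" by (rule multiplicity_dvd')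
    with insert show ?thesis by blast
  qed
qed

text \<open>A prime power that divides the least common multiple divides one of the numbers up to
  \<open>m\<close>, hence is at most \<open>m\<close>. Each prime up to \<open>m\<close> thus
  contributes a factor of at most \<open>m\<close>.\<close>

lemma Lcm_le_power_prime_count: "Lcm {1..m::nat} \<le> m ^ card {p. prime p \<and> p \<le> m}"
proof -
  let ?d = "Lcm {1..m}"
  have d0: "?d \<noteq> 0" by (subst Lcm_0_iff) auto
  have le: "p ^ multiplicity p ?d \<le> m" and pm: "p \<le> m" if "p \<in> prime_factors ?d" for p
  proof -
    from that have p: "prime p" "p dvd ?d" by auto
    then have mult: "multiplicity p ?d > 0" using d0 by (simp add: prime_multiplicity_gt_zero_iff)
    have "\<exists>a\<in>{1..m}. p ^ multiplicity p ?d dvd a"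
      by (rule prime_power_dvd_Lcm[OF p(1)]) (use mult in \<open>auto simp: multiplicity_dvd\<close>)
    then obtain a where "a \<le> m" "a > 0" "p ^ multiplicity p ?d dvd a" by auto
    then show *: "p ^ multiplicity p ?d \<le> m" using dvd_imp_le le_trans by blast
    have "p ^ 1 \<le> p ^ multiplicity p ?d"
      using prime_ge_1_nat[OF p(1)] mult by (intro power_increasing) auto
    with * show "p \<le> m" by simp
  qed
  have "?d = (\<Prod>p\<in>prime_factors ?d. p ^ multiplicity p ?d)"
    using d0 by (intro prime_factorization_nat) (simp only: neq0_conv)
  also have "\<dots> \<le> (\<Prod>p\<in>prime_factors ?d. m)" by (intro prod_mono) (use le in auto)
  also have "\<dots> = m ^ card (prime_factors ?d)" by simp
  also have "\<dots> \<le> m ^ card {p. prime p \<and> p \<le> m}"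
  proof (cases "m = 0")
    case False
    have "prime_factors ?d \<subseteq> {p. prime p \<and> p \<le> m}"
      using pm in_prime_factors_imp_prime by (intro subsetI CollectI conjI)
    moreover have "finite {p. prime p \<and> p \<le> m}" by (rule finite_subset[of _ "{..m}"]) auto
    ultimately have "card (prime_factors ?d) \<le> card {p. prime p \<and> p \<le> m}" by (rule card_mono[rotated])
    then show ?thesis using False by (intro power_increasing) simp_all
  next
    case True
    then have "{p. prime p \<and> p \<le> m} = {}" "prime_factors ?d = {}" by auto
    then show ?thesis by (simp only: order.refl)
  qed
  finally show ?thesis .
qed

text \<open>Chebyshev's bound by way of the least common multiple: \<open>4 ^ N\<close> is at most
  \<open>2 * N\<close> times the central binomial coefficient, and \<open>N\<close> times that
  coefficient is at most \<open>Lcm {1..2 * N}\<close>. It says that a random number below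
  \<open>2 * N\<close> is prime with probability at least \<open>1 / (2 * h)\<close>.\<close>

lemma prime_count_lower:
  assumes "2 \<le> N" "2 * N \<le> 2 ^ h"
  shows "2 * N \<le> 2 * h * card {p. prime p \<and> p < 2 * N}"
proof -
  let ?\<pi> = "card {p. prime p \<and> p < 2 * N}"
  \<comment> \<open>Draws are strictly below \<open>2 * N\<close>, whereas the least common multiple
    includes \<open>2 * N\<close>.\<close>
  have "\<not> prime (2 * N)" using assms(1) prime_product[of 2 N] by auto
  then have eq: "{p. prime p \<and> p \<le> 2 * N} = {p. prime p \<and> p < 2 * N}"
    by (auto simp: order.order_iff_strict)
  have "4 ^ N / (2 * real N) \<le> real (2 * N choose N)"
    using central_binomial_lower_bound[of N] assms by simp
  then have "4 ^ N \<le> 2 * real N * real (2 * N choose N)"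
    using assms by (simp add: field_simps)
  also have "\<dots> = real (2 * (N * (2 * N choose N)))" by simp
  finally have "4 ^ N \<le> 2 * (N * (2 * N choose N))" by (metis of_nat_le_iff of_nat_numeral of_nat_power)
  also have "\<dots> \<le> 2 * Lcm {1..2 * N}" using binomial_le_Lcm[of N "2 * N"] assms by simp
  also have "\<dots> \<le> 2 * (2 * N) ^ ?\<pi>" using Lcm_le_power_prime_count[of "2 * N"] by (simp add: eq)
  also have "\<dots> \<le> 2 * (2 ^ h) ^ ?\<pi>" using assms by (intro mult_left_mono power_mono) auto
  also have "\<dots> = 2 ^ (1 + h * ?\<pi>)" by (simp add: power_mult)
  also have "(4::nat) ^ N = 2 ^ (2 * N)" by (simp add: power_mult)
  finally have "2 * N \<le> 1 + h * ?\<pi>" by (rule power_le_imp_le_exp[rotated]) simp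
  with assms show ?thesis by simp
qed

text \<open>The distinct prime divisors multiply to at most \<open>\<bar>D\<bar>\<close>, and each
  of them is at least 2.\<close>

lemma card_prime_divisors_le:
  fixes D :: int
  assumes "D \<noteq> 0" "\<bar>D\<bar> < 2 ^ B"
  shows "finite {p::nat. prime p \<and> int p dvd D}" "card {p::nat. prime p \<and> int p dvd D} \<le> B"
proof -
  let ?d = "nat \<bar>D\<bar>"
  have d0: "?d \<noteq> 0" using assms by simp
  have eq: "{p::nat. prime p \<and> int p dvd D} = prime_factors ?d"
    using d0 by (auto simp: prime_factors_dvd dvd_nat_abs_iff)
  then show "finite {p::nat. prime p \<and> int p dvd D}" by simp
  have "2 ^ card (prime_factors ?d) = (\<Prod>p\<in>prime_factors ?d. 2::nat)" by simp
  also have "\<dots> \<le> (\<Prod>p\<in>prime_factors ?d. p ^ multiplicity p ?d)"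
  proof (intro prod_mono conjI)
    fix p assume "p \<in> prime_factors ?d"
    then have p: "2 \<le> p" "multiplicity p ?d > 0"
      by (auto simp: prime_factors_multiplicity prime_ge_2_nat)
    then have "p ^ 1 \<le> p ^ multiplicity p ?d" by (intro power_increasing) auto
    then have "p \<le> p ^ multiplicity p ?d" by (simp only: power_one_right)
    with p(1) show "2 \<le> p ^ multiplicity p ?d" by (rule le_trans)
  qed simp
  also have "\<dots> = ?d" using d0 by (intro prime_factorization_nat[symmetric]) simp
  also have "\<dots> < 2 ^ B" using assms(2) by (subst nat_less_iff) simp_all
  finally have "card (prime_factors ?d) < B" by (rule power_less_imp_less_exp[rotated]) simp
  then show "card {p::nat. prime p \<and> int p dvd D} \<le> B" unfolding eq by (rule less_imp_le)
qed

section \<open>The random modulus\<close>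

text \<open>The default \<open>1\<close> stands for a search without success. It contributes nothing
  to the modulus, divides everything, and is therefore counted as a failure below. Taking the last
  prime needs just one register that is overwritten during a fixed number of draws.\<close>

definition last_prime :: "nat list \<Rightarrow> nat" where
  "last_prime xs = fold (\<lambda>x q. if prime x then x else q) xs 1"

fun modulus :: "nat \<Rightarrow> nat \<Rightarrow> nat list \<Rightarrow> nat" where
  "modulus T 0 \<omega> = 1"
| "modulus T (Suc r) \<omega> = last_prime (take T \<omega>) * modulus T r (drop T \<omega>)"

lemma last_prime_cases:
  fixes q0 :: nat
  shows "fold (\<lambda>x q. if prime x then x else q) xs q0 \<in> {x \<in> set xs. prime x} \<or>
    fold (\<lambda>x q. if prime x then x else q) xs q0 = q0 \<and> (\<forall>x\<in>set xs. \<not> prime x)"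
proof (induction xs arbitrary: q0)
  case (Cons a xs)
  show ?case using Cons.IH[of "if prime a then a else q0"] by (cases "prime a") auto
qed simp

lemma last_prime_bounds: "set xs \<subseteq> {..<R} \<Longrightarrow> 1 \<le> last_prime xs \<and> last_prime xs \<le> max 1 R"
proof -
  assume *: "set xs \<subseteq> {..<R}"
  from last_prime_cases[of xs 1, folded last_prime_def] show ?thesis
  proof
    assume "last_prime xs \<in> {x \<in> set xs. prime x}"
    then have "last_prime xs < R" "prime (last_prime xs)" using * by blast+
    then show ?thesis using prime_ge_1_nat[of "last_prime xs"] by linarith
  qed simp
qed

lemma modulus_bounds:
  assumes "1 \<le> R"
  shows "set \<omega> \<subseteq> {..<R} \<Longrightarrow> 1 \<le> modulus T r \<omega> \<and> modulus T r \<omega> \<le> R ^ r"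
proof (induction r arbitrary: \<omega>)
  case (Suc r)
  have "set (take T \<omega>) \<subseteq> {..<R}" "set (drop T \<omega>) \<subseteq> {..<R}"
    using Suc.prems set_take_subset[of T \<omega>] set_drop_subset[of T \<omega>] by auto
  with Suc.IH[of "drop T \<omega>"] last_prime_bounds[of "take T \<omega>" R] assms
  have "1 \<le> last_prime (take T \<omega>)" "last_prime (take T \<omega>) \<le> R"
    "1 \<le> modulus T r (drop T \<omega>)" "modulus T r (drop T \<omega>) \<le> R ^ r" by auto
  then show ?case
    using mult_le_mono[of 1 "last_prime (take T \<omega>)" 1 "modulus T r (drop T \<omega>)"]
      mult_le_mono[of "last_prime (take T \<omega>)" R "modulus T r (drop T \<omega>)" "R ^ r"] by simp
qed simp

section \<open>Failure probability of the random modulus\<close>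

lemma replicate_pmf_Suc_pair:
  "replicate_pmf (Suc n) p = map_pmf (\<lambda>(x, xs). x # xs) (pair_pmf p (replicate_pmf n p))"
  by (simp add: pair_pmf_def map_pmf_def bind_assoc_pmf bind_return_pmf)

lemma replicate_pmf_add_pair:
  "replicate_pmf (m + n) p = map_pmf (\<lambda>(x, xs). x @ xs) (pair_pmf (replicate_pmf m p) (replicate_pmf n p))"
  by (simp add: replicate_pmf_distrib pair_pmf_def map_pmf_def bind_assoc_pmf bind_return_pmf)

lemma prob_replicate_all:
  fixes p :: "'a::countable pmf"
  shows "measure_pmf.prob (replicate_pmf n p) {xs. set xs \<subseteq> A} = measure_pmf.prob p A ^ n"
proof (induction n)
  case (Suc n)
  have "(\<lambda>(x, xs). x # xs) -` {xs. set xs \<subseteq> A} = A \<times> {xs. set xs \<subseteq> A}" by auto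
  then show ?case using Suc
    by (simp add: replicate_pmf_Suc_pair measure_pmf_prob_product del: replicate_pmf.simps(2))
qed simp

lemma prob_replicate_ex:
  fixes p :: "'a::countable pmf"
  shows "measure_pmf.prob (replicate_pmf n p) {xs. \<exists>x\<in>set xs. x \<in> A} \<le> n * measure_pmf.prob p A"
proof (induction n)
  case (Suc n)
  let ?B = "{xs. \<exists>x\<in>set xs. x \<in> A}"
  have "(\<lambda>(x, xs). x # xs) -` ?B = A \<times> UNIV \<union> UNIV \<times> ?B" by auto
  then have "measure_pmf.prob (replicate_pmf (Suc n) p) ?B =
      measure_pmf.prob (pair_pmf p (replicate_pmf n p)) (A \<times> UNIV \<union> UNIV \<times> ?B)"
    by (simp add: replicate_pmf_Suc_pair del: replicate_pmf.simps(2))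
  also have "\<dots> \<le> measure_pmf.prob (pair_pmf p (replicate_pmf n p)) (A \<times> UNIV) +
      measure_pmf.prob (pair_pmf p (replicate_pmf n p)) (UNIV \<times> ?B)"
    by (intro measure_Un_le) auto
  also have "\<dots> = measure_pmf.prob p A + measure_pmf.prob (replicate_pmf n p) ?B"
    by (simp add: measure_pmf_prob_product)
  also have "\<dots> \<le> Suc n * measure_pmf.prob p A" using Suc by (simp add: algebra_simps)
  finally show ?case .
qed simp

text \<open>There are two ways to fail: no draw is prime, or some draw is a prime divisor of
  \<open>D\<close>. A union bound over all \<open>T\<close> draws for the second event avoids
  conditioning on which draw is the last prime; the extra factor \<open>T\<close> is absorbed by a
  larger \<open>R\<close>.\<close>

lemma prob_last_prime_dvd:
  fixes D :: int
  assumes R: "0 < R" "R \<le> 2 * h * card {p. prime p \<and> p < R}" and h: "0 < h"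
    and D: "D \<noteq> 0" "\<bar>D\<bar> < 2 ^ B"
  shows "measure_pmf.prob (replicate_pmf T (pmf_of_set {..<R})) {xs. int (last_prime xs) dvd D}
    \<le> (1 - 1 / (2 * real h)) ^ T + real T * (real B / real R)"
proof -
  let ?U = "pmf_of_set {..<R}" and ?P = "{p. prime p \<and> p < R}"
  have prob: "measure_pmf.prob ?U A = card ({..<R} \<inter> A) / R" for A
    using R by (subst measure_pmf_of_set) (auto simp: lessThan_empty_iff)
  have "{..<R} \<inter> {x. prime x} = ?P" by auto
  moreover have "real R \<le> real (2 * h * card ?P)" using R(2) by (simp only: of_nat_le_iff)
  then have "real R \<le> 2 * real h * real (card ?P)" by simp
  ultimately have "1 / (2 * real h) \<le> measure_pmf.prob ?U {x. prime x}"
    using R h by (simp add: prob field_simps)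
  moreover have "{x. \<not> prime x} = UNIV - {x::nat. prime x}" by auto
  then have "measure_pmf.prob ?U {x. \<not> prime x} = 1 - measure_pmf.prob ?U {x. prime x}"
    using measure_pmf.prob_compl[of "{x::nat. prime x}" ?U] by simp
  ultimately have p0: "measure_pmf.prob ?U {x. \<not> prime x} \<le> 1 - 1 / (2 * real h)" by linarith
  let ?A = "{p::nat. prime p \<and> int p dvd D}"
  have "card ({..<R} \<inter> ?A) \<le> B"
    using card_prime_divisors_le[OF D] by (meson card_mono inf_le2 order_trans)
  then have pA: "measure_pmf.prob ?U ?A \<le> real B / real R"
    using R by (simp add: prob divide_right_mono)
  have "{xs. int (last_prime xs) dvd D} \<subseteq> {xs. set xs \<subseteq> {x. \<not> prime x}} \<union> {xs. \<exists>x\<in>set xs. x \<in> ?A}"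
  proof
    fix xs assume "xs \<in> {xs. int (last_prime xs) dvd D}"
    with last_prime_cases[of xs 1]
    show "xs \<in> {xs. set xs \<subseteq> {x. \<not> prime x}} \<union> {xs. \<exists>x\<in>set xs. x \<in> ?A}"
      unfolding last_prime_def by blast
  qed
  then have "measure_pmf.prob (replicate_pmf T ?U) {xs. int (last_prime xs) dvd D}
      \<le> measure_pmf.prob (replicate_pmf T ?U) ({xs. set xs \<subseteq> {x. \<not> prime x}} \<union> {xs. \<exists>x\<in>set xs. x \<in> ?A})"
    by (intro measure_pmf.finite_measure_mono) auto
  also have "\<dots> \<le> measure_pmf.prob (replicate_pmf T ?U) {xs. set xs \<subseteq> {x. \<not> prime x}} +
      measure_pmf.prob (replicate_pmf T ?U) {xs. \<exists>x\<in>set xs. x \<in> ?A}"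
    by (intro measure_Un_le) auto
  also have "measure_pmf.prob (replicate_pmf T ?U) {xs. set xs \<subseteq> {x. \<not> prime x}} \<le> (1 - 1 / (2 * real h)) ^ T"
    unfolding prob_replicate_all using p0 by (intro power_mono) auto
  also have "measure_pmf.prob (replicate_pmf T ?U) {xs. \<exists>x\<in>set xs. x \<in> ?A} \<le> real T * (real B / real R)"
    using prob_replicate_ex[of T ?U ?A] mult_left_mono[OF pA, of "real T"] by linarith
  finally show ?thesis by simp
qed

text \<open>A product divides \<open>D\<close> only if each factor does, and the factors come from
  disjoint blocks of the tape, so the probabilities multiply.\<close>

lemma prob_modulus_dvd:
  fixes D :: int
  assumes \<rho>: "measure_pmf.prob (replicate_pmf T p) {xs. int (last_prime xs) dvd D} \<le> \<rho>"
  shows "measure_pmf.prob (replicate_pmf (r * T) p) {\<omega>. int (modulus T r \<omega>) dvd D} \<le> \<rho> ^ r"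
proof (induction r)
  case (Suc r)
  let ?p1 = "replicate_pmf T p" and ?p2 = "replicate_pmf (r * T) p"
  let ?A = "{xs. int (last_prime xs) dvd D}" and ?B = "{\<omega>. int (modulus T r \<omega>) dvd D}"
  let ?V = "(\<lambda>(x, xs). x @ xs) -` {\<omega>. int (modulus T (Suc r) \<omega>) dvd D}"
  have "measure_pmf.prob (replicate_pmf (Suc r * T) p) {\<omega>. int (modulus T (Suc r) \<omega>) dvd D} =
      measure_pmf.prob (pair_pmf ?p1 ?p2) ?V"
    by (simp add: replicate_pmf_add_pair)
  also have "\<dots> = measure_pmf.prob (pair_pmf ?p1 ?p2) (?V \<inter> set_pmf (pair_pmf ?p1 ?p2))"
    by (rule measure_Int_set_pmf[symmetric])
  also have "\<dots> \<le> measure_pmf.prob (pair_pmf ?p1 ?p2) (?A \<times> ?B)"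
    by (intro measure_pmf.finite_measure_mono)
      (auto simp: set_replicate_pmf intro: dvd_mult_left dvd_mult_right)
  also have "\<dots> = measure_pmf.prob ?p1 ?A * measure_pmf.prob ?p2 ?B"
    by (intro measure_pmf_prob_product) auto
  also have "\<dots> \<le> \<rho> * \<rho> ^ r" using \<rho> Suc by (intro mult_mono) (auto intro: order_trans[OF measure_nonneg])
  finally show ?case by simp
qed simp

section \<open>Long palindromes and their runs\<close>

text \<open>Texts are infinite in both directions and indexed by integers: reflections
  \<open>2 * m + 1 - u\<close> are then exact, and no border cases arise. For
  \<open>l \<le> 0\<close> the condition is vacuous.\<close>

definition pal_at :: "(int \<Rightarrow> 'a) \<Rightarrow> int \<Rightarrow> int \<Rightarrow> bool" where
  "pal_at \<tau> m l \<longleftrightarrow> (\<forall>t. 1 \<le> t \<and> t \<le> l \<longrightarrow> \<tau> (m + 1 - t) = \<tau> (m + t))"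

definition symmetric_on :: "(int \<Rightarrow> 'a) \<Rightarrow> int \<Rightarrow> int \<Rightarrow> int \<Rightarrow> bool" where
  "symmetric_on \<tau> lo hi m \<longleftrightarrow>
     (\<forall>u. lo < u \<and> u \<le> hi \<and> lo < 2 * m + 1 - u \<and> 2 * m + 1 - u \<le> hi \<longrightarrow> \<tau> u = \<tau> (2 * m + 1 - u))"

lemma pal_at_mono: "pal_at \<tau> m l \<Longrightarrow> l' \<le> l \<Longrightarrow> pal_at \<tau> m l'"
  by (auto simp: pal_at_def)

lemma pal_atD: "pal_at \<tau> m l \<Longrightarrow> 1 \<le> t \<Longrightarrow> t \<le> l \<Longrightarrow> u = m + 1 - t \<Longrightarrow> v = m + t \<Longrightarrow> \<tau> u = \<tau> v"
  by (simp add: pal_at_def)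

lemma pal_at_reflect:
  assumes "pal_at \<tau> m l" "m - l < u" "u \<le> m + l" "v = 2 * m + 1 - u"
  shows "\<tau> u = \<tau> v"
proof (cases "m < u")
  case True
  with assms(2-4) show ?thesis by (intro pal_atD[OF assms(1), of "u - m", symmetric]) auto
next
  case False
  with assms(2-4) show ?thesis by (intro pal_atD[OF assms(1), of "m + 1 - u"]) auto
qed

lemma symmetric_on_reflect:
  "symmetric_on \<tau> lo hi m \<Longrightarrow> lo < u \<Longrightarrow> u \<le> hi \<Longrightarrow> lo < v \<Longrightarrow> v \<le> hi \<Longrightarrow> v = 2 * m + 1 - u \<Longrightarrow> \<tau> u = \<tau> v"
  unfolding symmetric_on_def by (drule spec[of _ u]) simp

lemma symmetric_on_imp_pal_at:
  assumes "symmetric_on \<tau> lo hi m" "l \<le> m - lo" "l \<le> hi - m"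
  shows "pal_at \<tau> m l"
  unfolding pal_at_def
proof (intro allI impI)
  fix t assume "1 \<le> t \<and> t \<le> l"
  with assms show "\<tau> (m + 1 - t) = \<tau> (m + t)" by (intro symmetric_on_reflect[OF assms(1)]) auto
qed

lemma pal_at_imp_symmetric_on:
  assumes "pal_at \<tau> m l" "m - l \<le> lo \<or> hi \<le> m + l"
  shows "symmetric_on \<tau> lo hi m"
  unfolding symmetric_on_def using assms(2) by (auto intro!: pal_at_reflect[OF assms(1)])

lemma pal_at_Suc: "0 \<le> l \<Longrightarrow> pal_at \<tau> m (l + 1) \<longleftrightarrow> pal_at \<tau> m l \<and> \<tau> (m - l) = \<tau> (m + l + 1)"
proof (intro iffI conjI)
  assume "0 \<le> l" and p: "pal_at \<tau> m (l + 1)"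
  then show "\<tau> (m - l) = \<tau> (m + l + 1)" by (intro pal_atD[OF p, of "l + 1"]) auto
  show "pal_at \<tau> m l" by (rule pal_at_mono[OF p]) simp
next
  assume "0 \<le> l" and p: "pal_at \<tau> m l \<and> \<tau> (m - l) = \<tau> (m + l + 1)"
  show "pal_at \<tau> m (l + 1)"
    unfolding pal_at_def
  proof (intro allI impI)
    fix t assume t: "1 \<le> t \<and> t \<le> l + 1"
    show "\<tau> (m + 1 - t) = \<tau> (m + t)"
    proof (cases "t = l + 1")
      case True
      then have "m + 1 - t = m - l" "m + t = m + l + 1" by auto
      with p show ?thesis by (simp only:)
    next
      case False
      with p t show ?thesis by (intro pal_atD[of \<tau> m l t]) auto
    qed
  qed
qed

section \<open>Distances between neighbouring centres of long palindromes\<close>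

text \<open>Reflecting at \<open>m\<close>, then at \<open>m + d\<close>, then at \<open>m\<close>
  again is the reflection at \<open>m - d\<close>. The surplus \<open>\<bar>d\<bar>\<close> in the
  length around \<open>m\<close> keeps all three images inside.\<close>

lemma pal_at_mirror:
  assumes "pal_at \<tau> m (w + \<bar>d\<bar>)" "pal_at \<tau> (m + d) w"
  shows "pal_at \<tau> (m - d) w"
  unfolding pal_at_def
proof (intro allI impI)
  fix t assume t: "1 \<le> t \<and> t \<le> w"
  have "\<tau> (m - d + 1 - t) = \<tau> (m + d + t)" by (rule pal_at_reflect[OF assms(1)]) (use t in auto)
  also have "\<dots> = \<tau> (m + d + 1 - t)" by (rule pal_at_reflect[OF assms(2)]) (use t in auto)
  also have "\<dots> = \<tau> (m - d + t)" by (rule pal_at_reflect[OF assms(1)]) (use t in auto)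
  finally show "\<tau> (m - d + 1 - t) = \<tau> (m - d + t)" .
qed

text \<open>Reflecting at two centres in turn is a translation.\<close>

lemma pal_at_period:
  assumes "pal_at \<tau> x w" "pal_at \<tau> y w" "y = x + d" "0 \<le> d" "x - w < t" "s \<le> y + w" "2 * d \<le> w" "s = t + 2 * d"
  shows "\<tau> t = \<tau> s"
proof (cases "t \<le> x + w")
  case True
  have "\<tau> t = \<tau> (2 * x + 1 - t)" by (rule pal_at_reflect[OF assms(1)]) (use assms True in auto)
  also have "\<dots> = \<tau> s" by (rule pal_at_reflect[OF assms(2)]) (use assms True in auto)
  finally show ?thesis .
qed (use assms in auto)

text \<open>The reflection at \<open>y + d\<close> is the reflection at \<open>y\<close> followed by
  a translation by \<open>2 * d\<close>, which the centres \<open>y - d\<close> and \<open>y\<close>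
  justify. Where \<open>v\<close> lies beyond the palindrome around \<open>y\<close>, it is first
  moved inside by the translation by \<open>2 * d'\<close> that comes from \<open>y\<close> and
  \<open>y + d'\<close>, and this is undone at the end.\<close>

lemma chain_right:
  assumes x: "pal_at \<tau> (y - d) w" and y: "pal_at \<tau> y w" and z: "pal_at \<tau> (y + d') w"
    and d: "0 < d" "d < d'" "2 * d' \<le> w"
  shows "pal_at \<tau> (y + d) w"
  unfolding pal_at_def
proof (intro allI impI)
  fix t assume t: "1 \<le> t \<and> t \<le> w"
  define u v where "u = y + d + 1 - t" and "v = y + d + t"
  have per: "\<tau> s = \<tau> s'" if "y - d - w < s" "s' \<le> y + w" "s' = s + 2 * d" for s s'
    using pal_at_period[OF x y, of d s s'] that d by auto
  have per': "\<tau> s = \<tau> s'" if "y - w < s" "s' \<le> y + d' + w" "s' = s + 2 * d'" for s s'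
    using pal_at_period[OF y z, of d' s s'] that d by auto
  show "\<tau> (y + d + 1 - t) = \<tau> (y + d + t)"
  proof (cases "v \<le> y + w")
    case True
    have "\<tau> v = \<tau> (u - 2 * d)" by (rule pal_at_reflect[OF y]) (use t d True in \<open>auto simp: u_def v_def\<close>)
    also have "\<dots> = \<tau> u" by (rule per) (use t d True in \<open>auto simp: u_def v_def\<close>)
    finally show ?thesis by (simp add: u_def v_def)
  next
    case False
    have "\<tau> v = \<tau> (v - 2 * d')"
      by (rule per'[symmetric]) (use t d False in \<open>auto simp: u_def v_def\<close>)
    also have "\<dots> = \<tau> (u - 2 * d + 2 * d')"
      by (rule pal_at_reflect[OF y]) (use t d False in \<open>auto simp: u_def v_def\<close>)
    also have "\<dots> = \<tau> (u + 2 * d')" by (rule per) (use t d False in \<open>auto simp: u_def v_def\<close>)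
    also have "\<dots> = \<tau> u" by (rule per'[symmetric]) (use t d False in \<open>auto simp: u_def v_def\<close>)
    finally show ?thesis by (simp add: u_def v_def)
  qed
qed

text \<open>A centre \<open>m\<close> lies between the positions \<open>m\<close> and
  \<open>m + 1\<close>, hence the shift by one under negation.\<close>

lemma pal_at_reverse: "pal_at (\<lambda>u. \<tau> (- u)) m l \<longleftrightarrow> pal_at \<tau> (- m - 1) l"
proof -
  have "\<tau> (- (m + 1 - t)) = \<tau> (- m - 1 + t) \<and> \<tau> (- (m + t)) = \<tau> (- m - 1 + 1 - t)" for t
    by (simp add: algebra_simps)
  then show ?thesis unfolding pal_at_def by metis
qed

lemma chain_left:
  assumes "pal_at \<tau> (y - d) w" "pal_at \<tau> y w" "pal_at \<tau> (y + d') w" "0 < d'" "d' < d" "2 * d \<le> w"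
  shows "pal_at \<tau> (y - d') w"
proof -
  have "pal_at (\<lambda>u. \<tau> (- u)) ((- y - 1) + d') w"
    by (rule chain_right[where d' = d]) (use assms in \<open>simp_all add: pal_at_reverse algebra_simps\<close>)
  then show ?thesis by (simp add: pal_at_reverse algebra_simps)
qed

text \<open>If the two gaps differed, carrying the smaller one to the other side of \<open>y\<close>
  would yield a long centre strictly inside the larger one.\<close>

lemma chain_gap:
  assumes "pal_at \<tau> x w" "pal_at \<tau> y w" "pal_at \<tau> z w" "x < y" "y < z" "2 * (y - x) \<le> w" "2 * (z - y) \<le> w"
    and none: "\<And>c. x < c \<Longrightarrow> c < z \<Longrightarrow> c \<noteq> y \<Longrightarrow> \<not> pal_at \<tau> c w"
  shows "z - y = y - x"
proof (rule ccontr)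
  assume "z - y \<noteq> y - x"
  then consider "y - x < z - y" | "z - y < y - x" by linarith
  then show False
  proof cases
    case 1
    have "pal_at \<tau> (y + (y - x)) w"
      by (rule chain_right[where d' = "z - y"]) (use assms 1 in auto)
    with none[of "y + (y - x)"] 1 assms show False by auto
  next
    case 2
    have "pal_at \<tau> (y - (z - y)) w"
      by (rule chain_left[where d = "y - x"]) (use assms 2 in auto)
    with none[of "y - (z - y)"] 2 assms show False by auto
  qed
qed

text \<open>A pair just outside the palindrome around \<open>y\<close> is moved inside by the period
  \<open>2 * d\<close> that holds on either side, reflected there, and moved out again. Consequently
  a third centre of a progression can only appear while the symmetry around the second is still
  intact.\<close>

lemma chain_alive:
  assumes x: "pal_at \<tau> (y - d) w" and y: "pal_at \<tau> y w" and z: "pal_at \<tau> (y + d) w" and d: "0 \<le> d" "2 * d \<le> w"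
  shows "pal_at \<tau> y (w + d)"
  unfolding pal_at_def
proof (intro allI impI)
  fix t assume t: "1 \<le> t \<and> t \<le> w + d"
  show "\<tau> (y + 1 - t) = \<tau> (y + t)"
  proof (cases "t \<le> w")
    case True
    with t show ?thesis by (intro pal_atD[OF y, of t]) auto
  next
    case False
    have "\<tau> (y + t) = \<tau> (y + t - 2 * d)"
      by (rule pal_at_period[OF y z, symmetric]) (use t d False in auto)
    also have "\<dots> = \<tau> (y + 1 - t + 2 * d)" by (rule pal_at_reflect[OF y]) (use t d False in auto)
    also have "\<dots> = \<tau> (y + 1 - t)"
      by (rule pal_at_period[OF x y, symmetric]) (use t d False in auto)
    finally show ?thesis by simp
  qed
qed

text \<open>A run: long palindromes around \<open>F, F + D, \<dots>, La\<close>, all of which are symmetry centres of the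
  window \<open>(Lf, Rt]\<close>, where the symmetry around \<open>F\<close> breaks exactly at \<open>Lf\<close>.\<close>

definition run_ok :: "(int \<Rightarrow> 'a) \<Rightarrow> int \<Rightarrow> int \<Rightarrow> int \<Rightarrow> int \<Rightarrow> int \<Rightarrow> int \<Rightarrow> bool" where
  "run_ok \<tau> w F D La Lf Rt \<longleftrightarrow> 0 < D \<and> 2 * D \<le> w \<and> D dvd La - F \<and> F + D \<le> La \<and> Lf + w \<le> F \<and>
     2 * F \<le> Lf + Rt \<and> La + w \<le> Rt \<and> Rt \<le> La + w + D \<and> \<not> pal_at \<tau> F (F - Lf + 1) \<and>
     (\<forall>m. F \<le> m \<and> m \<le> La \<and> D dvd m - F \<longrightarrow> symmetric_on \<tau> Lf Rt m)"

context
  fixes \<tau> :: "int \<Rightarrow> 'a" and w F D La Lf Rt :: int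
  assumes run: "run_ok \<tau> w F D La Lf Rt"
begin

lemma runD:
  shows "0 < D" "2 * D \<le> w" "D dvd La - F" "F + D \<le> La" "Lf + w \<le> F" "2 * F \<le> Lf + Rt"
    "La + w \<le> Rt" "Rt \<le> La + w + D" "\<not> pal_at \<tau> F (F - Lf + 1)"
  using run by (auto simp: run_ok_def)

section \<open>Growth of a run and the palindromes cut off at its ends\<close>

lemma run_sym: "F \<le> m \<Longrightarrow> m \<le> La \<Longrightarrow> D dvd m - F \<Longrightarrow> symmetric_on \<tau> Lf Rt m"
  using run by (simp add: run_ok_def)

lemma run_pal_at:
  "F \<le> m \<Longrightarrow> m \<le> La \<Longrightarrow> D dvd m - F \<Longrightarrow> l \<le> m - Lf \<Longrightarrow> l \<le> Rt - m \<Longrightarrow> pal_at \<tau> m l"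
  by (rule symmetric_on_imp_pal_at[OF run_sym])

text \<open>\<open>2 * m - Rt\<close> is the mirror image of \<open>Rt + 1\<close> at the member
  \<open>m\<close>. Reflecting at \<open>m - D\<close> and then at \<open>m\<close> shows that this
  letter is the same for all members whose image lies in the window. So the next letter fits all of
  them or none.\<close>

lemma run_right_chain:
  assumes "F \<le> La - int q * D" "Lf < 2 * (La - int q * D) - Rt"
  shows "\<tau> (2 * (La - int q * D) - Rt) = \<tau> (2 * La - Rt)"
  using assms
proof (induction q)
  case (Suc q)
  define m where "m = La - int (Suc q) * D"
  have eq: "La - int q * D = m + D" by (simp add: m_def algebra_simps)
  have m: "F \<le> m" "Lf < 2 * m - Rt" using Suc.prems by (auto simp: m_def)
  obtain k where k: "La - F = D * k" using runD(3) by (auto elim: dvdE)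
  then have k': "m - F = D * (k - int (Suc q))" by (simp add: m_def algebra_simps)
  then have dv: "D dvd m - F" by simp
  \<comment> \<open>The image \<open>2 * F - Rt\<close> at the first member is not right of
    \<open>Lf\<close>, so \<open>m\<close> is a later member and \<open>m - D\<close> is one
    too.\<close>
  have "m \<noteq> F" using m(2) runD(6) by auto
  with m(1) dv have "F + D \<le> m" using zdvd_imp_le[OF dv] by auto
  moreover have "m - D - F = D * (k - int (Suc q) - 1)" using k' by (simp add: algebra_simps)
  then have "D dvd m - D - F" by simp
  moreover have La: "m \<le> La" using runD(1) by (simp add: m_def)
  ultimately have s1: "symmetric_on \<tau> Lf Rt (m - D)" and s2: "symmetric_on \<tau> Lf Rt m"
    using run_sym[of "m - D"] run_sym[of m] dv m(1) runD(1) by auto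
  have "\<tau> (2 * m - Rt) = \<tau> (Rt + 1 - 2 * D)"
    by (rule symmetric_on_reflect[OF s1]) (use m runD La in auto)
  also have "\<dots> = \<tau> (2 * (m + D) - Rt)"
    by (rule symmetric_on_reflect[OF s2]) (use m runD La in auto)
  also have "\<dots> = \<tau> (2 * La - Rt)" using Suc.IH m runD(1) unfolding eq by auto
  finally show ?case by (simp only: m_def)
qed simp

lemma run_member_right:
  assumes "F \<le> m" "m \<le> La" "D dvd m - F"
  obtains q where "m = La - int q * D"
proof -
  have "D dvd (La - F) - (m - F)" using assms(3) runD(3) by (rule dvd_diff[rotated])
  then have "D dvd La - m" by simp
  then obtain k where k: "La - m = D * k" by (auto simp: dvd_def)
  with assms(2) runD(1) have "k \<ge> 0" by (smt (verit) mult_pos_neg)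
  then obtain q where "k = int q" using nonneg_int_cases by blast
  with k have "m = La - int q * D" by (simp add: algebra_simps)
  then show ?thesis by (rule that)
qed

text \<open>The letter at \<open>Rt + 1\<close> that breaks the symmetry at \<open>La\<close> breaks
  it at every member whose nearer end is the right one.\<close>

lemma run_right:
  assumes "F \<le> m" "m \<le> La" "D dvd m - F" "Rt - m < m - Lf" "\<not> pal_at \<tau> La (Rt + 1 - La)"
  shows "\<not> pal_at \<tau> m (Rt + 1 - m)"
proof
  assume b: "pal_at \<tau> m (Rt + 1 - m)"
  obtain q where q: "m = La - int q * D" using run_member_right[OF assms(1-3)] .
  have "pal_at \<tau> La (Rt - La)" by (rule run_pal_at) (use runD in auto)
  then have "\<tau> (2 * La - Rt) \<noteq> \<tau> (Rt + 1)"
    using assms(5) pal_at_Suc[of "Rt - La" \<tau> La] runD by (auto simp: algebra_simps)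
  moreover have "\<tau> (2 * m - Rt) = \<tau> (Rt + 1)"
    by (rule pal_at_reflect[OF b]) (use assms runD in auto)
  ultimately show False using run_right_chain[of q] assms q by auto
qed

lemma run_extend:
  assumes alive: "pal_at \<tau> La (Rt + 1 - La)" and "Rt < La + w + D"
  shows "run_ok \<tau> w F D La Lf (Rt + 1)"
proof -
  have main: "\<tau> (Rt + 1) = \<tau> (2 * m - Rt)" if m: "F \<le> m" "m \<le> La" "D dvd m - F" "Lf < 2 * m - Rt" for m
  proof -
    obtain q where q: "m = La - int q * D" using run_member_right[OF m(1-3)] .
    have "\<tau> (Rt + 1) = \<tau> (2 * La - Rt)" by (rule pal_at_reflect[OF alive]) (use runD in auto)
    also have "\<dots> = \<tau> (2 * m - Rt)" using run_right_chain[of q] m q by auto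
    finally show ?thesis .
  qed
  have "symmetric_on \<tau> Lf (Rt + 1) m" if m: "F \<le> m" "m \<le> La" "D dvd m - F" for m
    unfolding symmetric_on_def
  proof (intro allI impI)
    fix u assume u: "Lf < u \<and> u \<le> Rt + 1 \<and> Lf < 2 * m + 1 - u \<and> 2 * m + 1 - u \<le> Rt + 1"
    consider "u = Rt + 1" | "2 * m + 1 - u = Rt + 1" | "u \<le> Rt" "2 * m + 1 - u \<le> Rt" using u by linarith
    then show "\<tau> u = \<tau> (2 * m + 1 - u)"
    proof cases
      case 1
      then have v: "2 * m + 1 - u = 2 * m - Rt" by simp
      with u have "Lf < 2 * m - Rt" by simp
      from main[OF m this] show ?thesis unfolding v unfolding 1 .
    next
      case 2
      then have u': "u = 2 * m - Rt" by simp
      with u have "Lf < 2 * m - Rt" by simp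
      from main[OF m this] show ?thesis unfolding 2 unfolding u' by (rule sym)
    next
      case 3
      then show ?thesis using u by (intro symmetric_on_reflect[OF run_sym[OF m]]) auto
    qed
  qed
  with run assms(2) show ?thesis unfolding run_ok_def by auto
qed

text \<open>Once the right end of the window coincides with that of the palindrome around
  \<open>La + D\<close>, every mirrored pair of the window at this centre lies inside that
  palindrome.\<close>

lemma run_next:
  assumes "pal_at \<tau> (La + D) w" "Rt = La + D + w"
  shows "run_ok \<tau> w F D (La + D) Lf Rt"
proof -
  have "symmetric_on \<tau> Lf Rt m" if "F \<le> m" "m \<le> La + D" "D dvd m - F" for m
  proof (cases "m \<le> La")
    case False
    have "D dvd (m - F) - (La - F)" using that(3) runD(3) by (rule dvd_diff)
    then have "D dvd m - La" by simp
    then have "D \<le> m - La" using False by (intro zdvd_imp_le) auto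
    with that(2) have "m = La + D" by simp
    with assms show ?thesis by (intro pal_at_imp_symmetric_on[of _ _ w]) auto
  qed (use run_sym that in auto)
  moreover have "D dvd (La - F) + D" using runD(3) by (intro dvd_add) simp_all
  then have "D dvd La + D - F" by (simp add: algebra_simps)
  ultimately show ?thesis using run assms(2) unfolding run_ok_def by auto
qed

text \<open>The mirror images \<open>2 * c + 1 - Lf\<close> of \<open>Lf\<close> at the members
  carry equal letters as long as they lie in the window, and for \<open>F\<close> this letter
  differs from the one at \<open>Lf\<close>.\<close>

lemma run_left:
  assumes "F \<le> m" "m \<le> La" "D dvd m - F" "m - Lf < Rt - m"
  shows "\<not> pal_at \<tau> m (m - Lf + 1)"
proof
  assume b: "pal_at \<tau> m (m - Lf + 1)"
  have chain: "2 * (F + int q * D) - Lf < Rt \<Longrightarrow> F + int q * D \<le> La \<Longrightarrow>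
      \<tau> (2 * (F + int q * D) + 1 - Lf) = \<tau> (2 * F + 1 - Lf)" for q
  proof (induction q)
    case (Suc q)
    define c where "c = F + int q * D"
    have eq: "F + int (Suc q) * D = c + D" by (simp add: c_def algebra_simps)
    have c: "F \<le> c" "D dvd c - F" using runD(1) by (auto simp: c_def)
    have p: "2 * (c + D) - Lf < Rt" "c + D \<le> La" using Suc.prems unfolding eq by auto
    have "D dvd (La - F) - (c - F) - D" by (rule dvd_diff[OF dvd_diff[OF runD(3) c(2)] dvd_refl])
    then have "D dvd La - (c + D)" by (simp add: algebra_simps)
    \<comment> \<open>The bounds on \<open>F\<close> and \<open>Rt\<close> give
      \<open>Lf + Rt \<le> 2 * La\<close>. So a centre left of the middle is not the last one, and
      the next member provides the second reflection.\<close>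
    moreover have "c + D \<noteq> La" using p(1) runD by auto
    ultimately have "D \<le> La - (c + D)" using p(2) by (intro zdvd_imp_le) auto
    then have s: "symmetric_on \<tau> Lf Rt (c + D)" "symmetric_on \<tau> Lf Rt (c + 2 * D)"
      using runD(1) c p(2) by (auto intro!: run_sym simp: c_def algebra_simps)
    have "\<tau> (2 * c + 1 - Lf) = \<tau> (2 * D + Lf)"
      by (rule symmetric_on_reflect[OF s(1)]) (use p c runD in auto)
    also have "\<dots> = \<tau> (2 * (c + D) + 1 - Lf)"
      by (rule symmetric_on_reflect[OF s(2)]) (use p c runD in auto)
    finally show ?case using Suc.IH p runD(1) unfolding eq c_def by auto
  qed simp
  from assms(3) obtain k where k: "m - F = D * k" by (auto simp: dvd_def)
  with assms(1) runD(1) have "k \<ge> 0" by (smt (verit) mult_pos_neg)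
  then obtain q where "k = int q" using nonneg_int_cases by blast
  with k have m: "m = F + int q * D" by (simp add: algebra_simps)
  have "pal_at \<tau> F (F - Lf)" by (rule run_pal_at) (use runD in auto)
  then have "\<tau> Lf \<noteq> \<tau> (2 * F + 1 - Lf)"
    using runD(9) pal_at_Suc[of "F - Lf" \<tau> F] runD by (auto simp: algebra_simps)
  moreover have "\<tau> Lf = \<tau> (2 * m + 1 - Lf)" by (rule pal_at_reflect[OF b]) (use assms runD in auto)
  ultimately show False using chain[of q] assms m by auto
qed

end

text \<open>The maximal palindrome around \<open>F\<close> occupies \<open>(2 * F - Rt, Rt]\<close>,
  so its left end is where the period breaks.\<close>

lemma run_start:
  assumes "pal_at \<tau> F (Rt - F)" "\<not> pal_at \<tau> F (Rt + 1 - F)" "F + w \<le> Rt" "Rt < F + d + w"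
    "pal_at \<tau> (F + d) w" "0 < d" "2 * d \<le> w"
  shows "run_ok \<tau> w F d (F + d) (2 * F - Rt) (F + d + w)"
proof -
  have "symmetric_on \<tau> (2 * F - Rt) (F + d + w) m" if "F \<le> m" "m \<le> F + d" "d dvd m - F" for m
  proof (cases "m = F")
    case True
    with assms(1) show ?thesis by (intro pal_at_imp_symmetric_on[of _ _ "Rt - F"]) auto
  next
    case False
    with that have "d \<le> m - F" by (intro zdvd_imp_le) auto
    with that have "m = F + d" by simp
    with assms(5) show ?thesis by (intro pal_at_imp_symmetric_on[of _ _ w]) auto
  qed
  with assms show ?thesis unfolding run_ok_def by (auto simp: algebra_simps)
qed

section \<open>The centre tracker\<close>

text \<open>In round \<open>i\<close> the centre \<open>i - W\<close> is decided. Centres of short palindromes, and those of long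
  ones that cannot be symmetry centres of a whole run, are reported at once with their estimate. The
  other long centres are stored in at most \<open>O(W)\<close> records: record \<open>j\<close> stands for the centres
  \<open>ffst, ffst + gap, \<dots>, lst\<close>, with \<open>gap = 0\<close> for a single one. The symmetry around \<open>lst\<close> is known
  up to position \<open>rgt\<close>, and \<open>lft\<close> is where the period breaks on the left. In a run, only the centre
  \<open>mid\<close> of \<open>(lft, rgt]\<close> can have a palindrome that extends beyond this interval; \<open>est\<close> is its
  estimate, and all others are cut off at the nearer end. \<open>chk c i\<close> is the oracle that tests whether
  the factor \<open>(c, i]\<close> is a palindrome.\<close>

record tracker =
  cnt :: nat
  ffst :: "nat \<Rightarrow> nat"
  gap :: "nat \<Rightarrow> nat"
  lst :: "nat \<Rightarrow> nat"
  lft :: "nat \<Rightarrow> nat"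
  rgt :: "nat \<Rightarrow> nat"
  mid :: "nat \<Rightarrow> nat"
  est :: "nat \<Rightarrow> nat"
  rep :: "(nat \<times> nat) list"

text \<open>The cap \<open>lst s j + W + H\<close> keeps the left end \<open>2 * lst s j - i\<close>
  at most \<open>2 * (W + H) \<le> 3 * W\<close> positions behind \<open>i\<close>, where
  fingerprints are still in the sliding window. For a run, the middle is rounded up, so that
  \<open>i - mid\<close> is a length that fits on both sides.\<close>

definition alive_step :: "nat \<Rightarrow> nat \<Rightarrow> (nat \<Rightarrow> nat \<Rightarrow> bool) \<Rightarrow> nat \<Rightarrow> tracker \<Rightarrow> tracker" where
  "alive_step W H chk i s = (let j = cnt s in
     if j \<noteq> 0 \<and> rgt s j + 1 = i \<and> i \<le> lst s j + W + H \<and> i \<le> 2 * lst s j \<and> chk (2 * lst s j - i) i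
     then if gap s j = 0 then s\<lparr>rgt := (rgt s)(j := i)\<rparr>
       else s\<lparr>rgt := (rgt s)(j := i), mid := (mid s)(j := (lft s j + i + 1) div 2),
         est := (est s)(j := i - (lft s j + i + 1) div 2)\<rparr>
     else s)"

text \<open>Tests whether the estimate \<open>l\<close> may be raised by another
  \<open>g\<close>.\<close>

definition short_pal :: "nat \<Rightarrow> nat \<Rightarrow> (nat \<Rightarrow> nat \<Rightarrow> bool) \<Rightarrow> nat \<Rightarrow> nat \<Rightarrow> bool" where
  "short_pal W g chk m l \<longleftrightarrow> l + g \<le> m \<and> l + g \<le> W \<and> chk (m - (l + g)) (m + (l + g))"

definition short :: "nat \<Rightarrow> nat \<Rightarrow> (nat \<Rightarrow> nat \<Rightarrow> bool) \<Rightarrow> nat \<Rightarrow> nat" where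
  "short W g chk m = g * (LEAST q. \<not> short_pal W g chk m (g * q))"

text \<open>The test \<open>W \<le> m\<close> guards the truncated subtraction \<open>m - W\<close>.
  The last branch meets a long centre off the progression; this is possible only after a wrong
  answer of the oracle, and reporting the centre anyway keeps all midpoints accounted for.\<close>

definition centre_step :: "nat \<Rightarrow> nat \<Rightarrow> nat \<Rightarrow> (nat \<Rightarrow> nat \<Rightarrow> bool) \<Rightarrow> nat \<Rightarrow> tracker \<Rightarrow> tracker" where
  "centre_step W H g chk i s = (if i \<le> W then s else let m = i - W; j = cnt s in
     if \<not> (W \<le> m \<and> chk (m - W) i) then s\<lparr>rep := rep s @ [(m, short W g chk m)]\<rparr>
     else if j = 0 \<or> lst s j + H < m then
       s\<lparr>cnt := Suc j, ffst := (ffst s)(Suc j := m), gap := (gap s)(Suc j := 0),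
         lst := (lst s)(Suc j := m), lft := (lft s)(Suc j := 0), rgt := (rgt s)(Suc j := i),
         mid := (mid s)(Suc j := m), est := (est s)(Suc j := W)\<rparr>
     else if gap s j = 0 then
       let lf = 2 * lst s j - rgt s j in
       s\<lparr>gap := (gap s)(j := m - lst s j), lst := (lst s)(j := m), lft := (lft s)(j := lf),
         rgt := (rgt s)(j := i), mid := (mid s)(j := (lf + i + 1) div 2),
         est := (est s)(j := i - (lf + i + 1) div 2)\<rparr>
     else if m = lst s j + gap s j then s\<lparr>lst := (lst s)(j := m)\<rparr>
     else s\<lparr>rep := rep s @ [(m, W)]\<rparr>)"

text \<open>For a positive multiple \<open>i\<close> of \<open>g\<close> this is the last position
  up to \<open>i\<close> that is congruent to \<open>x\<close> modulo \<open>g\<close>. With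
  \<open>x = 2 * c\<close> its mirror image \<open>2 * c - p\<close> is a multiple of
  \<open>g\<close>, where a fingerprint is kept forever.\<close>

definition scan_pos :: "nat \<Rightarrow> nat \<Rightarrow> nat \<Rightarrow> nat" where
  "scan_pos g i x = i - (g - x mod g) mod g"

definition scan_est :: "nat \<Rightarrow> (nat \<Rightarrow> nat \<Rightarrow> bool) \<Rightarrow> nat \<Rightarrow> nat \<Rightarrow> nat \<Rightarrow> nat" where
  "scan_est g chk i c e = (let p = scan_pos g i (2 * c) in
     if p \<le> 2 * c \<and> c + e < p \<and> chk (2 * c - p) p then p - c else e)"

definition scan_step :: "nat \<Rightarrow> (nat \<Rightarrow> nat \<Rightarrow> bool) \<Rightarrow> nat \<Rightarrow> tracker \<Rightarrow> tracker" where
  "scan_step g chk i s = (if g dvd i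
     then s\<lparr>est := (\<lambda>j. if 1 \<le> j \<and> j \<le> cnt s then scan_est g chk i (mid s j) (est s j) else est s j)\<rparr>
     else s)"

text \<open>If the gap is 0, divisibility by 0 leaves \<open>ffst s j\<close> alone.\<close>

definition members :: "tracker \<Rightarrow> nat \<Rightarrow> nat set" where
  "members s j = {m. ffst s j \<le> m \<and> m \<le> lst s j \<and> gap s j dvd m - ffst s j}"

definition all_members :: "tracker \<Rightarrow> nat set" where
  "all_members s = (\<Union>j\<in>{1..cnt s}. members s j)"

definition final_est :: "tracker \<Rightarrow> nat \<Rightarrow> nat \<Rightarrow> nat" where
  "final_est s j m = (if m = mid s j then est s j else min (m - lft s j) (rgt s j - m))"

definition empty_tracker :: "tracker \<Rightarrow> bool" where
  "empty_tracker s \<longleftrightarrow> cnt s = 0 \<and> rep s = []"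

subsection \<open>Properties that hold for every oracle\<close>

text \<open>The inequality for \<open>j * (H + 1)\<close> records that first centres of consecutive
  records are more than \<open>H\<close> apart, which bounds the number of records. The bounds on
  the fields exclude overflow even when the oracle lies, and the last line partitions the decided
  centres into reported and recorded ones.\<close>

definition shape :: "nat \<Rightarrow> nat \<Rightarrow> nat \<Rightarrow> nat \<Rightarrow> tracker \<Rightarrow> bool" where
  "shape W H i k s \<longleftrightarrow>
     (\<forall>j. 1 \<le> j \<and> j \<le> cnt s \<longrightarrow> W \<le> ffst s j \<and> ffst s j \<le> lst s j \<and> lst s j \<le> k \<and>
       gap s j dvd lst s j - ffst s j \<and> j * (H + 1) \<le> ffst s j + H + 1 \<and>
       rgt s j \<le> i \<and> lft s j \<le> 2 * i \<and> mid s j \<le> 2 * i \<and> est s j \<le> i) \<and>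
     (\<forall>j. 1 \<le> j \<and> j < cnt s \<longrightarrow> lst s j + H < ffst s (Suc j)) \<and>
     distinct (map fst (rep s)) \<and> fst ` set (rep s) \<inter> all_members s = {} \<and>
     fst ` set (rep s) \<union> all_members s = {1..k}"

lemma all_members_cong:
  assumes "cnt s' = cnt s" "ffst s' = ffst s" "lst s' = lst s" "gap s' = gap s"
  shows "all_members s' = all_members s"
  using assms by (simp add: all_members_def members_def)

lemma shape_update:
  assumes "shape W H i k s" "cnt s' = cnt s" "ffst s' = ffst s" "lst s' = lst s" "gap s' = gap s" "rep s' = rep s"
    and "\<And>j. 1 \<le> j \<Longrightarrow> j \<le> cnt s \<Longrightarrow> rgt s' j \<le> i \<and> lft s' j \<le> 2 * i \<and> mid s' j \<le> 2 * i \<and> est s' j \<le> i"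
  shows "shape W H i k s'"
  using assms(1,7) unfolding shape_def all_members_cong[OF assms(2-5)] assms(2-6) by blast

lemma shapeD:
  assumes "shape W H i k s" "1 \<le> j" "j \<le> cnt s"
  shows "W \<le> ffst s j" "ffst s j \<le> lst s j" "lst s j \<le> k" "gap s j dvd lst s j - ffst s j"
    "j * (H + 1) \<le> ffst s j + H + 1" "rgt s j \<le> i" "lft s j \<le> 2 * i" "mid s j \<le> 2 * i" "est s j \<le> i"
  using assms unfolding shape_def by blast+

lemma shape_mono:
  assumes s: "shape W H i k s" and i: "i \<le> i'"
  shows "shape W H i' k s"
proof -
  have "W \<le> ffst s j \<and> ffst s j \<le> lst s j \<and> lst s j \<le> k \<and>
       gap s j dvd lst s j - ffst s j \<and> j * (H + 1) \<le> ffst s j + H + 1 \<and>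
       rgt s j \<le> i' \<and> lft s j \<le> 2 * i' \<and> mid s j \<le> 2 * i' \<and> est s j \<le> i'" if "1 \<le> j \<and> j \<le> cnt s" for j
    using shapeD[OF s, of j] that i by simp
  with s show ?thesis unfolding shape_def by blast
qed

lemma alive_step_cases:
  obtains (stay) "alive_step W H chk i s = s"
  | (single) "cnt s \<noteq> 0" "gap s (cnt s) = 0" "alive_step W H chk i s = s\<lparr>rgt := (rgt s)(cnt s := i)\<rparr>"
  | (run) "cnt s \<noteq> 0" "gap s (cnt s) \<noteq> 0" "alive_step W H chk i s =
      s\<lparr>rgt := (rgt s)(cnt s := i), mid := (mid s)(cnt s := (lft s (cnt s) + i + 1) div 2),
        est := (est s)(cnt s := i - (lft s (cnt s) + i + 1) div 2)\<rparr>"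
  unfolding alive_step_def Let_def by (metis (full_types))

lemma alive_step_simps [simp]:
  "cnt (alive_step W H chk i s) = cnt s" "ffst (alive_step W H chk i s) = ffst s"
  "lst (alive_step W H chk i s) = lst s" "gap (alive_step W H chk i s) = gap s"
  "rep (alive_step W H chk i s) = rep s" "lft (alive_step W H chk i s) = lft s"
  by (simp_all add: alive_step_def Let_def)

lemma shape_alive_step:
  assumes s: "shape W H i k s"
  shows "shape W H i k (alive_step W H chk i s)"
proof (rule shape_update[OF s])
  fix j assume j: "1 \<le> j" "j \<le> cnt s"
  note sj = shapeD[OF s j]
  show "rgt (alive_step W H chk i s) j \<le> i \<and> lft (alive_step W H chk i s) j \<le> 2 * i \<and>
      mid (alive_step W H chk i s) j \<le> 2 * i \<and> est (alive_step W H chk i s) j \<le> i"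
  proof (cases rule: alive_step_cases[of W H chk i s])
    case stay
    with sj show ?thesis by simp
  next
    case single
    with sj show ?thesis by simp
  next
    case run
    have "(lft s j + i + 1) div 2 \<le> 2 * i \<or> i = 0" using sj by linarith
    with sj have "j = cnt s \<longrightarrow> (lft s j + i + 1) div 2 \<le> 2 * i" by auto
    with run sj show ?thesis by simp
  qed
qed simp_all

lemma scan_pos_le: "scan_pos g i x \<le> i"
  by (simp add: scan_pos_def)

lemma shape_scan_step:
  assumes s: "shape W H i k s"
  shows "shape W H i k (scan_step g chk i s)"
proof (rule shape_update[OF s])
  fix j assume j: "1 \<le> j" "j \<le> cnt s"
  have "scan_est g chk i (mid s j) (est s j) \<le> i"
    using shapeD[OF s j] scan_pos_le[of g i "2 * mid s j"] by (auto simp: scan_est_def Let_def)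
  then show "rgt (scan_step g chk i s) j \<le> i \<and> lft (scan_step g chk i s) j \<le> 2 * i \<and>
      mid (scan_step g chk i s) j \<le> 2 * i \<and> est (scan_step g chk i s) j \<le> i"
    using shapeD[OF s j] j by (simp add: scan_step_def)
qed (simp_all add: scan_step_def)

lemma shape_report:
  assumes "shape W H i k s"
  shows "shape W H i (Suc k) (s\<lparr>rep := rep s @ [(Suc k, e)]\<rparr>)"
proof -
  have am: "all_members (s\<lparr>rep := r\<rparr>) = all_members s" for r
    by (rule all_members_cong) auto
  from assms have *: "distinct (map fst (rep s))" "fst ` set (rep s) \<inter> all_members s = {}"
    "fst ` set (rep s) \<union> all_members s = {1..k}" unfolding shape_def by auto
  have "Suc k \<notin> fst ` set (rep s) \<union> all_members s" unfolding *(3) by simp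
  then have "Suc k \<notin> fst ` set (rep s)" "Suc k \<notin> all_members s" by blast+
  moreover have "insert (Suc k) {1..k} = {1..Suc k}" by auto
  ultimately show ?thesis using assms * unfolding shape_def am
    by (auto simp del: atLeastAtMostSuc_conv intro: le_SucI)
qed

lemma all_members_Suc:
  assumes "cnt s' = Suc (cnt s)" "\<And>j. j \<le> cnt s \<Longrightarrow> members s' j = members s j"
  shows "all_members s' = all_members s \<union> members s' (Suc (cnt s))"
  using assms by (auto simp: all_members_def atLeastAtMostSuc_conv)

lemma all_members_extend:
  assumes "cnt s' = cnt s" "cnt s \<noteq> 0" "\<And>j. j < cnt s \<Longrightarrow> members s' j = members s j"
    "members s' (cnt s) = insert m (members s (cnt s))"
  shows "all_members s' = insert m (all_members s)"
proof -
  have "{1..cnt s} = insert (cnt s) {1..<cnt s}" using assms(2) by auto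
  then show ?thesis using assms by (auto simp: all_members_def)
qed

lemma shape_insert:
  assumes "shape W H i k s" "all_members s' = insert (Suc k) (all_members s)" "rep s' = rep s"
    and "\<And>j. 1 \<le> j \<Longrightarrow> j \<le> cnt s' \<Longrightarrow> W \<le> ffst s' j \<and> ffst s' j \<le> lst s' j \<and> lst s' j \<le> Suc k \<and>
       gap s' j dvd lst s' j - ffst s' j \<and> j * (H + 1) \<le> ffst s' j + H + 1 \<and>
       rgt s' j \<le> i \<and> lft s' j \<le> 2 * i \<and> mid s' j \<le> 2 * i \<and> est s' j \<le> i"
    and "\<And>j. 1 \<le> j \<Longrightarrow> j < cnt s' \<Longrightarrow> lst s' j + H < ffst s' (Suc j)"
  shows "shape W H i (Suc k) s'"
proof -
  from assms(1) have *: "distinct (map fst (rep s))" "fst ` set (rep s) \<inter> all_members s = {}"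
    "fst ` set (rep s) \<union> all_members s = {1..k}" unfolding shape_def by auto
  have "Suc k \<notin> fst ` set (rep s) \<union> all_members s" unfolding *(3) by simp
  then have "Suc k \<notin> fst ` set (rep s)" by blast
  moreover have "insert (Suc k) {1..k} = {1..Suc k}" by auto
  ultimately show ?thesis using assms(2-5) * unfolding shape_def by auto
qed

lemma shape_centre_step:
  assumes s: "shape W H i (i - 1 - W) s"
  shows "shape W H i (i - W) (centre_step W H g chk i s)"
proof (cases "i \<le> W")
  case True
  with s show ?thesis by (simp add: centre_step_def)
next
  case False
  define k where "k = i - 1 - W"
  define m where "m = i - W"
  define j where "j = cnt s"
  have m: "m = Suc k" "m \<le> i" "1 \<le> i" using False by (auto simp: m_def k_def)
  have s: "shape W H i k s" using s by (simp add: k_def)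
  consider (short) "\<not> (W \<le> m \<and> chk (m - W) i)"
    | (new) "W \<le> m \<and> chk (m - W) i" "j = 0 \<or> lst s j + H < m"
    | (pair) "W \<le> m \<and> chk (m - W) i" "\<not> (j = 0 \<or> lst s j + H < m)" "gap s j = 0"
    | (more) "W \<le> m \<and> chk (m - W) i" "\<not> (j = 0 \<or> lst s j + H < m)" "gap s j \<noteq> 0" "m = lst s j + gap s j"
    | (bad) "W \<le> m \<and> chk (m - W) i" "\<not> (j = 0 \<or> lst s j + H < m)" "gap s j \<noteq> 0" "m \<noteq> lst s j + gap s j"
    by blast
  then have "shape W H i m (centre_step W H g chk i s)"
  proof cases
    case short
    then have "centre_step W H g chk i s = s\<lparr>rep := rep s @ [(Suc k, short W g chk m)]\<rparr>"
      using False m unfolding centre_step_def m_def by (simp add: Let_def)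
    then show ?thesis using shape_report[OF s] m by simp
  next
    case bad
    then have "centre_step W H g chk i s = s\<lparr>rep := rep s @ [(Suc k, W)]\<rparr>"
      using False m unfolding centre_step_def m_def j_def by (simp add: Let_def)
    then show ?thesis using shape_report[OF s] m by simp
  next
    case new
    define s' where "s' = centre_step W H g chk i s"
    have s': "s' = s\<lparr>cnt := Suc j, ffst := (ffst s)(Suc j := m), gap := (gap s)(Suc j := 0),
         lst := (lst s)(Suc j := m), lft := (lft s)(Suc j := 0), rgt := (rgt s)(Suc j := i),
         mid := (mid s)(Suc j := m), est := (est s)(Suc j := W)\<rparr>"
      using False new unfolding s'_def centre_step_def m_def j_def by (simp add: Let_def)
    have "members s' (Suc j) = {m}" by (auto simp: members_def s')
    moreover have "all_members s' = all_members s \<union> members s' (Suc j)"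
      unfolding j_def by (rule all_members_Suc) (auto simp: s' j_def members_def)
    ultimately have am: "all_members s' = insert (Suc k) (all_members s)" using m by simp
    have "j * (H + 1) \<le> lst s j + H + 1" if "j \<noteq> 0"
      using shapeD[OF s, of j] that by (simp add: j_def)
    then have J: "Suc j * (H + 1) \<le> m + H + 1" using new by (cases "j = 0") auto
    have "shape W H i (Suc k) s'"
    proof (rule shape_insert[OF s am])
      fix l assume l: "1 \<le> l" "l \<le> cnt s'"
      show "W \<le> ffst s' l \<and> ffst s' l \<le> lst s' l \<and> lst s' l \<le> Suc k \<and>
       gap s' l dvd lst s' l - ffst s' l \<and> l * (H + 1) \<le> ffst s' l + H + 1 \<and>
       rgt s' l \<le> i \<and> lft s' l \<le> 2 * i \<and> mid s' l \<le> 2 * i \<and> est s' l \<le> i"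
      proof (cases "l = Suc j")
        case True
        then show ?thesis using new(1) m J False by (simp add: s')
      next
        case False
        then have "l \<le> cnt s" using l by (simp add: s' j_def)
        from shapeD[OF s l(1) this] False show ?thesis by (simp add: s')
      qed
    next
      fix l assume l: "1 \<le> l" "l < cnt s'"
      show "lst s' l + H < ffst s' (Suc l)"
      proof (cases "l = j")
        case True
        then show ?thesis using new(2) l by (simp add: s')
      next
        case False
        then have "l < cnt s" using l by (simp add: s' j_def)
        with s l False show ?thesis by (simp add: s' j_def shape_def)
      qed
    qed (simp add: s')
    then show ?thesis using m s'_def by simp
  next
    case pair
    define s' where "s' = centre_step W H g chk i s"
    define lf where "lf = 2 * lst s j - rgt s j"
    have s': "s' = s\<lparr>gap := (gap s)(j := m - lst s j), lst := (lst s)(j := m), lft := (lft s)(j := lf),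
         rgt := (rgt s)(j := i), mid := (mid s)(j := (lf + i + 1) div 2),
         est := (est s)(j := i - (lf + i + 1) div 2)\<rparr>"
      using False pair unfolding s'_def centre_step_def m_def j_def lf_def by (simp add: Let_def)
    have j: "1 \<le> j" "j \<le> cnt s" using pair(2) by (auto simp: j_def)
    note sj = shapeD[OF s j]
    have eq: "lst s j = ffst s j" using sj pair(3) by auto
    have ms: "members s j = {ffst s j}" using pair(3) eq by (auto simp: members_def)
    have "members s' j = insert m (members s j)"
      unfolding ms using eq sj m by (auto simp: members_def s' dest: dvd_imp_le)
    then have am: "all_members s' = insert (Suc k) (all_members s)"
      using j m by (intro all_members_extend) (auto simp: s' j_def members_def)
    have "lf \<le> 2 * i" using sj m by (simp add: lf_def k_def)
    then have lf: "lf \<le> 2 * i" "(lf + i + 1) div 2 \<le> 2 * i" using m by auto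
    have "shape W H i (Suc k) s'"
    proof (rule shape_insert[OF s am])
      fix l assume l: "1 \<le> l" "l \<le> cnt s'"
      show "W \<le> ffst s' l \<and> ffst s' l \<le> lst s' l \<and> lst s' l \<le> Suc k \<and>
       gap s' l dvd lst s' l - ffst s' l \<and> l * (H + 1) \<le> ffst s' l + H + 1 \<and>
       rgt s' l \<le> i \<and> lft s' l \<le> 2 * i \<and> mid s' l \<le> 2 * i \<and> est s' l \<le> i"
      proof (cases "l = j")
        case True
        then show ?thesis using sj m lf eq by (simp add: s')
      next
        case False
        then show ?thesis using shapeD[OF s l(1)] l by (simp add: s')
      qed
    next
      fix l assume l: "1 \<le> l" "l < cnt s'"
      then have "l \<noteq> j" by (simp add: s' j_def)
      then show "lst s' l + H < ffst s' (Suc l)" using s l by (simp add: s' shape_def)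
    qed (simp add: s')
    then show ?thesis using m s'_def by simp
  next
    case more
    define s' where "s' = centre_step W H g chk i s"
    have s': "s' = s\<lparr>lst := (lst s)(j := m)\<rparr>"
      using False more unfolding s'_def centre_step_def m_def j_def by (simp add: Let_def)
    have j: "1 \<le> j" "j \<le> cnt s" using more(2) by (auto simp: j_def)
    note sj = shapeD[OF s j]
    have "m - ffst s j = (lst s j - ffst s j) + gap s j" using sj(2) more(4) by simp
    then have dv: "gap s j dvd m - ffst s j" using sj(4) by simp
    have "members s' j = insert m (members s j)"
    proof (intro equalityI subsetI)
      fix x assume x: "x \<in> members s' j"
      then have x': "ffst s j \<le> x" "x \<le> m" "gap s j dvd x - ffst s j" by (auto simp: members_def s')
      show "x \<in> insert m (members s j)"
      proof (cases "x \<le> lst s j")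
        case False
        have "gap s j dvd (x - ffst s j) - (lst s j - ffst s j)" using x'(3) sj(4) by (rule dvd_diff_nat)
        then have "gap s j dvd x - lst s j" using sj(2) False by simp
        with False have "gap s j \<le> x - lst s j" by (intro dvd_imp_le) auto
        with x'(2) more(4) False have "x = m" by linarith
        then show ?thesis by simp
      qed (use x' in \<open>simp add: members_def\<close>)
    next
      fix x assume "x \<in> insert m (members s j)"
      with dv sj m more(4) show "x \<in> members s' j" by (auto simp: members_def s')
    qed
    then have am: "all_members s' = insert (Suc k) (all_members s)"
      using j m by (intro all_members_extend) (auto simp: s' j_def members_def)
    have "shape W H i (Suc k) s'"
    proof (rule shape_insert[OF s am])
      fix l assume l: "1 \<le> l" "l \<le> cnt s'"
      show "W \<le> ffst s' l \<and> ffst s' l \<le> lst s' l \<and> lst s' l \<le> Suc k \<and>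
       gap s' l dvd lst s' l - ffst s' l \<and> l * (H + 1) \<le> ffst s' l + H + 1 \<and>
       rgt s' l \<le> i \<and> lft s' l \<le> 2 * i \<and> mid s' l \<le> 2 * i \<and> est s' l \<le> i"
      proof (cases "l = j")
        case True
        then show ?thesis using sj m dv more(4) by (simp add: s')
      next
        case False
        then show ?thesis using shapeD[OF s l(1)] l by (simp add: s')
      qed
    next
      fix l assume l: "1 \<le> l" "l < cnt s'"
      then have "l \<noteq> j" by (simp add: s' j_def)
      then show "lst s' l + H < ffst s' (Suc l)" using s l by (simp add: s' shape_def)
    qed (simp add: s')
    then show ?thesis using m s'_def by simp
  qed
  then show ?thesis by (simp add: m_def)
qed

definition track_step :: "nat \<Rightarrow> nat \<Rightarrow> nat \<Rightarrow> (nat \<Rightarrow> nat \<Rightarrow> bool) \<Rightarrow> nat \<Rightarrow> tracker \<Rightarrow> tracker" where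
  "track_step W H g chk i s = scan_step g chk i (centre_step W H g chk i (alive_step W H chk i s))"

lemma shape_track_step:
  "shape W H (i - 1) (i - 1 - W) s \<Longrightarrow> shape W H i (i - W) (track_step W H g chk i s)"
  unfolding track_step_def
  by (intro shape_scan_step shape_centre_step shape_alive_step) (auto elim: shape_mono)

lemma shape_empty: "empty_tracker s \<Longrightarrow> shape W H i 0 s"
  by (simp add: empty_tracker_def shape_def all_members_def)

subsection \<open>Correctness for a faithful oracle\<close>

text \<open>The oracle must be right up to \<open>n + W\<close> because centre \<open>m\<close> is
  decided in round \<open>m + W\<close>. The assumption \<open>zero\<close> starts the invariant
  that no long centre has been overlooked.\<close>

locale faithful =
  fixes \<tau> :: "int \<Rightarrow> nat" and n W H g :: nat and chk :: "nat \<Rightarrow> nat \<Rightarrow> bool"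
  assumes W: "1 \<le> W" "2 * H \<le> W" "1 \<le> g" "g \<le> W"
    and inside: "\<And>m l. 1 \<le> m \<Longrightarrow> m \<le> n \<Longrightarrow> pal_at \<tau> (int m) (int l) \<Longrightarrow> l \<le> m \<and> m + l \<le> n"
    and zero: "\<not> pal_at \<tau> 0 (int W)"
    and chk: "\<And>m l. 1 \<le> m \<Longrightarrow> l \<le> m \<Longrightarrow> m + l \<le> n + W \<Longrightarrow> chk (m - l) (m + l) \<longleftrightarrow> pal_at \<tau> (int m) (int l)"
begin

abbreviation B :: "nat \<Rightarrow> nat \<Rightarrow> bool" where
  "B m l \<equiv> pal_at \<tau> (int m) (int l)"

definition accurate :: "nat \<Rightarrow> nat \<Rightarrow> bool" where
  "accurate m e \<longleftrightarrow> B m e \<and> \<not> B m (e + g)"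

lemma B_mono: "B m l \<Longrightarrow> l' \<le> l \<Longrightarrow> B m l'"
  by (erule pal_at_mono) simp

lemma B_0: "B m 0"
  by (simp add: pal_at_def)

lemma chk': "1 \<le> m \<Longrightarrow> m \<le> i \<Longrightarrow> i \<le> 2 * m \<Longrightarrow> i \<le> n + W \<Longrightarrow> chk (2 * m - i) i \<longleftrightarrow> B m (i - m)"
  using chk[of m "i - m"] by (simp add: mult_2)

text \<open>In a run \<open>c\<close> is the middle of the window and may fail to be a member; then
  its estimate carries no information and is never reported.\<close>

definition rec_ok :: "nat \<Rightarrow> nat \<Rightarrow> nat \<Rightarrow> nat \<Rightarrow> nat \<Rightarrow> nat \<Rightarrow> nat \<Rightarrow> bool" where
  "rec_ok F D La Lf Rt c e \<longleftrightarrow>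
     (if D = 0 then La = F \<and> c = F \<and> B F e
      else run_ok \<tau> (int W) (int F) (int D) (int La) (int Lf) (int Rt) \<and> c = (Lf + Rt + 1) div 2 \<and>
        D \<le> H \<and> (F \<le> c \<and> c \<le> La \<and> D dvd c - F \<longrightarrow> B c e))"

definition ended :: "nat \<Rightarrow> nat \<Rightarrow> nat \<Rightarrow> bool" where
  "ended D La Rt \<longleftrightarrow> D = 0 \<or> \<not> B La (Rt + 1 - La)"

text \<open>The estimate has caught up with every length whose left end has a permanent fingerprint
  and whose right end is at most \<open>p\<close>.\<close>

definition scanned :: "nat \<Rightarrow> nat \<Rightarrow> nat \<Rightarrow> bool" where
  "scanned c e p \<longleftrightarrow> (\<forall>l\<le>c. c + l \<le> p \<and> g dvd c - l \<and> B c l \<longrightarrow> l \<le> e)"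

text \<open>\<open>Rt = i\<close> means that the window of the last record is still growing. A
  single centre remembers that no long centre lies up to \<open>H\<close> before it; this excludes
  the mirror image of a second centre. By the final clause a run may have
  \<open>Rt = La + W + D\<close> only within a round, after the window has been extended and before
  the centre \<open>i - W = La + D\<close> is decided.\<close>

definition current :: "nat \<Rightarrow> nat \<Rightarrow> nat \<Rightarrow> nat \<Rightarrow> nat \<Rightarrow> nat \<Rightarrow> bool" where
  "current i k F D La Rt \<longleftrightarrow> 1 \<le> F \<and> F \<le> La \<and> La \<le> k \<and> B La W \<and> Rt \<le> i \<and>
     (\<forall>c. La < c \<and> c \<le> k \<longrightarrow> \<not> B c W) \<and> La + W \<le> Rt \<and>
     (if D = 0 then B La (Rt - La) \<and> Rt \<le> La + W + H \<and>
        (\<forall>c. c < F \<and> F \<le> c + H \<longrightarrow> \<not> B c W) \<and>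
        (Rt = i \<or> Rt = La + W + H \<or> \<not> B La (Rt + 1 - La))
      else D < La \<and> B (La - D) W \<and> (\<forall>c. La - D < c \<and> c < La \<longrightarrow> \<not> B c W) \<and>
        (Rt = i \<or> \<not> B La (Rt + 1 - La)) \<and> (Rt < La + W + D \<or> Rt = i \<and> k + W < i))"

text \<open>Three clocks advance separately within a round: \<open>i\<close> for the windows,
  \<open>k\<close> for the decided centres and \<open>p\<close> for the scans.\<close>

definition good :: "nat \<Rightarrow> nat \<Rightarrow> nat \<Rightarrow> tracker \<Rightarrow> bool" where
  "good i k p s \<longleftrightarrow> (\<forall>(m, e)\<in>set (rep s). accurate m e) \<and>
     (\<forall>j. 1 \<le> j \<and> j \<le> cnt s \<longrightarrow>
        rec_ok (ffst s j) (gap s j) (lst s j) (lft s j) (rgt s j) (mid s j) (est s j) \<and>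
        scanned (mid s j) (est s j) p) \<and>
     (\<forall>j. 1 \<le> j \<and> j < cnt s \<longrightarrow> ended (gap s j) (lst s j) (rgt s j)) \<and>
     (if cnt s = 0 then \<forall>c\<le>k. \<not> B c W
      else current i k (ffst s (cnt s)) (gap s (cnt s)) (lst s (cnt s)) (rgt s (cnt s)))"

lemma rec_okD:
  assumes "rec_ok F D La Lf Rt c e" "D \<noteq> 0"
  shows "run_ok \<tau> (int W) (int F) (int D) (int La) (int Lf) (int Rt)" "c = (Lf + Rt + 1) div 2" "D \<le> H"
  using assms by (auto simp: rec_ok_def)

lemma run_B:
  assumes run: "run_ok \<tau> (int W) (int F) (int D) (int La) (int Lf) (int Rt)"
    and m: "F \<le> m" "m \<le> La" "D dvd m - F" "m + l \<le> Rt" "Lf + l \<le> m"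
  shows "B m l"
proof -
  have "int D dvd int m - int F" using m by (metis int_dvd_int_iff of_nat_diff)
  then show ?thesis using m by (intro run_pal_at[OF run]) auto
qed

lemma rec_run:
  assumes "run_ok \<tau> (int W) (int F) (int D) (int La) (int Lf) (int Rt)" "D \<le> H" "0 < D"
  shows "rec_ok F D La Lf Rt ((Lf + Rt + 1) div 2) (Rt - (Lf + Rt + 1) div 2)"
proof -
  let ?c = "(Lf + Rt + 1) div 2"
  have "Lf < Rt" using runD(4-7)[OF assms(1)] assms(3) W(1) by linarith
  then have le: "?c + (Rt - ?c) \<le> Rt" "Lf + (Rt - ?c) \<le> ?c" by linarith+
  have "B ?c (Rt - ?c)" if "F \<le> ?c \<and> ?c \<le> La \<and> D dvd ?c - F"
    using that le by (intro run_B[OF assms(1)]) blast+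
  moreover have "D \<noteq> 0" using assms(3) by simp
  ultimately show ?thesis unfolding rec_ok_def using assms(1,2) by (simp only: if_False) blast
qed

lemma scanned_new: "i \<le> c + e \<Longrightarrow> p \<le> i \<Longrightarrow> scanned c e p"
  unfolding scanned_def by auto

text \<open>The centre right of the last one is long exactly if the window still extends symmetrically.\<close>

lemma run_strict:
  assumes cur: "current i k F D La Rt" and rc: "rec_ok F D La Lf Rt c e" and D: "D \<noteq> 0"
    and none: "\<not> B (i - W) W" and k: "k = i - 1 - W" "W < i"
  shows "Rt < La + W + D"
proof (rule ccontr)
  assume "\<not> Rt < La + W + D"
  with cur D rec_okD(1)[OF rc D] have Rt: "Rt = i" "Rt = La + W + D"
    using runD(8) by (fastforce simp: current_def)+
  note run = rec_okD(1)[OF rc D]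
  \<comment> \<open>Inside this longer palindrome the long centre \<open>La - D\<close> is mirrored
    to \<open>La + D = i - W\<close>, which was assumed not to be long.\<close>
  have "B La (W + D)"
    using runD(1-6)[OF run] Rt cur
    by (intro run_B[OF run]) (auto simp: current_def simp flip: int_dvd_int_iff of_nat_diff)
  moreover have "B (La - D) W" "D < La" using cur D by (auto simp: current_def)
  ultimately have "pal_at \<tau> (int La - (- int D)) (int W)"
    by (intro pal_at_mirror) (auto simp: of_nat_diff)
  moreover have "int (i - W) = int La - (- int D)" using Rt by simp
  ultimately show False using none by (simp only: not_True_eq_False)
qed

lemma alive_good:
  assumes "good (i - 1) k p s" "1 \<le> i" "i \<le> n + W" "k = i - 1 - W" "k \<le> n" "p \<le> i"
  shows "good i k p (alive_step W H chk i s)"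
proof (cases "cnt s = 0")
  case True
  with assms show ?thesis by (simp add: alive_step_def good_def)
next
  case False
  define j where "j = cnt s"
  define F where "F = ffst s j"
  define D where "D = gap s j"
  define La where "La = lst s j"
  define Lf where "Lf = lft s j"
  define Rt where "Rt = rgt s j"
  note defs = F_def D_def La_def Lf_def Rt_def
  have j: "1 \<le> j" "cnt s = j" "j \<noteq> 0" using False by (auto simp: j_def)
  have cur: "current (i - 1) k F D La Rt" and rc: "rec_ok F D La Lf Rt (mid s j) (est s j)"
    and sc: "scanned (mid s j) (est s j) p"
    using assms(1) j by (auto simp: good_def defs)
  have La: "1 \<le> La" "La \<le> n" "La \<le> k" using cur assms by (auto simp: current_def)
  then have iW: "W + La < i" and kW: "k + W = i - 1" using assms(4) by auto
  have B: "chk (2 * La - i) i \<longleftrightarrow> B La (i - La)" if "i \<le> 2 * La"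
    using chk'[of La i] La iW that assms by auto
  show ?thesis
  proof (cases "Rt + 1 = i \<and> i \<le> La + W + H \<and> i \<le> 2 * La \<and> chk (2 * La - i) i")
    case True
    with B have Bi: "B La (i - La)" by auto
    show ?thesis
    proof (cases "D = 0")
      case D: True
      have s': "alive_step W H chk i s = s\<lparr>rgt := (rgt s)(j := i)\<rparr>"
        using True D j by (simp add: alive_step_def Let_def defs)
      have "current i k F D La i" using cur D Bi True by (auto simp: current_def)
      moreover have "rec_ok F D La Lf i (mid s j) (est s j)" using rc D by (simp add: rec_ok_def)
      ultimately show ?thesis using assms(1) j unfolding s' good_def by (auto simp: defs)
    next
      case D: False
      let ?c = "(Lf + i + 1) div 2"
      have s': "alive_step W H chk i s =
          s\<lparr>rgt := (rgt s)(j := i), mid := (mid s)(j := ?c), est := (est s)(j := i - ?c)\<rparr>"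
        using True D j by (simp add: alive_step_def Let_def defs)
      have strict: "Rt < La + W + D" using cur D kW unfolding current_def by auto
      note run = rec_okD(1)[OF rc D]
      have "run_ok \<tau> (int W) (int F) (int D) (int La) (int Lf) (int Rt + 1)"
      proof (rule run_extend[OF run])
        have "int Rt + 1 - int La = int (i - La)" using True iW by auto
        then show "pal_at \<tau> (int La) (int Rt + 1 - int La)" using Bi by (simp only:)
      qed (use strict in auto)
      moreover have "int Rt + 1 = int i" using True by auto
      ultimately have run': "run_ok \<tau> (int W) (int F) (int D) (int La) (int Lf) (int i)" by (simp only:)
      have "rec_ok F D La Lf i ?c (i - ?c)" using rec_run[OF run'] rec_okD(3)[OF rc D] D by simp
      moreover have "scanned ?c (i - ?c) p" using assms(6) by (intro scanned_new[of i]) auto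
      moreover have "current i k F D La i"
        using cur D True strict assms(4) iW by (auto simp: current_def)
      ultimately show ?thesis using assms(1) j unfolding s' good_def by (auto simp: defs)
    qed
  next
    case F: False
    have s': "alive_step W H chk i s = s"
      using F j by (auto simp: alive_step_def Let_def defs)
    have "Rt + 1 = i \<Longrightarrow> i \<le> 2 * La \<Longrightarrow> \<not> chk (2 * La - i) i \<Longrightarrow> \<not> B La (Rt + 1 - La)" using B by simp
    \<comment> \<open>If \<open>i\<close> exceeds \<open>2 * La\<close>, its mirror image lies left
      of the string, so the symmetry is broken without any check.\<close>
    moreover have "\<not> B La (i - La)" if "\<not> i \<le> 2 * La"
      using inside[of La "i - La"] La that by auto
    ultimately have dead: "Rt + 1 = i \<Longrightarrow> i \<le> La + W + H \<Longrightarrow> \<not> B La (Rt + 1 - La)"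
      using F by metis
    have "current i k F D La Rt"
    proof (cases "D = 0")
      case True
      with cur dead iW show ?thesis unfolding current_def by (cases "Rt + 1 = i") auto
    next
      case D: False
      have strict: "Rt < La + W + D" using cur D kW unfolding current_def by auto
      moreover have "D \<le> H" using rec_okD(3)[OF rc D] .
      ultimately have "Rt + 1 = i \<Longrightarrow> \<not> B La (Rt + 1 - La)" using dead by auto
      then show ?thesis using cur D strict unfolding current_def by (cases "Rt + 1 = i") auto
    qed
    then show ?thesis using assms(1) j unfolding s' good_def by (auto simp: defs)
  qed
qed

lemma accurate_short:
  assumes m: "1 \<le> m" "m \<le> n" and nB: "\<not> B m W"
  shows "accurate m (short W g chk m)"
proof -
  define P where "P q = (\<not> short_pal W g chk m (g * q))" for q
  \<comment> \<open>Since \<open>g * m + g > m\<close>, the value \<open>m\<close> satisfies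
    \<open>P\<close>, so the \<open>LEAST\<close> in \<open>short\<close> exists.\<close>
  have "1 * (m + 1) \<le> g * (m + 1)" using W(3) by (rule mult_le_mono1)
  then have "P m" by (auto simp: P_def short_pal_def)
  define q where "q = (LEAST q. P q)"
  have q: "P q" unfolding q_def using \<open>P m\<close> by (rule LeastI)
  have short: "short W g chk m = g * q" by (simp add: short_def q_def P_def)
  have ck: "l + g \<le> m \<Longrightarrow> l + g \<le> W \<Longrightarrow> chk (m - (l + g)) (m + (l + g)) \<longleftrightarrow> B m (l + g)" for l
    using m by (intro chk) auto
  have "B m (g * q)"
  proof (cases q)
    case 0
    then show ?thesis using B_0 by simp
  next
    case (Suc q')
    then have "\<not> P q'" using not_less_Least[of q' P] by (simp add: q_def)
    then have "short_pal W g chk m (g * q')" by (simp add: P_def)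
    with ck[of "g * q'"] have "B m (g * q' + g)" unfolding short_pal_def by blast
    then show ?thesis by (simp add: Suc add.commute)
  qed
  moreover have "\<not> B m (g * q + g)"
  proof
    assume b: "B m (g * q + g)"
    have "g * q + g \<le> m" using inside[OF m b] by simp
    moreover have "g * q + g \<le> W" using b nB B_mono by (meson nat_le_linear)
    ultimately have "short_pal W g chk m (g * q)" using ck[of "g * q"] b by (simp add: short_pal_def)
    with q show False by (simp add: P_def)
  qed
  ultimately show ?thesis by (simp add: accurate_def short)
qed

lemma centre_good:
  assumes gd: "good i k p s" and i: "W < i" "i \<le> n + W" and k: "k = i - 1 - W" and p: "p \<le> i"
  shows "good i (i - W) p (centre_step W H g chk i s)"
proof -
  define m where "m = i - W"
  define j where "j = cnt s"
  define F where "F = ffst s j"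
  define D where "D = gap s j"
  define La where "La = lst s j"
  define Lf where "Lf = lft s j"
  define Rt where "Rt = rgt s j"
  note defs = F_def D_def La_def Lf_def Rt_def
  have m: "1 \<le> m" "m \<le> n" "i = m + W" "m = Suc k" using i k by (auto simp: m_def)
  have long: "W \<le> m \<and> chk (m - W) i \<longleftrightarrow> B m W"
    using chk[of m W] inside[of m W] m by auto
  have cr: "j \<noteq> 0 \<Longrightarrow> current i k F D La Rt"
    and rc: "j \<noteq> 0 \<Longrightarrow> rec_ok F D La Lf Rt (mid s j) (est s j)"
    and sc: "j \<noteq> 0 \<Longrightarrow> scanned (mid s j) (est s j) p"
    using gd by (auto simp: good_def defs j_def)
  show ?thesis
  proof (cases "B m W")
    case False
    have s': "centre_step W H g chk i s = s\<lparr>rep := rep s @ [(m, short W g chk m)]\<rparr>"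
      using long False i by (simp add: centre_step_def Let_def m_def)
    have acc: "accurate m (short W g chk m)" using m False by (intro accurate_short) auto
    have none: "\<not> B c W" if "c \<le> m" "\<not> c \<le> k" for c using that m False by (cases "c = m") auto
    show ?thesis
    proof (cases "j = 0")
      case True
      with gd acc none show ?thesis unfolding s' good_def m_def[symmetric] by (auto simp: j_def)
    next
      case j0: False
      have "D \<noteq> 0 \<Longrightarrow> Rt < La + W + D"
        using run_strict[OF cr[OF j0] rc[OF j0]] False k i by (auto simp: m_def)
      then have "current i m F D La Rt"
        using cr[OF j0] none m unfolding current_def by (auto split: if_splits)
      then show ?thesis using gd acc j0 unfolding s' good_def m_def[symmetric] by (auto simp: j_def defs)
    qed
  next
    case Bm: True
    show ?thesis
    proof (cases "j = 0 \<or> La + H < m")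
      case True
      have s': "centre_step W H g chk i s = s\<lparr>cnt := Suc j, ffst := (ffst s)(Suc j := m),
         gap := (gap s)(Suc j := 0), lst := (lst s)(Suc j := m), lft := (lft s)(Suc j := 0),
         rgt := (rgt s)(Suc j := i), mid := (mid s)(Suc j := m), est := (est s)(Suc j := W)\<rparr>"
        using long Bm i True by (simp add: centre_step_def Let_def m_def j_def defs)
      \<comment> \<open>The new centre is more than \<open>H \<ge> D\<close> away, so
        \<open>Rt \<le> La + W + D < m + W = i\<close>: the old window has stopped growing, and only
        a mismatch can have stopped it.\<close>
      have "ended D La Rt" if "j \<noteq> 0"
      proof (cases "D = 0")
        case D: False
        have "Rt \<le> La + W + D" "D \<le> H"
          using rec_okD[OF rc[OF that] D] runD(8)[OF rec_okD(1)[OF rc[OF that] D]] by auto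
        with True that m have "Rt \<noteq> i" by auto
        with cr[OF that] D show ?thesis by (auto simp: ended_def current_def)
      qed (simp add: ended_def)
      moreover have "\<not> B c W" if c: "c < m" "m \<le> c + H" for c
      proof (cases "j = 0")
        case True
        with gd c m show ?thesis by (auto simp: good_def j_def)
      next
        case False
        with True c m cr show ?thesis by (auto simp: current_def)
      qed
      then have "current i m m 0 m i" using m Bm by (auto simp: current_def)
      moreover have "rec_ok m 0 m 0 i m W" using Bm by (simp add: rec_ok_def)
      moreover have "scanned m W p" using p m by (intro scanned_new[of i]) auto
      ultimately show ?thesis
        using gd unfolding s' good_def m_def[symmetric]
        by (auto simp: j_def defs less_Suc_eq le_Suc_eq)
    next
      case False
      then have j0: "j \<noteq> 0" "1 \<le> j" and mH: "m \<le> La + H" by auto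
      note cur = cr[OF j0(1)] and rc = rc[OF j0(1)]
      have La: "1 \<le> F" "La \<le> k" "B La W" "La < m" "F \<le> La"
        and none: "\<And>c. La < c \<Longrightarrow> c < m \<Longrightarrow> \<not> B c W"
        using cur m by (auto simp: current_def)
      show ?thesis
      proof (cases "D = 0")
        case D: True
        define d where "d = m - La"
        define lf where "lf = 2 * La - Rt"
        have d: "0 < d" "d \<le> H" "m = La + d" using La mH by (auto simp: d_def)
        let ?c = "(lf + i + 1) div 2"
        have s': "centre_step W H g chk i s = s\<lparr>gap := (gap s)(j := d), lst := (lst s)(j := m),
            lft := (lft s)(j := lf), rgt := (rgt s)(j := i), mid := (mid s)(j := ?c),
            est := (est s)(j := i - ?c)\<rparr>"
          using long Bm i False D by (simp add: centre_step_def Let_def m_def j_def defs d_def lf_def)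
        have FL: "La = F" using rc D by (simp add: rec_ok_def)
        have BRt: "B La (Rt - La)" and Rt: "La + W \<le> Rt" "Rt \<le> La + W + H" "Rt \<le> i"
          and Rtd: "Rt = i \<or> Rt = La + W + H \<or> \<not> B La (Rt + 1 - La)"
          and before: "\<And>c. c < F \<Longrightarrow> F \<le> c + H \<Longrightarrow> \<not> B c W"
          using cur D by (auto simp: current_def)
        have Rt2: "Rt \<le> 2 * La" using inside[OF _ _ BRt] La m Rt by auto
        \<comment> \<open>Otherwise \<open>m = La + d\<close> would be mirrored to a long centre
          \<open>La - d\<close>, less than \<open>H + 1\<close> before \<open>La\<close>, and the
          record would not have been started at \<open>La\<close>.\<close>
        have "\<not> B La (W + d)"
        proof
          assume b: "B La (W + d)"
          have "pal_at \<tau> (int La - int d) (int W)"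
            using b Bm d by (intro pal_at_mirror) auto
          moreover have "W + d \<le> La" using inside[OF _ _ b] La m by auto
          then have "int La - int d = int (La - d)" by simp
          ultimately have "B (La - d) W" by (simp only:)
          with before[of "La - d"] \<open>W + d \<le> La\<close> W d FL show False by auto
        qed
        then have RtB: "Rt < La + W + d"
          using B_mono[OF BRt, of "W + d"] by linarith
        \<comment> \<open>\<open>Rt < La + W + d = i\<close> excludes a window that is still
          growing, and \<open>d \<le> H\<close> excludes the cap; so a mismatch ended it.\<close>
        then have dead: "\<not> B La (Rt + 1 - La)" using Rtd d m by auto
        have run: "run_ok \<tau> (int W) (int La) (int d) (int La + int d) (2 * int La - int Rt) (int La + int d + int W)"
        proof (rule run_start)
          have "int Rt - int La = int (Rt - La)" using Rt by simp
          then show "pal_at \<tau> (int La) (int Rt - int La)" using BRt by (simp only:)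
          have "int Rt + 1 - int La = int (Rt + 1 - La)" using Rt by simp
          then show "\<not> pal_at \<tau> (int La) (int Rt + 1 - int La)" using dead by (simp only: not_False_eq_True)
          show "pal_at \<tau> (int La + int d) (int W)" using Bm d by simp
        qed (use Rt RtB d W in auto)
        have "2 * int La - int Rt = int lf" using Rt2 by (simp add: lf_def of_nat_diff)
        with run d m FL have run': "run_ok \<tau> (int W) (int F) (int d) (int m) (int lf) (int i)" by simp
        have "rec_ok F d m lf i ?c (i - ?c)" using rec_run[OF run'] d by simp
        moreover have "scanned ?c (i - ?c) p" using p by (intro scanned_new[of i]) auto
        moreover have md: "m - d = La" "d < m" "d \<noteq> 0" "F \<le> m" "i < m + W + d" "m + W \<le> i"
          using d La m by auto
        have "current i m F d m i"
          unfolding current_def md(1) using La(1,3) Bm none md(2-) by auto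
        ultimately show ?thesis
          using gd j0 unfolding s' good_def m_def[symmetric] by (auto simp: j_def defs)
      next
        case D: False
        note run = rec_okD(1)[OF rc D]
        have DH: "D \<le> H" "D < La" "B (La - D) W" "\<And>c. La - D < c \<Longrightarrow> c < La \<Longrightarrow> \<not> B c W"
          "Rt = i \<or> \<not> B La (Rt + 1 - La)" "Rt \<le> i" "La + W \<le> Rt"
          using rec_okD(3)[OF rc D] cur D by (auto simp: current_def)
        \<comment> \<open>No long centre lies strictly between neighbours among
          \<open>La - D\<close>, \<open>La\<close> and \<open>m\<close>, so the progression
          continues with the same gap.\<close>
        have "int m - int La = int La - int (La - D)"
        proof (rule chain_gap)
          fix c :: int assume c: "int (La - D) < c" "c < int m" "c \<noteq> int La"
          then obtain c' where c': "c = int c'" by (metis nonneg_int_cases less_imp_le of_nat_0_le_iff order.strict_trans1)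
          show "\<not> pal_at \<tau> c (int W)" using c DH(4)[of c'] none[of c'] unfolding c' by (cases "c' < La") auto
        qed (use DH La Bm W mH D in auto)
        then have mD: "m = La + D" using DH by auto
        have s': "centre_step W H g chk i s = s\<lparr>lst := (lst s)(j := m)\<rparr>"
          using long Bm i False D mD by (simp add: centre_step_def Let_def m_def[symmetric] j_def[symmetric] defs[symmetric])
        have "pal_at \<tau> (int La) (int W + int D)"
          by (rule chain_alive) (use DH La Bm W mD in \<open>auto simp: of_nat_diff\<close>)
        then have b: "B La (W + D)" by simp
        \<comment> \<open>The three centres force the palindrome around \<open>La\<close> to have
          length at least \<open>W + D\<close>, so no mismatch can have occurred before
          \<open>La + D + W = i\<close>.\<close>
        have Rti: "Rt = i"
        proof (rule ccontr)
          assume "Rt \<noteq> i"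
          with DH have "\<not> B La (Rt + 1 - La)" "Rt + 1 \<le> i" by auto
          with B_mono[OF b, of "Rt + 1 - La"] m mD show False by auto
        qed
        have run': "run_ok \<tau> (int W) (int F) (int D) (int La + int D) (int Lf) (int Rt)"
          by (rule run_next[OF run]) (use Bm mD Rti m in auto)
        have "rec_ok F D m Lf Rt (mid s j) (est s j)"
        proof -
          have c: "mid s j = (Lf + Rt + 1) div 2" using rec_okD(2)[OF rc D] .
          have "B (mid s j) (est s j)" if mem: "F \<le> mid s j" "mid s j \<le> m" "D dvd mid s j - F"
          proof (cases "mid s j \<le> La")
            case True
            with rc D mem show ?thesis by (auto simp: rec_ok_def)
          next
            case False
            have "int D dvd int (mid s j) - int F" using mem by (metis int_dvd_int_iff of_nat_diff)
            then have "int D dvd (int (mid s j) - int F) - (int La - int F)"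
              using runD(3)[OF run] by (rule dvd_diff)
            then have "int D dvd int (mid s j) - int La" by simp
            then have "int D \<le> int (mid s j) - int La" using False by (intro zdvd_imp_le) auto
            then have "mid s j = m" using mem mD by auto
            \<comment> \<open>The new member lies right of the middle of the window, so the middle
              does not become a member now and its estimate needs no new proof.\<close>
            moreover have "2 * int m > int Lf + int Rt + 1"
              using runD(1,4,5,8)[OF run] mD by auto
            ultimately show ?thesis using c by auto
          qed
          with run' c DH(1) D mD show ?thesis by (auto simp: rec_ok_def)
        qed
        moreover have md: "m - D = La" "D < m" "F \<le> m" "Rt < m + W + D" "m + W \<le> Rt" "Rt \<le> i"
          using mD D La m Rti by auto
        have "current i m F D m Rt"
          unfolding current_def md(1) using La(1,3) Bm none md(2-) D Rti by auto
        ultimately show ?thesis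
          using gd j0 unfolding s' good_def m_def[symmetric] by (auto simp: j_def defs)
      qed
    qed
  qed
qed

lemma rec_ok_est: "rec_ok F D La Lf Rt c e \<Longrightarrow> e' = e \<or> B c e' \<Longrightarrow> rec_ok F D La Lf Rt c e'"
  by (auto simp: rec_ok_def split: if_splits)

lemma scan_pos_unique:
  assumes "g dvd i" "q \<le> i" "i < q + g" "q mod g = x mod g"
  shows "scan_pos g i x = q"
proof (cases "q = i")
  case True
  with assms show ?thesis by (simp add: scan_pos_def flip: assms(4))
next
  case False
  define r where "r = g - (i - q)"
  have r: "0 < r" "r < g" "q + g = i + r" using assms False by (auto simp: r_def)
  obtain a where a: "i = g * a" using assms(1) by (elim dvdE)
  have "q mod g = (q + g) mod g" by simp
  also have "\<dots> = (g * a + r) mod g" by (simp only: r(3) a)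
  also have "\<dots> = r" using r by simp
  finally have "x mod g = r" using assms(4) by simp
  moreover have "(g - r) mod g = g - r" "i - (g - r) = q" using r assms(2) by auto
  ultimately show ?thesis by (simp only: scan_pos_def)
qed

lemma scan_good:
  assumes "good i k p s" "g dvd i" "i \<le> p + g" "i \<le> n + W"
  shows "good i k i (scan_step g chk i s)"
proof -
  have *: "rec_ok F D La Lf Rt c (scan_est g chk i c e) \<and> scanned c (scan_est g chk i c e) i"
    if rc: "rec_ok F D La Lf Rt c e" and sc: "scanned c e p" for F D La Lf Rt c e
  proof
    define q where "q = scan_pos g i (2 * c)"
    have B: "chk (2 * c - q) q \<longleftrightarrow> B c (q - c)" if "q \<le> 2 * c" "c + e < q"
      using that assms(4) scan_pos_le[of g i "2 * c"] by (intro chk') (auto simp: q_def)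
    have cases: "scan_est g chk i c e = (if q \<le> 2 * c \<and> c + e < q \<and> B c (q - c) then q - c else e)"
      using B by (auto simp: scan_est_def Let_def q_def)
    then show "rec_ok F D La Lf Rt c (scan_est g chk i c e)" by (intro rec_ok_est[OF rc]) auto
    show "scanned c (scan_est g chk i c e) i"
      unfolding scanned_def
    proof (intro allI impI)
      fix l assume l: "l \<le> c" "c + l \<le> i \<and> g dvd c - l \<and> B c l"
      show "l \<le> scan_est g chk i c e"
      proof (cases "c + l \<le> p")
        case True
        with sc l have "l \<le> e" by (auto simp: scanned_def)
        then show ?thesis using cases by auto
      next
        case False
        \<comment> \<open>As \<open>g\<close> divides \<open>c - l\<close>, the right end
          \<open>c + l\<close> is congruent to \<open>2 * c\<close> modulo \<open>g\<close>. At most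
          one such position lies between \<open>p\<close> and \<open>i \<le> p + g\<close>, and it
          is the one that is checked.\<close>
        have "2 * c = (c + l) + (c - l)" using l by simp
        then have "(c + l) mod g = (2 * c) mod g"
          using l by (metis dvd_eq_mod_eq_0 mod_add_right_eq add.right_neutral)
        then have "q = c + l" unfolding q_def
          using l False assms(2,3) by (intro scan_pos_unique) auto
        then show ?thesis using cases l by (cases "l \<le> e") auto
      qed
    qed
  qed
  from assms(1) * show ?thesis
    unfolding good_def scan_step_def using assms(2) by auto
qed

lemma track_good:
  assumes "good (i - 1) (i - 1 - W) (g * ((i - 1) div g)) s" "1 \<le> i" "i \<le> n + W"
  shows "good i (i - W) (g * (i div g)) (track_step W H g chk i s)"
proof -
  define p where "p = g * ((i - 1) div g)"
  have p: "p \<le> i - 1" "i - 1 < p + g"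
    using W(3) times_div_less_eq_dividend[of g "i - 1"] dividend_less_times_div[of g "i - 1"]
    by (simp_all add: p_def)
  define s1 where "s1 = alive_step W H chk i s"
  define s2 where "s2 = centre_step W H g chk i s1"
  have s1: "good i (i - 1 - W) p s1"
    unfolding s1_def
  proof (rule alive_good)
    show "good (i - 1) (i - 1 - W) p s" using assms(1) by (simp only: p_def)
  qed (use assms p in auto)
  have s2: "good i (i - W) p s2"
  proof (cases "W < i")
    case True
    then show ?thesis unfolding s2_def using s1 assms(3) p by (intro centre_good[where k = "i - 1 - W"]) auto
  next
    case False
    then show ?thesis using s1 by (simp add: s2_def centre_step_def)
  qed
  show ?thesis
  proof (cases "g dvd i")
    case True
    then have "g * (i div g) = i" by simp
    moreover have "good i (i - W) i (scan_step g chk i s2)"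
      using s2 True p assms by (intro scan_good[where p = p]) auto
    ultimately show ?thesis by (simp add: track_step_def s1_def s2_def)
  next
    case False
    have "i div g = (i - 1) div g"
    proof -
      have "i = Suc (i - 1)" using assms by simp
      then show ?thesis using False by (metis div_Suc dvd_eq_mod_eq_0 Suc_pred)
    qed
    then have "p = g * (i div g)" by (simp add: p_def)
    with s2 False show ?thesis by (simp add: track_step_def scan_step_def s1_def s2_def)
  qed
qed

lemma good_empty: "empty_tracker s \<Longrightarrow> good 0 0 0 s"
  using zero by (simp add: good_def empty_tracker_def)

text \<open>Among the \<open>g\<close> lengths from \<open>e + 1\<close> to \<open>e + g\<close> one
  has its left end at a multiple of \<open>g\<close>. Had the palindrome length
  \<open>e + g\<close>, the scan would have raised the estimate to that length.\<close>

lemma accurate_scanned: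
  assumes c: "1 \<le> c" "c \<le> n" and B: "B c e" and sc: "scanned c e p" and p: "n \<le> p"
  shows "accurate c e"
  unfolding accurate_def
proof (intro conjI notI B)
  assume b: "B c (e + g)"
  have le: "e + g \<le> c" "c + (e + g) \<le> n" using inside[OF c b] by auto
  define q where "q = (c - e - 1) div g"
  define l where "l = c - g * q"
  have "g * q \<le> c - e - 1" "c - e - 1 < g * q + g"
    using W(3) times_div_less_eq_dividend[of g "c - e - 1"] dividend_less_times_div[of g "c - e - 1"]
    by (simp_all add: q_def)
  then have l: "e < l" "l \<le> e + g" "l \<le> c" "c - l = g * q" using le W(3) by (auto simp: l_def)
  then have "B c l" using B_mono[OF b] by simp
  then have "l \<le> e" using sc l le p unfolding scanned_def by simp
  with l show False by simp
qed

text \<open>Away from the middle the estimates are exact, since the palindrome breaks right behind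
  the nearer end of the window. Only singles and middles rely on the scans.\<close>

lemma good_final:
  assumes gd: "good (n + W) n p s" and p: "n \<le> p" and sh: "shape W H (n + W) n s"
    and j: "1 \<le> j" "j \<le> cnt s" and m: "m \<in> members s j"
  shows "accurate m (final_est s j m)"
proof -
  define F where "F = ffst s j"
  define D where "D = gap s j"
  define La where "La = lst s j"
  define Lf where "Lf = lft s j"
  define Rt where "Rt = rgt s j"
  note defs = F_def D_def La_def Lf_def Rt_def
  have rc: "rec_ok F D La Lf Rt (mid s j) (est s j)" and sc: "scanned (mid s j) (est s j) p"
    using gd j by (auto simp: good_def defs)
  have mm: "F \<le> m" "m \<le> La" "D dvd m - F" using m by (auto simp: members_def defs)
  have mn: "1 \<le> m" "m \<le> n" "1 \<le> La" "La \<le> n" using mm shapeD[OF sh j] W(1) by (auto simp: defs)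
  show ?thesis
  proof (cases "m = mid s j")
    case True
    then have "B m (est s j)" using rc mm by (auto simp: rec_ok_def split: if_splits)
    with sc True mn p show ?thesis by (auto simp: final_est_def intro!: accurate_scanned)
  next
    case False
    have D: "D \<noteq> 0"
    proof
      assume "D = 0"
      with rc mm have "m = mid s j" by (simp add: rec_ok_def)
      with False show False by simp
    qed
    note run = rec_okD(1)[OF rc D]
    have LR: "Lf + W \<le> F" "La + W \<le> Rt" "Lf + Rt \<le> 2 * La"
      using runD[OF run] W(1) by linarith+
    have dead: "\<not> B La (Rt + 1 - La)"
    proof (cases "j = cnt s")
      case True
      with gd j have cur: "current (n + W) n F D La Rt" by (auto simp: good_def defs)
      \<comment> \<open>A window that is still open after the last round would make the palindrome
        around \<open>La\<close> stick out of the string.\<close>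
      have "Rt \<noteq> n + W"
      proof
        assume R: "Rt = n + W"
        have "D dvd La - F" using runD(3)[OF run] mm by (simp add: int_dvd_int_iff flip: of_nat_diff)
        then have "B La (Rt - La)" using LR mm by (intro run_B[OF run]) auto
        then have "La + (Rt - La) \<le> n" using inside mn by blast
        then show False using R LR W(1) by simp
      qed
      with cur D show ?thesis unfolding current_def by (simp only: if_False) blast
    next
      case False
      with gd j have "ended D La Rt" by (auto simp: good_def defs)
      with D show ?thesis unfolding ended_def by blast
    qed
    have dv: "int D dvd int m - int F" using mm by (metis int_dvd_int_iff of_nat_diff)
    \<comment> \<open>A member at equal distance from both ends would be \<open>mid\<close>; for all
      others one end is strictly nearer.\<close>
    have ne: "2 * m \<noteq> Lf + Rt" using False rec_okD(2)[OF rc D] by auto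
    have fe: "final_est s j m = min (m - Lf) (Rt - m)" using False by (simp add: final_est_def defs)
    have "B m (min (m - Lf) (Rt - m))"
      using mm LR by (intro run_B[OF run]) auto
    moreover have "\<not> B m (min (m - Lf) (Rt - m) + 1)"
    proof (cases "m - Lf < Rt - m")
      case True
      have "\<not> pal_at \<tau> (int m) (int m - int Lf + 1)"
        by (rule run_left[OF run]) (use mm dv LR True in auto)
      moreover have "int m - int Lf + 1 = int (min (m - Lf) (Rt - m) + 1)" using True LR mm by auto
      ultimately show ?thesis by (simp only: not_False_eq_True)
    next
      case F: False
      have dead': "\<not> pal_at \<tau> (int La) (int Rt + 1 - int La)"
      proof -
        have "int Rt + 1 - int La = int (Rt + 1 - La)" using LR by auto
        with dead show ?thesis by (simp only: not_False_eq_True)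
      qed
      have "\<not> pal_at \<tau> (int m) (int Rt + 1 - int m)"
        by (rule run_right[OF run _ _ dv _ dead']) (use mm LR F ne in auto)
      moreover have "int Rt + 1 - int m = int (min (m - Lf) (Rt - m) + 1)" using F LR mm by auto
      ultimately show ?thesis by (simp only: not_False_eq_True)
    qed
    then have "\<not> B m (min (m - Lf) (Rt - m) + g)"
      using B_mono[of m "min (m - Lf) (Rt - m) + g" "min (m - Lf) (Rt - m) + 1"] W(3) by auto
    ultimately show ?thesis unfolding fe accurate_def by blast
  qed
qed

end

lemma track_step_0:
  assumes "cnt s = 0"
  shows "track_step W H g chk 0 s = s"
proof -
  have "(\<lambda>j. if 1 \<le> j \<and> j \<le> 0 then x j else est s j) = est s" for x by auto
  with assms show ?thesis
    by (simp add: track_step_def alive_step_def centre_step_def scan_step_def)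
qed

section \<open>Fingerprints\<close>

primrec fwd_hash :: "(nat \<Rightarrow> nat) \<Rightarrow> nat \<Rightarrow> nat \<Rightarrow> nat" where
  "fwd_hash \<sigma> b 0 = 0"
| "fwd_hash \<sigma> b (Suc i) = fwd_hash \<sigma> b i * b + \<sigma> (Suc i)"

primrec rev_hash :: "(nat \<Rightarrow> nat) \<Rightarrow> nat \<Rightarrow> nat \<Rightarrow> nat" where
  "rev_hash \<sigma> b 0 = 0"
| "rev_hash \<sigma> b (Suc i) = rev_hash \<sigma> b i + \<sigma> (Suc i) * b ^ i"

text \<open>Read as numbers in base \<open>b\<close>, the factor \<open>(c, i]\<close> has the
  forward value \<open>fwd_hash i - b ^ (i - c) * fwd_hash c\<close> and the reversed value
  \<open>(rev_hash i - rev_hash c) / b ^ c\<close>. Multiplying by \<open>b ^ c\<close> and moving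
  the negative terms to the other side avoids both an inverse modulo \<open>M\<close> and truncated
  subtraction.\<close>

definition hash_check :: "(nat \<Rightarrow> nat) \<Rightarrow> nat \<Rightarrow> nat \<Rightarrow> nat \<Rightarrow> nat \<Rightarrow> bool" where
  "hash_check \<sigma> b M c i \<longleftrightarrow>
     (rev_hash \<sigma> b i + b ^ i * fwd_hash \<sigma> b c) mod M = (rev_hash \<sigma> b c + b ^ c * fwd_hash \<sigma> b i) mod M"

definition hash_diff :: "(nat \<Rightarrow> nat) \<Rightarrow> nat \<Rightarrow> nat \<Rightarrow> nat \<Rightarrow> int" where
  "hash_diff \<sigma> b c i = int (rev_hash \<sigma> b i + b ^ i * fwd_hash \<sigma> b c) - int (rev_hash \<sigma> b c + b ^ c * fwd_hash \<sigma> b i)"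

lemma hash_check_iff: "hash_check \<sigma> b M c i \<longleftrightarrow> int M dvd hash_diff \<sigma> b c i"
  unfolding hash_check_def hash_diff_def by (metis mod_eq_dvd_iff of_nat_eq_iff of_nat_mod)

lemma fwd_hash_add: "fwd_hash \<sigma> b (c + l) = b ^ l * fwd_hash \<sigma> b c + (\<Sum>k<l. \<sigma> (c + l - k) * b ^ k)"
proof (induction l)
  case (Suc l)
  have "(\<Sum>k<Suc l. \<sigma> (c + Suc l - k) * b ^ k) = \<sigma> (c + Suc l) + (\<Sum>k<l. \<sigma> (c + l - k) * (b * b ^ k))"
    by (subst sum.lessThan_Suc_shift) simp
  also have "(\<Sum>k<l. \<sigma> (c + l - k) * (b * b ^ k)) = b * (\<Sum>k<l. \<sigma> (c + l - k) * b ^ k)"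
    by (simp add: sum_distrib_left mult.left_commute)
  finally show ?case using Suc by (simp add: algebra_simps)
qed simp

lemma rev_hash_add: "rev_hash \<sigma> b (c + l) = rev_hash \<sigma> b c + b ^ c * (\<Sum>k<l. \<sigma> (c + 1 + k) * b ^ k)"
  by (induction l) (simp_all add: algebra_simps power_add)

lemma hash_diff_eq:
  "hash_diff \<sigma> b c (c + l) = int b ^ c * (\<Sum>k<l. (int (\<sigma> (c + 1 + k)) - int (\<sigma> (c + l - k))) * int b ^ k)"
  unfolding hash_diff_def fwd_hash_add rev_hash_add
  by (simp add: algebra_simps power_add sum_subtractf)

text \<open>The lowest digit is a multiple of \<open>b\<close> and smaller than \<open>b\<close> in
  absolute value, hence 0; then a factor \<open>b\<close> can be cancelled.\<close>

lemma digits_zero: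
  fixes d :: "nat \<Rightarrow> int"
  assumes "\<And>k. k < l \<Longrightarrow> \<bar>d k\<bar> < b" "(\<Sum>k<l. d k * b ^ k) = 0" "k < l"
  shows "d k = 0"
  using assms
proof (induction l arbitrary: d k)
  case (Suc l)
  have "b > 0" using Suc.prems(1)[of 0] by simp
  have "(\<Sum>k<Suc l. d k * b ^ k) = d 0 + b * (\<Sum>k<l. d (Suc k) * b ^ k)"
    by (subst sum.lessThan_Suc_shift) (simp add: sum_distrib_left mult.left_commute)
  with Suc.prems(2) have eq: "d 0 = - b * (\<Sum>k<l. d (Suc k) * b ^ k)" by simp
  then have "b dvd d 0" by simp
  then have d0: "d 0 = 0" using Suc.prems(1)[of 0] by (meson dvd_imp_le_int not_less zero_less_Suc abs_of_pos \<open>b > 0\<close> order.strict_trans2 abs_ge_self)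
  then have s: "(\<Sum>k<l. d (Suc k) * b ^ k) = 0" using eq \<open>b > 0\<close> by simp
  show ?case
  proof (cases k)
    case 0
    with d0 show ?thesis by simp
  next
    case (Suc k')
    with Suc.prems show ?thesis using Suc.IH[of "\<lambda>k. d (Suc k)" k'] s by simp
  qed
qed simp

lemma digits_bound:
  fixes d :: "nat \<Rightarrow> int"
  assumes "\<And>k. k < l \<Longrightarrow> \<bar>d k\<bar> < b"
  shows "\<bar>\<Sum>k<l. d k * b ^ k\<bar> < b ^ l"
  using assms
proof (induction l)
  case (Suc l)
  then have dl: "\<bar>d l\<bar> \<le> b - 1" "b > 0" by force+
  have "\<bar>\<Sum>k<Suc l. d k * b ^ k\<bar> \<le> \<bar>\<Sum>k<l. d k * b ^ k\<bar> + \<bar>d l\<bar> * b ^ l"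
    using abs_triangle_ineq[of "\<Sum>k<l. d k * b ^ k" "d l * b ^ l"] dl(2) by (simp add: abs_mult)
  also have "\<dots> < b ^ l + \<bar>d l\<bar> * b ^ l" using Suc by simp
  also have "\<dots> \<le> b ^ l + (b - 1) * b ^ l" using dl by (intro add_left_mono mult_right_mono) auto
  also have "\<dots> = b ^ Suc l" by (simp add: algebra_simps)
  finally show ?case .
qed simp

lemma hash_diff_zero_iff:
  assumes "\<And>x. \<sigma> x < b"
  shows "hash_diff \<sigma> b c (c + l) = 0 \<longleftrightarrow> (\<forall>k<l. \<sigma> (c + 1 + k) = \<sigma> (c + l - k))"
proof
  let ?d = "\<lambda>k. int (\<sigma> (c + 1 + k)) - int (\<sigma> (c + l - k))"
  have "b > 0" using assms[of 0] by simp
  assume "hash_diff \<sigma> b c (c + l) = 0"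
  with \<open>b > 0\<close> have s: "(\<Sum>k<l. ?d k * int b ^ k) = 0" by (simp add: hash_diff_eq)
  have "\<bar>?d k\<bar> < int b" for k using assms[of "c + 1 + k"] assms[of "c + l - k"] by linarith
  then have "?d k = 0" if "k < l" for k using digits_zero[of l ?d "int b" k] s that by blast
  then show "\<forall>k<l. \<sigma> (c + 1 + k) = \<sigma> (c + l - k)" by simp
qed (simp add: hash_diff_eq)

lemma hash_diff_bound:
  assumes "\<And>x. \<sigma> x < b"
  shows "\<bar>hash_diff \<sigma> b c (c + l)\<bar> < int b ^ (c + l)"
proof -
  let ?d = "\<lambda>k. int (\<sigma> (c + 1 + k)) - int (\<sigma> (c + l - k))"
  have "b > 0" using assms[of 0] by simp
  have "\<bar>?d k\<bar> < int b" for k using assms[of "c + 1 + k"] assms[of "c + l - k"] by linarith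
  then have "\<bar>\<Sum>k<l. ?d k * int b ^ k\<bar> < int b ^ l" by (intro digits_bound)
  then show ?thesis using \<open>b > 0\<close> by (simp add: hash_diff_eq abs_mult power_add)
qed

text \<open>The string is padded on the right by the letter 1, which is smaller than the code of any letter
  of the string, and on the left by 0. So no palindrome centred in the string sticks out of it.\<close>

definition code :: "nat list \<Rightarrow> nat \<Rightarrow> nat" where
  "code S x = (if 1 \<le> x \<and> x \<le> length S then S ! (x - 1) + 2 else 1)"

definition padded :: "nat list \<Rightarrow> int \<Rightarrow> nat" where
  "padded S u = (if u < 1 then 0 else code S (nat u))"

section \<open>Palindromes of the string and of its padding\<close>

lemma padded_pos: "1 \<le> x \<Longrightarrow> padded S (int x) = code S x"
  by (simp add: padded_def)

lemma code_ge: "1 \<le> code S x"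
  by (simp add: code_def)

lemma pal_at_padded_iff:
  assumes "l \<le> m"
  shows "pal_at (padded S) (int m) (int l) \<longleftrightarrow> (\<forall>t\<in>{1..l}. code S (m + 1 - t) = code S (m + t))"
proof -
  have eq: "padded S (int m + 1 - int t) = code S (m + 1 - t)" "padded S (int m + int t) = code S (m + t)"
    if "1 \<le> t" "t \<le> l" for t
  proof -
    have e: "int m + 1 - int t = int (m + 1 - t)" "int m + int t = int (m + t)" using that assms by auto
    show "padded S (int m + 1 - int t) = code S (m + 1 - t)"
      unfolding e(1) by (rule padded_pos) (use that assms in simp)
    show "padded S (int m + int t) = code S (m + t)"
      unfolding e(2) by (rule padded_pos) (use that in simp)
  qed
  show ?thesis
  proof
    assume p: "pal_at (padded S) (int m) (int l)"
    show "\<forall>t\<in>{1..l}. code S (m + 1 - t) = code S (m + t)"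
    proof
      fix t assume "t \<in> {1..l}"
      then have t: "1 \<le> t" "t \<le> l" by auto
      have "padded S (int m + 1 - int t) = padded S (int m + int t)"
        by (rule pal_atD[OF p, of "int t"]) (use t in auto)
      then show "code S (m + 1 - t) = code S (m + t)" by (simp only: eq[OF t])
    qed
  next
    assume c: "\<forall>t\<in>{1..l}. code S (m + 1 - t) = code S (m + t)"
    show "pal_at (padded S) (int m) (int l)"
      unfolding pal_at_def
    proof (intro allI impI)
      fix t assume t: "1 \<le> t \<and> t \<le> int l"
      define u where "u = nat t"
      have u: "t = int u" "1 \<le> u" "u \<le> l" using t by (auto simp: u_def)
      have "code S (m + 1 - u) = code S (m + u)" using c u by auto
      then show "padded S (int m + 1 - t) = padded S (int m + t)" unfolding u(1) by (simp only: eq[OF u(2,3)])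
    qed
  qed
qed

lemma pal_at_padded_inside:
  assumes "1 \<le> m" "m \<le> length S" and p: "pal_at (padded S) (int m) (int l)"
  shows "l \<le> m \<and> m + l \<le> length S"
proof (rule ccontr)
  assume "\<not> ?thesis"
  \<comment> \<open>The border nearer to \<open>m\<close> decides: the palindrome meets position 0
    or position \<open>length S + 1\<close> first, and the padding letter there has no equal
    partner.\<close>
  then consider "m < l" "2 * m < length S" | "length S < m + l" "length S \<le> 2 * m" by linarith
  then show False
  proof cases
    case 1
    have "padded S 0 = padded S (int (2 * m + 1))"
      by (rule pal_atD[OF p, of "int (m + 1)"]) (use 1 in auto)
    also have "\<dots> = code S (2 * m + 1)" by (rule padded_pos) simp
    finally show False using code_ge[of S "2 * m + 1"] by (simp add: padded_def)
  next
    case 2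
    have "padded S (2 * int m - int (length S)) = padded S (int (length S + 1))"
      by (rule pal_atD[OF p, of "int (length S + 1 - m)"]) (use 2 assms in auto)
    also have "\<dots> = code S (length S + 1)" by (rule padded_pos) simp
    also have "\<dots> = 1" by (simp add: code_def)
    finally have "padded S (2 * int m - int (length S)) = 1" .
    moreover have "2 * int m - int (length S) < 1 \<or>
        1 \<le> nat (2 * int m - int (length S)) \<and> nat (2 * int m - int (length S)) \<le> length S"
      using assms by linarith
    moreover have "code S x \<noteq> 1" if "1 \<le> x" "x \<le> length S" for x using that by (simp add: code_def)
    ultimately show False unfolding padded_def by (metis zero_neq_one)
  qed
qed

lemma contains_palindrome_iff:
  assumes m: "1 \<le> m" "m \<le> length S"
  shows "contains_palindrome S m l \<longleftrightarrow> pal_at (padded S) (int m) (int l)"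
proof -
  have eq: "letter S (m - t + 1) = letter S (m + t) \<longleftrightarrow> code S (m + 1 - t) = code S (m + t)"
    if "1 \<le> t" "t \<le> m" "m + t \<le> length S" for t
  proof -
    have "m - t + 1 = m + 1 - t" using that by simp
    with that show ?thesis by (simp add: letter_def code_def)
  qed
  show ?thesis
  proof
    assume c: "contains_palindrome S m l"
    have l: "l \<le> m"
    proof (cases "l = 0")
      case False
      with c show ?thesis unfolding contains_palindrome_def by (meson atLeastAtMost_iff le_refl less_one not_le)
    qed simp
    show "pal_at (padded S) (int m) (int l)"
      unfolding pal_at_padded_iff[OF l]
    proof
      fix t assume t: "t \<in> {1..l}"
      with c have "t \<le> m \<and> m + t \<le> length S \<and> letter S (m - t + 1) = letter S (m + t)"
        unfolding contains_palindrome_def by blast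
      with eq[of t] t show "code S (m + 1 - t) = code S (m + t)" by simp
    qed
  next
    assume p: "pal_at (padded S) (int m) (int l)"
    from pal_at_padded_inside[OF m p] have l: "l \<le> m" "m + l \<le> length S" by auto
    from p have p': "\<forall>t\<in>{1..l}. code S (m + 1 - t) = code S (m + t)" unfolding pal_at_padded_iff[OF l(1)] .
    show "contains_palindrome S m l"
      unfolding contains_palindrome_def
    proof
      fix t assume t: "t \<in> {1..l}"
      with p' eq[of t] l show "t \<le> m \<and> m + t \<le> length S \<and> letter S (m - t + 1) = letter S (m + t)"
        by simp
    qed
  qed
qed

lemma pal_length_bounds:
  assumes m: "1 \<le> m" "m \<le> length S"
    and "pal_at (padded S) (int m) (int e)" "\<not> pal_at (padded S) (int m) (int (e + g))"
  shows "e \<le> pal_length S m" "pal_length S m < e + g"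
proof -
  have c: "contains_palindrome S m e" "\<not> contains_palindrome S m (e + g)"
    using assms by (simp_all only: contains_palindrome_iff not_False_eq_True)
  have bd: "contains_palindrome S m l \<Longrightarrow> l \<le> m" for l
    using pal_at_padded_inside[OF m] by (simp only: contains_palindrome_iff[OF m])
  show "e \<le> pal_length S m"
    unfolding pal_length_def using c(1) bd by (rule Greatest_le_nat)
  have "contains_palindrome S m (pal_length S m)"
    unfolding pal_length_def using c(1) bd by (rule GreatestI_nat)
  with c(2) show "pal_length S m < e + g"
    unfolding contains_palindrome_def by (metis atLeastAtMost_iff le_trans not_le)
qed

lemma hash_diff_zero_iff_pal:
  assumes "\<And>x. code S x < b" "l \<le> m"
  shows "hash_diff (code S) b (m - l) (m + l) = 0 \<longleftrightarrow> pal_at (padded S) (int m) (int l)"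
proof -
  have e: "m + l = (m - l) + 2 * l" using assms(2) by simp
  have "hash_diff (code S) b (m - l) (m + l) = 0 \<longleftrightarrow>
      (\<forall>k<2 * l. code S (m - l + 1 + k) = code S (m + l - k))"
    using hash_diff_zero_iff[of "code S" b "m - l" "2 * l", OF assms(1)] by (simp only: e[symmetric])
  also have "\<dots> \<longleftrightarrow> (\<forall>t\<in>{1..l}. code S (m + 1 - t) = code S (m + t))"
  proof
    assume a: "\<forall>k<2 * l. code S (m - l + 1 + k) = code S (m + l - k)"
    show "\<forall>t\<in>{1..l}. code S (m + 1 - t) = code S (m + t)"
    proof
      fix t assume t: "t \<in> {1..l}"
      have "m - l + 1 + (l - t) = m + 1 - t" "m + l - (l - t) = m + t" using t assms(2) by auto
      moreover have "l - t < 2 * l" using t by auto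
      ultimately show "code S (m + 1 - t) = code S (m + t)" using a by metis
    qed
  next
    assume a: "\<forall>t\<in>{1..l}. code S (m + 1 - t) = code S (m + t)"
    show "\<forall>k<2 * l. code S (m - l + 1 + k) = code S (m + l - k)"
    proof (intro allI impI)
      fix k assume k: "k < 2 * l"
      show "code S (m - l + 1 + k) = code S (m + l - k)"
      proof (cases "k < l")
        case True
        then have "m - l + 1 + k = m + 1 - (l - k)" "m + l - k = m + (l - k)" "l - k \<in> {1..l}"
          using assms(2) by auto
        with a show ?thesis by metis
      next
        case False
        then have "m - l + 1 + k = m + (k + 1 - l)" "m + l - k = m + 1 - (k + 1 - l)" "k + 1 - l \<in> {1..l}"
          using assms(2) k by auto
        with a show ?thesis by metis
      qed
    qed
  qed
  finally show ?thesis by (simp only: pal_at_padded_iff[OF assms(2)])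
qed

definition good_modulus :: "nat list \<Rightarrow> nat \<Rightarrow> nat \<Rightarrow> nat \<Rightarrow> bool" where
  "good_modulus S b N M \<longleftrightarrow> (\<forall>m l. l \<le> m \<and> m + l \<le> N \<longrightarrow>
     int M dvd hash_diff (code S) b (m - l) (m + l) \<longrightarrow> hash_diff (code S) b (m - l) (m + l) = 0)"

lemma faithful_hash_check:
  assumes "1 \<le> W" "2 * H \<le> W" "1 \<le> g" "g \<le> W" "\<And>x. code S x < b"
    "good_modulus S b (length S + W) M"
  shows "faithful (padded S) (length S) W H g (hash_check (code S) b M)"
proof
  show "\<not> pal_at (padded S) 0 (int W)"
  proof
    assume p: "pal_at (padded S) 0 (int W)"
    have "padded S 0 = padded S (int 1)" by (rule pal_atD[OF p, of 1]) (use assms(1) in auto)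
    also have "\<dots> = code S 1" by (rule padded_pos) simp
    finally show False using code_ge[of S 1] by (simp add: padded_def)
  qed
next
  fix m l assume ml: "1 \<le> m" "l \<le> m" "m + l \<le> length S + W"
  have "hash_check (code S) b M (m - l) (m + l) \<longleftrightarrow> hash_diff (code S) b (m - l) (m + l) = 0"
    using assms(6) ml unfolding hash_check_iff good_modulus_def by auto
  then show "hash_check (code S) b M (m - l) (m + l) \<longleftrightarrow> pal_at (padded S) (int m) (int l)"
    using hash_diff_zero_iff_pal[of S b l m, OF assms(5) ml(2)] by simp
qed (use assms pal_at_padded_inside in \<open>auto\<close>)

text \<open>A union bound over all pairs of centre and length. Each difference is below
  \<open>b ^ N = 2 ^ (\<beta> * N)\<close> in absolute value, hence has at most
  \<open>\<beta> * N\<close> prime divisors.\<close>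

lemma prob_bad_modulus:
  assumes R: "0 < R" "R \<le> 2 * h * card {p. prime p \<and> p < R}" and h: "0 < h"
    and b: "b = 2 ^ \<beta>" "\<And>x. code S x < b"
    and \<rho>: "(1 - 1 / (2 * real h)) ^ T + real T * (real (\<beta> * N) / real R) \<le> \<rho>"
  shows "measure_pmf.prob (replicate_pmf (r * T) (pmf_of_set {..<R})) {\<omega>. \<not> good_modulus S b N (modulus T r \<omega>)}
    \<le> (real N + 1)\<^sup>2 * \<rho> ^ r"
proof -
  let ?p = "replicate_pmf (r * T) (pmf_of_set {..<R})"
  let ?I = "{(m, l). l \<le> m \<and> m + l \<le> N \<and> hash_diff (code S) b (m - l) (m + l) \<noteq> 0}"
  let ?E = "\<lambda>(m, l). {\<omega>. int (modulus T r \<omega>) dvd hash_diff (code S) b (m - l) (m + l)}"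
  have sub: "?I \<subseteq> {..N} \<times> {..N}" by auto
  then have fin: "finite ?I" by (rule finite_subset) auto
  have card: "card ?I \<le> (N + 1) * (N + 1)" using card_mono[OF _ sub] by (simp add: card_cartesian_product)
  have each: "measure_pmf.prob ?p (?E x) \<le> \<rho> ^ r" if "x \<in> ?I" for x
  proof -
    obtain m l where x: "x = (m, l)" by (cases x)
    let ?D = "hash_diff (code S) b (m - l) (m + l)"
    have ml: "l \<le> m" "m + l \<le> N" "?D \<noteq> 0" using that x by auto
    have "\<bar>?D\<bar> < int b ^ (m + l)"
      using hash_diff_bound[of "code S" b "m - l" "2 * l", OF b(2)] ml(1) by (simp add: add.commute)
    also have "\<dots> \<le> int b ^ N" using b(1) ml(2) by (intro power_increasing) auto
    also have "\<dots> = 2 ^ (\<beta> * N)" by (simp add: b(1) power_mult)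
    finally have D: "\<bar>?D\<bar> < 2 ^ (\<beta> * N)" .
    have "measure_pmf.prob ?p {\<omega>. int (modulus T r \<omega>) dvd ?D} \<le> \<rho> ^ r"
      by (rule prob_modulus_dvd) (rule order_trans[OF prob_last_prime_dvd[OF R h ml(3) D] \<rho>])
    then show ?thesis by (simp add: x)
  qed
  have "{\<omega>. \<not> good_modulus S b N (modulus T r \<omega>)} \<subseteq> (\<Union>x\<in>?I. ?E x)"
    by (auto simp: good_modulus_def)
  then have "measure_pmf.prob ?p {\<omega>. \<not> good_modulus S b N (modulus T r \<omega>)} \<le> measure_pmf.prob ?p (\<Union>x\<in>?I. ?E x)"
    by (intro measure_pmf.finite_measure_mono) auto
  also have "\<dots> \<le> (\<Sum>x\<in>?I. measure_pmf.prob ?p (?E x))"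
    using fin by (intro measure_pmf.finite_measure_subadditive_finite) auto
  also have "\<dots> \<le> (\<Sum>x\<in>?I. \<rho> ^ r)" by (intro sum_mono each)
  also have "\<dots> = real (card ?I) * \<rho> ^ r" by simp
  also have "\<dots> \<le> real ((N + 1) * (N + 1)) * \<rho> ^ r"
  proof (intro mult_right_mono)
    have "0 \<le> (1 - 1 / (2 * real h)) ^ T + real T * (real (\<beta> * N) / real R)"
      using h by (intro add_nonneg_nonneg zero_le_power mult_nonneg_nonneg) (auto simp: field_simps)
    then show "0 \<le> \<rho> ^ r" using \<rho> by (intro zero_le_power) linarith
  qed (use card of_nat_le_iff in blast)
  also have "real ((N + 1) * (N + 1)) = (real N + 1)\<^sup>2" by (simp add: power2_eq_square algebra_simps)
  finally show ?thesis .
qed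

section \<open>The program\<close>

abbreviation plus_e (infixl "+\<^sub>e" 65) where "a +\<^sub>e b \<equiv> Op Add a b"
abbreviation minus_e (infixl "-\<^sub>e" 65) where "a -\<^sub>e b \<equiv> Op Sub a b"
abbreviation times_e (infixl "*\<^sub>e" 70) where "a *\<^sub>e b \<equiv> Op Mult a b"
abbreviation div_e (infixl "div\<^sub>e" 70) where "a div\<^sub>e b \<equiv> Op Div a b"
abbreviation mod_e (infixl "mod\<^sub>e" 70) where "a mod\<^sub>e b \<equiv> Op Mod a b"

text \<open>Truncated subtraction serves as comparison; any nonzero value counts as true.\<close>

definition less_e (infix "<\<^sub>e" 50) where "(a <\<^sub>e b) = b -\<^sub>e a"
definition le_e (infix "\<le>\<^sub>e" 50) where "(a \<le>\<^sub>e b) = b +\<^sub>e Num 1 -\<^sub>e a"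
text \<open>The double subtraction from 1 normalises a truth value to 0 or 1, so the product cannot
  overflow. Both operands are always evaluated, so a conjunct does not guard the safety of another
  one.\<close>

definition and_e (infixr "\<and>\<^sub>e" 35) where
  "(a \<and>\<^sub>e b) = (Num 1 -\<^sub>e (Num 1 -\<^sub>e a)) *\<^sub>e (Num 1 -\<^sub>e (Num 1 -\<^sub>e b))"
definition eq_e (infix "=\<^sub>e" 50) where "(a =\<^sub>e b) = (a \<le>\<^sub>e b \<and>\<^sub>e b \<le>\<^sub>e a)"

lemma val_less_e [simp]: "val (a <\<^sub>e b) s = 0 \<longleftrightarrow> \<not> val a s < val b s"
  by (auto simp: less_e_def)

lemma val_le_e [simp]: "val (a \<le>\<^sub>e b) s = 0 \<longleftrightarrow> \<not> val a s \<le> val b s"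
  by (auto simp: le_e_def)

lemma val_and_e [simp]: "val (a \<and>\<^sub>e b) s = 0 \<longleftrightarrow> val a s = 0 \<or> val b s = 0"
  by (auto simp: and_e_def)

lemma val_eq_e [simp]: "val (a =\<^sub>e b) s = 0 \<longleftrightarrow> val a s \<noteq> val b s"
  by (auto simp: eq_e_def)

lemma safe_less_e [simp]: "safe w X (a <\<^sub>e b) s \<longleftrightarrow> safe w X a s \<and> safe w X b s"
  by (auto simp: less_e_def)

lemma safe_le_e [simp]:
  "safe w X (a \<le>\<^sub>e b) s \<longleftrightarrow> safe w X a s \<and> safe w X b s \<and> val b s + 1 < 2 ^ w"
  by (auto simp: le_e_def)

lemma safe_and_e [simp]:
  assumes "1 \<le> w"
  shows "safe w X (a \<and>\<^sub>e b) s \<longleftrightarrow> safe w X a s \<and> safe w X b s"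
proof -
  have "(1::nat) < 2 ^ w" using assms by (intro one_less_power) auto
  moreover have "(1 - (1 - val a s)) * (1 - (1 - val b s)) \<le> 1 * 1" by (intro mult_le_mono) auto
  ultimately show ?thesis by (auto simp: and_e_def)
qed

lemma safe_eq_e [simp]:
  "1 \<le> w \<Longrightarrow> safe w X (a =\<^sub>e b) s \<longleftrightarrow>
    safe w X a s \<and> safe w X b s \<and> val a s + 1 < 2 ^ w \<and> val b s + 1 < 2 ^ w"
  by (auto simp: eq_e_def)

text \<open>Variables: 0 is \<open>n\<close>, 1 is \<open>\<lfloor>\<epsilon> n\<rfloor>\<close>, 2 is \<open>W\<close>, 3 is \<open>g\<close>, 4 is \<open>H\<close>, 5 is the size \<open>3 W + 1\<close> of the
  sliding window, 6 is the base \<open>b\<close>, 11 is the modulus \<open>M\<close>, 17 is the position \<open>i\<close>, 18 is the number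
  \<open>n + W + 1\<close> of rounds, 19, 20 and 21 are the fingerprints of the prefix of length \<open>i\<close>, and 22 counts
  the records. Arrays 0, 1 and 2 are the sliding window of fingerprints, 3, 4 and 5 are the
  fingerprints at the multiples of \<open>g\<close>, and 6 to 12 are the fields of the records.\<close>

definition check_e :: "nat \<Rightarrow> expr \<Rightarrow> expr \<Rightarrow> expr" where
  "check_e f a b =
    ((Arr 1 b +\<^sub>e Arr 2 b *\<^sub>e Arr f a) mod\<^sub>e Var 11 =\<^sub>e (Arr (Suc f) a +\<^sub>e Arr (Suc (Suc f)) a *\<^sub>e Arr 0 b) mod\<^sub>e Var 11)"

definition win_check :: "expr \<Rightarrow> expr \<Rightarrow> expr" where
  "win_check a b = check_e 0 (a mod\<^sub>e Var 5) (b mod\<^sub>e Var 5)"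

text \<open>The index of \<open>a\<close> is not reduced modulo \<open>Var 5\<close> and may be too
  large for an arbitrary \<open>a\<close>. Therefore \<open>scan_body\<close> evaluates this check
  inside a nested conditional.\<close>

definition point_check :: "expr \<Rightarrow> expr \<Rightarrow> expr" where
  "point_check a b = check_e 3 (a div\<^sub>e Var 3) (b mod\<^sub>e Var 5)"

abbreviation rec_e :: "nat \<Rightarrow> expr" where
  "rec_e f \<equiv> Arr f (Var 22)"

definition store_c :: com where
  "store_c = AAssign 0 (Var 17 mod\<^sub>e Var 5) (Var 19) ;; AAssign 1 (Var 17 mod\<^sub>e Var 5) (Var 20) ;;
    AAssign 2 (Var 17 mod\<^sub>e Var 5) (Var 21) ;;
    Cond (Var 17 mod\<^sub>e Var 3) Skip
      (AAssign 3 (Var 17 div\<^sub>e Var 3) (Var 19) ;; AAssign 4 (Var 17 div\<^sub>e Var 3) (Var 20) ;;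
       AAssign 5 (Var 17 div\<^sub>e Var 3) (Var 21))"

definition alive_c :: com where
  "alive_c = Cond (Var 22)
    (Cond (rec_e 10 +\<^sub>e Num 1 =\<^sub>e Var 17 \<and>\<^sub>e Var 17 \<le>\<^sub>e rec_e 8 +\<^sub>e Var 2 +\<^sub>e Var 4 \<and>\<^sub>e
       Var 17 \<le>\<^sub>e Num 2 *\<^sub>e rec_e 8 \<and>\<^sub>e win_check (Num 2 *\<^sub>e rec_e 8 -\<^sub>e Var 17) (Var 17))
      (AAssign 10 (Var 22) (Var 17) ;;
       Cond (rec_e 7)
        (AAssign 11 (Var 22) ((rec_e 9 +\<^sub>e Var 17 +\<^sub>e Num 1) div\<^sub>e Num 2) ;;
         AAssign 12 (Var 22) (Var 17 -\<^sub>e rec_e 11)) Skip) Skip) Skip"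

definition new_c :: com where
  "new_c = Assign 22 (Var 22 +\<^sub>e Num 1) ;; AAssign 6 (Var 22) (Var 25) ;; AAssign 7 (Var 22) (Num 0) ;;
    AAssign 8 (Var 22) (Var 25) ;; AAssign 9 (Var 22) (Num 0) ;; AAssign 10 (Var 22) (Var 17) ;;
    AAssign 11 (Var 22) (Var 25) ;; AAssign 12 (Var 22) (Var 2)"

definition old_c :: com where
  "old_c = Cond (rec_e 7)
    (Cond (Var 25 =\<^sub>e rec_e 8 +\<^sub>e rec_e 7) (AAssign 8 (Var 22) (Var 25)) (Output (Var 25) (Var 2)))
    (AAssign 9 (Var 22) (Num 2 *\<^sub>e rec_e 8 -\<^sub>e rec_e 10) ;; AAssign 7 (Var 22) (Var 25 -\<^sub>e rec_e 8) ;;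
     AAssign 8 (Var 22) (Var 25) ;; AAssign 10 (Var 22) (Var 17) ;;
     AAssign 11 (Var 22) ((rec_e 9 +\<^sub>e Var 17 +\<^sub>e Num 1) div\<^sub>e Num 2) ;;
     AAssign 12 (Var 22) (Var 17 -\<^sub>e rec_e 11))"

definition long_c :: com where
  "long_c = Cond (Var 22) (Cond (Var 25 \<le>\<^sub>e rec_e 8 +\<^sub>e Var 4) old_c new_c) new_c"

definition short_cond :: expr where
  "short_cond = (Var 23 +\<^sub>e Var 3 \<le>\<^sub>e Var 25 \<and>\<^sub>e Var 23 +\<^sub>e Var 3 \<le>\<^sub>e Var 2 \<and>\<^sub>e
    win_check (Var 25 -\<^sub>e (Var 23 +\<^sub>e Var 3)) (Var 25 +\<^sub>e (Var 23 +\<^sub>e Var 3)))"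

definition short_c :: com where
  "short_c = Assign 23 (Num 0) ;; While short_cond (Assign 23 (Var 23 +\<^sub>e Var 3)) ;;
    Output (Var 25) (Var 23)"

definition centre_c :: com where
  "centre_c = Cond (Var 2 <\<^sub>e Var 17)
    (Assign 25 (Var 17 -\<^sub>e Var 2) ;;
     Cond (Var 2 \<le>\<^sub>e Var 25 \<and>\<^sub>e win_check (Var 25 -\<^sub>e Var 2) (Var 17)) long_c short_c) Skip"

definition scan_body :: com where
  "scan_body = Assign 27 (Var 17 -\<^sub>e (Var 3 -\<^sub>e (Num 2 *\<^sub>e Arr 11 (Var 24)) mod\<^sub>e Var 3) mod\<^sub>e Var 3) ;;
    Cond (Var 27 \<le>\<^sub>e Num 2 *\<^sub>e Arr 11 (Var 24) \<and>\<^sub>e Arr 11 (Var 24) +\<^sub>e Arr 12 (Var 24) <\<^sub>e Var 27)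
     (Cond (point_check (Num 2 *\<^sub>e Arr 11 (Var 24) -\<^sub>e Var 27) (Var 27))
       (AAssign 12 (Var 24) (Var 27 -\<^sub>e Arr 11 (Var 24))) Skip) Skip ;;
    Assign 24 (Var 24 -\<^sub>e Num 1)"

definition scan_c :: com where
  "scan_c = Cond (Var 17 mod\<^sub>e Var 3) Skip (Assign 24 (Var 22) ;; While (Var 24) scan_body)"

text \<open>The reversed fingerprint in variable 20 needs the old power of the base, so variable 21
  is updated after it.\<close>

definition update_c :: com where
  "update_c = Assign 20 ((Var 20 +\<^sub>e Var 26 *\<^sub>e Var 21) mod\<^sub>e Var 11) ;;
    Assign 19 ((Var 19 *\<^sub>e Var 6 +\<^sub>e Var 26) mod\<^sub>e Var 11) ;;
    Assign 21 ((Var 21 *\<^sub>e Var 6) mod\<^sub>e Var 11) ;; Assign 17 (Var 17 +\<^sub>e Num 1)"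

definition read_c :: com where
  "read_c = Cond (Var 17 <\<^sub>e Var 0) (GetLetter 26 ;; Assign 26 (Var 26 +\<^sub>e Num 2)) (Assign 26 (Num 1)) ;;
    update_c"

definition round_c :: com where
  "round_c = store_c ;; alive_c ;; centre_c ;; scan_c ;; read_c"

section \<open>The program simulates the tracker, one round at a time\<close>

definition view :: "state \<Rightarrow> tracker" where
  "view s = \<lparr>cnt = vars s 22, ffst = arr s 6, gap = arr s 7, lst = arr s 8, lft = arr s 9,
    rgt = arr s 10, mid = arr s 11, est = arr s 12, rep = outp s\<rparr>"

lemma view_simps [simp]:
  "cnt (view s) = vars s 22" "ffst (view s) = arr s 6" "gap (view s) = arr s 7" "lst (view s) = arr s 8"
  "lft (view s) = arr s 9" "rgt (view s) = arr s 10" "mid (view s) = arr s 11" "est (view s) = arr s 12"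
  "rep (view s) = outp s"
  by (simp_all add: view_def)

lemma terminates_Cond:
  assumes "safe w X e s" "val e s \<noteq> 0 \<Longrightarrow> terminates w X R c1 s T Q"
    "val e s = 0 \<Longrightarrow> terminates w X R c2 s T Q"
  shows "terminates w X R (Cond e c1 c2) s (T + expr_time e + 2) Q"
proof (cases "val e s = 0")
  case True
  with assms(3) obtain t s' where "t \<le> T" "big w X R c2 s t s'" "Q s'" by (auto simp: terminates_def)
  with big.CondF[OF assms(1) True this(2)] show ?thesis
    unfolding terminates_def by (intro exI[of _ "expr_time e + 1 + t"] conjI exI[of _ s']) auto
next
  case False
  with assms(2) obtain t s' where "t \<le> T" "big w X R c1 s t s'" "Q s'" by (auto simp: terminates_def)
  with big.CondT[OF assms(1) False this(2)] show ?thesis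
    unfolding terminates_def by (intro exI[of _ "expr_time e + 1 + t + 1"] conjI exI[of _ s']) auto
qed

lemma terminates_While_wp:
  fixes k :: nat
  assumes "I k s" "\<And>k s. I k s \<Longrightarrow> safe w X e s"
    and "\<And>k s. I k s \<Longrightarrow> val e s \<noteq> 0 \<Longrightarrow> k > 0 \<and> wp w X R c (I (k - 1)) s"
    and "\<And>k s. I k s \<Longrightarrow> val e s = 0 \<Longrightarrow> Q s"
  shows "terminates w X R (While e c) s ((k + 1) * com_size (While e c)) Q"
proof -
  have "terminates w X R (While e c) s ((\<Sum>j=1..k. com_size c + (expr_time e + 2)) + expr_time e + 1)
    (\<lambda>s'. (\<exists>k'. I k' s') \<and> val e s' = 0)"
    by (rule terminates_While[where I = I, OF assms(1,2)]) (use assms(3) terminates_wp in blast)+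
  then show ?thesis by (rule terminates_mono) (use assms(4) in \<open>auto simp: algebra_simps\<close>)
qed

text \<open>Keeps the sum of \<open>lst\<close> and \<open>gap\<close> within a word.\<close>

lemma gap_le_track_step:
  assumes "\<And>j. gap s j \<le> lst s j"
  shows "gap (track_step W H g chk i s) j \<le> lst (track_step W H g chk i s) j"
proof -
  have "gap (centre_step W H g chk i s) j \<le> lst (centre_step W H g chk i s) j"
    if "\<And>j. gap s j \<le> lst s j" for s j
    using that[of j] that[of "cnt s"] unfolding centre_step_def Let_def by auto
  then show ?thesis using assms by (simp add: track_step_def scan_step_def)
qed

text \<open>\<open>X\<close> bounds all array indices: \<open>3 * W\<close> covers the sliding
  window and the at most \<open>2 * W\<close> records, and \<open>(n + W) div g\<close> the
  positions divisible by \<open>g\<close>. The sum \<open>M * M + M + b * M\<close> dominates all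
  intermediate results with fingerprints.\<close>

locale machine =
  fixes S :: "nat list" and W g H b M w X R n Z :: nat
  assumes n: "n = length S" and Z: "Z = 3 * W + 1"
    and W: "1 \<le> W" "2 * H \<le> W" "W \<le> 2 * H + 1" "n < W * W" and g: "1 \<le> g" "g \<le> W"
    and X: "X = 3 * W + (n + W) div g" and M: "1 \<le> M"
    and w: "1 \<le> w" "5 * (n + W) + 5 < 2 ^ w" "M * M + M + b * M < 2 ^ w" "b < 2 ^ w"
    and b: "\<And>x. code S x < b"
begin

abbreviation hF :: "nat \<Rightarrow> nat" where "hF i \<equiv> fwd_hash (code S) b i mod M"
abbreviation hR :: "nat \<Rightarrow> nat" where "hR i \<equiv> rev_hash (code S) b i mod M"
abbreviation hP :: "nat \<Rightarrow> nat" where "hP i \<equiv> b ^ i mod M"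
abbreviation ok :: "nat \<Rightarrow> nat \<Rightarrow> bool" where "ok \<equiv> hash_check (code S) b M"

text \<open>The fingerprints of the prefixes shorter than \<open>i'\<close> have been stored; \<open>i\<close> is the current position.\<close>

definition env :: "nat \<Rightarrow> nat \<Rightarrow> state \<Rightarrow> bool" where
  "env i' i s \<longleftrightarrow> vars s 0 = n \<and> vars s 2 = W \<and> vars s 3 = g \<and> vars s 4 = H \<and> vars s 5 = Z \<and>
     vars s 6 = b \<and> vars s 11 = M \<and> vars s 18 = n + W + 1 \<and> vars s 17 = i \<and> vars s 19 = hF i \<and>
     vars s 20 = hR i \<and> vars s 21 = hP i \<and> inp s = drop i S \<and> tape s = [] \<and>
     (\<forall>f<6. \<forall>x. arr s f x < M) \<and>
     (\<forall>x. x < i' \<and> i < x + Z \<longrightarrow>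
        arr s 0 (x mod Z) = hF x \<and> arr s 1 (x mod Z) = hR x \<and> arr s 2 (x mod Z) = hP x) \<and>
     (\<forall>x. x < i' \<and> g dvd x \<longrightarrow>
        arr s 3 (x div g) = hF x \<and> arr s 4 (x div g) = hR x \<and> arr s 5 (x div g) = hP x)"

lemma env_vars:
  assumes "env i' i s"
  shows "vars s 0 = n" "vars s 2 = W" "vars s 3 = g" "vars s 4 = H" "vars s 5 = Z" "vars s 6 = b"
    "vars s 11 = M" "vars s 18 = n + W + 1" "vars s 17 = i" "vars s 19 = hF i" "vars s 20 = hR i"
    "vars s 21 = hP i" "inp s = drop i S" "tape s = []"
  using assms by (auto simp: env_def)

lemma env_cong:
  assumes "env i' i s" "\<And>x. x < 22 \<Longrightarrow> vars s' x = vars s x" "\<And>f. f < 6 \<Longrightarrow> arr s' f = arr s f"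
    "inp s' = inp s" "tape s' = tape s"
  shows "env i' i s'"
  using assms unfolding env_def by simp

lemma Z_pos: "0 < Z" "x mod Z \<le> X"
proof -
  show "0 < Z" by (simp add: Z)
  then have "x mod Z < Z" by simp
  then have "x mod Z \<le> 3 * W" using Z by linarith
  then show "x mod Z \<le> X" unfolding X by (rule trans_le_add1)
qed

lemma check_mod:
  "(hR i + hP i * hF c) mod M = (hR c + hP c * hF i) mod M \<longleftrightarrow> ok c i"
proof -
  have "(hR x + hP x * hF y) mod M =
      (rev_hash (code S) b x + b ^ x * fwd_hash (code S) b y) mod M" for x y
    by (intro mod_add_cong mod_mult_cong mod_mod_trivial)
  then show ?thesis unfolding hash_check_def by (simp only:)
qed

lemma val_win_check:
  assumes "env (Suc i) i s" "val c s \<le> i" "i < val c s + Z" "val x s \<le> i" "i < val x s + Z"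
  shows "val (win_check c x) s = 0 \<longleftrightarrow> \<not> ok (val c s) (val x s)"
  using assms check_mod[of "val x s" "val c s"] unfolding win_check_def check_e_def
  by (simp add: env_def numeral_2_eq_2)

lemma val_point_check:
  assumes "env (Suc i) i s" "val c s \<le> i" "g dvd val c s" "val x s \<le> i" "i < val x s + Z"
  shows "val (point_check c x) s = 0 \<longleftrightarrow> \<not> ok (val c s) (val x s)"
  using assms check_mod[of "val x s" "val c s"] unfolding point_check_def check_e_def
  by (simp add: env_def numeral_2_eq_2)

lemma word_bound: "x < M \<Longrightarrow> y < M \<Longrightarrow> z < M \<Longrightarrow> x + y * z < 2 ^ w"
  using mult_le_mono[of y M z M] w(3) by linarith

lemma safe_check:
  assumes "env i' i s" "safe w X c s" "safe w X x s" "val c s \<le> X" "val x s \<le> X" "f = 0 \<or> f = 3"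
  shows "safe w X (check_e f c x) s"
proof -
  have a: "arr s f y < M" if "f < 6" for f y using assms(1) that by (simp add: env_def)
  have "1 * M \<le> M * M" using M by (rule mult_le_mono1)
  then have M1: "M + 1 < 2 ^ w" using w(3) M by linarith
  have p: "arr s f y * arr s f' z < 2 ^ w" if "f < 6" "f' < 6" for f f' y z
    using word_bound[of 0 "arr s f y" "arr s f' z"] a that M by simp
  have m: "Suc (x mod M) < 2 ^ w" for x using M1 M mod_less_divisor[of M x] by linarith
  show ?thesis
    using assms a p m w(1) env_vars[OF assms(1)] unfolding check_e_def
    by (auto intro!: word_bound)
qed

lemma safe_win_check:
  "env i' i s \<Longrightarrow> safe w X c s \<Longrightarrow> safe w X x s \<Longrightarrow> safe w X (win_check c x) s"
  unfolding win_check_def using Z_pos by (intro safe_check) (auto simp: env_vars)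

lemma safe_point_check:
  "env i' i s \<Longrightarrow> safe w X c s \<Longrightarrow> safe w X x s \<Longrightarrow> val c s \<le> n + W \<Longrightarrow> safe w X (point_check c x) s"
  unfolding point_check_def using Z_pos div_le_mono[of "val c s" "n + W" g]
  by (intro safe_check) (auto simp: env_vars X)

text \<open>More than \<open>2 * W\<close> records, with first centres more than \<open>H\<close>
  apart, would need \<open>W * (2 * H + 2) \<le> n\<close>, but \<open>2 * H + 2\<close> exceeds
  \<open>W\<close> and \<open>n < W * W\<close>.\<close>

lemma record_bound:
  assumes "shape W H i k s" "1 \<le> j" "j \<le> cnt s" "k \<le> n"
  shows "j \<le> 2 * W"
proof (rule ccontr)
  assume "\<not> j \<le> 2 * W"
  then have "(2 * W + 1) * (H + 1) \<le> j * (H + 1)" by (intro mult_le_mono1) simp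
  also have "\<dots> \<le> n + H + 1" using shapeD[OF assms(1-3)] assms(4) by linarith
  finally have "W * (2 * H + 2) \<le> n" by (simp add: algebra_simps)
  moreover have "W * W \<le> W * (2 * H + 2)" using W(3) by (intro mult_le_mono2) simp
  ultimately show False using W(4) by simp
qed

lemma wp_store:
  assumes "env i i s" "i \<le> n + W"
  shows "wp w X R store_c (\<lambda>s'. env (Suc i) i s' \<and> view s' = view s) s"
proof -
  have d: "i div g \<le> X" using assms(2) div_le_mono[of i "n + W" g] by (simp add: X)
  have inj: "x = i" if "x mod Z = i mod Z" "x < i" "i < x + Z" for x
  proof -
    have "Z dvd i - x" using that by (metis mod_eq_dvd_iff_nat less_imp_le)
    then show ?thesis using that by (auto dest: dvd_imp_le)
  qed
  have inj': "x = i" if "x div g = i div g" "g dvd x" "g dvd i" for x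
    using that g by (metis dvd_mult_div_cancel)
  note v = env_vars[OF assms(1)]
  have old: "\<And>f x. f < 6 \<Longrightarrow> arr s f x < M"
    "\<And>x. x < i \<Longrightarrow> i < x + Z \<Longrightarrow> arr s 0 (x mod Z) = hF x \<and> arr s 1 (x mod Z) = hR x \<and> arr s 2 (x mod Z) = hP x"
    "\<And>x. x < i \<Longrightarrow> g dvd x \<Longrightarrow> arr s 3 (x div g) = hF x \<and> arr s 4 (x div g) = hR x \<and> arr s 5 (x div g) = hP x"
    using assms(1) by (auto simp: env_def)
  define A where "A = (arr s)(0 := (arr s 0)(i mod Z := hF i), 1 := (arr s 1)(i mod Z := hR i),
    2 := (arr s 2)(i mod Z := hP i))"
  define A' where "A' = A(3 := (arr s 3)(i div g := hF i), 4 := (arr s 4)(i div g := hR i),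
    5 := (arr s 5)(i div g := hP i))"
  have AM: "A f x < M" "A' f x < M" if "f < 6" for f x
    using old(1)[OF that, of x] M by (auto simp: A_def A'_def)
  have win: "A 0 (x mod Z) = hF x \<and> A 1 (x mod Z) = hR x \<and> A 2 (x mod Z) = hP x"
    if "x < Suc i" "i < x + Z" for x
  proof (cases "x = i")
    case False
    with that have "x < i" by simp
    with inj[of x] that have "x mod Z \<noteq> i mod Z" by auto
    with old(2)[OF \<open>x < i\<close> that(2)] show ?thesis by (simp add: A_def)
  qed (simp add: A_def)
  have pt: "A' 3 (x div g) = hF x \<and> A' 4 (x div g) = hR x \<and> A' 5 (x div g) = hP x"
    if "x < Suc i" "g dvd x" "g dvd i" for x
  proof (cases "x = i")
    case False
    with that have "x < i" by simp
    with inj'[of x] that have "x div g \<noteq> i div g" by auto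
    with old(3)[OF \<open>x < i\<close> that(2)] show ?thesis by (simp add: A'_def A_def)
  qed (simp add: A'_def)
  have A': "A' 0 = A 0" "A' 1 = A 1" "A' 2 = A 2" by (simp_all add: A'_def)
  have "env (Suc i) i (s\<lparr>arr := if g dvd i then A' else A\<rparr>)"
  proof (cases "g dvd i")
    case True
    then show ?thesis unfolding env_def using AM win pt A' v by simp
  next
    case False
    have "A 3 = arr s 3" "A 4 = arr s 4" "A 5 = arr s 5" by (simp_all add: A_def)
    moreover have "x < i" if "x < Suc i" "g dvd x" for x using that False by (cases "x = i") auto
    ultimately show ?thesis unfolding env_def using AM win old(3) v False by simp
  qed
  moreover have "view (s\<lparr>arr := if g dvd i then A' else A\<rparr>) = view s"
    by (simp add: view_def A_def A'_def)
  ultimately show ?thesis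
    unfolding store_c_def using Z_pos d v
    by (cases "g dvd i") (simp_all add: A_def A'_def mod_eq_0_iff_dvd)
qed

lemma wp_alive:
  assumes e: "env (Suc i) i s" and i: "i \<le> n + W" and sh: "shape W H i k (view s)" and k: "k \<le> n" "k \<le> i"
  shows "wp w X R alive_c (\<lambda>s'. env (Suc i) i s' \<and> view s' = alive_step W H ok i (view s)) s"
proof (cases "vars s 22 = 0")
  case True
  with e show ?thesis by (simp add: alive_c_def alive_step_def)
next
  case False
  define j where "j = vars s 22"
  have j: "1 \<le> j" "j \<le> cnt (view s)" using False by (auto simp: j_def)
  note sj = shapeD[OF sh j, simplified]
  have jX: "j \<le> X" using record_bound[OF sh j k(1)] by (simp add: X)
  note v = env_vars[OF e]
  have ck: "val (win_check (Num 2 *\<^sub>e rec_e 8 -\<^sub>e Var 17) (Var 17)) s = 0 \<longleftrightarrow> \<not> ok (2 * arr s 8 j - i) i"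
    if "i \<le> arr s 8 j + W + H" "i \<le> 2 * arr s 8 j" "arr s 8 j \<le> i"
    using that v Z W by (subst val_win_check[OF e]) (auto simp: j_def)

  have sc: "safe w X (win_check (Num 2 *\<^sub>e rec_e 8 -\<^sub>e Var 17) (Var 17)) s"
    using sj jX k w i by (intro safe_win_check[OF e]) (auto simp: j_def)
  have l: "arr s 8 j \<le> i" using sj k by simp
  define C where "C = (rec_e 10 +\<^sub>e Num 1 =\<^sub>e Var 17 \<and>\<^sub>e Var 17 \<le>\<^sub>e rec_e 8 +\<^sub>e Var 2 +\<^sub>e Var 4 \<and>\<^sub>e
       Var 17 \<le>\<^sub>e Num 2 *\<^sub>e rec_e 8 \<and>\<^sub>e win_check (Num 2 *\<^sub>e rec_e 8 -\<^sub>e Var 17) (Var 17))"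
  define P where "P \<longleftrightarrow> arr s 10 j + 1 = i \<and> i \<le> arr s 8 j + W + H \<and> i \<le> 2 * arr s 8 j \<and>
      ok (2 * arr s 8 j - i) i"
  have C: "val C s = 0 \<longleftrightarrow> \<not> P"
    using ck l by (auto simp: C_def P_def v j_def[symmetric])
  have sC: "safe w X C s"
    using sc sj jX w i l W by (simp add: C_def j_def[symmetric] v)
  have j0: "j \<noteq> 0" using j by simp
  have step: "alive_step W H ok i (view s) = (if P then if arr s 7 j = 0 then (view s)\<lparr>rgt := (arr s 10)(j := i)\<rparr>
      else (view s)\<lparr>rgt := (arr s 10)(j := i), mid := (arr s 11)(j := (arr s 9 j + i + 1) div 2),
         est := (arr s 12)(j := i - (arr s 9 j + i + 1) div 2)\<rparr> else view s)"
    using j0 unfolding alive_step_def Let_def P_def by (simp add: j_def)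
  have b1: "arr s 9 j + i < 2 ^ w" "Suc (arr s 9 j + i) < 2 ^ w" "2 < (2::nat) ^ w" "Suc 0 < (2::nat) ^ w"
    using sj i w by auto
  show ?thesis
    unfolding alive_c_def C_def[symmetric] step
    by (cases P; cases "arr s 7 j = 0")
      (simp_all add: C sC j0 jX b1 e v j_def[symmetric] view_def env_cong[OF e])
qed


lemma wp_long:
  assumes gl: "\<And>j. arr s 7 j \<le> arr s 8 j"
  assumes e: "env (Suc i) i s" and i: "W < i" "i \<le> n + W" and sh: "shape W H i (i - 1 - W) (view s)"
    and m: "vars s 25 = i - W" and long: "W \<le> i - W" "ok (i - W - W) i"
  shows "wp w X R long_c (\<lambda>s'. env (Suc i) i s' \<and> view s' = centre_step W H g ok i (view s)) s"
proof -
  define j where "j = vars s 22"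
  have jX: "j \<le> X"
  proof (cases "j = 0")
    case False
    have "i - 1 - W \<le> n" using i by linarith
    with False record_bound[OF sh, of j] have "j \<le> 2 * W" by (simp add: j_def)
    then show ?thesis unfolding X by linarith
  qed simp
  note v = env_vars[OF e]
  have w': "5 * i + 5 < 2 ^ w" "2 < (2::nat) ^ w" "Suc 0 < (2::nat) ^ w" "W < 2 ^ w"
    "j + 1 < 2 ^ w \<or> True" using i w by auto
  show ?thesis
  proof (cases "j = 0 \<or> arr s 8 j + H < i - W")
    case True
    have step: "centre_step W H g ok i (view s) = (view s)\<lparr>cnt := Suc j, ffst := (arr s 6)(Suc j := i - W),
        gap := (arr s 7)(Suc j := 0), lst := (arr s 8)(Suc j := i - W), lft := (arr s 9)(Suc j := 0),
        rgt := (arr s 10)(Suc j := i), mid := (arr s 11)(Suc j := i - W), est := (arr s 12)(Suc j := W)\<rparr>"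
      using i long True by (simp add: centre_step_def Let_def j_def)
    \<comment> \<open>The index of the record about to be written is bounded through the shape of
      the tracker after the step.\<close>
    have "shape W H i (i - W) (centre_step W H g ok i (view s))" by (rule shape_centre_step[OF sh])
    then have "Suc j \<le> 2 * W" by (rule record_bound) (use i in \<open>auto simp: step\<close>)
    then have sX: "Suc j \<le> X" "Suc j \<le> W + W" by (auto simp: X)
    have "Suc j \<le> 5 * (n + W) + 5" using sX(2) by simp
    then have sw: "Suc j < 2 ^ w" using w(2) by (rule le_less_trans)
    have "wp w X R new_c (\<lambda>s'. env (Suc i) i s' \<and> view s' = centre_step W H g ok i (view s)) s"
      unfolding new_c_def step
      by (simp add: sX sw w' e v j_def[symmetric] m view_def env_cong[OF e])
    moreover have "arr s 8 j + H < 2 ^ w" "Suc (arr s 8 j + H) < 2 ^ w" if "j \<noteq> 0"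
      using shapeD[OF sh, of j] that i w W by (simp_all add: j_def)
    ultimately show ?thesis
      using True jX w' unfolding long_c_def by (auto simp: j_def[symmetric] m v)
  next
    case False
    then have j: "1 \<le> j" "j \<le> cnt (view s)" by (auto simp: j_def)
    note sj = shapeD[OF sh j, simplified]
    have b: "2 * arr s 8 j < 2 ^ w" "arr s 8 j + H < 2 ^ w" "Suc (arr s 8 j + H) < 2 ^ w"
      using sj i w W by auto
    show ?thesis
    proof (cases "arr s 7 j = 0")
      case D: True
      let ?lf = "2 * arr s 8 j - arr s 10 j"
      have step: "centre_step W H g ok i (view s) = (view s)\<lparr>gap := (arr s 7)(j := i - W - arr s 8 j),
          lst := (arr s 8)(j := i - W), lft := (arr s 9)(j := ?lf), rgt := (arr s 10)(j := i),
          mid := (arr s 11)(j := (?lf + i + 1) div 2), est := (arr s 12)(j := i - (?lf + i + 1) div 2)\<rparr>"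
        using i long False D by (simp add: centre_step_def Let_def j_def[symmetric])
      have b': "?lf + i < 2 ^ w" "Suc (?lf + i) < 2 ^ w" using sj i w by auto
      have "wp w X R old_c (\<lambda>s'. env (Suc i) i s' \<and> view s' = centre_step W H g ok i (view s)) s"
        unfolding old_c_def step
        by (simp add: D jX b b' w' e v j_def[symmetric] m view_def env_cong[OF e])
      then show ?thesis
        using False jX b w' i w unfolding long_c_def by (auto simp: j_def[symmetric] m v)
    next
      case D: False
      have b': "arr s 8 j + arr s 7 j < 2 ^ w" "Suc (arr s 8 j + arr s 7 j) < 2 ^ w" "i - W < 2 ^ w" "Suc (i - W) < 2 ^ w"
        using gl[of j] sj w i by auto
      have step: "centre_step W H g ok i (view s) = (if i - W = arr s 8 j + arr s 7 j
          then (view s)\<lparr>lst := (arr s 8)(j := i - W)\<rparr> else (view s)\<lparr>rep := outp s @ [(i - W, W)]\<rparr>)"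
        using i long False D by (simp add: centre_step_def Let_def j_def[symmetric])
      have "wp w X R old_c (\<lambda>s'. env (Suc i) i s' \<and> view s' = centre_step W H g ok i (view s)) s"
        unfolding old_c_def step
        by (simp add: D jX b b' w' e v j_def[symmetric] m view_def env_cong[OF e] w(1)[simplified])
      then show ?thesis
        using False jX b w' i w unfolding long_c_def by (auto simp: j_def[symmetric] m v)
    qed
  qed
qed

end

context machine
begin

text \<open>Variable 23 grows by \<open>g\<close> and stays at most \<open>W\<close>. So a centre
  costs \<open>O(W / g)\<close>, which is of order \<open>1 / \<epsilon>\<close>.\<close>

lemma terminates_short:
  assumes e: "env (Suc i) i s" and i: "W < i" "i \<le> n + W" and m: "vars s 25 = i - W"
  shows "terminates w X R short_c s ((W div g + 1) * com_size short_c)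
    (\<lambda>s'. env (Suc i) i s' \<and> view s' = (view s)\<lparr>rep := outp s @ [(i - W, short W g ok (i - W))]\<rparr>)"
proof -
  define m where "m = i - W"
  define I where "I k s' \<longleftrightarrow> (\<exists>q. q + k = W div g \<and> s' = set_var s 23 (g * q) \<and>
      (\<forall>q'<q. short_pal W g ok m (g * q')))" for k :: nat and s'
  have env': "env (Suc i) i (set_var s 23 v)" for v
    by (rule env_cong[OF e]) auto
  have mi: "m + W = i" using i by (simp add: m_def)
  have le: "g * q \<le> W" if "q \<le> W div g" for q
    using mult_le_mono2[OF that, of g] times_div_less_eq_dividend[of g W] by linarith
  have cond: "val short_cond (set_var s 23 (g * q)) = 0 \<longleftrightarrow> \<not> short_pal W g ok m (g * q)" for q
  proof (cases "g * q + g \<le> m \<and> g * q + g \<le> W")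
    case True
    have "val (win_check (Var 25 -\<^sub>e (Var 23 +\<^sub>e Var 3)) (Var 25 +\<^sub>e (Var 23 +\<^sub>e Var 3))) (set_var s 23 (g * q)) = 0
        \<longleftrightarrow> \<not> ok (m - (g * q + g)) (m + (g * q + g))"
      using True mi m env_vars[OF e] Z
      by (subst val_win_check[OF env']) (auto simp: m_def)
    with True m env_vars[OF e] show ?thesis by (simp add: short_cond_def short_pal_def m_def[symmetric])
  next
    case False
    with m env_vars[OF e] show ?thesis by (auto simp: short_cond_def short_pal_def m_def[symmetric])
  qed
  have "terminates w X R (While short_cond (Assign 23 (Var 23 +\<^sub>e Var 3))) (set_var s 23 0)
    ((W div g + 1) * com_size (While short_cond (Assign 23 (Var 23 +\<^sub>e Var 3))))
    (\<lambda>s'. s' = set_var s 23 (short W g ok m))"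
  proof (rule terminates_While_wp[where I = I])
    show "I (W div g) (set_var s 23 0)" by (simp add: I_def)
  next
    fix k s' assume "I k s'"
    then obtain q where "q + k = W div g" and q2: "s' = set_var s 23 (g * q)" unfolding I_def by blast
    then have q: "q \<le> W div g" "s' = set_var s 23 (g * q)" by linarith+
    have "g * q + g \<le> W + W" using le[OF q(1)] g by simp
    with i w g mi have "Suc (m + (g * q + g)) < 2 ^ w" by simp
    then show "safe w X short_cond s'"
      using i w g mi m env_vars[OF e]
      unfolding short_cond_def q(2) by (auto intro!: safe_win_check[OF env'] simp: m_def[symmetric])
  next
    fix k s' assume I: "I k s'" and nz: "val short_cond s' \<noteq> 0"
    then obtain q where q: "q + k = W div g" "s' = set_var s 23 (g * q)"
      "\<forall>q'<q. short_pal W g ok m (g * q')"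
      unfolding I_def by blast
    have sp: "short_pal W g ok m (g * q)" using cond[of q] nz q(2) by simp
    then have "g * Suc q \<le> W" by (simp add: short_pal_def)
    then have "g * Suc q div g \<le> W div g" by (rule div_le_mono)
    then have lt: "q < W div g" using g by simp
    have "I (k - 1) (set_var s 23 (g * Suc q))"
      unfolding I_def using q sp lt by (intro exI[of _ "Suc q"]) (auto simp: less_Suc_eq)
    moreover have "g * q + g < 2 ^ w" using \<open>g * Suc q \<le> W\<close> w by simp
    ultimately show "k > 0 \<and> wp w X R (Assign 23 (Var 23 +\<^sub>e Var 3)) (I (k - 1)) s'"
      using lt q(1) by (simp add: q(2) env_vars[OF e] add.commute)
  next
    fix k s' assume I: "I k s'" and z: "val short_cond s' = 0"
    then obtain q where q: "s' = set_var s 23 (g * q)" "\<forall>q'<q. short_pal W g ok m (g * q')"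
      unfolding I_def by blast
    have "(LEAST q. \<not> short_pal W g ok m (g * q)) = q"
      by (rule Least_equality) (use cond[of q] z q in \<open>auto simp: not_less[symmetric]\<close>)
    with q(1) show "s' = set_var s 23 (short W g ok m)" by (simp add: short_def)
  qed
  then have "terminates w X R short_c s (com_size (Assign 23 (Num 0)) +
      ((W div g + 1) * com_size (While short_cond (Assign 23 (Var 23 +\<^sub>e Var 3))) + com_size (Output (Var 25) (Var 23))))
    (\<lambda>s'. env (Suc i) i s' \<and> view s' = (view s)\<lparr>rep := outp s @ [(i - W, short W g ok (i - W))]\<rparr>)"
    unfolding short_c_def
    apply (intro terminates_Seq[OF terminates_wp[where Q = "\<lambda>s1. s1 = set_var s 23 0"]] terminates_Seq)
      apply simp
     apply simp
    apply (rule terminates_wp)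
    apply (simp add: m view_def m_def[symmetric] env_cong[OF e])
    done
  then show ?thesis by (rule terminates_mono) (auto simp: short_c_def algebra_simps)
qed

lemma terminates_centre:
  assumes gl: "\<And>j. arr s 7 j \<le> arr s 8 j" and e: "env (Suc i) i s" and i: "i \<le> n + W"
    and sh: "shape W H i (i - 1 - W) (view s)"
  shows "terminates w X R centre_c s ((W div g + 1) * com_size centre_c)
    (\<lambda>s'. env (Suc i) i s' \<and> view s' = centre_step W H g ok i (view s))"
proof (cases "W < i")
  case False
  then have "wp w X R centre_c (\<lambda>s'. env (Suc i) i s' \<and> view s' = centre_step W H g ok i (view s)) s"
    using e by (simp add: centre_c_def centre_step_def env_vars[OF e])
  from terminates_wp[OF this] show ?thesis by (rule terminates_mono) auto
next
  case True
  define C where "C = (Var 2 \<le>\<^sub>e Var 25 \<and>\<^sub>e win_check (Var 25 -\<^sub>e Var 2) (Var 17))"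
  define s1 where "s1 = set_var s 25 (i - W)"
  note v = env_vars[OF e]
  have e1: "env (Suc i) i s1" unfolding s1_def by (rule env_cong[OF e]) auto
  have v1: "view s1 = view s" "vars s1 25 = i - W" "outp s1 = outp s" by (simp_all add: s1_def view_def)
  have gl1: "arr s1 7 j \<le> arr s1 8 j" for j using gl by (simp add: s1_def)
  note ve = env_vars[OF e1]
  have C: "val C s1 = 0 \<longleftrightarrow> \<not> (W \<le> i - W \<and> ok (i - W - W) i)"
  proof (cases "W \<le> i - W")
    case W: True
    have "val (win_check (Var 25 -\<^sub>e Var 2) (Var 17)) s1 = 0 \<longleftrightarrow> \<not> ok (i - W - W) i"
      using True W v1 ve Z by (subst val_win_check[OF e1]) auto
    with W v1 ve show ?thesis by (simp add: C_def)
  qed (use v1 ve in \<open>simp add: C_def\<close>)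
  have sC: "safe w X C s1"
    using i w v1 ve unfolding C_def by (auto intro!: safe_win_check[OF e1])
  have "terminates w X R (Cond C long_c short_c) s1
      ((W div g + 1) * (com_size long_c + com_size short_c) + expr_time C + 2)
      (\<lambda>s'. env (Suc i) i s' \<and> view s' = centre_step W H g ok i (view s))"
  proof (rule terminates_Cond[OF sC])
    assume "val C s1 \<noteq> 0"
    with C have l: "W \<le> i - W" "ok (i - W - W) i" by auto
    have "wp w X R long_c (\<lambda>s'. env (Suc i) i s' \<and> view s' = centre_step W H g ok i (view s1)) s1"
      by (rule wp_long[OF gl1 e1 True i _ v1(2) l]) (use sh v1 in simp)
    from terminates_wp[OF this] show "terminates w X R long_c s1 ((W div g + 1) * (com_size long_c + com_size short_c))
      (\<lambda>s'. env (Suc i) i s' \<and> view s' = centre_step W H g ok i (view s))"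
      by (rule terminates_mono) (auto simp: v1)
  next
    assume "val C s1 = 0"
    with C True have "centre_step W H g ok i (view s) = (view s)\<lparr>rep := outp s @ [(i - W, short W g ok (i - W))]\<rparr>"
      by (simp add: centre_step_def Let_def)
    with terminates_short[OF e1 True i v1(2)]
    show "terminates w X R short_c s1 ((W div g + 1) * (com_size long_c + com_size short_c))
      (\<lambda>s'. env (Suc i) i s' \<and> view s' = centre_step W H g ok i (view s))"
      by (elim terminates_mono) (auto simp: v1 algebra_simps)
  qed
  moreover have "wp w X R (Assign 25 (Var 17 -\<^sub>e Var 2)) (\<lambda>s'. s' = s1) s"
    by (simp add: s1_def v)
  ultimately have seq: "terminates w X R (Assign 25 (Var 17 -\<^sub>e Var 2) ;; Cond C long_c short_c) s
    (com_size (Assign 25 (Var 17 -\<^sub>e Var 2)) + ((W div g + 1) * (com_size long_c + com_size short_c) + expr_time C + 2))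
    (\<lambda>s'. env (Suc i) i s' \<and> view s' = centre_step W H g ok i (view s))"
    by (intro terminates_Seq[OF terminates_wp]) auto
  have "terminates w X R centre_c s
    (com_size (Assign 25 (Var 17 -\<^sub>e Var 2)) + ((W div g + 1) * (com_size long_c + com_size short_c) + expr_time C + 2)
      + expr_time (Var 2 <\<^sub>e Var 17) + 2)
    (\<lambda>s'. env (Suc i) i s' \<and> view s' = centre_step W H g ok i (view s))"
    unfolding centre_c_def C_def[symmetric]
    by (rule terminates_Cond[OF _ seq]) (use True v in auto)
  then show ?thesis
    by (rule terminates_mono) (auto simp: centre_c_def C_def[symmetric] algebra_simps)
qed

end

text \<open>Positivity of the position excludes \<open>i = 0\<close>, where truncated subtraction
  would destroy the congruence.\<close>

lemma dvd_diff_scan_pos: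
  assumes "g dvd i" "0 < g" "scan_pos g i x \<le> x" "0 < scan_pos g i x"
  shows "g dvd x - scan_pos g i x"
proof -
  define p where "p = scan_pos g i x"
  have "x mod g = p mod g"
  proof (cases "x mod g = 0")
    case True
    then have "p = i" by (simp add: p_def scan_pos_def)
    with True assms(1) show ?thesis by (simp add: dvd_eq_mod_eq_0)
  next
    case False
    then have "(g - x mod g) mod g = g - x mod g" using assms(2) by simp
    then have p: "p = i - (g - x mod g)" by (simp add: p_def scan_pos_def)
    obtain a where a: "i = g * a" using assms(1) by (elim dvdE)
    have "0 < p" using assms(4) by (simp only: p_def)
    then have "a \<noteq> 0" unfolding p a by (cases "a = 0") simp_all
    then obtain a' where "a = Suc a'" by (cases a) auto
    then have "p = g * a' + x mod g" using p a mod_less_divisor[OF assms(2), of x] by simp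
    then show ?thesis by simp
  qed
  then show ?thesis using assms(3) unfolding p_def[symmetric] by (metis mod_eq_dvd_iff_nat)
qed

lemma scan_pos_gt: "0 < g \<Longrightarrow> 0 < i \<Longrightarrow> i < scan_pos g i x + g"
  unfolding scan_pos_def using mod_less_divisor[of g "g - x mod g"] by linarith

context machine
begin

lemma scan_body_wp:
  assumes e: "env (Suc i) i s" and i: "i \<le> n + W" "g dvd i" and j: "0 < j" "vars s 24 = j" "j \<le> X"
    and bd: "arr s 11 j \<le> 2 * i" "arr s 12 j \<le> i"
  shows "wp w X R scan_body (\<lambda>s'. env (Suc i) i s' \<and> vars s' 24 = j - 1 \<and>
    view s' = (view s)\<lparr>est := (arr s 12)(j := scan_est g ok i (arr s 11 j) (arr s 12 j))\<rparr>) s"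
proof -
  define c where "c = arr s 11 j"
  define a where "a = arr s 12 j"
  define p where "p = scan_pos g i (2 * c)"
  define s1 where "s1 = set_var s 27 p"
  note v = env_vars[OF e]
  have e1: "env (Suc i) i s1" unfolding s1_def by (rule env_cong[OF e]) auto
  have v1: "view s1 = view s" "vars s1 24 = j" "arr s1 = arr s" "vars s1 27 = p"
    "vars s1 22 = vars s 22" "outp s1 = outp s"
    by (simp_all add: s1_def view_def j)
  have w2: "2 * c < 2 ^ w" "c + a < 2 ^ w" "2 < (2::nat) ^ w" "Suc 0 < (2::nat) ^ w" "Suc (2 * c) < 2 ^ w"
    using bd w i by (auto simp: c_def a_def)
  have pi: "p \<le> i" by (simp add: p_def scan_pos_le)
  have ck: "val (point_check (Num 2 *\<^sub>e Arr 11 (Var 24) -\<^sub>e Var 27) (Var 27)) s1 = 0 \<longleftrightarrow> \<not> ok (2 * c - p) p"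
    and sf: "safe w X (point_check (Num 2 *\<^sub>e Arr 11 (Var 24) -\<^sub>e Var 27) (Var 27)) s1"
    if "p \<le> 2 * c" "c + a < p"
  proof -
    have "g dvd 2 * c - p" unfolding p_def
      by (rule dvd_diff_scan_pos) (use that g i in \<open>auto simp: p_def\<close>)
    moreover have "i < p + Z" using scan_pos_gt[of g i "2 * c"] g that pi by (simp add: p_def Z)
    ultimately show "val (point_check (Num 2 *\<^sub>e Arr 11 (Var 24) -\<^sub>e Var 27) (Var 27)) s1 = 0 \<longleftrightarrow> \<not> ok (2 * c - p) p"
      using that pi by (subst val_point_check[OF e1]) (auto simp: v1 c_def[symmetric])
    show "safe w X (point_check (Num 2 *\<^sub>e Arr 11 (Var 24) -\<^sub>e Var 27) (Var 27)) s1"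
      by (rule safe_point_check[OF e1]) (use that pi i w2 j in \<open>auto simp: v1 c_def[symmetric]\<close>)
  qed
  have se: "scan_est g ok i c a = (if p \<le> 2 * c \<and> c + a < p \<and> ok (2 * c - p) p then p - c else a)"
    by (simp add: scan_est_def Let_def p_def)
  have pos: "i - (g - 2 * c mod g) mod g = p" by (simp add: p_def scan_pos_def)
  have id: "(arr s 12)(j := a) = arr s 12" by (simp add: a_def)
  show ?thesis
  proof (cases "p \<le> 2 * c \<and> c + a < p")
    case True
    then show ?thesis
      unfolding scan_body_def c_def[symmetric] a_def[symmetric] se
      using ck sf
      by (cases "ok (2 * c - p) p")
        (simp_all add: v j w2 c_def[symmetric] a_def[symmetric] pos s1_def[symmetric] v1
          w(1)[simplified] id env_cong[OF e1] view_def)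
  next
    case False
    then have "val (Var 27 \<le>\<^sub>e Num 2 *\<^sub>e Arr 11 (Var 24) \<and>\<^sub>e Arr 11 (Var 24) +\<^sub>e Arr 12 (Var 24) <\<^sub>e Var 27) s1 = 0"
      by (simp add: v1 c_def[symmetric] a_def[symmetric])
    with False show ?thesis
      unfolding scan_body_def c_def[symmetric] a_def[symmetric] se
      by (auto simp: v j w2 c_def[symmetric] a_def[symmetric] pos s1_def[symmetric] v1
          w(1)[simplified] id env_cong[OF e1] view_def)
  qed
qed

lemma terminates_scan:
  assumes e: "env (Suc i) i s" and i: "i \<le> n + W" and sh: "shape W H i (i - W) (view s)"
  shows "terminates w X R scan_c s ((if g dvd i then 2 * W + 2 else 1) * com_size scan_c)
    (\<lambda>s'. env (Suc i) i s' \<and> view s' = scan_step g ok i (view s))"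
proof (cases "g dvd i")
  case False
  then have "wp w X R scan_c (\<lambda>s'. env (Suc i) i s' \<and> view s' = scan_step g ok i (view s)) s"
    using e by (simp add: scan_c_def scan_step_def env_vars[OF e] mod_eq_0_iff_dvd)
  from terminates_wp[OF this] show ?thesis by (rule terminates_mono) (use False in auto)
next
  case True
  define N where "N = vars s 22"
  \<comment> \<open>The records are scanned from the last to the first, so those above
    \<open>k\<close> already have their new estimates.\<close>
  define E where "E k = (\<lambda>j. if k < j \<and> j \<le> N then scan_est g ok i (arr s 11 j) (arr s 12 j) else arr s 12 j)" for k
  define I where "I k s' \<longleftrightarrow> env (Suc i) i s' \<and> vars s' 24 = k \<and> k \<le> N \<and> view s' = (view s)\<lparr>est := E k\<rparr>" for k s'
  define s1 where "s1 = set_var s 24 N"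
  have NW: "N \<le> 2 * W"
  proof (cases "N = 0")
    case False
    then show ?thesis using i by (intro record_bound[OF sh]) (auto simp: N_def)
  qed simp
  have body: "k > 0 \<and> wp w X R scan_body (I (k - 1)) s'" if I: "I k s'" and nz: "val (Var 24) s' \<noteq> 0" for k s'
  proof
    show k: "k > 0" using I nz by (simp add: I_def)
    have e': "env (Suc i) i s'" and k': "vars s' 24 = k" "k \<le> N" and vw: "view s' = (view s)\<lparr>est := E k\<rparr>"
      using I by (auto simp: I_def)
    have c: "arr s' 11 = arr s 11" "arr s' 12 = E k"
      using arg_cong[OF vw, of mid] arg_cong[OF vw, of est] by simp_all
    have "E k k = arr s 12 k" by (simp add: E_def)
    then have bd: "arr s' 11 k \<le> 2 * i" "arr s' 12 k \<le> i"
      using shapeD[OF sh, of k] k k' by (simp_all add: c N_def)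
    have "(E k)(k := scan_est g ok i (arr s 11 k) (E k k)) = E (k - 1)"
    proof
      fix j show "((E k)(k := scan_est g ok i (arr s 11 k) (E k k))) j = E (k - 1) j"
        using k k' by (cases "j = k") (auto simp: E_def)
    qed
    moreover have "wp w X R scan_body (\<lambda>s''. env (Suc i) i s'' \<and> vars s'' 24 = k - 1 \<and>
      view s'' = (view s')\<lparr>est := (arr s' 12)(k := scan_est g ok i (arr s' 11 k) (arr s' 12 k))\<rparr>) s'"
      using NW k' by (intro scan_body_wp[OF e' i True k k'(1) _ bd]) (simp add: X)
    ultimately have *: "wp w X R scan_body (\<lambda>s''. env (Suc i) i s'' \<and> vars s'' 24 = k - 1 \<and>
      view s'' = (view s)\<lparr>est := E (k - 1)\<rparr>) s'"
      by (simp add: c vw)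
    have "k - 1 \<le> N" using k' by simp
    with * show "wp w X R scan_body (I (k - 1)) s'" unfolding I_def by simp
  qed
  have "E 0 = (\<lambda>j. if 1 \<le> j \<and> j \<le> N then scan_est g ok i (arr s 11 j) (arr s 12 j) else arr s 12 j)"
    by (auto simp: E_def)
  then have fin: "scan_step g ok i (view s) = (view s)\<lparr>est := E 0\<rparr>"
    using True by (simp add: scan_step_def N_def cong: if_cong)
  have "E N = arr s 12" by (auto simp: E_def)
  then have "(view s)\<lparr>est := E N\<rparr> = view s" by (simp add: view_def)
  moreover have "env (Suc i) i s1" unfolding s1_def by (rule env_cong[OF e]) auto
  ultimately have I0: "I N s1" by (simp add: I_def s1_def view_def)
  have "terminates w X R (While (Var 24) scan_body) s1 ((N + 1) * com_size (While (Var 24) scan_body))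
      (\<lambda>s'. env (Suc i) i s' \<and> view s' = scan_step g ok i (view s))"
    by (rule terminates_While_wp[where I = I]) (use I0 body in \<open>auto simp: I_def fin\<close>)
  moreover have "wp w X R (Assign 24 (Var 22)) (\<lambda>s'. s' = s1) s"
    by (simp add: s1_def N_def)
  ultimately have seq: "terminates w X R (Assign 24 (Var 22) ;; While (Var 24) scan_body) s
    (com_size (Assign 24 (Var 22)) + (N + 1) * com_size (While (Var 24) scan_body))
    (\<lambda>s'. env (Suc i) i s' \<and> view s' = scan_step g ok i (view s))"
    by (intro terminates_Seq[OF terminates_wp]) auto
  have "terminates w X R scan_c s
    (com_size (Assign 24 (Var 22)) + (N + 1) * com_size (While (Var 24) scan_body) + expr_time (Var 17 mod\<^sub>e Var 3) + 2)
    (\<lambda>s'. env (Suc i) i s' \<and> view s' = scan_step g ok i (view s))"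
    unfolding scan_c_def
    by (rule terminates_Cond[OF _ _ seq]) (use True env_vars[OF e] in auto)
  moreover have "(N + 1) * com_size (While (Var 24) scan_body) \<le> (2 * W + 1) * com_size (While (Var 24) scan_body)"
    using NW by (intro mult_le_mono1) simp
  ultimately show ?thesis
    by (elim terminates_mono) (use True in \<open>auto simp: scan_c_def algebra_simps\<close>)
qed

lemma wp_read:
  assumes e: "env (Suc i) i s" and i: "i \<le> n + W"
  shows "wp w X R read_c (\<lambda>s'. env (Suc i) (Suc i) s' \<and> view s' = view s) s"
proof -
  define c where "c = code S (Suc i)"
  note v = env_vars[OF e]
  have hs: "(hR i + c * hP i) mod M = hR (Suc i)" "(hF i * b + c) mod M = hF (Suc i)" "hP i * b mod M = hP (Suc i)"
  proof -
    have "(hR i + c * hP i) mod M = (rev_hash (code S) b i + c * b ^ i) mod M"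
      by (intro mod_add_cong mod_mult_cong mod_mod_trivial HOL.refl)
    then show "(hR i + c * hP i) mod M = hR (Suc i)" by (simp add: c_def)
    have "(hF i * b + c) mod M = (fwd_hash (code S) b i * b + c) mod M"
      by (intro mod_add_cong mod_mult_cong mod_mod_trivial HOL.refl)
    then show "(hF i * b + c) mod M = hF (Suc i)" by (simp add: c_def)
    have "hP i * b mod M = (b ^ i * b) mod M"
      by (intro mod_mult_cong mod_mod_trivial HOL.refl)
    then show "hP i * b mod M = hP (Suc i)" by (simp add: mult.commute)
  qed
  have cb: "c < b" unfolding c_def by (rule b)
  have hM: "hR i < M" "hF i < M" "hP i < M" using M by simp_all
  have bounds: "c * hP i < 2 ^ w" "hR i + c * hP i < 2 ^ w" "hF i * b < 2 ^ w" "hF i * b + c < 2 ^ w"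
    "hP i * b < 2 ^ w" "Suc i < 2 ^ w" "Suc 0 < (2::nat) ^ w" "2 < (2::nat) ^ w" "c < 2 ^ w"
  proof -
    have 1: "c * hP i \<le> b * M" using cb hM by (intro mult_le_mono) auto
    have "hF i * b + b = Suc (hF i) * b" by simp
    also have "\<dots> \<le> M * b" by (rule mult_le_mono1[OF Suc_leI[OF hM(2)]])
    finally have 2: "hF i * b + b \<le> b * M" by (simp add: mult.commute)
    have "hP i * b \<le> M * b" by (rule mult_le_mono1[OF less_imp_le[OF hM(3)]])
    then have 3: "hP i * b \<le> b * M" by (simp add: mult.commute)
    show "c * hP i < 2 ^ w" "hR i + c * hP i < 2 ^ w" "hF i * b < 2 ^ w" "hF i * b + c < 2 ^ w"
      "hP i * b < 2 ^ w" "c < 2 ^ w" using 1 2 3 w(3,4) hM cb by linarith+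
    show "Suc i < 2 ^ w" "Suc 0 < (2::nat) ^ w" "2 < (2::nat) ^ w" using i w(2) by auto
  qed
  have old: "\<And>f x. f < 6 \<Longrightarrow> arr s f x < M"
    "\<And>x. x < Suc i \<Longrightarrow> i < x + Z \<Longrightarrow> arr s 0 (x mod Z) = hF x \<and> arr s 1 (x mod Z) = hR x \<and> arr s 2 (x mod Z) = hP x"
    "\<And>x. x < Suc i \<Longrightarrow> g dvd x \<Longrightarrow> arr s 3 (x div g) = hF x \<and> arr s 4 (x div g) = hR x \<and> arr s 5 (x div g) = hP x"
    using e by (auto simp: env_def)
  have upd: "wp w X R update_c (\<lambda>s'. env (Suc i) (Suc i) s' \<and> view s' = view s) s1"
    if s1: "vars s1 26 = c" "\<And>x. x \<noteq> 26 \<Longrightarrow> vars s1 x = vars s x" "arr s1 = arr s" "inp s1 = drop (Suc i) S"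
      "outp s1 = outp s" "tape s1 = tape s" for s1
  proof -
    let ?s' = "s1\<lparr>vars := (vars s1)(20 := hR (Suc i), 19 := hF (Suc i), 21 := hP (Suc i), 17 := Suc i)\<rparr>"
    have "env (Suc i) (Suc i) ?s'"
      unfolding env_def using old v by (simp add: s1 del: fwd_hash.simps rev_hash.simps power_Suc)
    moreover have "view ?s' = view s" by (simp add: view_def s1)
    ultimately show ?thesis
      unfolding update_c_def
      by (simp add: s1 v bounds hs del: fwd_hash.simps rev_hash.simps power_Suc)
  qed
  show ?thesis
  proof (cases "i < n")
    case True
    then have inp: "inp s = S ! i # drop (Suc i) S" using v n by (simp add: Cons_nth_drop_Suc)
    have c: "c = S ! i + 2" using True n by (simp add: c_def code_def)
    then have S: "S ! i < 2 ^ w" "Suc (Suc (S ! i)) < 2 ^ w" using bounds(9) by auto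
    have "wp w X R update_c (\<lambda>s'. env (Suc i) (Suc i) s' \<and> view s' = view s)
      (set_var (set_var (s\<lparr>inp := drop (Suc i) S\<rparr>) 26 (S ! i)) 26 (S ! i + 2))"
      by (rule upd) (auto simp: c)
    then show ?thesis
      unfolding read_c_def using True inp bounds(8) S by (simp add: v)
  next
    case False
    then have inp: "inp s = drop (Suc i) S" using v n by simp
    have c: "c = 1" using False n by (simp add: c_def code_def)
    have "wp w X R update_c (\<lambda>s'. env (Suc i) (Suc i) s' \<and> view s' = view s) (set_var s 26 1)"
      by (rule upd) (auto simp: c inp)
    then show ?thesis
      unfolding read_c_def using False bounds(7) by (simp add: v)
  qed
qed

lemma terminates_round:
  assumes e: "env i i s" and i: "i \<le> n + W" and sh: "shape W H (i - 1) (i - 1 - W) (view s)"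
    and gl: "\<And>j. arr s 7 j \<le> arr s 8 j"
  shows "terminates w X R round_c s ((W div g + 2 + (if g dvd i then 2 * W + 2 else 0)) * com_size round_c)
    (\<lambda>s'. env (Suc i) (Suc i) s' \<and> view s' = track_step W H g ok i (view s))"
proof -
  define s1 where "s1 = alive_step W H ok i (view s)"
  define s2 where "s2 = centre_step W H g ok i s1"
  have sh0: "shape W H i (i - 1 - W) (view s)" using sh by (rule shape_mono) simp
  have sh1: "shape W H i (i - 1 - W) s1" unfolding s1_def by (rule shape_alive_step[OF sh0])
  have sh2: "shape W H i (i - W) s2" unfolding s2_def by (rule shape_centre_step[OF sh1])
  have gl1: "gap s1 j \<le> lst s1 j" for j using gl by (simp add: s1_def)
  let ?t = "com_size store_c + (com_size alive_c + ((W div g + 1) * com_size centre_c +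
      ((if g dvd i then 2 * W + 2 else 1) * com_size scan_c + com_size read_c)))"
  have "terminates w X R round_c s ?t
    (\<lambda>s'. env (Suc i) (Suc i) s' \<and> view s' = scan_step g ok i s2)"
    unfolding round_c_def
  proof (rule terminates_Seq[OF terminates_wp[OF wp_store[OF e i]]])
    fix a assume a: "env (Suc i) i a \<and> view a = view s"
    show "terminates w X R (alive_c ;; centre_c ;; scan_c ;; read_c) a
      (com_size alive_c + ((W div g + 1) * com_size centre_c +
      ((if g dvd i then 2 * W + 2 else 1) * com_size scan_c + com_size read_c)))
      (\<lambda>s'. env (Suc i) (Suc i) s' \<and> view s' = scan_step g ok i s2)"
    proof (rule terminates_Seq[OF terminates_wp[OF wp_alive[where i = i and k = "i - 1 - W"]]])
      fix c assume c: "env (Suc i) i c \<and> view c = alive_step W H ok i (view a)"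
      then have vc: "view c = s1" using a by (simp add: s1_def)
      show "terminates w X R (centre_c ;; scan_c ;; read_c) c
        ((W div g + 1) * com_size centre_c +
        ((if g dvd i then 2 * W + 2 else 1) * com_size scan_c + com_size read_c))
        (\<lambda>s'. env (Suc i) (Suc i) s' \<and> view s' = scan_step g ok i s2)"
      proof (rule terminates_Seq[OF terminates_centre[where i = i]])
        show "arr c 7 j \<le> arr c 8 j" for j using gl1[of j] vc by (metis view_simps(3,4))
        fix d assume d: "env (Suc i) i d \<and> view d = centre_step W H g ok i (view c)"
        then have vd: "view d = s2" using vc by (simp add: s2_def)
        show "terminates w X R (scan_c ;; read_c) d
          ((if g dvd i then 2 * W + 2 else 1) * com_size scan_c + com_size read_c)
          (\<lambda>s'. env (Suc i) (Suc i) s' \<and> view s' = scan_step g ok i s2)"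
        proof (rule terminates_Seq[OF terminates_scan[where i = i]])
          fix f assume f: "env (Suc i) i f \<and> view f = scan_step g ok i (view d)"
          then have "wp w X R read_c (\<lambda>s'. env (Suc i) (Suc i) s' \<and> view s' = view f) f"
            using i by (intro wp_read) auto
          with f vd show "terminates w X R read_c f (com_size read_c)
            (\<lambda>s'. env (Suc i) (Suc i) s' \<and> view s' = scan_step g ok i s2)"
            by (intro terminates_wp) simp
        qed (use d vd sh2 i in auto)
      qed (use c vc sh1 i in auto)
    qed (use a sh0 i in auto)
  qed
  then show ?thesis
  proof (rule terminates_mono)
    define m where "m = W div g + 2 + (if g dvd i then 2 * W + 2 else 0)"
    have m: "1 \<le> m" "W div g + 1 \<le> m" "(if g dvd i then 2 * W + 2 else 1) \<le> m" by (auto simp: m_def)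
    have "1 * com_size store_c \<le> m * com_size store_c" "1 * com_size alive_c \<le> m * com_size alive_c"
      "1 * com_size read_c \<le> m * com_size read_c" by (rule mult_le_mono1[OF m(1)])+
    moreover note mult_le_mono1[OF m(2), of "com_size centre_c"] mult_le_mono1[OF m(3), of "com_size scan_c"]
    moreover have "m * com_size round_c = m * com_size store_c + (m * com_size alive_c + (m * com_size centre_c +
      (m * com_size scan_c + m * com_size read_c)))" by (simp add: round_c_def distrib_left)
    ultimately show "?t \<le> (W div g + 2 + (if g dvd i then 2 * W + 2 else 0)) * com_size round_c"
      unfolding m_def[symmetric] by linarith
  qed (simp add: track_step_def s1_def s2_def)
qed

end

definition empty_trk :: tracker where
  "empty_trk = \<lparr>cnt = 0, ffst = \<lambda>_. 0, gap = \<lambda>_. 0, lst = \<lambda>_. 0, lft = \<lambda>_. 0, rgt = \<lambda>_. 0, mid = \<lambda>_. 0,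
    est = \<lambda>_. 0, rep = []\<rparr>"

text \<open>The value at \<open>i\<close> is the tracker before round \<open>i\<close>. Round 0
  leaves the empty tracker as it is, by \<open>track_step_0\<close>.\<close>

primrec tracked :: "nat \<Rightarrow> nat \<Rightarrow> nat \<Rightarrow> (nat \<Rightarrow> nat \<Rightarrow> bool) \<Rightarrow> nat \<Rightarrow> tracker" where
  "tracked W H g chk 0 = empty_trk"
| "tracked W H g chk (Suc i) = track_step W H g chk i (tracked W H g chk i)"

section \<open>All rounds, and the report of the records\<close>

lemma shape_tracked: "shape W H (i - 1) (i - 1 - W) (tracked W H g chk i)"
proof (induction i)
  case 0
  then show ?case using shape_empty[of empty_trk W H 0] by (simp add: empty_tracker_def empty_trk_def)
next
  case (Suc i)
  from shape_track_step[OF this] show ?case by simp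
qed

lemma gap_le_tracked: "gap (tracked W H g chk i) j \<le> lst (tracked W H g chk i) j"
proof (induction i arbitrary: j)
  case (Suc i)
  then show ?case by (simp add: gap_le_track_step)
qed (simp add: empty_trk_def)

lemma (in faithful) good_tracked:
  "i \<le> n + W \<Longrightarrow> good i (i - W) (g * (i div g)) (tracked W H g chk (Suc i))"
proof (induction i)
  case 0
  have "good 0 0 0 empty_trk" by (rule good_empty) (simp add: empty_tracker_def empty_trk_def)
  then show ?case using track_step_0[of empty_trk] by (simp add: empty_trk_def)
next
  case (Suc i)
  have "good (Suc i) (Suc i - W) (g * (Suc i div g)) (track_step W H g chk (Suc i) (tracked W H g chk (Suc i)))"
    by (rule track_good) (use Suc in auto)
  then show ?case by simp
qed

lemma lst_less_ffst:
  assumes sh: "shape W H i k s" and "1 \<le> j" "j < j'" "j' \<le> cnt s"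
  shows "lst s j < ffst s j'"
  using assms(3,4)
proof (induction j')
  case (Suc j')
  have step: "lst s j' < ffst s (Suc j')" if "1 \<le> j'" using sh Suc.prems that unfolding shape_def by fastforce
  show ?case
  proof (cases "j = j'")
    case True
    then show ?thesis using step assms(2) by simp
  next
    case False
    then have "lst s j < ffst s j'" using Suc by simp
    also have "\<dots> \<le> lst s j'" using shapeD(2)[OF sh, of j'] Suc.prems assms(2) False by simp
    also have "\<dots> < ffst s (Suc j')" using step Suc.prems assms(2) by simp
    finally show ?thesis .
  qed
qed simp

text \<open>The intervals from \<open>ffst s j\<close> to \<open>lst s j\<close> are disjoint, so
  bounding the report of each record by the length of its interval still costs \<open>O(n)\<close>
  in total.\<close>

lemma sum_lengths:
  assumes sh: "shape W H i k s" and "1 \<le> W"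
  shows "c \<le> cnt s \<Longrightarrow> (\<Sum>j=1..c. lst s j + 2 - ffst s j) \<le> k + c"
proof (cases "c = 0")
  case False
  assume c: "c \<le> cnt s"
  from False have "1 \<le> c" by simp
  then have "(\<Sum>j=1..c. lst s j + 2 - ffst s j) \<le> lst s c + c"
    using c
  proof (induction c rule: nat_induct_at_least)
    case base
    then show ?case using shapeD(1)[OF sh, of 1] assms(2) by simp
  next
    case (Suc c)
    have "lst s c < ffst s (Suc c)" using Suc by (intro lst_less_ffst[OF sh]) auto
    moreover have "ffst s (Suc c) \<le> lst s (Suc c)" using shapeD(2)[OF sh, of "Suc c"] Suc.prems by simp
    ultimately show ?case using Suc by simp
  qed
  also have "\<dots> \<le> k + c" using shapeD(3)[OF sh, of c] c \<open>1 \<le> c\<close> by simp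
  finally show ?thesis .
qed simp

text \<open>A gap of 0 would not advance variable 25, so a single centre sends it beyond
  \<open>lst\<close> and thereby ends the loop.\<close>

definition inner_body :: com where
  "inner_body = Cond (Var 25 =\<^sub>e Arr 11 (Var 24)) (Output (Var 25) (Arr 12 (Var 24)))
     (Cond (Var 25 -\<^sub>e Arr 9 (Var 24) \<le>\<^sub>e Arr 10 (Var 24) -\<^sub>e Var 25)
       (Output (Var 25) (Var 25 -\<^sub>e Arr 9 (Var 24))) (Output (Var 25) (Arr 10 (Var 24) -\<^sub>e Var 25))) ;;
    Cond (Arr 7 (Var 24)) (Assign 25 (Var 25 +\<^sub>e Arr 7 (Var 24))) (Assign 25 (Arr 8 (Var 24) +\<^sub>e Num 1))"

definition inner_c :: com where
  "inner_c = While (Var 25 \<le>\<^sub>e Arr 8 (Var 24)) inner_body"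

definition outer_body :: com where
  "outer_body = Assign 25 (Arr 6 (Var 24)) ;; inner_c ;; Assign 24 (Var 24 -\<^sub>e Num 1)"

definition report_c :: com where
  "report_c = Assign 24 (Var 22) ;; While (Var 24) outer_body"

definition main_c :: com where
  "main_c = While (Var 17 <\<^sub>e Var 18) round_c"

lemma card_multiples: "0 < g \<Longrightarrow> card {i. i < N \<and> g dvd i} \<le> N div g + 1"
proof -
  assume "0 < g"
  have "{i. i < N \<and> g dvd i} \<subseteq> (\<lambda>q. g * q) ` {..N div g}"
  proof
    fix i assume "i \<in> {i. i < N \<and> g dvd i}"
    then have "i = g * (i div g)" "i div g \<le> N div g" by (auto intro: div_le_mono)
    then show "i \<in> (\<lambda>q. g * q) ` {..N div g}" by blast
  qed
  then have "card {i. i < N \<and> g dvd i} \<le> card ((\<lambda>q. g * q) ` {..N div g})" by (intro card_mono) auto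
  also have "\<dots> \<le> card {..N div g}" by (rule card_image_le) simp
  finally show ?thesis by simp
qed

context machine
begin

lemma terminates_main:
  assumes e: "env 0 0 s" and v: "view s = empty_trk"
  shows "terminates w X R main_c s
    (((n + W + 2) * (W div g + 4) + (2 * W + 2) * ((n + W + 1) div g + 1)) * (com_size round_c + expr_time (Var 17 <\<^sub>e Var 18)))
    (\<lambda>s'. view s' = tracked W H g ok (n + W + 1) \<and> tape s' = [])"
proof -
  let ?N = "n + W + 1"
  define I where "I k s \<longleftrightarrow> (\<exists>i. i + k = ?N \<and> env i i s \<and> view s = tracked W H g ok i)" for k :: nat and s
  define T where "T k = (W div g + 2 + (if g dvd ?N - k then 2 * W + 2 else 0)) * com_size round_c" for k
  let ?e = "Var 17 <\<^sub>e Var 18"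
  have "terminates w X R main_c s ((\<Sum>j=1..?N. T j + (expr_time ?e + 2)) + expr_time ?e + 1)
    (\<lambda>s'. (\<exists>k'. I k' s') \<and> val ?e s' = 0)"
    unfolding main_c_def
  proof (rule terminates_While[where I = I])
    show "I ?N s" using e v by (auto simp: I_def)
  next
    fix k s assume "I k s" "val ?e s \<noteq> 0"
    then obtain i where i: "i + k = ?N" "env i i s" "view s = tracked W H g ok i" "i < ?N"
      by (auto simp: I_def env_vars)
    have "terminates w X R round_c s ((W div g + 2 + (if g dvd i then 2 * W + 2 else 0)) * com_size round_c)
      (\<lambda>s'. env (Suc i) (Suc i) s' \<and> view s' = track_step W H g ok i (view s))"
    proof (rule terminates_round[OF i(2)])
      show "shape W H (i - 1) (i - 1 - W) (view s)" unfolding i(3) by (rule shape_tracked)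
      show "arr s 7 j \<le> arr s 8 j" for j
        using gap_le_tracked[of W H g ok i j] unfolding i(3)[symmetric] by simp
    qed (use i in simp)
    moreover have "?N - k = i" using i by simp
    ultimately have "terminates w X R round_c s (T k) (I (k - 1))"
      by (elim terminates_mono) (use i in \<open>auto simp: T_def I_def intro!: exI[of _ "Suc i"]\<close>)
    with i show "0 < k \<and> terminates w X R round_c s (T k) (I (k - 1))" by simp
  qed auto
  then show ?thesis
  proof (rule terminates_mono)
    fix s' assume "(\<exists>k'. I k' s') \<and> val ?e s' = 0"
    then obtain k' i where i: "i + k' = ?N" "env i i s'" "view s' = tracked W H g ok i" "val ?e s' = 0"
      unfolding I_def by blast
    then have "i = ?N" by (simp add: env_vars[OF i(2)])
    with i show "view s' = tracked W H g ok ?N \<and> tape s' = []"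
      using env_vars(14)[OF i(2)] by simp
  next
    \<comment> \<open>The loop rule counts the remaining rounds down. Indexing by the round
      \<open>i\<close> isolates the multiples of \<open>g\<close>, at which alone the records are
      scanned.\<close>
    have "(\<Sum>j=1..?N. T j) = (\<Sum>i<?N. T (?N - i))"
      by (rule sum.reindex_bij_witness[of _ "\<lambda>i. ?N - i" "\<lambda>j. ?N - j"]) auto
    also have "\<dots> = (\<Sum>i<?N. (W div g + 2) * com_size round_c + (if g dvd i then (2 * W + 2) * com_size round_c else 0))"
      by (intro sum.cong) (auto simp: T_def algebra_simps)
    also have "\<dots> = ?N * ((W div g + 2) * com_size round_c) +
        (\<Sum>i<?N. if g dvd i then (2 * W + 2) * com_size round_c else 0)"
      unfolding sum.distrib by (simp only: sum_constant card_lessThan of_nat_id)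
    also have "(\<Sum>i<?N. if g dvd i then (2 * W + 2) * com_size round_c else 0) =
        (\<Sum>i\<in>{i \<in> {..<?N}. g dvd i}. (2 * W + 2) * com_size round_c)"
      by (rule sum.inter_filter[symmetric]) simp
    also have "\<dots> = card {i \<in> {..<?N}. g dvd i} * ((2 * W + 2) * com_size round_c)"
      by (simp only: sum_constant of_nat_id)
    also have "{i \<in> {..<?N}. g dvd i} = {i. i < ?N \<and> g dvd i}" by auto
    also have "?N * ((W div g + 2) * com_size round_c) + card {i. i < ?N \<and> g dvd i} * ((2 * W + 2) * com_size round_c)
        \<le> ?N * ((W div g + 2) * com_size round_c) + (?N div g + 1) * ((2 * W + 2) * com_size round_c)"
      using g by (intro add_left_mono mult_le_mono1 card_multiples) simp
    finally have T: "(\<Sum>j=1..?N. T j) \<le> ?N * ((W div g + 2) * com_size round_c) + (?N div g + 1) * ((2 * W + 2) * com_size round_c)" .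
    define c where "c = com_size round_c"
    define x where "x = expr_time ?e"
    define a where "a = W div g"
    define d where "d = ?N div g"
    have c: "2 \<le> c" by (simp add: c_def round_c_def store_c_def)
    have "(\<Sum>j=1..?N. T j + (x + 2)) + x + 1 \<le> ?N * ((a + 2) * c) + (d + 1) * ((2 * W + 2) * c) + ?N * (x + 2) + x + 1"
      using T unfolding sum.distrib by (simp add: c_def a_def d_def)
    also have "\<dots> \<le> ?N * ((a + 2) * c) + (d + 1) * ((2 * W + 2) * c) + ?N * (x + c) + x + 1"
      using c by (intro add_mono mult_le_mono2 order.refl) simp
    also have "\<dots> \<le> ((n + W + 2) * (a + 4) + (2 * W + 2) * (d + 1)) * (c + x)"
      using c by (simp add: algebra_simps)
    finally show "(\<Sum>j=1..?N. T j + (expr_time ?e + 2)) + expr_time ?e + 1 \<le>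
      ((n + W + 2) * (W div g + 4) + (2 * W + 2) * (?N div g + 1)) * (com_size round_c + expr_time ?e)"
      unfolding c_def x_def a_def d_def .
  qed
qed

lemma terminates_inner:
  assumes t: "view s = t\<lparr>rep := outp s\<rparr>" and sh: "shape W H (n + W) n t" and gl: "\<And>j. gap t j \<le> lst t j"
    and j: "1 \<le> j" "j \<le> cnt t" "vars s 24 = j" "vars s 25 = ffst t j"
  shows "terminates w X R inner_c s ((lst t j + 2 - ffst t j) * com_size inner_c)
    (\<lambda>s'. arr s' = arr s \<and> vars s' 24 = j \<and> vars s' 22 = vars s 22 \<and> tape s' = tape s \<and>
      (\<exists>l. outp s' = outp s @ l \<and> distinct (map fst l) \<and> fst ` set l = members t j \<and>
        (\<forall>(m, e)\<in>set l. e = final_est t j m)))"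
proof -
  define I where "I k s' \<longleftrightarrow> arr s' = arr s \<and> vars s' 24 = j \<and> vars s' 22 = vars s 22 \<and> tape s' = tape s \<and>
      ffst t j \<le> vars s' 25 \<and> lst t j + 1 \<le> vars s' 25 + k \<and>
      (vars s' 25 \<le> lst t j \<longrightarrow> gap t j dvd vars s' 25 - ffst t j) \<and>
      (\<exists>l. outp s' = outp s @ l \<and> distinct (map fst l) \<and> fst ` set l = {x \<in> members t j. x < vars s' 25} \<and>
        (\<forall>(m, e)\<in>set l. e = final_est t j m))" for k :: nat and s' :: state
  note sj = shapeD[OF sh j(1,2)]
  have jX: "j \<le> X" using record_bound[OF sh j(1,2)] by (simp add: X)
  have av: "arr s 6 = ffst t" "arr s 7 = gap t" "arr s 8 = lst t" "arr s 9 = lft t" "arr s 10 = rgt t"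
    "arr s 11 = mid t" "arr s 12 = est t"
    using arg_cong[OF t, of ffst] arg_cong[OF t, of gap] arg_cong[OF t, of lst] arg_cong[OF t, of lft]
      arg_cong[OF t, of rgt] arg_cong[OF t, of mid] arg_cong[OF t, of est] by simp_all
  have wb: "5 * (n + W) + 5 < 2 ^ w" by (rule w(2))
  have b0: "Suc (mid t j) < 2 ^ w" "Suc (lst t j) < 2 ^ w" "Suc 0 < (2::nat) ^ w" "Suc (rgt t j) < 2 ^ w"
    "lst t j + lst t j < 2 ^ w"
    using sj wb by auto
  have "terminates w X R inner_c s ((lst t j + 1 - ffst t j + 1) * com_size inner_c)
    (\<lambda>s'. arr s' = arr s \<and> vars s' 24 = j \<and> vars s' 22 = vars s 22 \<and> tape s' = tape s \<and>
      (\<exists>l. outp s' = outp s @ l \<and> distinct (map fst l) \<and> fst ` set l = members t j \<and>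
        (\<forall>(m, e)\<in>set l. e = final_est t j m)))"
    unfolding inner_c_def
  proof (rule terminates_While_wp[where I = I])
    show "I (lst t j + 1 - ffst t j) s"
      unfolding I_def using j by (auto simp: members_def intro!: exI[of _ "[]"])
  next
    fix k s' assume "I k s'"
    then show "safe w X (Var 25 \<le>\<^sub>e Arr 8 (Var 24)) s'"
      using jX b0 by (simp add: I_def av)
  next
    fix k s' assume I: "I k s'" and "val (Var 25 \<le>\<^sub>e Arr 8 (Var 24)) s' \<noteq> 0"
    define m where "m = vars s' 25"
    define D where "D = gap t j"
    have ml: "m \<le> lst t j" using I \<open>val _ s' \<noteq> 0\<close> by (simp add: I_def av m_def)
    then have mm: "m \<in> members t j" using I by (simp add: I_def m_def members_def)
    obtain l where l: "outp s' = outp s @ l" "distinct (map fst l)" "fst ` set l = {x \<in> members t j. x < m}"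
      "\<forall>(m, e)\<in>set l. e = final_est t j m" using I by (auto simp: I_def m_def)
    define m' where "m' = (if D = 0 then lst t j + 1 else m + D)"
    define l' where "l' = l @ [(m, final_est t j m)]"
    have mlt: "m < m'" using ml by (simp add: m'_def)
    have new: "{x \<in> members t j. x < m'} = insert m {x \<in> members t j. x < m}"
    proof -
      have "x = m" if x: "x \<in> members t j" "x < m'" "\<not> x < m" for x
      proof (cases "D = 0")
        case True
        then show ?thesis using x mm by (simp add: members_def D_def)
      next
        case False
        have "D dvd x - ffst t j" "D dvd m - ffst t j" using x mm by (auto simp: members_def D_def)
        then have "D dvd (x - ffst t j) - (m - ffst t j)" by (rule dvd_diff_nat)
        then have "D dvd x - m" using mm x(3) by (simp add: members_def)
        then show ?thesis using x False dvd_imp_le[of D "x - m"] by (cases "x = m") (auto simp: m'_def)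
      qed
      then show ?thesis using mm mlt by auto
    qed
    have l': "distinct (map fst l')" "fst ` set l' = {x \<in> members t j. x < m'}" "\<forall>(m, e)\<in>set l'. e = final_est t j m"
      using l unfolding l'_def new by auto
    have dv: "D dvd m' - ffst t j" if "m' \<le> lst t j"
    proof -
      have "m' - ffst t j = (m - ffst t j) + D" using that mm by (auto simp: m'_def members_def split: if_splits)
      moreover have "D dvd m - ffst t j" using mm by (simp add: members_def D_def)
      then have "D dvd (m - ffst t j) + D" by (rule dvd_add) simp
      ultimately show ?thesis by (simp only:)
    qed
    define s2 where "s2 = s'\<lparr>vars := (vars s')(25 := m'), outp := outp s @ l'\<rparr>"
    have k: "k > 0" using I ml by (simp add: I_def m_def)
    have I2: "I (k - 1) s2"
      unfolding I_def s2_def using I k mlt l' dv mm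
      by (auto simp: I_def D_def[symmetric] m_def[symmetric] members_def)
    have sv: "vars s' 24 = j" "vars s' 25 = m" "arr s' = arr s" using I by (auto simp: I_def m_def)
    have fe: "final_est t j m = (if m = mid t j then est t j else if m - lft t j \<le> rgt t j - m then m - lft t j else rgt t j - m)"
      by (auto simp: final_est_def)
    have b1: "m + D < 2 ^ w" "Suc m < 2 ^ w" "Suc (rgt t j - m) < 2 ^ w"
      using ml gl[of j] b0 by (auto simp: D_def)
    have "wp w X R inner_body (\<lambda>s3. s3 = s2) s'"
      unfolding inner_body_def s2_def l'_def fe m'_def D_def
      using b1 b0 jX l(1) w(1)[simplified] by (auto simp: sv av D_def)
    moreover have "wp w X R inner_body (\<lambda>s3. s3 = s2) s' \<Longrightarrow> wp w X R inner_body (I (k - 1)) s'"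
      using I2 unfolding inner_body_def by (auto split: if_splits)
    ultimately show "k > 0 \<and> wp w X R inner_body (I (k - 1)) s'" using k by blast
  next
    fix k s' assume I: "I k s'" and z: "val (Var 25 \<le>\<^sub>e Arr 8 (Var 24)) s' = 0"
    then have "lst t j < vars s' 25" by (simp add: I_def av)
    then have "{x \<in> members t j. x < vars s' 25} = members t j" by (auto simp: members_def)
    with I show "arr s' = arr s \<and> vars s' 24 = j \<and> vars s' 22 = vars s 22 \<and> tape s' = tape s \<and>
      (\<exists>l. outp s' = outp s @ l \<and> distinct (map fst l) \<and> fst ` set l = members t j \<and>
        (\<forall>(m, e)\<in>set l. e = final_est t j m))" by (simp add: I_def)
  qed
  moreover have "lst t j + 1 - ffst t j + 1 = lst t j + 2 - ffst t j" using sj by simp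
  ultimately show ?thesis by (simp only:)
qed

lemma terminates_report:
  assumes t: "view s = t" and sh: "shape W H (n + W) n t" and gl: "\<And>j. gap t j \<le> lst t j"
  shows "terminates w X R report_c s ((n + 6 * W + 2) * com_size report_c)
    (\<lambda>s'. tape s' = tape s \<and> distinct (map fst (outp s')) \<and> fst ` set (outp s') = {1..n} \<and>
      (\<forall>(m, e)\<in>set (outp s'). (m, e) \<in> set (rep t) \<or> (\<exists>j\<in>{1..cnt t}. m \<in> members t j \<and> e = final_est t j m)))"
proof -
  define I where "I k s' \<longleftrightarrow> arr s' = arr s \<and> vars s' 24 = k \<and> k \<le> cnt t \<and> vars s' 22 = vars s 22 \<and> tape s' = tape s \<and>
      (\<exists>l. outp s' = rep t @ l \<and> distinct (map fst l) \<and> fst ` set l = (\<Union>j\<in>{k<..cnt t}. members t j) \<and>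
        (\<forall>(m, e)\<in>set l. \<exists>j\<in>{1..cnt t}. m \<in> members t j \<and> e = final_est t j m))" for k :: nat and s' :: state
  define T where "T k = (lst t k + 2 - ffst t k) * com_size inner_c +
      (com_size (Assign 25 (Arr 6 (Var 24))) + com_size (Assign 24 (Var 24 -\<^sub>e Num 1)))" for k
  define N where "N = cnt t"
  have NW: "N \<le> 2 * W"
  proof (cases "N = 0")
    case False
    then show ?thesis by (intro record_bound[OF sh]) (auto simp: N_def)
  qed simp
  have one: "Suc 0 < (2::nat) ^ w" using w(2) by auto
  have av: "arr s 6 = ffst t" using t by auto
  have body: "k > 0 \<and> terminates w X R outer_body s' (T k) (I (k - 1))"
    if I: "I k s'" and nz: "val (Var 24) s' \<noteq> 0" for k s'
  proof
    show k: "k > 0" using I nz by (simp add: I_def)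
    obtain l where l: "outp s' = rep t @ l" "distinct (map fst l)" "fst ` set l = (\<Union>j\<in>{k<..cnt t}. members t j)"
      "\<forall>(m, e)\<in>set l. \<exists>j\<in>{1..cnt t}. m \<in> members t j \<and> e = final_est t j m"
      and s': "arr s' = arr s" "vars s' 24 = k" "k \<le> cnt t" "vars s' 22 = vars s 22" "tape s' = tape s"
      using I unfolding I_def by blast
    define s1 where "s1 = set_var s' 25 (ffst t k)"
    have kX: "k \<le> X" using NW s'(3) by (simp add: X N_def)
    have v1: "view s1 = t\<lparr>rep := outp s1\<rparr>" by (simp add: s1_def view_def t[symmetric] s')
    have a: "wp w X R (Assign 25 (Arr 6 (Var 24))) (\<lambda>x. x = s1) s'"
      using s' kX by (simp add: s1_def av)
    have inner: "terminates w X R inner_c s1 ((lst t k + 2 - ffst t k) * com_size inner_c)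
     (\<lambda>s2. arr s2 = arr s \<and> vars s2 24 = k \<and> vars s2 22 = vars s 22 \<and> tape s2 = tape s \<and>
      (\<exists>l'. outp s2 = rep t @ l @ l' \<and> distinct (map fst l') \<and> fst ` set l' = members t k \<and>
        (\<forall>(m, e)\<in>set l'. e = final_est t k m)))"
      by (rule terminates_mono[OF terminates_inner[OF v1 sh gl, of k]]) (use k s' l(1) in \<open>auto simp: s1_def\<close>)
    have last: "wp w X R (Assign 24 (Var 24 -\<^sub>e Num 1)) (I (k - 1)) s2"
      if s2: "arr s2 = arr s \<and> vars s2 24 = k \<and> vars s2 22 = vars s 22 \<and> tape s2 = tape s \<and>
      (\<exists>l'. outp s2 = rep t @ l @ l' \<and> distinct (map fst l') \<and> fst ` set l' = members t k \<and>
        (\<forall>(m, e)\<in>set l'. e = final_est t k m))" for s2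
    proof -
      from s2 obtain l' where l': "outp s2 = rep t @ l @ l'" "distinct (map fst l')" "fst ` set l' = members t k"
        "\<forall>(m, e)\<in>set l'. e = final_est t k m" by blast
      have dj: "x \<notin> members t j" if "x \<in> members t k" "k < j" "j \<le> cnt t" for x j
        using lst_less_ffst[OF sh, of k j] k that by (auto simp: members_def)
      have disj: "fst ` set l \<inter> fst ` set l' = {}" unfolding l(3) l'(3) by (auto dest: dj)
      have "{k - 1<..cnt t} = insert k {k<..cnt t}" using k s'(3) by auto
      then have un: "fst ` set (l @ l') = (\<Union>j\<in>{k - 1<..cnt t}. members t j)"
        using l(3) l'(3) by auto
      have al: "\<forall>(m, e)\<in>set (l @ l'). \<exists>j\<in>{1..cnt t}. m \<in> members t j \<and> e = final_est t j m"
      proof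
        fix x assume "x \<in> set (l @ l')"
        then consider "x \<in> set l" | "x \<in> set l'" by auto
        then show "case x of (m, e) \<Rightarrow> \<exists>j\<in>{1..cnt t}. m \<in> members t j \<and> e = final_est t j m"
        proof cases
          case 2
          then have "fst x \<in> members t k" using l'(3) by blast
          with 2 l'(4) k s'(3) show ?thesis by (auto intro!: bexI[of _ k])
        qed (use l(4) in blast)
      qed
      have "distinct (map fst (l @ l'))" using disj l(2) l'(2) by auto
      then have "I (k - 1) (set_var s2 24 (k - 1))"
        unfolding I_def using s2 s'(3) un al l'(1) by (auto intro!: exI[of _ "l @ l'"])
      then show ?thesis using s2 one by simp
    qed
    have "terminates w X R outer_body s' (com_size (Assign 25 (Arr 6 (Var 24))) +
        ((lst t k + 2 - ffst t k) * com_size inner_c + com_size (Assign 24 (Var 24 -\<^sub>e Num 1)))) (I (k - 1))"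
      unfolding outer_body_def
      by (rule terminates_Seq[OF terminates_wp[OF a]]; hypsubst; rule terminates_Seq[OF inner]; rule terminates_wp; rule last)
    then show "terminates w X R outer_body s' (T k) (I (k - 1))"
      by (rule terminates_mono) (simp_all add: T_def)
  qed
  define s1 where "s1 = set_var s 24 N"
  have "vars s 22 = N" using t by (auto simp: N_def)
  then have a: "wp w X R (Assign 24 (Var 22)) (\<lambda>x. x = s1) s" by (simp add: s1_def)
  have loop: "terminates w X R (While (Var 24) outer_body) s1 ((\<Sum>j=1..N. T j + (expr_time (Var 24) + 2)) + expr_time (Var 24) + 1)
    (\<lambda>s'. (\<exists>k'. I k' s') \<and> val (Var 24) s' = 0)"
  proof (rule terminates_While[where I = I])
    show "I N s1" using t by (auto simp: I_def s1_def N_def view_def intro!: exI[of _ "[]"])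
  qed (use body in auto)
  have "terminates w X R report_c s (com_size (Assign 24 (Var 22)) +
      ((\<Sum>j=1..N. T j + (expr_time (Var 24) + 2)) + expr_time (Var 24) + 1))
    (\<lambda>s'. (\<exists>k'. I k' s') \<and> val (Var 24) s' = 0)"
    unfolding report_c_def
    by (rule terminates_Seq[OF terminates_wp[OF a]]) (use loop in simp)
  then show ?thesis
  proof (rule terminates_mono)
    fix s' assume "(\<exists>k'. I k' s') \<and> val (Var 24) s' = 0"
    then have I: "I 0 s'" by (auto simp: I_def)
    then obtain l where l: "outp s' = rep t @ l" "distinct (map fst l)" "fst ` set l = (\<Union>j\<in>{0<..cnt t}. members t j)"
      "\<forall>(m, e)\<in>set l. \<exists>j\<in>{1..cnt t}. m \<in> members t j \<and> e = final_est t j m" "tape s' = tape s"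
      unfolding I_def by blast
    have "{0<..cnt t} = {1..cnt t}" by auto
    then have l3: "fst ` set l = all_members t" unfolding all_members_def l(3) by simp
    have r: "distinct (map fst (rep t))" "fst ` set (rep t) \<inter> all_members t = {}"
      "fst ` set (rep t) \<union> all_members t = {1..n}" using sh unfolding shape_def by blast+
    have "fst ` set (outp s') = {1..n}" using r(3) l3 by (simp add: l(1) image_Un)
    moreover have "distinct (map fst (outp s'))" using r l3 l(2) by (auto simp: l(1))
    ultimately show "tape s' = tape s \<and> distinct (map fst (outp s')) \<and> fst ` set (outp s') = {1..n} \<and>
      (\<forall>(m, e)\<in>set (outp s'). (m, e) \<in> set (rep t) \<or> (\<exists>j\<in>{1..cnt t}. m \<in> members t j \<and> e = final_est t j m))"
      using l(4,5) l(1) by auto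
  next
    define c where "c = com_size inner_c"
    define c2 where "c2 = com_size (Assign 25 (Arr 6 (Var 24))) + com_size (Assign 24 (Var 24 -\<^sub>e Num 1))"
    have "(\<Sum>j=1..N. T j) = (\<Sum>j=1..N. lst t j + 2 - ffst t j) * c + N * c2"
      unfolding T_def sum.distrib c_def[symmetric] c2_def[symmetric] by (simp add: sum_distrib_right)
    also have "\<dots> \<le> (n + N) * c + N * c2"
      using sum_lengths[OF sh W(1), of N] by (intro add_mono mult_le_mono1) (auto simp: N_def)
    finally have S: "(\<Sum>j=1..N. T j) \<le> (n + N) * c + N * c2" .
    have R: "com_size report_c = 8 + (c + c2)"
      by (simp add: report_c_def outer_body_def c_def c2_def)
    have "(n + N) * c \<le> (n + 6 * W + 2) * c" "N * c2 \<le> (n + 6 * W + 2) * c2" "N * 4 \<le> (n + 6 * W + 2) * 4"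
      by (rule mult_le_mono1, use NW in simp)+
    moreover have "(n + 6 * W + 2) * com_size report_c = (n + 6 * W + 2) * c + (n + 6 * W + 2) * c2 + (n + 6 * W + 2) * 8"
      unfolding R by (simp add: distrib_left)
    ultimately show "com_size (Assign 24 (Var 22)) + ((\<Sum>j=1..N. T j + (expr_time (Var 24) + 2)) + expr_time (Var 24) + 1)
      \<le> (n + 6 * W + 2) * com_size report_c"
      using S unfolding sum.distrib by (simp add: algebra_simps)
  qed
qed

end

section \<open>Initialisation\<close>

text \<open>Parameters: \<open>2 ^ a\<close> bounds the letters in units of \<open>floorlog 2 n\<close> bits, \<open>A\<close> scales the range \<open>R\<close> of
  the random numbers, \<open>K\<close> scales the number of draws per prime and \<open>r\<close> is the number of primes.\<close>

definition width_c :: com where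
  "width_c = Assign 2 (Num 1) ;; While (Var 2 *\<^sub>e Var 2 \<le>\<^sub>e Var 0) (Assign 2 (Var 2 +\<^sub>e Num 1))"

text \<open>Halving \<open>n\<close> down to 0 takes \<open>floorlog 2 n\<close> rounds, which
  yields this number in variable 7 and the base in variable 6. The initial factor 4 makes room for
  the shift of the letters by 2.\<close>

definition base_c :: "nat \<Rightarrow> com" where
  "base_c a = Assign 8 (Var 0) ;; Assign 6 (Num 4) ;;
    While (Var 8) (Assign 8 (Var 8 div\<^sub>e Num 2) ;; Assign 6 (Var 6 *\<^sub>e Num (2 ^ a)) ;; Assign 7 (Var 7 +\<^sub>e Num 1))"

definition consts_c :: "nat \<Rightarrow> nat \<Rightarrow> nat \<Rightarrow> com" where
  "consts_c A K r = Assign 3 (Var 1 div\<^sub>e Var 2) ;; Cond (Var 3) Skip (Assign 3 (Num 1)) ;;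
    Assign 4 (Var 2 div\<^sub>e Num 2) ;; Assign 5 (Num 3 *\<^sub>e Var 2 +\<^sub>e Num 1) ;;
    Assign 9 (Num A *\<^sub>e Var 0 *\<^sub>e Var 2) ;; Assign 10 (Num K *\<^sub>e Var 7 *\<^sub>e Var 7) ;;
    Assign 18 (Var 0 +\<^sub>e Var 2 +\<^sub>e Num 1) ;; Assign 11 (Num 1) ;; Assign 12 (Num r)"

section \<open>Random primes by trial division\<close>

definition trial_e :: expr where
  "trial_e = (Var 16 *\<^sub>e Var 16 \<le>\<^sub>e Var 15 \<and>\<^sub>e Var 15 mod\<^sub>e Var 16)"

definition draw_c :: com where
  "draw_c = Draw 15 9 ;; Assign 16 (Num 2) ;; While trial_e (Assign 16 (Var 16 +\<^sub>e Num 1)) ;;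
    Cond (Num 2 \<le>\<^sub>e Var 15 \<and>\<^sub>e Var 15 <\<^sub>e Var 16 *\<^sub>e Var 16) (Assign 13 (Var 15)) Skip ;;
    Assign 14 (Var 14 -\<^sub>e Num 1)"

definition chunk_c :: com where
  "chunk_c = Assign 13 (Num 1) ;; Assign 14 (Var 10) ;; While (Var 14) draw_c ;;
    Assign 11 (Var 11 *\<^sub>e Var 13) ;; Assign 12 (Var 12 -\<^sub>e Num 1)"

definition modulus_c :: com where
  "modulus_c = While (Var 12) chunk_c ;; Assign 21 (Num 1 mod\<^sub>e Var 11)"

text \<open>If the search stopped because of \<open>x < d * d\<close>, a composite \<open>x\<close>
  would have a factor below \<open>d\<close>. A prime divisible by \<open>d\<close> equals
  \<open>d\<close>, hence is below \<open>d * d\<close>. The condition \<open>2 \<le> x\<close>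
  handles 0 and 1.\<close>

lemma prime_trial:
  fixes x d :: nat
  assumes "2 \<le> d" "\<And>c. 2 \<le> c \<Longrightarrow> c < d \<Longrightarrow> \<not> c dvd x" "x < d * d \<or> d dvd x"
  shows "2 \<le> x \<and> x < d * d \<longleftrightarrow> prime x"
proof
  assume x: "2 \<le> x \<and> x < d * d"
  show "prime x"
  proof (rule ccontr)
    assume "\<not> prime x"
    then obtain c where c: "c dvd x" "c \<noteq> 1" "c \<noteq> x" using x by (auto simp: prime_nat_iff)
    then obtain e where e: "x = c * e" by (auto elim: dvdE)
    have ce: "2 \<le> c" "2 \<le> e" using c e x by (cases c; cases e; force)+
    have "min c e * min c e \<le> c * e" by (intro mult_le_mono) auto
    also have "\<dots> < d * d" using x e by simp
    finally have "min c e < d" by (meson mult_le_mono not_le)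
    moreover have "min c e dvd x" "2 \<le> min c e" using e ce by (auto simp: min_def)
    ultimately show False using assms(2) by blast
  qed
next
  assume p: "prime x"
  show "2 \<le> x \<and> x < d * d"
  proof (rule ccontr)
    assume "\<not> ?thesis"
    with p assms(1,3) have "d dvd x" "d * d \<le> x" by (auto simp: prime_ge_2_nat)
    with p assms(1) have "d = x" by (auto simp: prime_nat_iff)
    with \<open>d * d \<le> x\<close> assms(1) show False by (cases d) auto
  qed
qed

text \<open>The part of the state that the random phase does not touch.\<close>

definition others :: "state \<Rightarrow> state \<Rightarrow> bool" where
  "others s s' \<longleftrightarrow> (\<forall>x. x \<notin> {11, 12, 13, 14, 15, 16, 21} \<longrightarrow> vars s' x = vars s x) \<and> arr s' = arr s \<and>
     inp s' = inp s \<and> outp s' = outp s"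

lemma others_trans: "others s s' \<Longrightarrow> others s' s'' \<Longrightarrow> others s s''"
  unfolding others_def by auto

lemma terminates_draw:
  assumes w: "1 \<le> w" "Y * Y + Y + 5 < 2 ^ w" and R: "R \<le> Y * Y" "2 \<le> Y"
    and s: "tape s = x # \<omega>" "vars s 9 = R" "x < R"
  shows "terminates w X R draw_c s ((Y + 1) * com_size draw_c)
    (\<lambda>s'. others s s' \<and> tape s' = \<omega> \<and> vars s' 11 = vars s 11 \<and> vars s' 12 = vars s 12 \<and>
      vars s' 13 = (if prime x then x else vars s 13) \<and> vars s' 14 = vars s 14 - 1)"
proof -
  define s1 where "s1 = set_var (set_var (s\<lparr>tape := \<omega>\<rparr>) 15 x) 16 2"
  define I where "I k s' \<longleftrightarrow> (\<exists>d. s' = set_var s1 16 d \<and> 2 \<le> d \<and> d \<le> Y \<and> Y \<le> d + k \<and>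
    (\<forall>c. 2 \<le> c \<and> c < d \<longrightarrow> \<not> c dvd x))" for k :: nat and s' :: state
  have w2: "2 < (2::nat) ^ w" "Suc 0 < (2::nat) ^ w" using w(2) R(2) by auto
  have xw: "x < 2 ^ w" "Suc x < 2 ^ w" using s(3) R w(2) by auto
  have dd: "d * d < 2 ^ w" "Suc (d * d) < 2 ^ w" "Suc d < 2 ^ w" if "d \<le> Y" for d
    using mult_le_mono[OF that that] that w(2) by auto
  have loop: "terminates w X R (While trial_e (Assign 16 (Var 16 +\<^sub>e Num 1))) s1
    ((Y - 2 + 1) * com_size (While trial_e (Assign 16 (Var 16 +\<^sub>e Num 1))))
    (\<lambda>s'. \<exists>d. s' = set_var s1 16 d \<and> d \<le> Y \<and> (2 \<le> x \<and> x < d * d \<longleftrightarrow> prime x))"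
  proof (rule terminates_While_wp[where I = I])
    have "s1 = set_var s1 16 2" by (simp add: s1_def)
    then show "I (Y - 2) s1" unfolding I_def using R(2) by (intro exI[of _ 2]) auto
  next
    fix k s' assume "I k s'"
    then obtain d where "s' = set_var s1 16 d" "d \<le> Y" unfolding I_def by blast
    then show "safe w X trial_e s'" using dd[of d] xw w(1) by (simp add: trial_e_def s1_def)
  next
    fix k s' assume "I k s'" and nz: "val trial_e s' \<noteq> 0"
    then obtain d where d: "s' = set_var s1 16 d" "2 \<le> d" "d \<le> Y" "Y \<le> d + k"
      "\<forall>c. 2 \<le> c \<and> c < d \<longrightarrow> \<not> c dvd x" unfolding I_def by blast
    have x: "d * d \<le> x" "\<not> d dvd x" using nz d(1) by (auto simp: trial_e_def s1_def dvd_eq_mod_eq_0)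
    have "d < Y"
    proof (rule ccontr)
      assume "\<not> d < Y"
      then have "Y * Y \<le> d * d" by (intro mult_le_mono) auto
      with x(1) s(3) R(1) show False by simp
    qed
    then have "I (k - 1) (set_var s1 16 (Suc d))"
      unfolding I_def using d x by (intro exI[of _ "Suc d"]) (auto simp: less_Suc_eq)
    moreover have "wp w X R (Assign 16 (Var 16 +\<^sub>e Num 1)) (\<lambda>s2. s2 = set_var s1 16 (Suc d)) s'"
      using d(1) dd[of d] d(3) w2 by (simp add: s1_def)
    ultimately show "k > 0 \<and> wp w X R (Assign 16 (Var 16 +\<^sub>e Num 1)) (I (k - 1)) s'"
      using \<open>d < Y\<close> d(4) by auto
  next
    fix k s' assume "I k s'" and z: "val trial_e s' = 0"
    then obtain d where d: "s' = set_var s1 16 d" "2 \<le> d" "d \<le> Y"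
      "\<forall>c. 2 \<le> c \<and> c < d \<longrightarrow> \<not> c dvd x" unfolding I_def by blast
    have "x < d * d \<or> d dvd x" using z d(1) by (auto simp: trial_e_def s1_def dvd_eq_mod_eq_0)
    with d show "\<exists>d. s' = set_var s1 16 d \<and> d \<le> Y \<and> (2 \<le> x \<and> x < d * d \<longleftrightarrow> prime x)"
      by (intro exI[of _ d] conjI prime_trial) auto
  qed
  have first: "wp w X R (Draw 15 9 ;; Assign 16 (Num 2)) (\<lambda>s'. s' = s1) s"
    using s w2 by (simp add: s1_def)
  define rest where "rest = (Cond (Num 2 \<le>\<^sub>e Var 15 \<and>\<^sub>e Var 15 <\<^sub>e Var 16 *\<^sub>e Var 16) (Assign 13 (Var 15)) Skip ;;
    Assign 14 (Var 14 -\<^sub>e Num 1))"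
  have last: "wp w X R rest (\<lambda>s'. others s s' \<and> tape s' = \<omega> \<and> vars s' 11 = vars s 11 \<and> vars s' 12 = vars s 12 \<and>
      vars s' 13 = (if prime x then x else vars s 13) \<and> vars s' 14 = vars s 14 - 1) s'"
    if "\<exists>d. s' = set_var s1 16 d \<and> d \<le> Y \<and> (2 \<le> x \<and> x < d * d \<longleftrightarrow> prime x)" for s'
  proof -
    from that obtain d where d: "s' = set_var s1 16 d" "d \<le> Y" "2 \<le> x \<and> x < d * d \<longleftrightarrow> prime x" by blast
    show ?thesis
      unfolding rest_def using d(2,3) dd[of d] xw w w2
      by (auto simp: d(1) s1_def others_def)
  qed
  have "terminates w X R draw_c s (com_size (Draw 15 9) + (com_size (Assign 16 (Num 2)) +
      ((Y - 2 + 1) * com_size (While trial_e (Assign 16 (Var 16 +\<^sub>e Num 1))) + com_size rest)))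
    (\<lambda>s'. others s s' \<and> tape s' = \<omega> \<and> vars s' 11 = vars s 11 \<and> vars s' 12 = vars s 12 \<and>
      vars s' 13 = (if prime x then x else vars s 13) \<and> vars s' 14 = vars s 14 - 1)"
  proof -
    have 1: "wp w X R (Draw 15 9) (\<lambda>s'. wp w X R (Assign 16 (Num 2)) (\<lambda>s'. s' = s1) s') s" using first by simp
    show ?thesis
      unfolding draw_c_def rest_def[symmetric]
      by (rule terminates_Seq[OF terminates_wp[OF 1]], rule terminates_Seq[OF terminates_wp], assumption,
          hypsubst, rule terminates_Seq[OF loop], rule terminates_wp, rule last)
  qed
  then show ?thesis
  proof (rule terminates_mono)
    define c where "c = com_size (While trial_e (Assign 16 (Var 16 +\<^sub>e Num 1)))"
    have "(Y - 2 + 1) * c \<le> (Y + 1) * c" by (intro mult_le_mono1) simp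
    moreover have "com_size draw_c = com_size (Draw 15 9) + com_size (Assign 16 (Num 2)) + c + com_size rest"
      by (simp add: draw_c_def rest_def c_def)
    ultimately show "com_size (Draw 15 9) + (com_size (Assign 16 (Num 2)) +
      ((Y - 2 + 1) * com_size (While trial_e (Assign 16 (Var 16 +\<^sub>e Num 1))) + com_size rest)) \<le> (Y + 1) * com_size draw_c"
      unfolding c_def[symmetric] by (simp add: algebra_simps)
  qed
qed

lemma terminates_chunk:
  assumes w: "1 \<le> w" "Y * Y + Y + 5 < 2 ^ w" and R: "R \<le> Y * Y" "2 \<le> Y"
    and s: "set (tape s) \<subseteq> {..<R}" "T \<le> length (tape s)" "vars s 9 = R" "vars s 10 = T"
    and M: "vars s 11 * max 1 R < 2 ^ w"
  shows "terminates w X R chunk_c s ((T + 1) * (Y + 2) * com_size chunk_c)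
    (\<lambda>s'. others s s' \<and> tape s' = drop T (tape s) \<and> vars s' 11 = vars s 11 * last_prime (take T (tape s)) \<and>
      vars s' 12 = vars s 12 - 1)"
proof -
  define s1 where "s1 = set_var (set_var s 13 1) 14 T"
  define f where "f = (\<lambda>x q. if prime x then x else q :: nat)"
  define I where "I k s' \<longleftrightarrow> k \<le> T \<and> others s s' \<and> tape s' = drop (T - k) (tape s) \<and> vars s' 14 = k \<and>
    vars s' 11 = vars s 11 \<and> vars s' 12 = vars s 12 \<and>
    vars s' 13 = fold f (take (T - k) (tape s)) 1" for k :: nat and s' :: state
  have w2: "2 < (2::nat) ^ w" "Suc 0 < (2::nat) ^ w" using w(2) by auto
  have loop: "terminates w X R (While (Var 14) draw_c) s1
    ((\<Sum>j=1..T. (Y + 1) * com_size draw_c + (expr_time (Var 14) + 2)) + expr_time (Var 14) + 1)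
    (\<lambda>s'. (\<exists>k. I k s') \<and> val (Var 14) s' = 0)"
  proof (rule terminates_While[where I = I])
    show "I T s1" by (simp add: I_def s1_def others_def)
  next
    fix k s' assume I: "I k s'" and nz: "val (Var 14) s' \<noteq> 0"
    then have k: "0 < k" "k \<le> T" by (auto simp: I_def)
    define p where "p = T - k"
    have p: "p < length (tape s)" "T - (k - 1) = Suc p" using k s(2) by (auto simp: p_def)
    have tp: "tape s' = tape s ! p # drop (Suc p) (tape s)"
      using I p by (simp add: I_def p_def[symmetric] Cons_nth_drop_Suc)
    have "tape s ! p < R" using s(1) p(1) nth_mem by blast
    moreover have "vars s' 9 = R" using I s(3) by (simp add: I_def others_def)
    ultimately have "terminates w X R draw_c s' ((Y + 1) * com_size draw_c)
     (\<lambda>s''. others s' s'' \<and> tape s'' = drop (Suc p) (tape s) \<and> vars s'' 11 = vars s' 11 \<and> vars s'' 12 = vars s' 12 \<and>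
      vars s'' 13 = (if prime (tape s ! p) then tape s ! p else vars s' 13) \<and> vars s'' 14 = vars s' 14 - 1)"
      using terminates_draw[OF w R tp] by blast
    then have "terminates w X R draw_c s' ((Y + 1) * com_size draw_c) (I (k - 1))"
      by (rule terminates_mono)
        (use I k p others_trans in \<open>auto simp: I_def p_def[symmetric] take_Suc_conv_app_nth f_def\<close>)
    with k show "0 < k \<and> terminates w X R draw_c s' ((Y + 1) * com_size draw_c) (I (k - 1))" by simp
  qed simp
  have last: "wp w X R (Assign 11 (Var 11 *\<^sub>e Var 13) ;; Assign 12 (Var 12 -\<^sub>e Num 1))
    (\<lambda>s'. others s s' \<and> tape s' = drop T (tape s) \<and> vars s' 11 = vars s 11 * last_prime (take T (tape s)) \<and>
      vars s' 12 = vars s 12 - 1) s'" if "(\<exists>k. I k s') \<and> val (Var 14) s' = 0" for s'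
  proof -
    have I: "I 0 s'" using that by (auto simp: I_def)
    have "set (take T (tape s)) \<subseteq> {..<R}" using s(1) set_take_subset by fast
    from last_prime_bounds[OF this] have "vars s 11 * last_prime (take T (tape s)) \<le> vars s 11 * max 1 R"
      by (intro mult_le_mono2) simp
    then have "vars s 11 * last_prime (take T (tape s)) < 2 ^ w" using M by linarith
    moreover have "vars s' 13 = last_prime (take T (tape s))" using I by (simp add: I_def last_prime_def f_def)
    ultimately show ?thesis using I w2 by (simp add: I_def others_def)
  qed
  have "terminates w X R chunk_c s (com_size (Assign 13 (Num 1)) + (com_size (Assign 14 (Var 10)) +
     (((\<Sum>j=1..T. (Y + 1) * com_size draw_c + (expr_time (Var 14) + 2)) + expr_time (Var 14) + 1) +
      com_size (Assign 11 (Var 11 *\<^sub>e Var 13) ;; Assign 12 (Var 12 -\<^sub>e Num 1)))))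
    (\<lambda>s'. others s s' \<and> tape s' = drop T (tape s) \<and> vars s' 11 = vars s 11 * last_prime (take T (tape s)) \<and>
      vars s' 12 = vars s 12 - 1)"
  proof -
    have 1: "wp w X R (Assign 13 (Num 1)) (\<lambda>s'. wp w X R (Assign 14 (Var 10)) (\<lambda>s'. s' = s1) s') s"
      using s w2 by (simp add: s1_def)
    show ?thesis
      unfolding chunk_c_def
      by (rule terminates_Seq[OF terminates_wp[OF 1]], rule terminates_Seq[OF terminates_wp], assumption,
          hypsubst, rule terminates_Seq[OF loop], rule terminates_wp, rule last)
  qed
  then show ?thesis
  proof (rule terminates_mono)
    define c where "c = com_size draw_c"
    define c2 where "c2 = com_size (Assign 11 (Var 11 *\<^sub>e Var 13) ;; Assign 12 (Var 12 -\<^sub>e Num 1))"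
    have ch: "com_size chunk_c = 3 + 4 + (c + 4) + c2" by (simp add: chunk_c_def c_def c2_def)
    show "com_size (Assign 13 (Num 1)) + (com_size (Assign 14 (Var 10)) +
     (((\<Sum>j=1..T. (Y + 1) * com_size draw_c + (expr_time (Var 14) + 2)) + expr_time (Var 14) + 1) +
      com_size (Assign 11 (Var 11 *\<^sub>e Var 13) ;; Assign 12 (Var 12 -\<^sub>e Num 1)))) \<le> (T + 1) * (Y + 2) * com_size chunk_c"
      unfolding ch c_def[symmetric] c2_def[symmetric] by (simp add: algebra_simps)
  qed
qed

lemma terminates_modulus:
  assumes w: "1 \<le> w" "Y * Y + Y + 5 < 2 ^ w" and R: "1 \<le> R" "R \<le> Y * Y" "2 \<le> Y" "R ^ r < 2 ^ w"
    and s: "set (tape s) \<subseteq> {..<R}" "length (tape s) = r * T" "vars s 9 = R" "vars s 10 = T"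
      "vars s 11 = 1" "vars s 12 = r"
  shows "terminates w X R modulus_c s ((r + 1) * (T + 1) * (Y + 2) * com_size modulus_c)
    (\<lambda>s'. others s s' \<and> tape s' = [] \<and> vars s' 11 = modulus T r (tape s) \<and>
      vars s' 21 = 1 mod modulus T r (tape s))"
proof -
  \<comment> \<open>The factor \<open>R ^ k\<close> reserves room for the \<open>k\<close> primes
    still to come, so that the product never exceeds \<open>R ^ r\<close> and does not
    overflow.\<close>
  define I where "I k s' \<longleftrightarrow> k \<le> r \<and> others s s' \<and> vars s' 12 = k \<and> set (tape s') \<subseteq> {..<R} \<and>
    length (tape s') = k * T \<and> vars s' 11 * R ^ k \<le> R ^ r \<and>
    vars s' 11 * modulus T k (tape s') = modulus T r (tape s)" for k :: nat and s' :: state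
  have w2: "Suc 0 < (2::nat) ^ w" using w(2) by auto
  have loop: "terminates w X R (While (Var 12) chunk_c) s
    ((\<Sum>j=1..r. (T + 1) * (Y + 2) * com_size chunk_c + (expr_time (Var 12) + 2)) + expr_time (Var 12) + 1)
    (\<lambda>s'. (\<exists>k. I k s') \<and> val (Var 12) s' = 0)"
  proof (rule terminates_While[where I = I])
    show "I r s" using s by (simp add: I_def others_def)
  next
    fix k s' assume I: "I k s'" and nz: "val (Var 12) s' \<noteq> 0"
    then obtain k' where k: "k = Suc k'" "k \<le> r" by (cases k) (auto simp: I_def)
    have R9: "vars s' 9 = R" "vars s' 10 = T" using I s by (auto simp: I_def others_def)
    have tp: "set (tape s') \<subseteq> {..<R}" "T \<le> length (tape s')" using I k by (auto simp: I_def)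
    have "vars s' 11 * (R * 1) \<le> vars s' 11 * (R * R ^ k')" using R(1) by (intro mult_le_mono2) simp
    also have "\<dots> \<le> R ^ r" using I k by (simp add: I_def)
    finally have m: "vars s' 11 * R \<le> R ^ r" by simp
    then have M: "vars s' 11 * max 1 R < 2 ^ w" using R(1,4) by (simp add: max_def)
    have "set (take T (tape s')) \<subseteq> {..<R}" using tp(1) set_take_subset by fast
    from last_prime_bounds[OF this] have lp: "last_prime (take T (tape s')) \<le> R" using R(1) by simp
    have "vars s' 11 * last_prime (take T (tape s')) * R ^ k' \<le> vars s' 11 * R * R ^ k'"
      using lp by (intro mult_le_mono1 mult_le_mono2)
    also have "\<dots> \<le> R ^ r" using I k by (simp add: I_def mult.assoc)
    finally have b: "vars s' 11 * last_prime (take T (tape s')) * R ^ k' \<le> R ^ r" .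
    have dr: "set (drop T (tape s')) \<subseteq> {..<R}" using tp(1) set_drop_subset by fast
    have "terminates w X R chunk_c s' ((T + 1) * (Y + 2) * com_size chunk_c) (I (k - 1))"
      by (rule terminates_mono[OF terminates_chunk[OF w R(2,3) tp R9 M]])
        (use I k b dr others_trans in \<open>auto simp: I_def mult.assoc\<close>)
    with k show "0 < k \<and> terminates w X R chunk_c s' ((T + 1) * (Y + 2) * com_size chunk_c) (I (k - 1))" by simp
  qed simp
  have last: "wp w X R (Assign 21 (Num 1 mod\<^sub>e Var 11)) (\<lambda>s'. others s s' \<and> tape s' = [] \<and>
      vars s' 11 = modulus T r (tape s) \<and> vars s' 21 = 1 mod modulus T r (tape s)) s'"
    if "(\<exists>k. I k s') \<and> val (Var 12) s' = 0" for s'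
  proof -
    have I: "I 0 s'" using that by (auto simp: I_def)
    then show ?thesis using w2 by (simp add: I_def others_def)
  qed
  have "terminates w X R modulus_c s (((\<Sum>j=1..r. (T + 1) * (Y + 2) * com_size chunk_c + (expr_time (Var 12) + 2)) + expr_time (Var 12) + 1) +
      com_size (Assign 21 (Num 1 mod\<^sub>e Var 11)))
    (\<lambda>s'. others s s' \<and> tape s' = [] \<and> vars s' 11 = modulus T r (tape s) \<and>
      vars s' 21 = 1 mod modulus T r (tape s))"
    unfolding modulus_c_def by (rule terminates_Seq[OF loop], rule terminates_wp, rule last)
  then show ?thesis
  proof (rule terminates_mono)
    define c where "c = com_size chunk_c"
    define q where "q = (T + 1) * (Y + 2)"
    have q: "1 \<le> q" by (simp add: q_def)
    have ch: "com_size modulus_c = (c + 4) + com_size (Assign 21 (Num 1 mod\<^sub>e Var 11))"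
      by (simp add: modulus_c_def c_def)
    have l: "((\<Sum>j=1..r. q * c + (expr_time (Var 12) + 2)) + expr_time (Var 12) + 1) +
      com_size (Assign 21 (Num 1 mod\<^sub>e Var 11)) = r * (q * c) + r * 4 + 9" by (simp add: algebra_simps)
    have "(r + 1) * (T + 1) * (Y + 2) = (r + 1) * q" by (simp only: q_def mult.assoc)
    then have rr: "(r + 1) * (T + 1) * (Y + 2) * com_size modulus_c = r * (q * c) + r * (10 * q) + q * c + 10 * q"
      unfolding ch by (simp add: algebra_simps)
    have "r * 4 \<le> r * (10 * q)" by (rule mult_le_mono2) (use q in simp)
    moreover have "9 \<le> 10 * q" using q by simp
    ultimately show "((\<Sum>j=1..r. (T + 1) * (Y + 2) * com_size chunk_c + (expr_time (Var 12) + 2)) + expr_time (Var 12) + 1) +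
      com_size (Assign 21 (Num 1 mod\<^sub>e Var 11)) \<le> (r + 1) * (T + 1) * (Y + 2) * com_size modulus_c"
      unfolding rr c_def[symmetric] q_def[symmetric] l by linarith
  qed
qed

section \<open>Computation of the parameters, and the complete program\<close>

definition init_c :: "nat \<Rightarrow> nat \<Rightarrow> nat \<Rightarrow> nat \<Rightarrow> com" where
  "init_c a A K r = width_c ;; base_c a ;; consts_c A K r"

definition prog :: "nat \<Rightarrow> nat \<Rightarrow> nat \<Rightarrow> nat \<Rightarrow> com" where
  "prog a A K r = init_c a A K r ;; modulus_c ;; main_c ;; report_c"

lemma terminates_width:
  assumes s: "vars s 0 = n" "W = Suc (floor_sqrt n)" "W * W + n + 2 < 2 ^ w"
  shows "terminates w X R width_c s ((W + 1) * com_size width_c) (\<lambda>s'. s' = set_var s 2 W)"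
proof -
  define e where "e = (Var 2 *\<^sub>e Var 2 \<le>\<^sub>e Var 0)"
  define c where "c = While e (Assign 2 (Var 2 +\<^sub>e Num 1))"
  define I where "I k s' \<longleftrightarrow> (\<exists>d. s' = set_var s 2 d \<and> d \<le> W \<and> W \<le> d + k)" for k :: nat and s' :: state
  have sq: "d * d \<le> n \<longleftrightarrow> d < W" for d
    using le_floor_sqrt_iff[of d n] s(2) by (auto simp: power2_eq_square)
  have dd: "d * d < 2 ^ w" "Suc d < 2 ^ w" if "d \<le> W" for d
    using mult_le_mono[OF that that] s(2,3) that by auto
  have loop: "terminates w X R c (set_var s 2 1) ((floor_sqrt n + 1) * com_size c) (\<lambda>s'. s' = set_var s 2 W)"
    unfolding c_def
  proof (rule terminates_While_wp[where I = I])
    show "I (floor_sqrt n) (set_var s 2 1)" unfolding I_def using s(2) by (intro exI[of _ 1]) auto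
  next
    fix k s' assume "I k s'"
    then obtain d where "s' = set_var s 2 d" "d \<le> W" unfolding I_def by blast
    then show "safe w X e s'" using dd[of d] s by (simp add: e_def)
  next
    fix k s' assume "I k s'" and nz: "val e s' \<noteq> 0"
    then obtain d where d: "s' = set_var s 2 d" "d \<le> W" "W \<le> d + k" unfolding I_def by blast
    have "d < W" using nz d(1) s(1) sq[of d] by (simp add: e_def)
    then have "I (k - 1) (set_var s 2 (Suc d))" unfolding I_def using d by (intro exI[of _ "Suc d"]) auto
    with d dd[of d] \<open>d < W\<close> s(3) show "k > 0 \<and> wp w X R (Assign 2 (Var 2 +\<^sub>e Num 1)) (I (k - 1)) s'" by auto
  next
    fix k s' assume "I k s'" and z: "val e s' = 0"
    then obtain d where d: "s' = set_var s 2 d" "d \<le> W" unfolding I_def by blast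
    have "\<not> d < W" using z d(1) s(1) sq[of d] by (simp add: e_def)
    with d show "s' = set_var s 2 W" by simp
  qed
  have 1: "wp w X R (Assign 2 (Num 1)) (\<lambda>s'. s' = set_var s 2 1) s" using s(3) by simp
  have "terminates w X R width_c s (com_size (Assign 2 (Num 1)) + (floor_sqrt n + 1) * com_size c) (\<lambda>s'. s' = set_var s 2 W)"
    unfolding width_c_def e_def[symmetric] c_def[symmetric]
    by (rule terminates_Seq[OF terminates_wp[OF 1]], hypsubst, rule loop)
  moreover have "com_size width_c = com_size (Assign 2 (Num 1)) + com_size c"
    by (simp add: width_c_def c_def e_def)
  ultimately show ?thesis by (elim terminates_mono) (auto simp: s(2) algebra_simps)
qed

lemma terminates_base:
  assumes s: "vars s 0 = n" "vars s 7 = 0" "L = floorlog 2 n" "4 * 2 ^ (a * L) < (2::nat) ^ w" "L < 2 ^ w"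
  shows "terminates w X R (base_c a) s ((L + 1) * com_size (base_c a))
    (\<lambda>s'. (\<forall>x. x \<notin> {6, 7, 8} \<longrightarrow> vars s' x = vars s x) \<and> arr s' = arr s \<and> inp s' = inp s \<and>
      outp s' = outp s \<and> tape s' = tape s \<and> vars s' 6 = 4 * 2 ^ (a * L) \<and> vars s' 7 = L)"
proof -
  define body where "body = (Assign 8 (Var 8 div\<^sub>e Num 2) ;; Assign 6 (Var 6 *\<^sub>e Num (2 ^ a)) ;; Assign 7 (Var 7 +\<^sub>e Num 1))"
  define c where "c = While (Var 8) body"
  define I where "I k s' \<longleftrightarrow> (\<forall>x. x \<notin> {6, 7, 8} \<longrightarrow> vars s' x = vars s x) \<and> arr s' = arr s \<and> inp s' = inp s \<and>
      outp s' = outp s \<and> tape s' = tape s \<and> k = floorlog 2 (vars s' 8) \<and> vars s' 6 = 4 * 2 ^ (a * vars s' 7) \<and>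
      vars s' 7 + k = L" for k :: nat and s' :: state
  let ?Q = "\<lambda>s'. (\<forall>x. x \<notin> {6, 7, 8} \<longrightarrow> vars s' x = vars s x) \<and> arr s' = arr s \<and> inp s' = inp s \<and>
      outp s' = outp s \<and> tape s' = tape s \<and> vars s' 6 = 4 * 2 ^ (a * L) \<and> vars s' 7 = L"
  have b: "4 * 2 ^ (a * l) < (2::nat) ^ w" if "l \<le> L" for l
  proof -
    have "(2::nat) ^ (a * l) \<le> 2 ^ (a * L)" by (intro power_increasing mult_le_mono2 that) simp
    then show ?thesis using s(4) by linarith
  qed
  have w: "4 < (2::nat) ^ w" "2 < (2::nat) ^ w" "Suc 0 < (2::nat) ^ w" using b[of 0] by auto
  have loop: "terminates w X R c (set_var (set_var s 8 n) 6 4) ((L + 1) * com_size c) ?Q"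
    unfolding c_def
  proof (rule terminates_While_wp[where I = I])
    show "I L (set_var (set_var s 8 n) 6 4)" using s by (simp add: I_def)
  next
    fix k s' assume I: "I k s'" and nz: "val (Var 8) s' \<noteq> 0"
    have fl: "k = Suc (floorlog 2 (vars s' 8 div 2))" using I nz by (simp add: I_def compute_floorlog[of 2 "vars s' 8"])
    then have l: "Suc (vars s' 7) \<le> L" using I by (simp add: I_def)
    have k1: "k - 1 = floorlog 2 (vars s' 8 div 2)" using fl by simp
    have l1: "Suc (vars s' 7) + (k - 1) = L" using I fl by (simp add: I_def)
    have p: "4 * 2 ^ (a * vars s' 7) * 2 ^ a < (2::nat) ^ w"
      using b[OF l] by (simp add: power_add mult.assoc mult.commute[of "2 ^ a"])
    have "1 * (2::nat) ^ a \<le> 4 * 2 ^ (a * vars s' 7) * 2 ^ a" by (intro mult_le_mono1) simp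
    then have pa: "(2::nat) ^ a < 2 ^ w" using p by linarith
    have v6: "vars s' 6 = 4 * 2 ^ (a * vars s' 7)" using I by (simp add: I_def)
    have safe: "vars s' 6 * 2 ^ a < 2 ^ w" using p v6 by simp
    have l7: "Suc (vars s' 7) < 2 ^ w" using l s(5) by simp
    have "wp w X R body (\<lambda>s2. s2 = set_var (set_var (set_var s' 8 (vars s' 8 div 2)) 6 (vars s' 6 * 2 ^ a)) 7 (Suc (vars s' 7))) s'"
      using pa safe l7 w by (simp add: body_def)
    moreover have "I (k - 1) (set_var (set_var (set_var s' 8 (vars s' 8 div 2)) 6 (vars s' 6 * 2 ^ a)) 7 (Suc (vars s' 7)))"
      using I[unfolded I_def] k1 l1 by (simp add: I_def power_add)
    ultimately show "k > 0 \<and> wp w X R body (I (k - 1)) s'" using fl pa safe l7 w by (simp add: body_def)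
  next
    fix k s' assume "I k s'" "val (Var 8) s' = 0"
    then show "?Q s'" by (simp add: I_def floorlog_def)
  qed simp
  have 1: "wp w X R (Assign 8 (Var 0)) (\<lambda>s'. wp w X R (Assign 6 (Num 4)) (\<lambda>s'. s' = set_var (set_var s 8 n) 6 4) s') s"
    using s w by simp
  have "terminates w X R (base_c a) s (com_size (Assign 8 (Var 0)) + (com_size (Assign 6 (Num 4)) + (L + 1) * com_size c)) ?Q"
    unfolding base_c_def body_def[symmetric] c_def[symmetric]
    by (rule terminates_Seq[OF terminates_wp[OF 1]], rule terminates_Seq[OF terminates_wp], assumption, hypsubst, rule loop)
  moreover have "com_size (base_c a) = com_size (Assign 8 (Var 0)) + (com_size (Assign 6 (Num 4)) + com_size c)"
    by (simp add: base_c_def c_def body_def)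
  ultimately show ?thesis by (elim terminates_mono) (auto simp: algebra_simps)
qed

definition ready :: "state \<Rightarrow> nat \<Rightarrow> nat \<Rightarrow> nat \<Rightarrow> nat \<Rightarrow> nat \<Rightarrow> nat \<Rightarrow> nat \<Rightarrow> state \<Rightarrow> bool" where
  "ready s n W g b R T r s' \<longleftrightarrow> vars s' 0 = n \<and> vars s' 2 = W \<and> vars s' 3 = g \<and> vars s' 4 = W div 2 \<and>
     vars s' 5 = 3 * W + 1 \<and> vars s' 6 = b \<and> vars s' 9 = R \<and> vars s' 10 = T \<and> vars s' 11 = 1 \<and> vars s' 12 = r \<and>
     vars s' 17 = 0 \<and> vars s' 18 = n + W + 1 \<and> vars s' 19 = 0 \<and> vars s' 20 = 0 \<and> vars s' 22 = 0 \<and>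
     arr s' = arr s \<and> inp s' = inp s \<and> outp s' = outp s \<and> tape s' = tape s"

lemma terminates_init:
  assumes s: "\<And>x. 2 \<le> x \<Longrightarrow> vars s x = 0" "vars s 0 = n" "vars s 1 = e" and n: "1 \<le> n"
    and W: "W = Suc (floor_sqrt n)" "W * W + n + 2 < 2 ^ w" and L: "L = floorlog 2 n" "L < 2 ^ w"
    and b: "b = 4 * 2 ^ (a * L)" "b < 2 ^ w" and w: "5 * (n + W) + 5 < 2 ^ w"
    and A: "A * n * W < 2 ^ w" "K * L * L < 2 ^ w" "r < 2 ^ w"
  shows "terminates w X R (init_c a A K r) s
    ((W + L + 3) * com_size (init_c a A K r))
    (ready s n W (max 1 (e div W)) b (A * n * W) (K * L * L) r)"
proof -
  have L1: "1 \<le> L" using n by (simp add: L compute_floorlog[of 2 n])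
  have W1: "1 \<le> W" by (simp add: W)
  have "A * 1 * 1 \<le> A * n * W" "A * n * 1 \<le> A * n * W" by (intro mult_le_mono mult_le_mono2 n W1 order_refl)+
  then have A': "A < 2 ^ w" "A * n < 2 ^ w" using A(1) by linarith+
  have "K * 1 * 1 \<le> K * L * L" "K * L * 1 \<le> K * L * L" by (intro mult_le_mono mult_le_mono2 L1 order_refl)+
  then have K': "K < 2 ^ w" "K * L < 2 ^ w" using A(2) by linarith+
  have w': "3 < (2::nat) ^ w" "2 < (2::nat) ^ w" "Suc 0 < (2::nat) ^ w" "3 * W < 2 ^ w" "Suc (3 * W) < 2 ^ w"
    "n + W < 2 ^ w" "Suc (n + W) < 2 ^ w" using w by auto
  have last: "wp w X R (consts_c A K r) (ready s n W (max 1 (e div W)) b (A * n * W) (K * L * L) r) s2"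
    if s1: "s1 = set_var s 2 W" and s2: "(\<forall>x. x \<notin> {6, 7, 8} \<longrightarrow> vars s2 x = vars s1 x) \<and> arr s2 = arr s1 \<and> inp s2 = inp s1 \<and>
      outp s2 = outp s1 \<and> tape s2 = tape s1 \<and> vars s2 6 = 4 * 2 ^ (a * L) \<and> vars s2 7 = L" for s1 s2
  proof -
    have v: "vars s2 0 = n" "vars s2 1 = e" "vars s2 2 = W" "vars s2 6 = b" "vars s2 7 = L"
      "vars s2 17 = 0" "vars s2 19 = 0" "vars s2 20 = 0" "vars s2 22 = 0"
      "arr s2 = arr s" "inp s2 = inp s" "outp s2 = outp s" "tape s2 = tape s"
      using s1 s2 s b by simp_all
    show ?thesis
      using A A' K' w' by (simp add: consts_c_def ready_def v v(2)[unfolded One_nat_def] max_def mult.assoc)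
  qed
  have "terminates w X R (init_c a A K r) s
    ((W + 1) * com_size width_c + ((L + 1) * com_size (base_c a) + com_size (consts_c A K r)))
    (ready s n W (max 1 (e div W)) b (A * n * W) (K * L * L) r)"
    unfolding init_c_def
    apply (rule terminates_Seq[OF terminates_width[OF s(2) W]])
    apply (rule terminates_Seq[OF terminates_base[where n = n and L = L]])
    using s L b apply simp_all[5]
    apply (rule terminates_wp, rule last, assumption+)
    done
  then show ?thesis by (rule terminates_mono) (auto simp: init_c_def algebra_simps)
qed

lemma wf_prog: "wf_com (prog a A K r)"
  by (simp add: prog_def init_c_def width_c_def base_c_def consts_c_def modulus_c_def main_c_def report_c_def
      chunk_c_def draw_c_def trial_e_def round_c_def store_c_def alive_c_def centre_c_def scan_c_def
      scan_body_def read_c_def update_c_def long_c_def short_c_def short_cond_def new_c_def old_c_def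
      outer_body_def inner_c_def inner_body_def win_check_def point_check_def check_e_def less_e_def le_e_def and_e_def eq_e_def)

text \<open>The summands pay for the parameters, the modulus, the rounds and the report, each up to
  the constant size of the program.\<close>

definition work :: "nat \<Rightarrow> nat \<Rightarrow> nat \<Rightarrow> nat \<Rightarrow> nat \<Rightarrow> nat \<Rightarrow> nat \<Rightarrow> nat" where
  "work n W g L T Y r = (W + L + 3) + (r + 1) * (T + 1) * (Y + 2) +
     ((n + W + 2) * (W div g + 4) + (2 * W + 2) * ((n + W + 1) div g + 1)) + (n + 6 * W + 2)"

locale parameters =
  fixes S :: "nat list" and n e W g L b R T Y X w a A K r :: nat
  assumes n: "n = length S" "1 \<le> n" and e: "e \<le> n"
    and W: "W = Suc (floor_sqrt n)" "W * W + n + 2 < 2 ^ w" "5 * (n + W) + 5 < 2 ^ w"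
    and g: "g = max 1 (e div W)" and L: "L = floorlog 2 n" "L < 2 ^ w"
    and b: "b = 4 * 2 ^ (a * L)" "b < 2 ^ w" "\<And>x. code S x < b"
    and R: "R = A * n * W" "1 \<le> A" and T: "T = K * L * L" "T < 2 ^ w" and r: "r < 2 ^ w" "1 \<le> r"
    and Y: "R \<le> Y * Y" "2 \<le> Y" "Y * Y + Y + 5 < 2 ^ w"
    and M: "R ^ r * R ^ r + R ^ r + b * R ^ r < 2 ^ w"
    and X: "X = 3 * W + (n + W) div g" "116 + 16 * X \<le> 2 ^ w"
begin

lemma W1: "1 \<le> W"
  by (simp add: W)

lemma R1: "1 \<le> R"
proof -
  have "1 * 1 * 1 \<le> A * n * W" by (intro mult_le_mono R n W1)
  then show ?thesis by (simp add: R)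
qed

lemma terminates_prog:
  assumes s: "\<And>x. 2 \<le> x \<Longrightarrow> vars s x = 0" "vars s 0 = n" "vars s 1 = e" "arr s = (\<lambda>_ _. 0)" "inp s = S"
      "outp s = []" "length (tape s) = r * T" "set (tape s) \<subseteq> {..<R}"
  shows "terminates w X R (prog a A K r) s (work n W g L T Y r * com_size (prog a A K r))
    (\<lambda>s'. tape s' = [] \<and> distinct (map fst (outp s')) \<and> fst ` set (outp s') = {1..n} \<and>
      (good_modulus S b (n + W) (modulus T r (tape s)) \<longrightarrow>
        (\<forall>(m, d)\<in>set (outp s'). d \<le> pal_length S m \<and> pal_length S m < d + g)))"
proof -
  define M where "M = modulus T r (tape s)"
  let ?Q = "\<lambda>s'. tape s' = [] \<and> distinct (map fst (outp s')) \<and> fst ` set (outp s') = {1..n} \<and>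
      (good_modulus S b (n + W) M \<longrightarrow>
        (\<forall>(m, d)\<in>set (outp s'). d \<le> pal_length S m \<and> pal_length S m < d + g))"
  have nW: "n < W * W" using Suc_floor_sqrt_power2_gt[of n] by (simp add: W power2_eq_square)
  have gW: "1 \<le> g" "g \<le> W"
  proof -
    have "e div W < W" using e nW by (intro less_mult_imp_div_less) simp
    then show "1 \<le> g" "g \<le> W" using W1 by (auto simp: g)
  qed
  have Mb: "1 \<le> M" "M \<le> R ^ r" using modulus_bounds[OF R1 s(8)] by (simp_all add: M_def)
  have w1: "1 \<le> w" using W(3) by (cases w) auto
  have Mw: "M * M + M + b * M < 2 ^ w"
  proof -
    have "M * M \<le> R ^ r * R ^ r" "b * M \<le> b * R ^ r" by (intro mult_le_mono Mb order_refl)+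
    then show ?thesis using Mb M by linarith
  qed
  have Rr: "R ^ r < 2 ^ w" using M by linarith
  have "R ^ 1 \<le> R ^ r" using R1 r by (intro power_increasing) auto
  then have Rw: "A * n * W < 2 ^ w" using Rr R by simp
  interpret mach: machine S W g "W div 2" b M w X R n "3 * W + 1"
    by unfold_locales (use n W1 nW gW X Mb w1 W Mw b in auto)
  have mods: "terminates w X R modulus_c s1 ((r + 1) * (T + 1) * (Y + 2) * com_size modulus_c)
      (\<lambda>s'. others s1 s' \<and> tape s' = [] \<and> vars s' 11 = M \<and> vars s' 21 = 1 mod M)"
    if "ready s n W g b R T r s1" for s1
  proof -
    have t: "tape s1 = tape s" and v: "vars s1 9 = R" "vars s1 10 = T" "vars s1 11 = 1" "vars s1 12 = r"
      using that unfolding ready_def by blast+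
    show ?thesis using terminates_modulus[OF w1 Y(3) R1 Y(1,2) Rr _ _ v, where X = X] s(7,8) by (simp add: t M_def)
  qed
  have main: "terminates w X R main_c s2
      (((n + W + 2) * (W div g + 4) + (2 * W + 2) * ((n + W + 1) div g + 1)) * (com_size round_c + expr_time (Var 17 <\<^sub>e Var 18)))
      (\<lambda>s'. view s' = tracked W (W div 2) g (hash_check (code S) b M) (n + W + 1) \<and> tape s' = [])"
    if "ready s n W g b R T r s1" and o: "others s1 s2 \<and> tape s2 = [] \<and> vars s2 11 = M \<and> vars s2 21 = 1 mod M" for s1 s2
  proof (rule mach.terminates_main)
    note rd = that(1)[unfolded ready_def]
    have v: "vars s2 0 = n" "vars s2 2 = W" "vars s2 3 = g" "vars s2 4 = W div 2" "vars s2 5 = 3 * W + 1"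
      "vars s2 6 = b" "vars s2 11 = M" "vars s2 17 = 0" "vars s2 18 = n + W + 1" "vars s2 19 = 0"
      "vars s2 20 = 0" "vars s2 21 = 1 mod M" "vars s2 22 = 0" "arr s2 = (\<lambda>_ _. 0)" "inp s2 = S" "outp s2 = []" "tape s2 = []"
      using o rd s(4-6) by (simp_all add: others_def)
    show "mach.env 0 0 s2" unfolding mach.env_def using Mb by (simp add: v)
    show "view s2 = empty_trk" by (simp add: view_def empty_trk_def v)
  qed
  have report: "terminates w X R report_c s3 ((n + 6 * W + 2) * com_size report_c) ?Q"
    if v: "view s3 = tracked W (W div 2) g (hash_check (code S) b M) (n + W + 1) \<and> tape s3 = []" for s3
  proof -
    define t where "t = tracked W (W div 2) g (hash_check (code S) b M) (n + W + 1)"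
    have sh: "shape W (W div 2) (n + W) n t" using shape_tracked[of W "W div 2" "n + W + 1"] by (simp add: t_def)
    have acc: "d \<le> pal_length S m \<and> pal_length S m < d + g"
      if gm: "good_modulus S b (n + W) M" and m: "1 \<le> m" "m \<le> n"
        and md: "(m, d) \<in> set (rep t) \<or> (\<exists>j\<in>{1..cnt t}. m \<in> members t j \<and> d = final_est t j m)" for m d
    proof -
      interpret f: faithful "padded S" n W "W div 2" g "hash_check (code S) b M"
        using faithful_hash_check[of W "W div 2" g S b M] W1 gW gm b n by simp
      have gd: "f.good (n + W) n (g * ((n + W) div g)) t" using f.good_tracked[of "n + W"] by (simp add: t_def)
      \<comment> \<open>Because \<open>g \<le> W\<close>, the last scan takes place at or after
        position \<open>n\<close>, so it covers every palindrome of the string.\<close>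
      have "n + W = g * ((n + W) div g) + (n + W) mod g" by simp
      moreover have "(n + W) mod g < g" using gW by simp
      ultimately have p: "n \<le> g * ((n + W) div g)" using gW by linarith
      have "f.accurate m d"
      proof (cases "(m, d) \<in> set (rep t)")
        case True
        then show ?thesis using gd unfolding f.good_def by blast
      next
        case False
        with md obtain j where j: "1 \<le> j" "j \<le> cnt t" "m \<in> members t j" "d = final_est t j m" by auto
        show ?thesis using f.good_final[OF gd p sh j(1-3)] by (simp add: j(4))
      qed
      then have "pal_at (padded S) (int m) (int d)" "\<not> pal_at (padded S) (int m) (int (d + g))"
        unfolding f.accurate_def by blast+
      from pal_length_bounds[OF m(1) _ this] m(2) n(1) show ?thesis by simp
    qed
    have gl: "\<And>j. gap t j \<le> lst t j" by (simp only: t_def gap_le_tracked)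
    have vt: "view s3 = t" using v by (simp add: t_def)
    show ?thesis
    proof (rule terminates_mono[OF mach.terminates_report[OF vt sh gl]])
      fix s' assume q: "tape s' = tape s3 \<and> distinct (map fst (outp s')) \<and> fst ` set (outp s') = {1..n} \<and>
      (\<forall>(m, e)\<in>set (outp s'). (m, e) \<in> set (rep t) \<or> (\<exists>j\<in>{1..cnt t}. m \<in> members t j \<and> e = final_est t j m))"
      have "d \<le> pal_length S m \<and> pal_length S m < d + g"
        if gm: "good_modulus S b (n + W) M" and md: "(m, d) \<in> set (outp s')" for m d
      proof -
        have "m \<in> fst ` set (outp s')" using md by force
        then have "1 \<le> m" "m \<le> n" using q by auto
        moreover have "(m, d) \<in> set (rep t) \<or> (\<exists>j\<in>{1..cnt t}. m \<in> members t j \<and> d = final_est t j m)"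
          using q md by blast
        ultimately show ?thesis using acc gm by blast
      qed
      moreover have "tape s' = []" using q v by simp
      ultimately show "?Q s'" using q by blast
    qed simp
  qed
  have init: "terminates w X R (init_c a A K r) s ((W + L + 3) * com_size (init_c a A K r)) (ready s n W g b R T r)"
    using terminates_init[OF s(1-3) n(2) W(1,2) L b(1,2) W(3) Rw _ r(1), where X = X and R = R and K = K] T R g by simp
  have "terminates w X R (prog a A K r) s ((W + L + 3) * com_size (init_c a A K r) +
      ((r + 1) * (T + 1) * (Y + 2) * com_size modulus_c +
       (((n + W + 2) * (W div g + 4) + (2 * W + 2) * ((n + W + 1) div g + 1)) * (com_size round_c + expr_time (Var 17 <\<^sub>e Var 18)) +
        (n + 6 * W + 2) * com_size report_c))) ?Q"
    unfolding prog_def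
    by (rule terminates_Seq[OF init], rule terminates_Seq[OF mods], assumption,
        rule terminates_Seq[OF main], assumption, assumption, rule report)
  then show ?thesis unfolding M_def
  proof (rule terminates_mono)
    define x1 x2 x3 x4 where "x1 = W + L + 3" and "x2 = (r + 1) * (T + 1) * (Y + 2)"
      and "x3 = (n + W + 2) * (W div g + 4) + (2 * W + 2) * ((n + W + 1) div g + 1)" and "x4 = n + 6 * W + 2"
    define C where "C = com_size (prog a A K r)"
    have "com_size (init_c a A K r) \<le> C" "com_size modulus_c \<le> C"
      "com_size round_c + expr_time (Var 17 <\<^sub>e Var 18) \<le> C" "com_size report_c \<le> C"
      by (simp_all add: C_def prog_def main_c_def)
    then have "x1 * com_size (init_c a A K r) + (x2 * com_size modulus_c +
        (x3 * (com_size round_c + expr_time (Var 17 <\<^sub>e Var 18)) + x4 * com_size report_c))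
      \<le> x1 * C + (x2 * C + (x3 * C + x4 * C))" by (intro add_mono mult_le_mono2)
    also have "\<dots> = (x1 + x2 + x3 + x4) * C" by (simp add: algebra_simps)
    finally show "(W + L + 3) * com_size (init_c a A K r) +
      ((r + 1) * (T + 1) * (Y + 2) * com_size modulus_c +
       (((n + W + 2) * (W div g + 4) + (2 * W + 2) * ((n + W + 1) div g + 1)) * (com_size round_c + expr_time (Var 17 <\<^sub>e Var 18)) +
        (n + 6 * W + 2) * com_size report_c)) \<le> work n W g L T Y r * com_size (prog a A K r)"
      unfolding work_def x1_def x2_def x3_def x4_def C_def .
  qed
qed


lemma run_prog:
  assumes \<epsilon>: "e = nat \<lfloor>\<epsilon> * real n\<rfloor>" and t: "work n W g L T Y r * com_size (prog a A K r) \<le> t"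
  defines "P \<equiv> code_com 0 (prog a A K r)"
  shows "\<exists>f. run w P t (start w \<epsilon> S) = map_pmf f (replicate_pmf (r * T) (pmf_of_set {..<R})) \<and>
    (\<forall>\<omega>. length \<omega> = r * T \<longrightarrow> set \<omega> \<subseteq> {..<R} \<longrightarrow> halted P (f \<omega>) \<and> used (f \<omega>) \<le> 116 + 16 * X \<and>
      distinct (map fst (out (f \<omega>))) \<and> fst ` set (out (f \<omega>)) = {1..n} \<and>
      (good_modulus S b (n + W) (modulus T r \<omega>) \<longrightarrow>
        (\<forall>(m, d)\<in>set (out (f \<omega>)). d \<le> pal_length S m \<and> pal_length S m < d + g)))"
proof (rule run_eq_map_tape)
  show "0 < R" using R1 by simp
next
  fix \<omega> :: "nat list" assume \<omega>: "length \<omega> = r * T" "set \<omega> \<subseteq> {..<R}"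
  let ?Q = "\<lambda>os. distinct (map fst os) \<and> fst ` set os = {1..n} \<and>
      (good_modulus S b (n + W) (modulus T r \<omega>) \<longrightarrow>
        (\<forall>(m, d)\<in>set os. d \<le> pal_length S m \<and> pal_length S m < d + g))"
  define s :: state where
    "s = \<lparr>vars = (\<lambda>_. 0)(0 := n, 1 := e), arr = (\<lambda>_ _. 0), inp = S, outp = [], tape = \<omega>\<rparr>"
  have "terminates w X R (prog a A K r) s (work n W g L T Y r * com_size (prog a A K r))
      (\<lambda>s'. tape s' = [] \<and> distinct (map fst (outp s')) \<and> fst ` set (outp s') = {1..n} \<and>
      (good_modulus S b (n + W) (modulus T r (tape s)) \<longrightarrow>
        (\<forall>(m, d)\<in>set (outp s'). d \<le> pal_length S m \<and> pal_length S m < d + g)))"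
    by (rule terminates_prog) (simp_all add: s_def \<omega>)
  then obtain t' s' where t': "t' \<le> work n W g L T Y r * com_size (prog a A K r)"
    "big w X R (prog a A K r) s t' s'" "tape s' = []" "?Q (outp s')"
    unfolding terminates_def by (auto simp: s_def)
  have bd: "n < 2 ^ w" "e < 2 ^ w" using W(3) e by auto
  have "represents w X s (start w \<epsilon> S)"
    using bd n \<epsilon> by (simp add: represents_def s_def start_def)
  moreover have "code_at P (pc (start w \<epsilon> S)) (code_com (pc (start w \<epsilon> S)) (prog a A K r))"
    unfolding code_at_def P_def by (intro exI[of _ "[]"]) (simp add: start_def)
  ultimately obtain c' where c': "tape_steps w R P t' (start w \<epsilon> S, tape s) (c', tape s')"
    "pc c' = pc (start w \<epsilon> S) + com_size (prog a A K r)" "represents w X s' c'"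
    using code_com_correct[OF X(2) t'(2) _ _ wf_prog] by blast
  show "\<exists>k\<le>t. \<exists>c'. tape_steps w R P k (start w \<epsilon> S, \<omega>) (c', []) \<and> halted P c' \<and>
    (used c' \<le> 116 + 16 * X \<and> ?Q (out c'))"
  proof (intro exI[of _ t'] exI[of _ c'] conjI)
    show "t' \<le> t" using t' t by simp
    show "tape_steps w R P t' (start w \<epsilon> S, \<omega>) (c', [])" using c'(1) t'(3) by (simp add: s_def)
    show "halted P c'" using c'(2) by (simp add: halted_def P_def length_code_com)
    show "used c' \<le> 116 + 16 * X" using c'(3) by (simp add: represents_def)
    have "out c' = outp s'" using c'(3) by (simp add: represents_def)
    then show "distinct (map fst (out c'))" "fst ` set (out c') = {1..n}"
      "good_modulus S b (n + W) (modulus T r \<omega>) \<longrightarrow>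
        (\<forall>(m, d)\<in>set (out c'). d \<le> pal_length S m \<and> pal_length S m < d + g)"
      using t'(4) by simp_all
  qed
qed

end

section \<open>The parameters\<close>

text \<open>The constant is \<open>33 ^ 3\<close>. From \<open>1 + y \<le> exp y\<close> and
  \<open>ln 2 \<ge> 2 / 3\<close> one gets \<open>L \<le> 33 * 2 powr ((L - 1) / 16)\<close>, and
  the cube of that power is at most the fourth root of \<open>2 ^ (L - 1) \<le> n\<close>.\<close>

lemma floorlog_cubed_le:
  assumes "1 \<le> n"
  shows "real (floorlog 2 n) ^ 3 \<le> 35937 * real n powr (1 / 4)"
proof -
  define L where "L = floorlog 2 n"
  have L: "1 \<le> L" "2 ^ (L - 1) \<le> n" using assms floorlog_bounds[of n 2] compute_floorlog[of 2 n] by (auto simp: L_def)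
  define v where "v = (2::real) powr (real (L - 1) / 16)"
  have "1 \<le> real L" using L(1) by simp
  then have "real L / 33 \<le> 1 + (real L - 1) / 24" by (simp add: field_simps)
  also have "\<dots> \<le> 1 + real (L - 1) / 16 * ln 2"
  proof -
    have "(real L - 1) / 16 * (2 / 3) \<le> (real L - 1) / 16 * ln 2"
      using ln2_ge_two_thirds L(1) by (intro mult_left_mono) auto
    then show ?thesis using L(1) by (simp add: of_nat_diff)
  qed
  also have "\<dots> \<le> v" unfolding v_def powr_def using exp_ge_add_one_self[of "real (L - 1) / 16 * ln 2"] by simp
  finally have "(real L / 33) ^ 3 \<le> v ^ 3" by (intro power_mono) auto
  also have "v ^ 3 = 2 powr (3 * (real (L - 1) / 16))" by (simp add: v_def powr_power mult.commute)
  also have "\<dots> \<le> 2 powr (real (L - 1) * (1 / 4))" by (intro powr_mono) auto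
  also have "\<dots> = (2 powr real (L - 1)) powr (1 / 4)" by (rule powr_powr[symmetric])
  also have "2 powr real (L - 1) = real (2 ^ (L - 1))" by (simp add: powr_realpow)
  also have "real (2 ^ (L - 1)) powr (1 / 4) \<le> real n powr (1 / 4)"
    using L(2) by (intro powr_mono2) (auto simp del: of_nat_power)
  finally show ?thesis unfolding L_def[symmetric] by (simp add: power_divide)
qed

text \<open>A larger range \<open>A = 2 ^ \<alpha>\<close> lowers the failure probability but makes
  primes rarer, so the number of draws grows with \<open>\<alpha> + 2\<close>. The exponential
  wins.\<close>

lemma exists_large_power: "\<exists>\<alpha>\<ge>2. c * (\<alpha> + 2) \<le> (2::nat) ^ \<alpha>"
proof (intro exI conjI)
  let ?\<alpha> = "2 * c + 4"
  have "c < 2 ^ c" by (rule less_exp)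
  then have "c * (2 * c + 6) \<le> 2 ^ c * (2 * 2 ^ c + 6)" by (intro mult_le_mono) auto
  also have "\<dots> \<le> 2 ^ c * (16 * 2 ^ c)"
  proof (rule mult_le_mono2)
    have "(1::nat) \<le> 2 ^ c" by simp
    then show "2 * 2 ^ c + 6 \<le> 16 * (2::nat) ^ c" by linarith
  qed
  also have "\<dots> = 2 ^ (c + (c + 4))" by (simp only: power_add) simp
  also have "c + (c + 4) = 2 * c + 4" by simp
  finally have "c * (2 * c + 6) \<le> 2 ^ (2 * c + 4)" .
  moreover have "?\<alpha> + 2 = 2 * c + 6" by simp
  ultimately show "c * (?\<alpha> + 2) \<le> 2 ^ ?\<alpha>" by (simp only:)
qed simp

text \<open>All quantities are bounded by powers of \<open>2 ^ L\<close>, hence fit into words of \<open>O(L)\<close> bits.\<close>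

lemma parameters_fit:
  fixes S :: "nat list" and \<alpha> a :: nat
  assumes n: "n = length S" "1 \<le> n" and S: "set S \<subseteq> {..<2 ^ (a * floorlog 2 n)}" and e: "e \<le> n" and \<alpha>: "2 \<le> \<alpha>"
  defines "W \<equiv> Suc (floor_sqrt n)"
  defines "g \<equiv> max 1 (e div W)" and "L \<equiv> floorlog 2 n" and "A \<equiv> 2 ^ \<alpha>" and "K \<equiv> 4 * (\<alpha> + 2)"
  shows "parameters S n e W g L (4 * 2 ^ (a * L)) (A * n * W) (K * L * L) (Suc (floor_sqrt (A * n * W)))
    (3 * W + (n + W) div g) ((56 * (\<alpha> + 2) + a + K + 20) * L) a A K 28"
    and "W \<le> n + 1" "n < 2 ^ L" "A * n * W \<le> 2 ^ ((\<alpha> + 2) * L)" "1 \<le> L"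
proof -
  define q where "q = (2::nat) ^ L"
  \<comment> \<open>The term \<open>56 * (\<alpha> + 2)\<close> pays for
    \<open>R ^ 28 * R ^ 28\<close>, the term \<open>a\<close> for the base, \<open>K\<close> for the
    number of draws and 20 for the constant factors.\<close>
  define k where "k = 56 * (\<alpha> + 2) + a + K + 20"
  define R where "R = A * n * W"
  define Y where "Y = Suc (floor_sqrt R)"
  define b where "b = 4 * (2::nat) ^ (a * L)"
  show Wn: "W \<le> n + 1" using floor_sqrt_le[of n] by (simp add: W_def)
  show nq: "n < 2 ^ L" using n(2) floorlog_bounds[of n 2] by (simp add: L_def)
  show L1: "1 \<le> L" using n(2) compute_floorlog[of 2 n] by (simp add: L_def)
  have "(2::nat) ^ 1 \<le> 2 ^ L" using L1 by (intro power_increasing) auto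
  then have q2: "2 \<le> q" by (simp add: q_def)
  have small: "2 ^ i \<le> q ^ i" for i using q2 by (intro power_mono) auto
  have fits: "x < 2 ^ (k * L)" if "x \<le> q ^ i" "i < k" for x i
  proof -
    have "q ^ i < q ^ k" using q2 that(2) by (intro power_strict_increasing) auto
    also have "q ^ k = 2 ^ (k * L)" by (metis q_def power_mult mult.commute)
    finally show ?thesis using that(1) by simp
  qed
  have prod: "x * y \<le> q ^ (i + j)" if "x \<le> q ^ i" "y \<le> q ^ j" for x y i j
    using mult_le_mono[OF that] by (simp add: power_add)
  have W1: "1 \<le> W" by (simp add: W_def)
  have Wq: "W \<le> q ^ 1" "n \<le> q ^ 1" using Wn nq by (simp_all add: q_def)
  have Lq: "L \<le> q ^ 1" using less_exp[of L] by (simp add: q_def)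
  have R: "R \<le> q ^ (\<alpha> + 1 + 1)" unfolding R_def A_def by (intro prod small Wq)
  have qp: "q ^ i = 2 ^ (i * L)" for i by (metis q_def power_mult mult.commute)
  from R show "A * n * W \<le> 2 ^ ((\<alpha> + 2) * L)" by (simp only: R_def qp add.assoc one_add_one)
  have "1 * 1 * 1 \<le> A * n * W" by (intro mult_le_mono n W1) (simp add: A_def)
  then have R1: "1 \<le> R" by (simp add: R_def)
  have Rr: "R ^ 28 \<le> q ^ (28 * (\<alpha> + 2))" using power_mono[OF R, of 28] by (simp only: power_mult[symmetric] mult.commute[of 28] add.assoc one_add_one)
  have bq: "b \<le> q ^ (2 + a)"
    unfolding b_def by (intro prod) (use small[of 2] qp[of a] in simp_all)
  have Y: "R \<le> Y * Y" "Y \<le> 2 * R" "2 \<le> Y"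
  proof -
    show "R \<le> Y * Y" using Suc_floor_sqrt_power2_gt[of R] by (simp add: Y_def power2_eq_square)
    show "Y \<le> 2 * R" using floor_sqrt_le[of R] R1 by (simp add: Y_def)
    have "1 \<le> floor_sqrt R" using R1 by (subst le_floor_sqrt_iff) simp
    then show "2 \<le> Y" by (simp add: Y_def)
  qed
  have Yq: "Y \<le> q ^ (1 + (\<alpha> + 1 + 1))" using prod[of 2 1 R, OF _ R] Y(2) small[of 1] by simp
  have le1: "x \<le> q ^ j" if "x \<le> q ^ i" "i \<le> j" for x i j
    using that power_increasing[of i j q] q2 by linarith
  have g1: "1 \<le> g" by (simp add: g_def)
  have dv: "(n + W) div g \<le> n + W" by simp
  show "parameters S n e W g L (4 * 2 ^ (a * L)) (A * n * W) (K * L * L) (Suc (floor_sqrt (A * n * W)))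
    (3 * W + (n + W) div g) ((56 * (\<alpha> + 2) + a + K + 20) * L) a A K 28"
    unfolding R_def[symmetric] Y_def[symmetric] b_def[symmetric] k_def[symmetric]
  proof
    have "W * W \<le> q * q" "n \<le> q" "q * 2 \<le> q * q" using Wq q2 by (auto intro: mult_le_mono)
    then have "W * W + n + 2 \<le> 3 * (q * q)" using q2 by linarith
    then have "W * W + n + 2 \<le> 3 * q ^ (1 + 1)" by (simp add: power2_eq_square)
    also have "\<dots> \<le> q ^ (2 + (1 + 1))" by (intro prod order_refl) (use small[of 2] in simp)
    finally show "W * W + n + 2 < 2 ^ (k * L)" by (rule fits) (simp add: k_def)
    have "5 * (n + W) + 5 \<le> 16 * q ^ 1" using Wq q2 by simp
    also have "\<dots> \<le> q ^ (4 + 1)" by (intro prod order_refl) (use small[of 4] in simp)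
    finally show "5 * (n + W) + 5 < 2 ^ (k * L)" by (rule fits) (simp add: k_def)
    show "L < 2 ^ (k * L)" using Lq by (rule fits) (simp add: k_def)
    show "b < 2 ^ (k * L)" using bq by (rule fits) (simp add: k_def)
    have "K \<le> q ^ K" using less_exp[of K] small[of K] by linarith
    then have "K * L * L \<le> q ^ (K + 1 + 1)" by (intro prod Lq)
    then show "K * L * L < 2 ^ (k * L)" by (rule fits) (simp add: k_def)
    have "28 \<le> q ^ 5" using small[of 5] by simp
    then show "28 < (2::nat) ^ (k * L)" by (rule fits) (simp add: k_def)
    have "Y * Y + Y + 5 \<le> 8 * (Y * Y)" using mult_le_mono[OF Y(3,3)] mult_le_mono2[OF Y(3), of Y] by linarith
    also have "\<dots> \<le> q ^ (3 + ((1 + (\<alpha> + 1 + 1)) + (1 + (\<alpha> + 1 + 1))))"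
      by (intro prod Yq) (use small[of 3] in simp)
    finally show "Y * Y + Y + 5 < 2 ^ (k * L)" by (rule fits) (simp add: k_def)
    define r1 where "r1 = q ^ (28 * (\<alpha> + 2) + 28 * (\<alpha> + 2) + (2 + a))"
    have "R ^ 28 * R ^ 28 \<le> q ^ (28 * (\<alpha> + 2) + 28 * (\<alpha> + 2))" by (intro prod Rr)
    then have "R ^ 28 * R ^ 28 \<le> r1" unfolding r1_def by (rule le1) simp
    moreover have "R ^ 28 \<le> r1" using Rr unfolding r1_def by (rule le1) simp
    moreover have "b * R ^ 28 \<le> q ^ ((2 + a) + 28 * (\<alpha> + 2))" by (intro prod Rr bq)
    then have "b * R ^ 28 \<le> r1" unfolding r1_def by (rule le1) simp
    ultimately have "R ^ 28 * R ^ 28 + R ^ 28 + b * R ^ 28 \<le> 4 * r1" by linarith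
    also have "\<dots> \<le> q ^ (2 + (28 * (\<alpha> + 2) + 28 * (\<alpha> + 2) + (2 + a)))"
      unfolding r1_def by (intro prod order_refl) (use small[of 2] in simp)
    finally show "R ^ 28 * R ^ 28 + R ^ 28 + b * R ^ 28 < 2 ^ (k * L)" by (rule fits) (simp add: k_def)
    have "116 + 16 * (3 * W + d) \<le> 256 * q ^ 1" if "d \<le> n + W" for d using that Wq q2 by simp
    from this[OF dv] have "116 + 16 * (3 * W + (n + W) div g) \<le> 256 * q ^ 1" .
    also have "\<dots> \<le> q ^ (8 + 1)" by (intro prod order_refl) (use small[of 8] in simp)
    finally have "116 + 16 * (3 * W + (n + W) div g) < 2 ^ (k * L)" by (rule fits) (simp add: k_def)
    then show "116 + 16 * (3 * W + (n + W) div g) \<le> 2 ^ (k * L)" by simp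
    show "1 \<le> A" by (simp add: A_def)
    have p1: "(1::nat) \<le> 2 ^ (a * L)" by simp
    show "code S x < b" for x
    proof (cases "1 \<le> x \<and> x \<le> length S")
      case True
      then have "S ! (x - 1) \<in> set S" by (intro nth_mem) arith
      with S have "S ! (x - 1) < 2 ^ (a * L)" by (auto simp: L_def)
      with True p1 show ?thesis unfolding code_def b_def by (simp del: One_nat_def)
    next
      case False
      then have "code S x = 1" unfolding code_def by (rule if_not_P)
      then show ?thesis unfolding b_def using p1 by linarith
    qed
  qed (use n e Y g_def W_def L_def R_def in \<open>simp_all add: b_def\<close>)
qed


text \<open>Replacing 0 by 1 keeps \<open>g\<close> below \<open>\<epsilon> * sqrt n\<close> because
  of \<open>1 / sqrt n \<le> \<epsilon>\<close>. The factor 8 collects three losses of 2: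
  \<open>e\<close> is at least half of \<open>\<epsilon> * n\<close>, \<open>e\<close> is at most
  \<open>2 * (W * g)\<close>, and \<open>W\<close> is at most \<open>2 * sqrt n\<close>.\<close>

lemma width_bounds:
  fixes n e :: nat and \<epsilon> :: real
  assumes n: "1 \<le> n" and \<epsilon>: "1 / sqrt (real n) \<le> \<epsilon>" "\<epsilon> \<le> 1"
  defines "e \<equiv> nat \<lfloor>\<epsilon> * real n\<rfloor>" and "W \<equiv> Suc (floor_sqrt n)"
  defines "g \<equiv> max 1 (e div W)"
  shows "e \<le> n" "sqrt (real n) < real W" "real W \<le> 2 * sqrt (real n)" "1 \<le> g"
    "real g \<le> \<epsilon> * sqrt (real n)" "\<epsilon> * sqrt (real n) / 8 \<le> real g"
proof -
  define v where "v = sqrt (real n)"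
  have v: "1 \<le> v" "v * v = real n" using n by (auto simp: v_def)
  have \<epsilon>1: "1 \<le> \<epsilon> * v" using \<epsilon>(1) v(1) by (simp add: v_def[symmetric] field_simps)
  have "\<epsilon> * v * 1 \<le> \<epsilon> * v * v" using \<epsilon>1 v by (intro mult_left_mono) auto
  then have \<epsilon>n: "1 \<le> \<epsilon> * real n" using \<epsilon>1 v(2) by (simp add: mult.assoc)
  have e0: "real e \<le> \<epsilon> * real n" "\<epsilon> * real n < real e + 1" using \<epsilon>n unfolding e_def by linarith+
  have "\<epsilon> * real n \<le> 1 * real n" using \<epsilon>(2) by (intro mult_right_mono) auto
  with e0 show en: "e \<le> n" by simp
  have eh: "\<epsilon> * real n / 2 \<le> real e" using e0 \<epsilon>n by (cases e) auto
  have "real n < (real W)\<^sup>2"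
    using Suc_floor_sqrt_power2_gt[of n] by (simp add: W_def del: of_nat_power of_nat_Suc flip: of_nat_power)
  then show Wl: "sqrt (real n) < real W" by (auto intro: real_less_lsqrt)
  have "(real (floor_sqrt n))\<^sup>2 \<le> real n" using floor_sqrt_power2_le[of n] by (simp flip: of_nat_power)
  then have "real (floor_sqrt n) \<le> v" unfolding v_def by (rule real_le_rsqrt)
  then show Wu: "real W \<le> 2 * sqrt (real n)" using v(1) by (simp add: W_def flip: v_def)
  show "1 \<le> g" by (simp add: g_def)
  have W0: "0 < real W" by (simp add: W_def)
  have "real (e div W) \<le> real e / real W" by (rule of_nat_div_le_of_nat)
  also have "\<dots> \<le> \<epsilon> * real n / v"
    using e0 Wl v \<epsilon>n by (intro frac_le) (auto simp: v_def)
  also have "\<dots> = \<epsilon> * v" using v by (simp add: field_simps)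
  finally show "real g \<le> \<epsilon> * sqrt (real n)" using \<epsilon>1 by (simp add: g_def v_def max_def)
  have "e mod W < W" by (simp add: W_def)
  then have "e \<le> W * (e div W) + W" using mult_div_mod_eq[of W e] by linarith
  also have "\<dots> \<le> W * g + W * g" by (intro add_mono mult_le_mono2[of _ g W]) (auto simp: g_def)
  finally have "real e \<le> 2 * (real W * real g)" by (simp flip: of_nat_mult)
  also have "\<dots> \<le> 2 * (2 * v * real g)" using Wu by (intro mult_left_mono mult_right_mono) (auto simp: v_def)
  finally have "\<epsilon> * (v * v) / 2 \<le> 4 * v * real g" using eh v by simp
  then have "v * (\<epsilon> * v / 8) \<le> v * real g" by (simp add: field_simps)
  then show "\<epsilon> * sqrt (real n) / 8 \<le> real g" using v(1) by (simp add: v_def)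
qed

text \<open>Let \<open>u\<close> be the fourth root of \<open>n\<close>. Testing one number below
  \<open>R\<close> takes \<open>O(u ^ 3)\<close> steps, and by \<open>floorlog_cubed_le\<close>
  there are \<open>O(u)\<close> tests, so the primes cost \<open>O(n)\<close>. The rounds dominate
  with \<open>O(n * W / g)\<close>, that is \<open>O(n / \<epsilon>)\<close>.\<close>

lemma work_le:
  fixes n e K A :: nat and \<epsilon> :: real
  assumes n: "1 \<le> n" and \<epsilon>: "1 / sqrt (real n) \<le> \<epsilon>" "\<epsilon> \<le> 1" and A: "1 \<le> A"
  defines "e \<equiv> nat \<lfloor>\<epsilon> * real n\<rfloor>" and "W \<equiv> Suc (floor_sqrt n)" and "L \<equiv> floorlog 2 n"
  defines "g \<equiv> max 1 (e div W)"
  shows "real (work n W g L (K * L * L) (Suc (floor_sqrt (A * n * W))) 28)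
      \<le> (334 + 232 * real A * (real K + 1) * 35937) * (real n / \<epsilon>)"
    and "real (116 + 16 * (3 * W + (n + W) div g)) \<le> 596 * (sqrt (real n) / \<epsilon>)"
proof -
  note wb = width_bounds[OF n \<epsilon>, folded e_def W_def, folded g_def]
  define u where "u = real n powr (1 / 4)"
  have u: "1 \<le> u" using n by (simp add: u_def ge_one_powr_ge_zero)
  have u4: "u ^ 4 = real n" using n by (simp add: u_def powr_power)
  have u2: "sqrt (real n) = u\<^sup>2"
    by (rule real_sqrt_unique) (use u4 in \<open>simp_all add: power_mult[symmetric]\<close>)
  have up: "1 \<le> u ^ i" for i using u by simp
  have "0 < 1 / sqrt (real n)" using n by simp
  then have \<epsilon>0: "0 < \<epsilon>" using \<epsilon>(1) by linarith
  have Wu: "real W \<le> 2 * u\<^sup>2" using wb(3) by (simp add: u2)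
  have Wn: "W \<le> n + 1" using floor_sqrt_le[of n] by (simp add: W_def)
  have Ln: "L \<le> n"
  proof -
    have "2 ^ (L - 1) \<le> n" using n floorlog_bounds[of n 2] by (simp add: L_def)
    then show ?thesis using less_exp[of "L - 1"] by linarith
  qed
  have g0: "0 < g" using wb(4) by simp
  have gl: "\<epsilon> * u\<^sup>2 / 8 \<le> real g" using wb(6) by (simp add: u2)
  have pos: "0 < \<epsilon> * u\<^sup>2 / 8" using \<epsilon>0 u by simp
  have inv: "1 \<le> 1 / \<epsilon>" using \<epsilon>(2) \<epsilon>0 by simp
  have n\<epsilon>: "real n \<le> real n / \<epsilon>" using mult_left_mono[OF inv, of "real n"] by simp
  have dv: "real (x div g) \<le> c * (y / \<epsilon>)" if "real x \<le> c / 8 * (y * u\<^sup>2)" "0 \<le> c / 8 * (y * u\<^sup>2)" for x c y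
  proof -
    have "real (x div g) \<le> real x / real g" by (rule of_nat_div_le_of_nat)
    also have "\<dots> \<le> (c / 8 * (y * u\<^sup>2)) / (\<epsilon> * u\<^sup>2 / 8)" using that gl pos by (intro frac_le) auto
    also have "\<dots> = c * (y / \<epsilon>)" using \<epsilon>0 u by (simp add: field_simps)
    finally show ?thesis .
  qed
  have d1: "real (W div g) \<le> 16 * (1 / \<epsilon>)" by (rule dv) (use Wu in auto)
  have n4: "real n = u\<^sup>2 * u\<^sup>2" using u4 by (simp flip: power_add)
  have Wn': "real W \<le> real n + 1" using Wn by linarith
  have d2: "real ((n + W + 1) div g) \<le> 32 * (u\<^sup>2 / \<epsilon>)"
    by (rule dv) (use Wn' n in \<open>simp_all add: u4 flip: n4\<close>)
  have d3: "real ((n + W) div g) \<le> 24 * (u\<^sup>2 / \<epsilon>)"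
    by (rule dv) (use Wn' n in \<open>simp_all add: u4 flip: n4\<close>)
  have u\<epsilon>: "u\<^sup>2 \<le> u\<^sup>2 / \<epsilon>" using mult_left_mono[OF inv, of "u\<^sup>2"] by simp
  have u1\<epsilon>: "1 \<le> u\<^sup>2 / \<epsilon>" using u\<epsilon> up[of 2] by linarith
  \<comment> \<open>The constant is \<open>596 = 116 + 48 * 2 + 16 * 24\<close>.\<close>
  have "real (116 + 16 * (3 * W + (n + W) div g)) = 116 + 48 * real W + 16 * real ((n + W) div g)" by simp
  then show "real (116 + 16 * (3 * W + (n + W) div g)) \<le> 596 * (sqrt (real n) / \<epsilon>)"
    unfolding u2 using d3 Wu u\<epsilon> u1\<epsilon> by linarith
  have n1: "1 \<le> real n" using n by simp
  have t1: "real (W + L + 3) \<le> 6 * (real n / \<epsilon>)" "real (n + 6 * W + 2) \<le> 15 * (real n / \<epsilon>)"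
    using Wn' Ln n1 n\<epsilon> by simp_all
  have t3: "real ((n + W + 2) * (W div g + 4)) \<le> 100 * (real n / \<epsilon>)"
  proof -
    have "real ((n + W + 2) * (W div g + 4)) = (real n + real W + 2) * (real (W div g) + 4)"
      by (simp only: of_nat_mult of_nat_add of_nat_numeral)
    also have "\<dots> \<le> (5 * real n) * (20 * (1 / \<epsilon>))" using Wn' n1 d1 inv by (intro mult_mono) auto
    finally show ?thesis by simp
  qed
  have t4: "real ((2 * W + 2) * ((n + W + 1) div g + 1)) \<le> 198 * (real n / \<epsilon>)"
  proof -
    have "real ((2 * W + 2) * ((n + W + 1) div g + 1)) = (2 * real W + 2) * (real ((n + W + 1) div g) + 1)"
      by (simp only: of_nat_mult of_nat_add of_nat_numeral of_nat_1)
    also have "\<dots> \<le> (6 * u\<^sup>2) * (33 * (u\<^sup>2 / \<epsilon>))" using Wu d2 u1\<epsilon> up[of 2] by (intro mult_mono) auto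
    also have "\<dots> = 198 * (real n / \<epsilon>)" by (simp add: n4)
    finally show ?thesis .
  qed
  have t2: "real (29 * (K * L * L + 1) * (Suc (floor_sqrt (A * n * W)) + 2))
      \<le> 232 * real A * (real K + 1) * 35937 * (real n / \<epsilon>)"
  proof -
    have L3: "real L ^ 3 \<le> 35937 * u" using floorlog_cubed_le[OF n] by (simp add: L_def u_def)
    have L1: "1 \<le> real L" using n compute_floorlog[of 2 n] by (simp add: L_def)
    have "real (K * L * L + 1) \<le> (real K + 1) * real L ^ 3"
    proof -
      have "real L ^ 2 \<le> real L ^ 3" "1 \<le> real L ^ 3" using L1 by (auto intro: power_increasing)
      then have "real K * real L ^ 2 \<le> real K * real L ^ 3" by (intro mult_left_mono) auto
      with \<open>1 \<le> real L ^ 3\<close> show ?thesis by (simp add: algebra_simps power2_eq_square)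
    qed
    also have "\<dots> \<le> (real K + 1) * (35937 * u)" using L3 by (intro mult_left_mono) auto
    finally have a: "real (K * L * L + 1) \<le> (real K + 1) * (35937 * u)" .
    have A1: "1 \<le> real A" using A by simp
    have "real (A * n * W) \<le> real A * u ^ 4 * (2 * u\<^sup>2)"
      unfolding of_nat_mult u4 using Wu by (intro mult_left_mono) auto
    also have "\<dots> = 2 * real A * (u ^ 3)\<^sup>2" by (simp add: power_mult[symmetric] flip: power_add)
    also have "\<dots> \<le> (2 * real A)\<^sup>2 * (u ^ 3)\<^sup>2"
    proof (rule mult_right_mono)
      show "2 * real A \<le> (2 * real A)\<^sup>2" using A1 by (intro self_le_power) auto
    qed simp
    also have "\<dots> = (2 * real A * u ^ 3)\<^sup>2" by (simp add: power_mult_distrib)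
    finally have "sqrt (real (A * n * W)) \<le> 2 * real A * u ^ 3"
      using A1 u by (intro real_le_lsqrt) auto
    moreover have "real (floor_sqrt (A * n * W)) \<le> sqrt (real (A * n * W))"
      by (rule real_le_rsqrt) (use floor_sqrt_power2_le[of "A * n * W"] in \<open>simp del: of_nat_mult flip: of_nat_power\<close>)
    moreover have "1 * 1 \<le> real A * u ^ 3" using A1 up[of 3] by (intro mult_mono) auto
    ultimately have b: "real (Suc (floor_sqrt (A * n * W)) + 2) \<le> 8 * real A * u ^ 3" by simp
    have "real (29 * (K * L * L + 1) * (Suc (floor_sqrt (A * n * W)) + 2)) =
      29 * (real (K * L * L + 1) * real (Suc (floor_sqrt (A * n * W)) + 2))" by (simp only: of_nat_mult of_nat_numeral mult.assoc)
    also have "\<dots> \<le> 29 * (((real K + 1) * (35937 * u)) * (8 * real A * u ^ 3))"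
      using u by (intro mult_left_mono mult_mono a b) auto
    also have "\<dots> = 232 * real A * (real K + 1) * 35937 * u ^ 4" by (simp add: power4_eq_xxxx power3_eq_cube)
    also have "\<dots> \<le> 232 * real A * (real K + 1) * 35937 * (real n / \<epsilon>)"
      unfolding u4 using n\<epsilon> by (intro mult_left_mono) auto
    finally show ?thesis .
  qed
  have "work n W g L (K * L * L) (Suc (floor_sqrt (A * n * W))) 28 = (W + L + 3) +
      29 * (K * L * L + 1) * (Suc (floor_sqrt (A * n * W)) + 2) +
      ((n + W + 2) * (W div g + 4) + (2 * W + 2) * ((n + W + 1) div g + 1)) + (n + 6 * W + 2)"
    unfolding work_def by simp
  then have "real (work n W g L (K * L * L) (Suc (floor_sqrt (A * n * W))) 28) = real (W + L + 3) +
      real (29 * (K * L * L + 1) * (Suc (floor_sqrt (A * n * W)) + 2)) +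
      (real ((n + W + 2) * (W div g + 4)) + real ((2 * W + 2) * ((n + W + 1) div g + 1))) + real (n + 6 * W + 2)"
    by (simp only: of_nat_add)
  with t1 t2 t3 t4 show "real (work n W g L (K * L * L) (Suc (floor_sqrt (A * n * W))) 28)
      \<le> (334 + 232 * real A * (real K + 1) * 35937) * (real n / \<epsilon>)" unfolding distrib_right by linarith
qed


text \<open>With \<open>u\<close> the fourth root of \<open>n\<close>, either way of failing has
  probability at most \<open>1 / (2 * u)\<close> for one prime: \<open>K\<close> is chosen such that
  \<open>T = 2 * L * (2 * h)\<close>, which makes a search without a prime as unlikely as
  \<open>exp (- 2 * L)\<close>, and \<open>A\<close> is chosen for the prime divisors. So 28 primes
  give \<open>1 / n ^ 7\<close> against fewer than \<open>(4 * n) ^ 2\<close> events, and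
  \<open>16 \<le> n ^ 4\<close> needs \<open>2 \<le> n\<close>.\<close>

lemma failure_le:
  fixes n \<alpha> a L W :: nat
  assumes n: "2 \<le> n" and \<alpha>: "2 \<le> \<alpha>" "24 * (a + 2) * 35937 * (\<alpha> + 2) \<le> 2 ^ \<alpha>"
  defines "W \<equiv> Suc (floor_sqrt n)" and "L \<equiv> floorlog 2 n" and "A \<equiv> 2 ^ \<alpha>" and "K \<equiv> 4 * (\<alpha> + 2)"
  defines "R \<equiv> A * n * W" and "b \<equiv> 4 * 2 ^ (a * L)"
  assumes R: "R \<le> 2 ^ ((\<alpha> + 2) * L)" and code: "\<And>x. code S x < b"
  shows "measure_pmf.prob (replicate_pmf (28 * (K * L * L)) (pmf_of_set {..<R}))
    {\<omega>. \<not> good_modulus S b (n + W) (modulus (K * L * L) 28 \<omega>)} \<le> 1 / real n"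
proof -
  define u where "u = real n powr (1 / 4)"
  define h where "h = (\<alpha> + 2) * L"
  define T where "T = K * L * L"
  have u: "1 \<le> u" using n by (simp add: u_def ge_one_powr_ge_zero)
  have u4: "u ^ 4 = real n" using n by (simp add: u_def powr_power)
  have L1: "1 \<le> L" using n compute_floorlog[of 2 n] by (simp add: L_def)
  have nL: "n < 2 ^ L" using n floorlog_bounds[of n 2] by (simp add: L_def)
  have Wn: "W \<le> n + 1" "1 \<le> W" using floor_sqrt_le[of n] by (simp_all add: W_def)
  have h0: "0 < h" using L1 by (simp add: h_def)
  have bb: "b = 2 ^ (a * L + 2)" by (simp add: b_def power_add)
  have A0: "1 \<le> A" by (simp add: A_def)
  have "1 * 1 * 1 \<le> A * n * W" by (intro mult_le_mono A0 Wn) (use n in simp)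
  then have R0: "0 < R" by (simp add: R_def)
  have Rh: "R \<le> 2 * h * card {p. prime p \<and> p < R}"
  proof -
    \<comment> \<open>The prime count is stated for even ranges; one factor 2 of \<open>A\<close>
      provides this.\<close>
    obtain \<alpha>' where \<alpha>': "\<alpha> = Suc \<alpha>'" "1 \<le> \<alpha>'" using \<alpha>(1) by (cases \<alpha>) auto
    have R2: "R = 2 * (2 ^ \<alpha>' * n * W)" by (simp add: R_def A_def \<alpha>'(1))
    have "1 * 2 * 1 \<le> 2 ^ \<alpha>' * n * W" by (intro mult_le_mono n Wn) simp
    then show ?thesis using prime_count_lower[of "2 ^ \<alpha>' * n * W" h] R by (simp add: R2 h_def)
  qed
  have e1: "(1 - 1 / (2 * real h)) ^ T \<le> 1 / 2 * (1 / u)"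
  proof -
    have "1 / (2 * real h) \<le> 1" using h0 by simp
    then have "(1 - 1 / (2 * real h)) ^ T \<le> exp (- (1 / (2 * real h))) ^ T"
      using exp_ge_add_one_self[of "- (1 / (2 * real h))"] by (intro power_mono) auto
    also have "\<dots> = exp (- (real T / (2 * real h)))" by (simp add: exp_of_nat_mult[symmetric])
    also have "real T / (2 * real h) = 2 * real L"
    proof -
      have "real T = 2 * real L * (2 * real h)" by (simp add: T_def K_def h_def algebra_simps)
      then show ?thesis using h0 by simp
    qed
    also have "exp (- (2 * real L)) = exp (- real L) * exp (- real L)" by (simp flip: exp_add)
    also have "\<dots> \<le> 1 / 2 * (1 / u)"
    proof (rule mult_mono)
      have e2: "(2::real) \<le> exp 1" using exp_ge_add_one_self[of 1] by simp
      have eL: "exp (- real L) \<le> 1 / 2 ^ L"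
      proof -
        have "(2::real) ^ L \<le> exp 1 ^ L" using e2 by (intro power_mono) auto
        also have "\<dots> = exp (real L)" by (simp add: exp_of_nat_mult[symmetric])
        finally show ?thesis by (simp add: exp_minus field_simps)
      qed
      have "(2::real) ^ 1 \<le> 2 ^ L" using L1 by (intro power_increasing) auto
      then have "1 / (2::real) ^ L \<le> 1 / 2" by (intro divide_left_mono) auto
      with eL show "exp (- real L) \<le> 1 / 2" by linarith
      have "u \<le> u ^ 4" using u by (intro self_le_power) auto
      moreover have "real n \<le> 2 ^ L" using nL by (metis less_imp_le of_nat_le_numeral_power_cancel_iff)
      ultimately have "u \<le> 2 ^ L" using u4 by linarith
      then have "1 / (2::real) ^ L \<le> 1 / u" using u by (intro divide_left_mono) auto
      with eL show "exp (- real L) \<le> 1 / u" by linarith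
    qed auto
    finally show ?thesis .
  qed
  have e2: "real T * (real ((a * L + 2) * (n + W)) / real R) \<le> 1 / 2 * (1 / u)"
  proof -
    have W2: "u\<^sup>2 \<le> real W"
    proof -
      have "sqrt (real n) = u\<^sup>2" by (rule real_sqrt_unique) (use u4 in \<open>simp_all add: power_mult[symmetric]\<close>)
      moreover have "real n < (real W)\<^sup>2"
        using Suc_floor_sqrt_power2_gt[of n] by (simp add: W_def del: of_nat_power of_nat_Suc flip: of_nat_power)
      ultimately show ?thesis by (metis less_imp_le of_nat_0_le_iff real_less_lsqrt)
    qed
    have pos: "0 < real n" "0 < real A" "0 < u" using n A0 u by auto
    have x1: "real ((a * L + 2) * (n + W)) \<le> (real (a + 2) * real L) * (3 * real n)"
    proof -
      have "(a * L + 2) * (n + W) \<le> ((a + 2) * L) * (3 * n)"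
        using L1 Wn n by (intro mult_le_mono) (auto simp: algebra_simps)
      then have "real ((a * L + 2) * (n + W)) \<le> real (((a + 2) * L) * (3 * n))" by (simp only: of_nat_le_iff)
      then show ?thesis by (simp only: of_nat_mult of_nat_numeral)
    qed
    have x2: "real T = 4 * real (\<alpha> + 2) * (real L * real L)" by (simp add: T_def K_def)
    have x3: "real A * real n * u\<^sup>2 \<le> real R" unfolding R_def of_nat_mult using W2 by (intro mult_left_mono) auto
    have "real T * (real ((a * L + 2) * (n + W)) / real R) \<le>
        (4 * real (\<alpha> + 2) * (real L * real L)) * ((real (a + 2) * real L * (3 * real n)) / (real A * real n * u\<^sup>2))"
      unfolding x2 using pos by (intro mult_left_mono frac_le x1 x3) auto
    also have "\<dots> = 12 * real (\<alpha> + 2) * real (a + 2) * real L ^ 3 / (real A * u\<^sup>2)"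
      using pos by (simp add: field_simps power3_eq_cube)
    also have "\<dots> \<le> 12 * real (\<alpha> + 2) * real (a + 2) * (35937 * u) / (real A * u\<^sup>2)"
      using floorlog_cubed_le[of n] n pos by (intro divide_right_mono mult_left_mono) (auto simp: L_def u_def)
    also have "\<dots> = real (24 * (a + 2) * 35937 * (\<alpha> + 2)) / real A * (1 / 2 * (1 / u))"
      using pos by (simp add: field_simps power2_eq_square)
    also have "\<dots> \<le> 1 * (1 / 2 * (1 / u))"
    proof (rule mult_right_mono)
      have "real (24 * (a + 2) * 35937 * (\<alpha> + 2)) \<le> real A" using \<alpha>(2) unfolding A_def by (simp only: of_nat_le_iff)
      then show "real (24 * (a + 2) * 35937 * (\<alpha> + 2)) / real A \<le> 1" using pos by (simp only: divide_le_eq_1_pos)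
    qed (use pos in simp)
    finally show ?thesis by simp
  qed
  have "measure_pmf.prob (replicate_pmf (28 * T) (pmf_of_set {..<R}))
      {\<omega>. \<not> good_modulus S b (n + W) (modulus T 28 \<omega>)} \<le> (real (n + W) + 1)\<^sup>2 * (1 / u) ^ 28"
    by (rule prob_bad_modulus[OF R0 Rh h0 bb code]) (use e1 e2 in linarith)
  also have "\<dots> \<le> (4 * real n)\<^sup>2 * (1 / u) ^ 28"
    using Wn n u by (intro mult_right_mono power_mono) auto
  also have "(1 / u) ^ 28 = 1 / real n ^ 7"
    unfolding u4[symmetric] by (simp add: power_one_over power_mult[symmetric])
  also have "(4 * real n)\<^sup>2 * (1 / real n ^ 7) = 16 / real n ^ 4 * (1 / real n)"
    using n by (simp add: field_simps eval_nat_numeral)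
  also have "\<dots> \<le> 1 * (1 / real n)"
  proof (rule mult_right_mono)
    have "(2::real) ^ 4 \<le> real n ^ 4" using n by (intro power_mono) auto
    then show "16 / real n ^ 4 \<le> 1" using n by simp
  qed simp
  finally show ?thesis by (simp add: T_def)
qed

text \<open>The bound on the alphabet says that letters fit into \<open>O(log n)\<close> bits, with
  \<open>a\<close> as the constant; program, word size and time constant depend on \<open>a\<close>
  only. The strict inequality comes from \<open>pal_length S m < d + g\<close> together with
  \<open>g \<le> \<epsilon> * sqrt n\<close>.\<close>

theorem theorem1:
  fixes a :: nat
  shows "\<exists>(P :: instr list) (k :: nat) (C_time :: real) (C_space :: real).
    \<forall>(n :: nat) (\<epsilon> :: real) (\<Sigma> :: nat set) (S :: nat list).
      1 \<le> n \<longrightarrow> 1 / sqrt (real n) \<le> \<epsilon> \<longrightarrow> \<epsilon> \<le> 1 \<longrightarrow>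
      \<Sigma> \<subseteq> {..<2 ^ word_bits a n} \<longrightarrow> length S = n \<longrightarrow> set S \<subseteq> \<Sigma> \<longrightarrow>
      (let w = word_bits k n;
           D = run w P (nat \<lfloor>C_time * (real n / \<epsilon>)\<rfloor>) (start w \<epsilon> S)
       in (\<forall>c\<in>set_pmf D.
             halted P c \<and>
             real (used c) \<le> C_space * (sqrt (real n) / \<epsilon>) \<and>
             distinct (map fst (out c)) \<and> fst ` set (out c) = {1..n}) \<and>
          measure_pmf.prob D
            {c. \<forall>(m, est)\<in>set (out c).
                  real (pal_length S m) - \<epsilon> * sqrt (real n) < real est \<and>
                  est \<le> pal_length S m} \<ge> 1 - 1 / real n)"
proof -
  obtain \<alpha> where \<alpha>: "2 \<le> \<alpha>" "24 * (a + 2) * 35937 * (\<alpha> + 2) \<le> (2::nat) ^ \<alpha>"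
    using exists_large_power by blast
  define A K :: nat where "A = 2 ^ \<alpha>" and "K = 4 * (\<alpha> + 2)"
  define P where "P = code_com 0 (prog a A K 28)"
  define k where "k = 56 * (\<alpha> + 2) + a + K + 20"
  define Ct where "Ct = (334 + 232 * real A * (real K + 1) * 35937) * real (com_size (prog a A K 28))"
  show ?thesis
  proof (rule exI[of _ P], rule exI[of _ k], rule exI[of _ Ct], rule exI[of _ 596], intro allI impI)
    fix n :: nat and \<epsilon> :: real and \<Sigma> :: "nat set" and S :: "nat list"
    assume n: "1 \<le> n" and \<epsilon>: "1 / sqrt (real n) \<le> \<epsilon>" "\<epsilon> \<le> 1"
      and \<Sigma>: "\<Sigma> \<subseteq> {..<2 ^ word_bits a n}" "set S \<subseteq> \<Sigma>" and S: "length S = n"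
    define e where "e = nat \<lfloor>\<epsilon> * real n\<rfloor>"
    define W where "W = Suc (floor_sqrt n)"
    define g where "g = max 1 (e div W)"
    define L where "L = floorlog 2 n"
    define R where "R = A * n * W"
    define T where "T = K * L * L"
    define X where "X = 3 * W + (n + W) div g"
    define t where "t = nat \<lfloor>Ct * (real n / \<epsilon>)\<rfloor>"
    let ?b = "4 * 2 ^ (a * L) :: nat"
    note wb = width_bounds[OF n \<epsilon>, folded e_def W_def, folded g_def]
    have Sa: "set S \<subseteq> {..<2 ^ (a * floorlog 2 n)}" using \<Sigma> unfolding word_bits_def by (rule order_trans[rotated])
    note fit = parameters_fit[OF S[symmetric] n Sa wb(1) \<alpha>(1), folded W_def L_def A_def K_def,
        folded g_def R_def T_def k_def, folded X_def]
    have R: "R \<le> 2 ^ ((\<alpha> + 2) * L)" using fit(4) .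
    interpret p: parameters S n e W g L ?b R T "Suc (floor_sqrt R)" X "k * L" a A K 28
      by (rule fit(1))
    have A1: "1 \<le> A" by (simp add: A_def)
    note wk = work_le(1)[OF n \<epsilon> A1, of K, folded e_def W_def L_def, folded g_def R_def T_def]
      work_le(2)[OF n \<epsilon> A1, folded e_def W_def, folded g_def, folded X_def]
    have "work n W g L T (Suc (floor_sqrt R)) 28 * com_size (prog a A K 28) \<le> t"
    proof -
      have "real (work n W g L T (Suc (floor_sqrt R)) 28) * real (com_size (prog a A K 28)) \<le>
        ((334 + 232 * real A * (real K + 1) * 35937) * (real n / \<epsilon>)) * real (com_size (prog a A K 28))"
        by (intro mult_right_mono wk(1)) simp
      then show ?thesis unfolding t_def Ct_def by (intro le_nat_floor) (simp add: mult_ac)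
    qed
    from p.run_prog[OF e_def this, folded P_def] obtain f where
      f: "run (k * L) P t (start (k * L) \<epsilon> S) = map_pmf f (replicate_pmf (28 * T) (pmf_of_set {..<R}))"
      and f': "\<And>\<omega>. length \<omega> = 28 * T \<Longrightarrow> set \<omega> \<subseteq> {..<R} \<Longrightarrow> halted P (f \<omega>) \<and> used (f \<omega>) \<le> 116 + 16 * X \<and>
        distinct (map fst (out (f \<omega>))) \<and> fst ` set (out (f \<omega>)) = {1..n} \<and>
        (good_modulus S ?b (n + W) (modulus T 28 \<omega>) \<longrightarrow>
          (\<forall>(m, d)\<in>set (out (f \<omega>)). d \<le> pal_length S m \<and> pal_length S m < d + g))" by blast
    define D where "D = replicate_pmf (28 * T) (pmf_of_set {..<R})"
    have D: "set_pmf D = {\<omega>. length \<omega> = 28 * T \<and> set \<omega> \<subseteq> {..<R}}"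
    proof -
      have "0 \<in> {..<R}" using p.R1 by simp
      then have "{..<R} \<noteq> {}" by blast
      then show ?thesis unfolding D_def by (auto simp: set_replicate_pmf set_pmf_of_set)
    qed
    let ?G = "{c. \<forall>(m, est)\<in>set (out c). real (pal_length S m) - \<epsilon> * sqrt (real n) < real est \<and> est \<le> pal_length S m}"
    have "1 - 1 / real n \<le> measure_pmf.prob (map_pmf f D) ?G"
    \<comment> \<open>For \<open>n = 1\<close> the required probability is 0, and the failure bound
      is available from \<open>n = 2\<close> on.\<close>
    proof (cases "n = 1")
      case False
      let ?B = "{\<omega>. \<not> good_modulus S ?b (n + W) (modulus T 28 \<omega>)}"
      have "measure_pmf.prob D ?B \<le> 1 / real n"
        using failure_le[OF _ \<alpha>, of n, folded W_def L_def A_def K_def, folded R_def T_def] False n R p.b(3) D_def by simp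
      moreover have "1 - measure_pmf.prob D ?B = measure_pmf.prob D (- ?B)"
        using measure_pmf.prob_compl[of ?B D] by (simp add: Compl_eq_Diff_UNIV)
      moreover have "measure_pmf.prob D (- ?B) \<le> measure_pmf.prob D (f -` ?G)"
      proof (rule measure_pmf.finite_measure_mono_AE)
        have "f \<omega> \<in> ?G" if \<omega>: "\<omega> \<in> set_pmf D" "\<omega> \<notin> ?B" for \<omega>
        proof -
          have "\<forall>(m, d)\<in>set (out (f \<omega>)). d \<le> pal_length S m \<and> pal_length S m < d + g"
            using f'[of \<omega>] \<omega> D by blast
          then show ?thesis using wb(5) by fastforce
        qed
        then show "AE \<omega> in measure_pmf D. \<omega> \<in> - ?B \<longrightarrow> \<omega> \<in> f -` ?G" unfolding AE_measure_pmf_iff by blast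
      qed simp
      ultimately show ?thesis unfolding measure_map_pmf by linarith
    qed simp
    moreover have "halted P c \<and> real (used c) \<le> 596 * (sqrt (real n) / \<epsilon>) \<and> distinct (map fst (out c)) \<and> fst ` set (out c) = {1..n}"
      if "c \<in> set_pmf (map_pmf f D)" for c
    proof -
      from that obtain \<omega> where \<omega>: "c = f \<omega>" "length \<omega> = 28 * T" "set \<omega> \<subseteq> {..<R}" by (auto simp: D)
      from f'[OF \<omega>(2,3)] have "real (used (f \<omega>)) \<le> real (116 + 16 * X)" by (simp only: of_nat_le_iff)
      then have "real (used (f \<omega>)) \<le> 596 * (sqrt (real n) / \<epsilon>)" using wk(2) by linarith
      with f'[OF \<omega>(2,3)] show ?thesis unfolding \<omega>(1) by blast
    qed
    ultimately show "let w = word_bits k n; D = run w P (nat \<lfloor>Ct * (real n / \<epsilon>)\<rfloor>) (start w \<epsilon> S)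
       in (\<forall>c\<in>set_pmf D. halted P c \<and> real (used c) \<le> 596 * (sqrt (real n) / \<epsilon>) \<and>
            distinct (map fst (out c)) \<and> fst ` set (out c) = {1..n}) \<and>
          measure_pmf.prob D ?G \<ge> 1 - 1 / real n"
      unfolding Let_def word_bits_def L_def[symmetric] t_def[symmetric] f D_def[symmetric] by blast
  qed
qed

end
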